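(* For every constant $c>0$ there exists a randomized algorithm that, given $\varepsilon>0$ and a symmetric matrix $A\in\mathbb{Z}^{n\times n}$ with integer entries in $[-U,U]$ and $\mathrm{nnz}$ nonzero entries, with probability at least $1-n^{-c}$ outputs reals $\tilde\lambda_1,\dots,\tilde\lambda_n$ and vectors $v_1,\dots,v_n$ (in fixed point representation) such that: (1) for all $i\in[n]$: $|\lambda_i(A)-\tilde\lambda_i|\le\varepsilon$, $\|v_i\|_2^2\in[1-\varepsilon,1+\varepsilon]$, and $\|Av_i-\tilde\lambda_iv_i\|_2\le\varepsilon$; (2) for all $i\ne j$ in $[n]$: $|\langle v_i,v_j\rangle|\le\varepsilon$; (3) the algorithm runs in $\tilde O(n^3(\mathrm{nnz}+n))$ bit operations and uses $O(n\log(nU/\varepsilon))$ bits of working space, where $\tilde O$ hides factors $\log^{O(1)}(nU\varepsilon^{-1})$.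
   Context: $\lambda_1(A)\le\dots\le\lambda_n(A)$ are the eigenvalues of $A$ in nondecreasing order. Computational model: RAM with read-only input; time in bit operations; space is working space in bits, excluding the read-only input and the output (which is written once and never re-read; any memorized output counts toward space).
   Formalization: In both resource bounds log(nU/ε) is replaced by log(2 + nU/ε + ε), since the literal log can vanish or be undefined (n=U=ε=1, or U=0) and is too small for ε>1 (A=aI, U=a, ε=a/10); for ε≤1 and nU/ε≥2 the two agree up to a constant factor. *)

theory Defs
  imports
    "HOL-Probability.Probability_Mass_Function"
    "HOL-Library.Log_Nat"
    "HOL-Computational_Algebra.Polynomial"
    "Jordan_Normal_Form.Char_Poly"
begin

section \<open>A randomized RAM with read-only input and write-once output\<close>

text \<open>
  The machine is a random access machine under the logarithmic cost criterion. A program is a finite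
  list of instructions; numeric operands are addresses of working-memory cells (\<open>Const\<close> takes an
  integer literal, \<open>JumpPos\<close> a jump target). \<open>Load d a\<close> and \<open>Store a s\<close> access the working memory
  indirectly, \<open>Input d a\<close> reads the input cell whose index is held in cell \<open>a\<close>, \<open>Output a s\<close> writes
  cell \<open>s\<close> to the output cell whose index is held in cell \<open>a\<close>, and \<open>Flip d\<close> stores a fresh
  fair coin. The machine halts when the program counter leaves the program.
\<close>

datatype ram_instr =
    Const nat int
  | Add nat nat nat
  | Sub nat nat nat
  | Mul nat nat nat
  | Div nat nat nat
  | Load nat nat
  | Store nat nat
  | Input nat nat
  | Output nat nat
  | Flip nat
  | JumpPos nat nat

type_synonym ram_program = "ram_instr list"

record ram_config =
  pc :: nat
  mem :: "nat \<Rightarrow> int"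
  outp :: "nat \<Rightarrow> int option"
  bit_ops :: nat
  peak_space :: nat

text \<open>Binary length, plus one bit for the sign.\<close>

definition bits :: "int \<Rightarrow> nat" where
  "bits x = floorlog 2 (nat \<bar>x\<bar>) + 1"

text \<open>
  Every cell with nonzero content is charged for its content and for its address, so that a memory
  state can be described by \<open>O(mem_bits)\<close> bits and nothing can be hidden in sparsely used addresses.
\<close>

definition mem_bits :: "(nat \<Rightarrow> int) \<Rightarrow> nat" where
  "mem_bits m = (\<Sum>i | m i \<noteq> 0. bits (int i) + bits (m i))"

text \<open>
  Bit operations of one instruction. Multiplication and division are charged as by the schoolbook
  methods. The addresses written in the program itself are constants and are not charged.
\<close>

fun instr_cost :: "ram_instr \<Rightarrow> (nat \<Rightarrow> int) \<Rightarrow> (nat \<Rightarrow> int) \<Rightarrow> nat" where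
  "instr_cost (Const d k) x m = bits k"
| "instr_cost (Add d a b) x m = bits (m a) + bits (m b)"
| "instr_cost (Sub d a b) x m = bits (m a) + bits (m b)"
| "instr_cost (Mul d a b) x m = bits (m a) * bits (m b)"
| "instr_cost (Div d a b) x m = bits (m a) * bits (m b)"
| "instr_cost (Load d a) x m = bits (m a) + bits (m (nat (m a)))"
| "instr_cost (Store a s) x m = bits (m a) + bits (m s)"
| "instr_cost (Input d a) x m = bits (m a) + bits (x (nat (m a)))"
| "instr_cost (Output a s) x m = bits (m a) + bits (m s)"
| "instr_cost (Flip d) x m = 1"
| "instr_cost (JumpPos a l) x m = bits (m a)"

fun instr_mem :: "ram_instr \<Rightarrow> (nat \<Rightarrow> int) \<Rightarrow> bool \<Rightarrow> (nat \<Rightarrow> int) \<Rightarrow> nat \<Rightarrow> int" where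
  "instr_mem (Const d k) x coin m = m(d := k)"
| "instr_mem (Add d a b) x coin m = m(d := m a + m b)"
| "instr_mem (Sub d a b) x coin m = m(d := m a - m b)"
| "instr_mem (Mul d a b) x coin m = m(d := m a * m b)"
| "instr_mem (Div d a b) x coin m = m(d := m a div m b)"
| "instr_mem (Load d a) x coin m = m(d := m (nat (m a)))"
| "instr_mem (Store a s) x coin m = m(nat (m a) := m s)"
| "instr_mem (Input d a) x coin m = m(d := x (nat (m a)))"
| "instr_mem (Output a s) x coin m = m"
| "instr_mem (Flip d) x coin m = m(d := of_bool coin)"
| "instr_mem (JumpPos a l) x coin m = m"

fun instr_outp ::
  "ram_instr \<Rightarrow> (nat \<Rightarrow> int) \<Rightarrow> (nat \<Rightarrow> int option) \<Rightarrow> nat \<Rightarrow> int option" where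
  "instr_outp (Output a s) m w =
     (if w (nat (m a)) = None then w(nat (m a) := Some (m s)) else w)"
| "instr_outp _ m w = w"

text \<open>An attempt to write an output cell a second time halts the machine.\<close>

fun instr_pc ::
  "ram_program \<Rightarrow> ram_instr \<Rightarrow> (nat \<Rightarrow> int) \<Rightarrow> (nat \<Rightarrow> int option) \<Rightarrow> nat \<Rightarrow> nat" where
  "instr_pc P (JumpPos a l) m w q = (if m a > 0 then l else Suc q)"
| "instr_pc P (Output a s) m w q = (if w (nat (m a)) = None then Suc q else length P)"
| "instr_pc P _ m w q = Suc q"

definition ram_halted :: "ram_program \<Rightarrow> ram_config \<Rightarrow> bool" where
  "ram_halted P \<sigma> \<longleftrightarrow> pc \<sigma> \<ge> length P"

definition ram_step_coin ::
  "ram_program \<Rightarrow> (nat \<Rightarrow> int) \<Rightarrow> bool \<Rightarrow> ram_config \<Rightarrow> ram_config" where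
  "ram_step_coin P x coin \<sigma> =
     (if ram_halted P \<sigma> then \<sigma> else
        let I = P ! pc \<sigma>; m' = instr_mem I x coin (mem \<sigma>) in
          \<lparr> pc = instr_pc P I (mem \<sigma>) (outp \<sigma>) (pc \<sigma>),
            mem = m',
            outp = instr_outp I (mem \<sigma>) (outp \<sigma>),
            bit_ops = bit_ops \<sigma> + instr_cost I x (mem \<sigma>),
            peak_space = max (peak_space \<sigma>) (mem_bits m') \<rparr>)"

text \<open>A coin is drawn in every step, but only \<open>Flip\<close> looks at it.\<close>

definition ram_step :: "ram_program \<Rightarrow> (nat \<Rightarrow> int) \<Rightarrow> ram_config \<Rightarrow> ram_config pmf" where
  "ram_step P x \<sigma> = map_pmf (\<lambda>coin. ram_step_coin P x coin \<sigma>) (bernoulli_pmf (1/2))"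

definition ram_init :: ram_config where
  "ram_init =
     \<lparr> pc = 0, mem = (\<lambda>_. 0), outp = (\<lambda>_. None), bit_ops = 0, peak_space = 0 \<rparr>"

fun ram_run :: "ram_program \<Rightarrow> (nat \<Rightarrow> int) \<Rightarrow> nat \<Rightarrow> ram_config pmf" where
  "ram_run P x 0 = return_pmf ram_init"
| "ram_run P x (Suc t) = bind_pmf (ram_run P x t) (ram_step P x)"

section \<open>Matrices, eigenvalues and their representation\<close>

text \<open>Indices of rows, columns, eigenvalues and vectors run over \<open>{0..<n}\<close>.\<close>

definition nonzero_positions :: "int mat \<Rightarrow> (nat \<times> nat) set" where
  "nonzero_positions A = {(i, j). i < dim_row A \<and> j < dim_col A \<and> A $$ (i, j) \<noteq> 0}"

definition nnz :: "int mat \<Rightarrow> nat" where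
  "nnz A = card (nonzero_positions A)"

text \<open>
  Eigenvalues in nondecreasing order, repeated according to multiplicity; for a symmetric
  \<open>n \<times> n\<close> matrix the list has length \<open>n\<close>.
\<close>

definition eigenvalues_sorted :: "real mat \<Rightarrow> real list" where
  "eigenvalues_sorted A = sorted_list_of_multiset (proots (char_poly A))"

definition norm2 :: "real Matrix.vec \<Rightarrow> real" where
  "norm2 v = sqrt (scalar_prod v v)"

text \<open>
  The input is a sparse matrix in coordinate format: the positions of the nonzero entries are listed
  in an arbitrary order \<open>ps\<close>.
  Cell \<open>0\<close> holds \<open>n\<close>, cell \<open>1\<close> the number of nonzero entries, and each nonzero entry takes
  three consecutive cells (row, column, value). Behind them follow the integer part of the real
  number \<open>\<epsilon>\<close> and its binary digits after the point, one per cell.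
\<close>

definition coordinate_order :: "int mat \<Rightarrow> (nat \<times> nat) list \<Rightarrow> bool" where
  "coordinate_order A ps \<longleftrightarrow> distinct ps \<and> set ps = nonzero_positions A"

definition encode_input :: "int mat \<Rightarrow> (nat \<times> nat) list \<Rightarrow> real \<Rightarrow> nat \<Rightarrow> int" where
  "encode_input A ps \<epsilon> cell =
     (let hd_cells = [int (dim_row A), int (length ps)] @
            concat (map (\<lambda>(i, j). [int i, int j, A $$ (i, j)]) ps)
      in if cell < length hd_cells then hd_cells ! cell
         else if cell = length hd_cells then \<lfloor>\<epsilon>\<rfloor>
         else \<lfloor>\<epsilon> * 2 ^ (cell - length hd_cells)\<rfloor> mod 2)"

text \<open>
  Fixed point output: cell \<open>0\<close> holds the number \<open>p\<close> of binary digits after the point, and an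
  integer \<open>z\<close> in any other cell denotes \<open>z / 2 ^ p\<close>. The \<open>n\<close> approximate eigenvalues come first,
  followed by the \<open>n\<close> vectors.
\<close>

definition fixed_point_output ::
  "nat \<Rightarrow> (nat \<Rightarrow> int option) \<Rightarrow> (nat \<Rightarrow> real) \<Rightarrow> (nat \<Rightarrow> real Matrix.vec) \<Rightarrow> bool" where
  "fixed_point_output n w l v \<longleftrightarrow>
     (\<exists>p::nat. w 0 = Some (int p) \<and>
        (\<forall>i<n. \<exists>z. w (1 + i) = Some z \<and> l i = of_int z / 2 ^ p) \<and>
        (\<forall>i<n. v i \<in> carrier_vec n \<and>
           (\<forall>j<n. \<exists>z. w (1 + n + n * i + j) = Some z \<and> vec_index (v i) j = of_int z / 2 ^ p)))"

text \<open>
  The quantity \<open>log (n U / \<epsilon>)\<close>, guarded so that it is meaningful for all parameters: if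
  \<open>\<epsilon> \<le> 1\<close> and \<open>n U / \<epsilon> \<ge> 2\<close>, it agrees with \<open>log (n U / \<epsilon>)\<close> up to a constant factor.
  The summand \<open>\<epsilon>\<close> only matters for \<open>\<epsilon> > 1\<close>, where \<open>log (n U / \<epsilon>)\<close> can be smaller than the number
  of bits of a single entry, or negative.
\<close>

definition log_size :: "nat \<Rightarrow> nat \<Rightarrow> real \<Rightarrow> real" where
  "log_size n U \<epsilon> = log 2 (2 + real n * real U / \<epsilon> + \<epsilon>)"

end

theory Submission
  imports Defs "Jordan_Normal_Form.Spectral_Radius"
begin

text \<open>
 The algorithm is exact integer arithmetic; the coins only serve to separate the eigenvalues. With
 \<open>Q = 2 ^ q\<close> a power of two exceeding \<open>n\<close>, the entries and \<open>1 / \<epsilon>\<close>, and \<open>F = Q ^ ph\<close>, the matrix \<open>F ^ 3 A + D\<close>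
 with a random integer diagonal \<open>D\<close>, \<open>0 \<le> D i < F ^ 2\<close>, has all eigenvalue gaps larger than \<open>1\<close>
 except with probability \<open>O(Q ^ 6 / F)\<close> (a discrete Wegner estimate from rank-one interlacing). Rounding
 \<open>D\<close> away costs only \<open>1 / F\<close> in the eigenvalues by Weyl's inequality.

 To stay in \<open>O(n log)\<close> bits no matrix is ever stored. For an integer shift \<open>s\<close> the matrix
 \<open>M = I + b (B - s I)\<close> with \<open>b = F ^ 8\<close> is the identity modulo \<open>b\<close>, so the \<open>b\<close>-adic digits of a column of
 its inverse come one after another from multiplications with the sparse \<open>B\<close>. A single entry of
 the inverse modulo \<open>b ^ (2 n)\<close> yields the ratio of two consecutive leading principal minors, hence the
 exact minors; their sign changes count the eigenvalues below \<open>s\<close> (Sylvester), which gives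
 bisection. The adjugate entries of the bracketing shift, computed in the same way one at a time,
 form one step of inverse iteration, whose error is controlled by the gap.
\<close>

text \<open>Orthogonality is one obstacle: in \<open>O(n log)\<close> bits the vectors cannot be
  kept for orthogonalisation, so each has to come out close to its member of one fixed orthonormal
  eigenbasis, without reference to the others. This needs a gap. The random diagonal consists of
  \<open>n\<close> words, so it can be kept and the same matrix serves all eigenvalues. The other
  obstacle is degeneracy: minors of \<open>B - s I\<close> may vanish, which spoils sign count and
  inversion. All leading minors of \<open>I + b (B - s I)\<close> are 1 modulo \<open>b\<close>, so
  nothing is singular and no pivoting occurs; the price is a threshold moved by
  \<open>1 / b\<close>.

  The scales are powers of \<open>F\<close>. A gap 1 of \<open>F ^ 3 A + D\<close> is a gap
  \<open>F\<close> of \<open>B = F (F ^ 3 A + D)\<close>, while bisection locates an eigenvalue of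
  \<open>B\<close> within 1; hence a single step of inverse iteration gains a factor of order
  \<open>F\<close>.

  Time: an entry of an inverse takes \<open>2 n\<close> passes of \<open>n + nnz\<close> word
  operations, \<open>n\<close> entries give the minors at one shift, logarithmically many shifts
  give one eigenvalue, and there are \<open>n\<close> eigenvalues: together
  \<open>n ^ 3 (nnz + n)\<close> up to logarithms.\<close>

unbundle no inner_syntax
unbundle no vec_syntax

section \<open>Spectral theorem for real symmetric matrices\<close>

lemma sum_of_bool_delta:
 fixes f :: "nat \<Rightarrow> 'a :: comm_semiring_1"
 shows "i < n \<Longrightarrow> (\<Sum>k<n. of_bool (i = k) * f k) = f i"
  and "i < n \<Longrightarrow> (\<Sum>k<n. of_bool (k = i) * f k) = f i"
proof -
 have *: "of_bool (i = k) * f k = (if i = k then f k else 0)" "of_bool (k = i) * f k = (if k = i then f k else 0)" for k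
  by auto
 show "i < n \<Longrightarrow> (\<Sum>k<n. of_bool (i = k) * f k) = f i"
  and "i < n \<Longrightarrow> (\<Sum>k<n. of_bool (k = i) * f k) = f i"
  unfolding * by simp_all
qed

text \<open>Over the complex numbers an eigenvector \<open>z = x + i y\<close> exists because the
  spectrum is nonempty. Symmetry makes the pairings of \<open>y\<close> with \<open>A x\<close> and
  of \<open>x\<close> with \<open>A y\<close> agree, which gives
  \<open>Im c (|x|^2 + |y|^2) = 0\<close>; so the eigenvalue is real, and \<open>x\<close> or
  \<open>y\<close>, whichever is nonzero, is a real eigenvector.\<close>

lemma symmetric_real_eigenvector:
 fixes A :: "real mat"
 assumes A: "A \<in> carrier_mat n n" and sym: "transpose_mat A = A" and n: "n > 0"
 shows "\<exists>l v. v \<in> carrier_vec n \<and> v \<bullet> v = 1 \<and> A *\<^sub>v v = l \<cdot>\<^sub>v v"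
proof -
 let ?C = "map_mat complex_of_real A"
 have C: "?C \<in> carrier_mat n n" using A by auto
 from spectrum_non_empty[OF C] n obtain c where "eigenvalue ?C c" unfolding spectrum_def by auto
 then obtain z where z: "z \<in> carrier_vec n" "z \<noteq> 0\<^sub>v n" "?C *\<^sub>v z = c \<cdot>\<^sub>v z"
  unfolding eigenvalue_def eigenvector_def using A by auto
 define x where "x = map_vec Re z"
 define y where "y = map_vec Im z"
 have xy: "x \<in> carrier_vec n" "y \<in> carrier_vec n" using z unfolding x_def y_def by auto
 have comp: "(\<Sum>j<n. complex_of_real (A $$ (i,j)) * z $ j) = c * z $ i" if "i < n" for i
 proof -
  have "(?C *\<^sub>v z) $ i = (c \<cdot>\<^sub>v z) $ i" using z by simp
  then show ?thesis using that z(1) A by (simp add: scalar_prod_def atLeast0LessThan)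
 qed
 have Ax: "A *\<^sub>v x = Re c \<cdot>\<^sub>v x - Im c \<cdot>\<^sub>v y"
 proof (rule eq_vecI)
  fix i assume "i < dim_vec (Re c \<cdot>\<^sub>v x - Im c \<cdot>\<^sub>v y)"
  then have i: "i < n" using xy by simp
  have "Re (\<Sum>j<n. complex_of_real (A $$ (i,j)) * z $ j) = Re (c * z $ i)" using comp[OF i] by simp
  then show "(A *\<^sub>v x) $ i = (Re c \<cdot>\<^sub>v x - Im c \<cdot>\<^sub>v y) $ i"
   using i z A by (simp add: scalar_prod_def atLeast0LessThan x_def y_def)
 qed (use A xy in auto)
 have Ay: "A *\<^sub>v y = Im c \<cdot>\<^sub>v x + Re c \<cdot>\<^sub>v y"
 proof (rule eq_vecI)
  fix i assume "i < dim_vec (Im c \<cdot>\<^sub>v x + Re c \<cdot>\<^sub>v y)"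
  then have i: "i < n" using xy by simp
  have "Im (\<Sum>j<n. complex_of_real (A $$ (i,j)) * z $ j) = Im (c * z $ i)" using comp[OF i] by simp
  then show "(A *\<^sub>v y) $ i = (Im c \<cdot>\<^sub>v x + Re c \<cdot>\<^sub>v y) $ i"
   using i z A by (simp add: scalar_prod_def atLeast0LessThan x_def y_def)
 qed (use A xy in auto)
 have "y \<bullet> (A *\<^sub>v x) = x \<bullet> (A *\<^sub>v y)"
 proof -
  have "y \<bullet> (A *\<^sub>v x) = (transpose_mat A *\<^sub>v y) \<bullet> x"
   using transpose_vec_mult_scalar[OF A xy(1) xy(2)] by simp
  then show ?thesis using sym comm_scalar_prod[OF xy(1), of "A *\<^sub>v y"] A xy by simp
 qed
 then have "Re c * (y \<bullet> x) - Im c * (y \<bullet> y) = Im c * (x \<bullet> x) + Re c * (x \<bullet> y)"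
  unfolding Ax Ay using xy by (simp add: scalar_prod_minus_distrib scalar_prod_add_distrib[of _ n])
 then have 0: "Im c * (x \<bullet> x + y \<bullet> y) = 0"
  using comm_scalar_prod[OF xy] by (simp add: algebra_simps)
 have nn: "x \<bullet> x \<ge> 0" "y \<bullet> y \<ge> 0" by (auto simp: scalar_prod_def intro!: sum_nonneg)
 have zz: "w = 0\<^sub>v n" if "w \<bullet> w = 0" "w \<in> carrier_vec n" for w :: "real Matrix.vec"
 proof -
  have "\<forall>i\<in>{0..<n}. w $ i * w $ i = 0"
   using that by (subst sum_nonneg_eq_0_iff[symmetric]) (auto simp: scalar_prod_def)
  then show ?thesis using that by (intro eq_vecI) auto
 qed
 have nz: "x \<bullet> x \<noteq> 0 \<or> y \<bullet> y \<noteq> 0"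
 proof (rule ccontr)
  assume "\<not> ?thesis"
  then have "x = 0\<^sub>v n" "y = 0\<^sub>v n" using zz xy by auto
  then have "\<forall>i<n. x $ i = 0 \<and> y $ i = 0" by auto
  then have "z = 0\<^sub>v n" using z unfolding x_def y_def
   by (intro eq_vecI) (auto simp: complex_eq_iff)
  then show False using z by simp
 qed
 then have im: "Im c = 0" using 0 nn by auto
 have Axy: "A *\<^sub>v x = Re c \<cdot>\<^sub>v x" "A *\<^sub>v y = Re c \<cdot>\<^sub>v y"
  using Ax Ay im xy by auto
 have fin: ?thesis if w: "w \<in> carrier_vec n" "w \<bullet> w \<noteq> 0" "A *\<^sub>v w = Re c \<cdot>\<^sub>v w" for w
 proof (intro exI conjI)
  let ?s = "1 / sqrt (w \<bullet> w)"
  have ge: "w \<bullet> w > 0" using w(2) by (smt (verit) scalar_prod_def sum_nonneg zero_le_square)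
  show "?s \<cdot>\<^sub>v w \<in> carrier_vec n" using w by simp
  show "(?s \<cdot>\<^sub>v w) \<bullet> (?s \<cdot>\<^sub>v w) = 1" using w ge by simp
  show "A *\<^sub>v (?s \<cdot>\<^sub>v w) = Re c \<cdot>\<^sub>v (?s \<cdot>\<^sub>v w)"
   using w A by (simp add: mult_mat_vec[of _ n n] smult_smult_assoc mult.commute)
 qed
 show ?thesis using nz fin xy Axy by blast
qed

lemma mat_mult_unit_vec:
 fixes M :: "'a :: comm_semiring_1 mat"
 shows "M \<in> carrier_mat m m \<Longrightarrow> j < m \<Longrightarrow> M *\<^sub>v unit_vec m j = col M j"
 by (intro eq_vecI) (auto simp: scalar_prod_right_unit)

text \<open>Induction by deflation: a Householder reflection \<open>H\<close> takes the last unit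
  vector to a unit eigenvector, so \<open>H A H\<close> vanishes in its last row and column off the
  diagonal, and the induction hypothesis diagonalises the leading block.\<close>

lemma symmetric_real_diagonalization:
 fixes A :: "real mat"
 assumes "A \<in> carrier_mat n n" and "transpose_mat A = A"
 shows "\<exists>V L. V \<in> carrier_mat n n \<and> L \<in> carrier_mat n n \<and> diagonal_mat L \<and>
  V * transpose_mat V = 1\<^sub>m n \<and> transpose_mat V * V = 1\<^sub>m n \<and> A = transpose_mat V * L * V"
 using assms
proof (induction n arbitrary: A)
 case 0
 then show ?case
  by (intro exI[of _ "1\<^sub>m 0"] exI[of _ "0\<^sub>m 0 0"]) (auto simp: diagonal_mat_def)
next
 case (Suc n A)
 note A = Suc.prems(1)
 obtain l v where v: "v \<in> carrier_vec (Suc n)" "v \<bullet> v = 1" "A *\<^sub>v v = l \<cdot>\<^sub>v v"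
  using symmetric_real_eigenvector[OF Suc.prems] by blast
 have sv: "(\<Sum>i<Suc n. v $ i * v $ i) = 1" using v by (simp add: scalar_prod_def atLeast0LessThan)
 define w where "w i = v $ i - of_bool (i = n)" for i
 define ww where "ww = (\<Sum>i<Suc n. w i * w i)"
 \<comment> \<open>\<open>w\<close> is the difference of \<open>v\<close> and the last unit vector,
   and \<open>ww\<close> its squared norm. If \<open>v\<close> is that unit vector, then
   \<open>ww = 0\<close> and \<open>2 / 0 = 0\<close> makes \<open>H\<close> the identity, which is
   the right map; the computations below cover this case.\<close>
 define H where "H = mat (Suc n) (Suc n) (\<lambda>(i,j). of_bool (i = j) - 2 / ww * w i * w j)"
 have H: "H \<in> carrier_mat (Suc n) (Suc n)" unfolding H_def by simp
 have Hs: "transpose_mat H = H" unfolding H_def by (intro eq_matI) auto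
 have HH: "H * H = 1\<^sub>m (Suc n)"
 proof (rule eq_matI)
  fix i j assume "i < dim_row (1\<^sub>m (Suc n))" "j < dim_col (1\<^sub>m (Suc n))"
  then have ij: "i < Suc n" "j < Suc n" by auto
  have "(H * H) $$ (i,j) = (\<Sum>k<Suc n. (of_bool (i = k) - 2 / ww * w i * w k) * (of_bool (k = j) - 2 / ww * w k * w j))"
   using ij by (simp add: H_def scalar_prod_def atLeast0LessThan del: sum.lessThan_Suc)
  also have "\<dots> = (\<Sum>k<Suc n. of_bool (i = k) * of_bool (k = j) - of_bool (i = k) * (2 / ww * w k * w j)
    - of_bool (k = j) * (2 / ww * w i * w k) + (2/ww)^2 * w i * w j * (w k * w k))"
   by (intro sum.cong) (auto simp: algebra_simps power2_eq_square)
  also have "\<dots> = of_bool (i = j) - 2 * (2 / ww * w i * w j) + (2/ww)^2 * w i * w j * ww"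
   unfolding sum.distrib sum_subtractf ww_def[symmetric] sum_distrib_left[symmetric]
   unfolding sum_of_bool_delta(1)[OF ij(1)] sum_of_bool_delta(2)[OF ij(2)] by simp
  also have "\<dots> = of_bool (i = j)" by (simp add: power2_eq_square)
  finally show "(H * H) $$ (i,j) = 1\<^sub>m (Suc n) $$ (i,j)" using ij by simp
 qed (use H in auto)
 have ww2: "ww = 2 - 2 * v $ n"
 proof -
  have "ww = (\<Sum>i<Suc n. v $ i * v $ i - 2 * (of_bool (i = n) * v $ i) + of_bool (i = n) * 1)"
   unfolding ww_def w_def by (intro sum.cong) (auto simp: algebra_simps)
  also have "\<dots> = 2 - 2 * v $ n"
   unfolding sum.distrib sum_subtractf sum_distrib_left[symmetric] sv
   by (subst (1 2) sum_of_bool_delta) auto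
  finally show ?thesis .
 qed
 have Hn: "col H n = v"
 proof (rule eq_vecI)
  fix i assume "i < dim_vec v"
  then have i: "i < Suc n" using v by simp
  have "of_bool (i = n) - 2 / ww * w i * w n = v $ i"
  proof (cases "ww = 0")
   case True
   then have "\<forall>i\<in>{..<Suc n}. w i * w i = 0"
    by (subst sum_nonneg_eq_0_iff[symmetric]) (auto simp: ww_def)
   then have "w i = 0" using i by auto
   then show ?thesis unfolding w_def by simp
  next
   case False
   have "2 * w n = - ww" unfolding ww2 w_def by simp
   then have "2 / ww * w n = -1" using False by (simp add: field_simps)
   then have "2 / ww * w i * w n = - w i" by (metis mult.assoc mult.commute mult_minus1)
   then show ?thesis unfolding w_def by simp
  qed
  then show "col H n $ i = v $ i" using i unfolding H_def by simp
 qed (use v in \<open>auto simp: H_def\<close>)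
 define B where "B = H * A * H"
 have B: "B \<in> carrier_mat (Suc n) (Suc n)" using A H unfolding B_def by simp
 have Bs: "transpose_mat B = B"
  unfolding B_def using A H Hs Suc.prems(2) by (simp add: transpose_mult[of _ "Suc n" "Suc n" _ "Suc n"])
 have Bn: "B $$ (i,n) = (if i = n then l else 0)" if i: "i < Suc n" for i
 proof -
  have "col B n = H *\<^sub>v (A *\<^sub>v (H *\<^sub>v unit_vec (Suc n) n))"
   unfolding B_def using A H
   by (simp add: mat_mult_unit_vec[of _ "Suc n", symmetric] assoc_mult_mat_vec[of _ "Suc n" "Suc n" _ "Suc n"])
  also have "H *\<^sub>v unit_vec (Suc n) n = v" using Hn H by (simp add: mat_mult_unit_vec)
  also have "H *\<^sub>v (A *\<^sub>v v) = l \<cdot>\<^sub>v (H *\<^sub>v v)" using v H by (simp add: mult_mat_vec[of _ "Suc n" "Suc n"])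
  also have "H *\<^sub>v v = H *\<^sub>v (H *\<^sub>v unit_vec (Suc n) n)" using Hn H by (simp add: mat_mult_unit_vec)
  also have "\<dots> = unit_vec (Suc n) n"
   using H by (simp add: assoc_mult_mat_vec[symmetric, of _ "Suc n" "Suc n" _ "Suc n"] HH del: assoc_mult_mat_vec)
  finally have "col B n $ i = (l \<cdot>\<^sub>v unit_vec (Suc n) n) $ i" by simp
  then show ?thesis using i B by auto
 qed
 have Bsym: "B $$ (i,j) = B $$ (j,i)" if "i < Suc n" "j < Suc n" for i j
  using Bs B that by (metis carrier_matD index_transpose_mat(1))
 define B1 where "B1 = mat n n (\<lambda>(i,j). B $$ (i,j))"
 have B1: "B1 \<in> carrier_mat n n" "transpose_mat B1 = B1"
  unfolding B1_def using Bsym by auto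
 obtain V L where V: "V \<in> carrier_mat n n" "L \<in> carrier_mat n n" "diagonal_mat L"
  "V * transpose_mat V = 1\<^sub>m n" "transpose_mat V * V = 1\<^sub>m n" "B1 = transpose_mat V * L * V"
  using Suc.IH[OF B1] by blast
 define Z where "Z = four_block_mat V (0\<^sub>m n 1) (0\<^sub>m 1 n) (1\<^sub>m 1)"
 define L' where "L' = four_block_mat L (0\<^sub>m n 1) (0\<^sub>m 1 n) (mat 1 1 (\<lambda>_. l))"
 have Z: "Z \<in> carrier_mat (Suc n) (Suc n)" unfolding Z_def using four_block_carrier_mat[of V n n "1\<^sub>m 1" 1 1] V by simp
 have L': "L' \<in> carrier_mat (Suc n) (Suc n)" unfolding L'_def using four_block_carrier_mat[of L n n "mat 1 1 (\<lambda>_. l)" 1 1] V by simp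
 have Zt: "transpose_mat Z = four_block_mat (transpose_mat V) (0\<^sub>m n 1) (0\<^sub>m 1 n) (1\<^sub>m 1)"
  unfolding Z_def using V by (subst transpose_four_block_mat[of _ n n _ 1 _ 1]) auto
 have ZZ: "Z * transpose_mat Z = 1\<^sub>m (Suc n)" "transpose_mat Z * Z = 1\<^sub>m (Suc n)"
  unfolding Zt unfolding Z_def using V
  by (subst mult_four_block_mat[of _ n n _ 1 _ 1 _ _ n _ 1]; auto)+
 have Bf: "B = four_block_mat B1 (0\<^sub>m n 1) (0\<^sub>m 1 n) (mat 1 1 (\<lambda>_. l))"
 proof (rule eq_matI)
  fix i j assume "i < dim_row (four_block_mat B1 (0\<^sub>m n 1) (0\<^sub>m 1 n) (mat 1 1 (\<lambda>_. l)))"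
   "j < dim_col (four_block_mat B1 (0\<^sub>m n 1) (0\<^sub>m 1 n) (mat 1 1 (\<lambda>_. l)))"
  then have "i < Suc n" "j < Suc n" using B1 by auto
  then show "B $$ (i,j) = four_block_mat B1 (0\<^sub>m n 1) (0\<^sub>m 1 n) (mat 1 1 (\<lambda>_. l)) $$ (i,j)"
   using Bn[of i] Bn[of j] Bsym[of i j] B1 by (auto simp: B1_def less_Suc_eq)
 qed (use B B1 in auto)
 have BZ: "B = transpose_mat Z * L' * Z"
 proof -
  have "transpose_mat Z * L' = four_block_mat (transpose_mat V * L) (0\<^sub>m n 1) (0\<^sub>m 1 n) (mat 1 1 (\<lambda>_. l))"
   unfolding Zt L'_def using V by (subst mult_four_block_mat[of _ n n _ 1 _ 1 _ _ n _ 1]) auto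
  then have "transpose_mat Z * L' * Z = four_block_mat (transpose_mat V * L) (0\<^sub>m n 1) (0\<^sub>m 1 n) (mat 1 1 (\<lambda>_. l)) *
    four_block_mat V (0\<^sub>m n 1) (0\<^sub>m 1 n) (1\<^sub>m 1)" by (simp only: Z_def)
  also have "\<dots> = B" unfolding Bf V(6) using V
   by (subst mult_four_block_mat[of _ n n _ 1 _ 1 _ _ n _ 1]) auto
  finally show ?thesis ..
 qed
 have assoc: "X * Y * K = X * (Y * K)" "X * Y \<in> carrier_mat (Suc n) (Suc n)"
  if "X \<in> carrier_mat (Suc n) (Suc n)" "Y \<in> carrier_mat (Suc n) (Suc n)" "K \<in> carrier_mat (Suc n) (Suc n)"
  for X Y K :: "real mat"
  using assoc_mult_mat[OF that] mult_carrier_mat[OF that(1,2)] by auto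
 have Ztc: "transpose_mat Z \<in> carrier_mat (Suc n) (Suc n)" using Z by simp
 define V' where "V' = Z * H"
 have V': "V' \<in> carrier_mat (Suc n) (Suc n)" unfolding V'_def using Z H by simp
 have V't: "transpose_mat V' = H * transpose_mat Z"
  unfolding V'_def using Z H Hs by (simp add: transpose_mult[of _ "Suc n" "Suc n" _ "Suc n"])
 have 1: "V' * transpose_mat V' = 1\<^sub>m (Suc n)"
 proof -
  have "V' * transpose_mat V' = Z * (H * H) * transpose_mat Z"
   unfolding V't unfolding V'_def using Z H Ztc
   by (simp add: assoc[of _ _ "transpose_mat Z"] assoc del: assoc_mult_mat)
  then show ?thesis unfolding HH using Z ZZ by simp
 qed
 have AB: "A = H * B * H"
 proof -
  have "H * B * H = (H * H) * A * (H * H)" unfolding B_def using A H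
   by (simp add: assoc[of _ _ H] assoc del: assoc_mult_mat)
  then show ?thesis unfolding HH using A by simp
 qed
 have 2: "A = transpose_mat V' * L' * V'"
  unfolding AB BZ V't unfolding V'_def using Z H L' Ztc
  by (simp add: assoc[of _ _ H] assoc del: assoc_mult_mat)
 have 3: "diagonal_mat L'"
  using V(2,3) unfolding L'_def diagonal_mat_def by (auto simp: less_Suc_eq)
 show ?case
  using 1 2 3 V' L' mat_mult_left_right_inverse[OF V' _ 1] by (intro exI[of _ V'] exI[of _ L']) auto
qed

section \<open>Orthonormal eigensystems and the sorted spectrum\<close>

text \<open>\<open>u k i\<close> is coordinate \<open>i\<close> of the eigenvector for
  \<open>\<alpha> k\<close>. Matrices are functions here, so that one \<open>A\<close> serves in all
  dimensions: \<open>eigsys k A\<close> speaks about the leading principal submatrix of order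
  \<open>k\<close>, as interlacing and the sign count require.\<close>

definition eigsys :: "nat \<Rightarrow> (nat \<Rightarrow> nat \<Rightarrow> real) \<Rightarrow> (nat \<Rightarrow> real) \<Rightarrow> (nat \<Rightarrow> nat \<Rightarrow> real) \<Rightarrow> bool" where
 "eigsys n A \<alpha> u \<longleftrightarrow>
  (\<forall>k<n. \<forall>l<n. (\<Sum>i<n. u k i * u l i) = of_bool (k = l)) \<and>
  (\<forall>i<n. \<forall>j<n. (\<Sum>k<n. u k i * u k j) = of_bool (i = j)) \<and>
  (\<forall>i<n. \<forall>j<n. A i j = (\<Sum>k<n. \<alpha> k * u k i * u k j)) \<and>
  (\<forall>k l. k \<le> l \<longrightarrow> l < n \<longrightarrow> \<alpha> k \<le> \<alpha> l)"

lemma eigsysD: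
 assumes "eigsys n A \<alpha> u"
 shows "k < n \<Longrightarrow> l < n \<Longrightarrow> (\<Sum>i<n. u k i * u l i) = of_bool (k = l)"
  and "i < n \<Longrightarrow> j < n \<Longrightarrow> (\<Sum>k<n. u k i * u k j) = of_bool (i = j)"
  and "i < n \<Longrightarrow> j < n \<Longrightarrow> A i j = (\<Sum>k<n. \<alpha> k * u k i * u k j)"
  and "k \<le> l \<Longrightarrow> l < n \<Longrightarrow> \<alpha> k \<le> \<alpha> l"
 using assms unfolding eigsys_def by blast+

lemma eigsys_exists:
 assumes sym: "\<And>i j. i < n \<Longrightarrow> j < n \<Longrightarrow> A i j = A j i"
 shows "\<exists>\<alpha> u. eigsys n A \<alpha> u"
proof -
 define M where "M = mat n n (\<lambda>(i,j). A i j)"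
 have M: "M \<in> carrier_mat n n" "transpose_mat M = M" unfolding M_def using sym by auto
 obtain V L where V: "V \<in> carrier_mat n n" and L: "L \<in> carrier_mat n n" and diag: "diagonal_mat L"
  and VV: "V * transpose_mat V = 1\<^sub>m n" "transpose_mat V * V = 1\<^sub>m n" and Meq: "M = transpose_mat V * L * V"
  using symmetric_real_diagonalization[OF M] by blast
 define xs where "xs = sort_key (\<lambda>k. L $$ (k,k)) [0..<n]"
 define \<pi> where "\<pi> k = xs ! k" for k
 have len: "length xs = n" "set xs = {..<n}" "distinct xs" unfolding xs_def by auto
 have bij: "bij_betw \<pi> {..<n} {..<n}"
  unfolding \<pi>_def by (rule bij_betw_nth) (simp_all add: len)
 then have pin: "\<pi> k < n" if "k < n" for k using that bij_betwE by blast
 have pinj: "\<pi> k = \<pi> l \<longleftrightarrow> k = l" if "k < n" "l < n" for k l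
  using bij that unfolding bij_betw_def inj_on_def by auto
 have srt: "L $$ (\<pi> k, \<pi> k) \<le> L $$ (\<pi> l, \<pi> l)" if "k \<le> l" "l < n" for k l
  using sorted_sort_key[of "\<lambda>k. L $$ (k,k)" "[0..<n]", folded xs_def] that len
  unfolding \<pi>_def sorted_iff_nth_mono by auto
 have "eigsys n A (\<lambda>k. L $$ (\<pi> k, \<pi> k)) (\<lambda>k i. V $$ (\<pi> k, i))"
  unfolding eigsys_def
 proof (intro conjI allI impI)
  fix k l assume kl: "k < n" "l < n"
  have "(V * transpose_mat V) $$ (\<pi> k, \<pi> l) = of_bool (k = l)"
   unfolding VV using kl pin pinj by auto
  then show "(\<Sum>i<n. V $$ (\<pi> k, i) * V $$ (\<pi> l, i)) = of_bool (k = l)"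
   using V kl pin by (simp add: scalar_prod_def atLeast0LessThan)
 next
  fix i j assume ij: "i < n" "j < n"
  have "(transpose_mat V * V) $$ (i, j) = of_bool (i = j)"
   unfolding VV using ij by auto
  then have "(\<Sum>k<n. V $$ (k, i) * V $$ (k, j)) = of_bool (i = j)"
   using V ij by (simp add: scalar_prod_def atLeast0LessThan)
  then show "(\<Sum>k<n. V $$ (\<pi> k, i) * V $$ (\<pi> k, j)) = of_bool (i = j)"
   using sum.reindex_bij_betw[OF bij, of "\<lambda>k. V $$ (k, i) * V $$ (k, j)"] by simp
 next
  fix i j assume ij: "i < n" "j < n"
  have "A i j = (transpose_mat V * L * V) $$ (i,j)" unfolding Meq[symmetric] M_def using ij by simp
  also have "\<dots> = (\<Sum>k<n. (transpose_mat V * L) $$ (i,k) * V $$ (k,j))"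
   using V L ij by (simp add: scalar_prod_def atLeast0LessThan del: assoc_mult_mat)
  also have "\<dots> = (\<Sum>k<n. L $$ (k,k) * V $$ (k,i) * V $$ (k,j))"
  proof (rule sum.cong[OF refl])
   fix k assume "k \<in> {..<n}"
   then have k: "k < n" by simp
   have "(transpose_mat V * L) $$ (i,k) = (\<Sum>l<n. V $$ (l,i) * L $$ (l,k))"
    using V L ij k by (simp add: scalar_prod_def atLeast0LessThan)
   also have "\<dots> = (\<Sum>l<n. of_bool (l = k) * (V $$ (l,i) * L $$ (l,k)))"
    using diag L k unfolding diagonal_mat_def by (intro sum.cong) auto
   also have "\<dots> = V $$ (k,i) * L $$ (k,k)" using k by (rule sum_of_bool_delta(2))
   finally show "(transpose_mat V * L) $$ (i,k) * V $$ (k,j) = L $$ (k,k) * V $$ (k,i) * V $$ (k,j)"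
    by simp
  qed
  also have "\<dots> = (\<Sum>k<n. L $$ (\<pi> k, \<pi> k) * V $$ (\<pi> k, i) * V $$ (\<pi> k, j))"
   using sum.reindex_bij_betw[OF bij, of "\<lambda>k. L $$ (k,k) * V $$ (k, i) * V $$ (k, j)"] by simp
  finally show "A i j = \<dots>" .
 qed (use srt in auto)
 then show ?thesis by blast
qed

lemma eigsys_similar:
 assumes "eigsys n A \<alpha> u"
 shows "similar_mat (mat n n (\<lambda>(i,j). A i j)) (mat n n (\<lambda>(i,j). if i = j then \<alpha> i else 0))"
proof -
 let ?M = "mat n n (\<lambda>(i,j). A i j)" and ?L = "mat n n (\<lambda>(i,j). if i = j then \<alpha> i else 0)"
 let ?V = "mat n n (\<lambda>(i,j). u i j)"
 have 1: "?V * transpose_mat ?V = 1\<^sub>m n" "transpose_mat ?V * ?V = 1\<^sub>m n"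
  using eigsysD(1,2)[OF assms] by (auto intro!: eq_matI simp: scalar_prod_def atLeast0LessThan)
 have tL: "transpose_mat ?V * ?L = mat n n (\<lambda>(i,k). \<alpha> k * u k i)"
 proof (rule eq_matI)
  fix i k assume "i < dim_row (mat n n (\<lambda>(i,k). \<alpha> k * u k i))" "k < dim_col (mat n n (\<lambda>(i,k). \<alpha> k * u k i))"
  then have ik: "i < n" "k < n" by auto
  have "(\<Sum>l<n. u l i * (if l = k then \<alpha> l else 0)) = (\<Sum>l<n. of_bool (l = k) * (\<alpha> l * u l i))"
   by (intro sum.cong) auto
  then show "(transpose_mat ?V * ?L) $$ (i,k) = mat n n (\<lambda>(i,k). \<alpha> k * u k i) $$ (i,k)"
   using ik by (simp add: scalar_prod_def atLeast0LessThan sum_of_bool_delta)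
 qed auto
 have 2: "?M = transpose_mat ?V * ?L * ?V"
  unfolding tL using eigsysD(3)[OF assms]
  by (auto intro!: eq_matI simp: scalar_prod_def atLeast0LessThan)
 have "similar_mat_wit ?M ?L (transpose_mat ?V) ?V"
  by (rule similar_mat_witI[OF 1(2) 1(1) 2]) auto
 then show ?thesis unfolding similar_mat_def by blast
qed

lemma eigsys_det:
 assumes "eigsys n A \<alpha> u"
 shows "det (mat n n (\<lambda>(i,j). A i j)) = (\<Prod>k<n. \<alpha> k)"
proof -
 let ?L = "mat n n (\<lambda>(i,j). if i = j then \<alpha> i else 0)"
 have "det ?L = prod_list (diag_mat ?L)"
  by (rule det_upper_triangular) (auto simp: upper_triangular_def)
 also have "diag_mat ?L = map \<alpha> [0..<n]" unfolding diag_mat_def by auto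
 also have "prod_list (map \<alpha> [0..<n]) = (\<Prod>k<n. \<alpha> k)"
  by (simp add: prod.distinct_set_conv_list[symmetric] atLeast0LessThan)
 finally show ?thesis using det_similar[OF eigsys_similar[OF assms]] by simp
qed

lemma proots_prod_list_linear:
 "proots (\<Prod>a\<leftarrow>as. [:- a, 1:]) = mset (as :: real list)"
proof (induction as)
 case (Cons a as)
 have "(\<Prod>a\<leftarrow>as. [:- a, 1:]) \<noteq> 0" by (auto simp: prod_list_zero_iff)
 then show ?case using Cons by (simp add: proots_mult del: mult_pCons_left)
qed simp

text \<open>The link to the roots of the characteristic polynomial, in terms of which the
  specification is stated; the analysis itself works with eigensystems.\<close>

lemma eigsys_eigenvalues_sorted:
 assumes "eigsys n A \<alpha> u" and "k < n"
 shows "eigenvalues_sorted (mat n n (\<lambda>(i,j). A i j)) ! k = \<alpha> k"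
proof -
 let ?L = "mat n n (\<lambda>(i,j). if i = j then \<alpha> i else 0)"
 have "char_poly (mat n n (\<lambda>(i,j). A i j)) = char_poly ?L"
  using char_poly_similar[OF eigsys_similar[OF assms(1)]] .
 also have "\<dots> = (\<Prod>a\<leftarrow>diag_mat ?L. [:- a, 1:])"
  by (rule char_poly_upper_triangular[of _ n]) (auto simp: upper_triangular_def)
 also have "diag_mat ?L = map \<alpha> [0..<n]" unfolding diag_mat_def by auto
 finally have "proots (char_poly (mat n n (\<lambda>(i,j). A i j))) = mset (map \<alpha> [0..<n])"
  using proots_prod_list_linear by metis
 moreover have "sort (map \<alpha> [0..<n]) = map \<alpha> [0..<n]"
  using eigsysD(4)[OF assms(1)] by (intro sorted_sort_id) (auto simp: sorted_iff_nth_mono)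
 ultimately show ?thesis using assms(2)
  unfolding eigenvalues_sorted_def by (simp only: sorted_list_of_multiset_mset) simp
qed

section \<open>Variational inequalities: Weyl and interlacing\<close>

definition qform :: "nat \<Rightarrow> (nat \<Rightarrow> nat \<Rightarrow> real) \<Rightarrow> (nat \<Rightarrow> real) \<Rightarrow> real" where
 "qform n A x = (\<Sum>i<n. \<Sum>j<n. x i * A i j * x j)"

lemma sum_rotate3:
 "(\<Sum>k<n. \<Sum>i<n. \<Sum>j<n. f k i j) = (\<Sum>i<n. \<Sum>j<n. \<Sum>k<(n::nat). f k i j)"
proof -
 have "(\<Sum>k<n. \<Sum>i<n. \<Sum>j<n. f k i j) = (\<Sum>i<n. \<Sum>k<n. \<Sum>j<n. f k i j)" by (rule sum.swap)
 also have "\<dots> = (\<Sum>i<n. \<Sum>j<n. \<Sum>k<n. f k i j)" by (intro sum.cong refl sum.swap)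
 finally show ?thesis .
qed

lemma eigsys_parseval:
 assumes "eigsys n A \<alpha> u"
 shows "(\<Sum>k<n. (\<Sum>i<n. u k i * x i) * (\<Sum>i<n. u k i * y i)) = (\<Sum>i<n. x i * y i)"
proof -
 have "(\<Sum>k<n. (\<Sum>i<n. u k i * x i) * (\<Sum>i<n. u k i * y i)) =
   (\<Sum>k<n. \<Sum>i<n. \<Sum>j<n. (u k i * u k j) * (x i * y j))"
  by (simp add: sum_product algebra_simps)
 also have "\<dots> = (\<Sum>i<n. \<Sum>j<n. (\<Sum>k<n. u k i * u k j) * (x i * y j))"
  unfolding sum_distrib_right by (rule sum_rotate3)
 also have "\<dots> = (\<Sum>i<n. \<Sum>j<n. of_bool (i = j) * (x i * y j))"
  using eigsysD(2)[OF assms] by simp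
 also have "\<dots> = (\<Sum>i<n. x i * y i)" by (simp add: sum_of_bool_delta)
 finally show ?thesis .
qed

lemma eigsys_apply:
 assumes "eigsys n A \<alpha> u" and k: "k < n"
 shows "(\<Sum>i<n. u k i * (\<Sum>j<n. A i j * x j)) = \<alpha> k * (\<Sum>j<n. u k j * x j)"
proof -
 have "(\<Sum>i<n. u k i * (\<Sum>j<n. A i j * x j)) =
   (\<Sum>i<n. \<Sum>j<n. \<Sum>l<n. u k i * u l i * (\<alpha> l * u l j * x j))"
  using eigsysD(3)[OF assms(1)] by (simp add: sum_distrib_left sum_distrib_right algebra_simps)
 also have "\<dots> = (\<Sum>l<n. (\<Sum>i<n. u k i * u l i) * (\<Sum>j<n. \<alpha> l * u l j * x j))"
  unfolding sum_product by (rule sum_rotate3[symmetric])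
 also have "\<dots> = (\<Sum>l<n. of_bool (k = l) * (\<Sum>j<n. \<alpha> l * u l j * x j))"
  using eigsysD(1)[OF assms(1) k] by simp
 also have "\<dots> = (\<Sum>j<n. \<alpha> k * u k j * x j)" by (rule sum_of_bool_delta(1)[OF k])
 finally show ?thesis by (simp add: sum_distrib_left mult.assoc)
qed

lemma eigsys_qform:
 assumes "eigsys n A \<alpha> u"
 shows "qform n A x = (\<Sum>k<n. \<alpha> k * (\<Sum>i<n. u k i * x i)\<^sup>2)"
proof -
 have "qform n A x = (\<Sum>i<n. x i * (\<Sum>j<n. A i j * x j))"
  unfolding qform_def by (simp add: sum_distrib_left mult.assoc)
 also have "\<dots> = (\<Sum>k<n. (\<Sum>i<n. u k i * x i) * (\<Sum>i<n. u k i * (\<Sum>j<n. A i j * x j)))"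
  using eigsys_parseval[OF assms] by simp
 finally show ?thesis using eigsys_apply[OF assms] by (simp add: power2_eq_square algebra_simps)
qed

text \<open>Only eigenvalues whose eigenvectors occur in \<open>x\<close> have to satisfy the bound.
  In min-max arguments \<open>x\<close> is made orthogonal to the others.\<close>

lemma eigsys_qform_le:
 assumes "eigsys n A \<alpha> u" and "\<And>k. k < n \<Longrightarrow> (\<Sum>i<n. u k i * x i) \<noteq> 0 \<Longrightarrow> \<alpha> k \<le> E"
 shows "qform n A x \<le> E * (\<Sum>i<n. (x i)\<^sup>2)"
proof -
 have "\<alpha> k * (\<Sum>i<n. u k i * x i)\<^sup>2 \<le> E * (\<Sum>i<n. u k i * x i)\<^sup>2" if "k < n" for k
  using assms(2)[OF that] by (cases "(\<Sum>i<n. u k i * x i) = 0") (auto intro: mult_right_mono)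
 then have "qform n A x \<le> (\<Sum>k<n. E * (\<Sum>i<n. u k i * x i)\<^sup>2)"
  unfolding eigsys_qform[OF assms(1)] by (intro sum_mono) auto
 also have "\<dots> = E * (\<Sum>i<n. (x i)\<^sup>2)"
  using eigsys_parseval[OF assms(1), of x x] unfolding sum_distrib_left[symmetric] by (simp add: power2_eq_square)
 finally show ?thesis .
qed

lemma eigsys_qform_ge:
 assumes "eigsys n A \<alpha> u" and "\<And>k. k < n \<Longrightarrow> (\<Sum>i<n. u k i * x i) \<noteq> 0 \<Longrightarrow> \<alpha> k \<ge> E"
 shows "qform n A x \<ge> E * (\<Sum>i<n. (x i)\<^sup>2)"
proof -
 have "\<alpha> k * (\<Sum>i<n. u k i * x i)\<^sup>2 \<ge> E * (\<Sum>i<n. u k i * x i)\<^sup>2" if "k < n" for k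
  using assms(2)[OF that] by (cases "(\<Sum>i<n. u k i * x i) = 0") (auto intro: mult_right_mono)
 then have "qform n A x \<ge> (\<Sum>k<n. E * (\<Sum>i<n. u k i * x i)\<^sup>2)"
  unfolding eigsys_qform[OF assms(1)] by (intro sum_mono) auto
 also have "(\<Sum>k<n. E * (\<Sum>i<n. u k i * x i)\<^sup>2) = E * (\<Sum>i<n. (x i)\<^sup>2)"
  using eigsys_parseval[OF assms(1), of x x] unfolding sum_distrib_left[symmetric] by (simp add: power2_eq_square)
 finally show ?thesis .
qed

text \<open>Replaces dimension counting. The conditions, padded by zero rows to a square matrix,
  leave row number \<open>card F\<close> zero, so every Leibniz product vanishes and the kernel is
  nontrivial.\<close>

lemma homogeneous_system_nontrivial:
 fixes F :: "(nat \<Rightarrow> real) set"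
 assumes "finite F" and "card F < n"
 obtains x where "(\<Sum>i<n. (x i)\<^sup>2) > 0" and "\<And>f. f \<in> F \<Longrightarrow> (\<Sum>i<n. f i * x i) = 0"
proof -
 obtain fs where fs: "set fs = F" "length fs = card F"
  using finite_distinct_list[OF assms(1)] distinct_card by metis
 define M where "M = mat n n (\<lambda>(r,i). if r < length fs then (fs ! r) i else 0)"
 have M: "M \<in> carrier_mat n n" unfolding M_def by simp
 have "(\<Prod>i = 0..<n. M $$ (i, p i)) = 0" if "p permutes {0..<n}" for p
 proof -
  have "card F \<in> {0..<n}" "M $$ (card F, p (card F)) = 0"
   using assms(2) fs permutes_in_image[OF that, of "card F"] by (auto simp: M_def)
  then show ?thesis by (meson finite_atLeastLessThan prod_zero)
 qed
 then have "det M = 0" unfolding det_def'[OF M] by (intro sum.neutral) auto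
 then obtain v where v: "v \<in> carrier_vec n" "v \<noteq> 0\<^sub>v n" "M *\<^sub>v v = 0\<^sub>v n"
  using det_0_iff_vec_prod_zero[OF M] by blast
 obtain i where "i < n" "v $ i \<noteq> 0" using v(1,2) by (metis eq_vecI carrier_vecD index_zero_vec)
 then have "(\<Sum>i<n. (v $ i)\<^sup>2) > 0" by (intro sum_pos2[of _ i]) auto
 moreover have "(\<Sum>i<n. f i * v $ i) = 0" if "f \<in> F" for f
 proof -
  from that fs obtain r where r: "r < length fs" "fs ! r = f" by (metis in_set_conv_nth)
  then have rn: "r < n" using assms fs by simp
  have "(M *\<^sub>v v) $ r = 0" using v rn by simp
  then show ?thesis using v(1) r rn by (simp add: M_def scalar_prod_def atLeast0LessThan)
 qed
 ultimately show ?thesis using that[of "\<lambda>i. v $ i"] by auto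
qed

lemma eigsys_qform_ge_index:
 assumes A: "eigsys n A \<alpha> u" and "\<And>f. f \<in> u ` {..<k} \<Longrightarrow> (\<Sum>i<n. f i * x i) = 0"
 shows "\<alpha> k * (\<Sum>i<n. (x i)\<^sup>2) \<le> qform n A x"
proof (rule eigsys_qform_ge[OF A])
 fix l assume l: "l < n" "(\<Sum>i<n. u l i * x i) \<noteq> 0"
 then have "k \<le> l" using assms(2)[of "u l"] by (meson image_eqI lessThan_iff not_le)
 then show "\<alpha> k \<le> \<alpha> l" using eigsysD(4)[OF A] l by blast
qed

lemma eigsys_qform_le_index:
 assumes A: "eigsys n A \<alpha> u" and "\<And>f. f \<in> u ` {k<..<n} \<Longrightarrow> (\<Sum>i<n. f i * x i) = 0" and k: "k < n"
 shows "qform n A x \<le> \<alpha> k * (\<Sum>i<n. (x i)\<^sup>2)"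
proof (rule eigsys_qform_le[OF A])
 fix l assume l: "l < n" "(\<Sum>i<n. u l i * x i) \<noteq> 0"
 then have "l \<le> k" using assms(2)[of "u l"] by (meson image_eqI greaterThanLessThan_iff not_le)
 then show "\<alpha> l \<le> \<alpha> k" using eigsysD(4)[OF A] k by blast
qed

lemma card_Un_images_le:
 "card (f ` {..<k} \<union> g ` {a<..<b}) \<le> k + (b - Suc a)"
proof -
 have "card (f ` {..<k} \<union> g ` {a<..<b}) \<le> card (f ` {..<k}) + card (g ` {a<..<b})" by (rule card_Un_le)
 also have "\<dots> \<le> card {..<k} + card {a<..<b}" by (intro add_mono card_image_le) auto
 finally show ?thesis by simp
qed

text \<open>Orthogonality to the first \<open>k\<close> eigenvectors of \<open>A\<close> and the
  last \<open>n - k - 1\<close> of \<open>B\<close> amounts to \<open>n - 1\<close> conditions, so a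
  nonzero such vector exists; on it the two quadratic forms compare \<open>\<alpha> k\<close> with
  \<open>\<beta> k\<close>.\<close>

lemma eigsys_weyl:
 assumes A: "eigsys n A \<alpha> u" and B: "eigsys n B \<beta> w" and k: "k < n"
  and le: "\<And>x. qform n A x \<le> qform n B x + \<eta> * (\<Sum>i<n. (x i)\<^sup>2)"
 shows "\<alpha> k \<le> \<beta> k + \<eta>"
proof -
 let ?F = "u ` {..<k} \<union> w ` {k<..<n}"
 have fin: "finite ?F" by simp
 have "card ?F \<le> k + (n - Suc k)"
  by (rule order_trans[OF card_Un_images_le]) simp
 then have "card ?F < n" using k by simp
 then obtain x where x: "(\<Sum>i<n. (x i)\<^sup>2) > 0" "\<And>f. f \<in> ?F \<Longrightarrow> (\<Sum>i<n. f i * x i) = 0"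
  by (rule homogeneous_system_nontrivial[OF fin]) (rule that)
 have "\<alpha> k * (\<Sum>i<n. (x i)\<^sup>2) \<le> qform n A x"
  using x(2) by (intro eigsys_qform_ge_index[OF A]) auto
 also have "\<dots> \<le> qform n B x + \<eta> * (\<Sum>i<n. (x i)\<^sup>2)" by (rule le)
 also have "qform n B x \<le> \<beta> k * (\<Sum>i<n. (x i)\<^sup>2)"
  using x(2) k by (intro eigsys_qform_le_index[OF B]) auto
 finally have "\<alpha> k * (\<Sum>i<n. (x i)\<^sup>2) \<le> (\<beta> k + \<eta>) * (\<Sum>i<n. (x i)\<^sup>2)" by (simp add: algebra_simps)
 then show ?thesis using x(1) by simp
qed

text \<open>The eigenvalues move up, but never past the next old one, however large \<open>t\<close>
  is: on vectors with \<open>x j = 0\<close> both forms agree. This is one more linear condition,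
  and the passage from \<open>k\<close> to \<open>Suc k\<close> pays for it.\<close>

lemma eigsys_rank_one:
 assumes A: "eigsys n A \<alpha> u" and B: "eigsys n B \<beta> w" and j: "j < n" and t: "t \<ge> 0"
  and BA: "\<And>i l. i < n \<Longrightarrow> l < n \<Longrightarrow> B i l = A i l + t * of_bool (i = j \<and> l = j)"
 shows "k < n \<Longrightarrow> \<alpha> k \<le> \<beta> k" and "Suc k < n \<Longrightarrow> \<beta> k \<le> \<alpha> (Suc k)"
proof -
 have q: "qform n B x = qform n A x + t * (x j)\<^sup>2" for x
 proof -
  have "qform n B x = qform n A x + (\<Sum>i<n. \<Sum>l<n. of_bool (i = j) * (of_bool (l = j) * (t * x i * x l)))"
   unfolding qform_def sum.distrib[symmetric] by (intro sum.cong refl) (auto simp: BA algebra_simps)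
  then show ?thesis using j
   by (simp add: sum_distrib_left[symmetric] sum_of_bool_delta power2_eq_square)
 qed
 { assume k: "k < n"
  have "\<alpha> k \<le> \<beta> k + 0" by (rule eigsys_weyl[OF A B k]) (use t q in auto)
  then show "\<alpha> k \<le> \<beta> k" by simp }
 assume k: "Suc k < n"
 let ?F = "(w ` {..<k} \<union> u ` {Suc k<..<n}) \<union> {\<lambda>i. of_bool (i = j)}"
 have fin: "finite ?F" by simp
 have "card (w ` {..<k} \<union> u ` {Suc k<..<n}) \<le> k + (n - Suc (Suc k))"
  by (rule order_trans[OF card_Un_images_le]) simp
 then have "card ?F < n" using k card_Un_le[of "w ` {..<k} \<union> u ` {Suc k<..<n}" "{\<lambda>i. of_bool (i = j) :: real}"] by simp
 then obtain x where x: "(\<Sum>i<n. (x i)\<^sup>2) > 0" "\<And>f. f \<in> ?F \<Longrightarrow> (\<Sum>i<n. f i * x i) = 0"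
  by (rule homogeneous_system_nontrivial[OF fin]) (rule that)
 have xj: "x j = 0" using x(2)[of "\<lambda>i. of_bool (i = j)"] j by (simp add: sum_of_bool_delta)
 have "\<beta> k * (\<Sum>i<n. (x i)\<^sup>2) \<le> qform n B x"
  using x(2) by (intro eigsys_qform_ge_index[OF B]) auto
 also have "qform n B x = qform n A x" using q xj by simp
 also have "qform n A x \<le> \<alpha> (Suc k) * (\<Sum>i<n. (x i)\<^sup>2)"
  using x(2) k by (intro eigsys_qform_le_index[OF A]) auto
 finally show "\<beta> k \<le> \<alpha> (Suc k)" using x(1) by simp
qed

text \<open>The same count in dimension \<open>n + 1\<close>, on the hyperplane
  \<open>x n = 0\<close>, where the form is that of the leading submatrix. \<open>w'\<close> extends
  the smaller eigenvectors by zero.\<close>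

lemma eigsys_cauchy:
 assumes A: "eigsys (Suc n) A \<alpha> u" and B: "eigsys n A \<beta> w" and k: "k < n"
 shows "\<alpha> k \<le> \<beta> k" and "\<beta> k \<le> \<alpha> (Suc k)"
proof -
 define w' where "w' k i = (if i < n then w k i else 0)" for k i
 have w': "(\<Sum>i<Suc n. w' k i * x i) = (\<Sum>i<n. w k i * x i)" for k and x :: "nat \<Rightarrow> real"
  unfolding w'_def by simp
 have q: "qform (Suc n) A x = qform n A x" "(\<Sum>i<Suc n. (x i)\<^sup>2) = (\<Sum>i<n. (x i)\<^sup>2)" if "x n = 0" for x
  unfolding qform_def using that by auto
 have en: "x n = 0" if "(\<Sum>i<Suc n. of_bool (i = n) * x i) = 0" for x :: "nat \<Rightarrow> real"
  using that by (subst (asm) sum_of_bool_delta) auto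
 let ?F = "(u ` {..<k} \<union> w' ` {k<..<n}) \<union> {\<lambda>i. of_bool (i = n)}"
 have fin: "finite ?F" by simp
 have "card (u ` {..<k} \<union> w' ` {k<..<n}) \<le> k + (n - Suc k)"
  by (rule order_trans[OF card_Un_images_le]) simp
 then have "card ?F < Suc n" using k card_Un_le[of "u ` {..<k} \<union> w' ` {k<..<n}" "{\<lambda>i. of_bool (i = n) :: real}"] by simp
 then obtain x where x: "(\<Sum>i<Suc n. (x i)\<^sup>2) > 0" "\<And>f. f \<in> ?F \<Longrightarrow> (\<Sum>i<Suc n. f i * x i) = 0"
  by (rule homogeneous_system_nontrivial[OF fin]) (rule that)
 have xn: "x n = 0" using x(2)[of "\<lambda>i. of_bool (i = n)"] en by blast
 have "\<alpha> k * (\<Sum>i<Suc n. (x i)\<^sup>2) \<le> qform (Suc n) A x"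
  using x(2) by (intro eigsys_qform_ge_index[OF A]) auto
 also have "\<dots> = qform n A x" using q xn by simp
 also have "\<dots> \<le> \<beta> k * (\<Sum>i<n. (x i)\<^sup>2)"
 proof (rule eigsys_qform_le[OF B])
  fix l assume l: "l < n" "(\<Sum>i<n. w l i * x i) \<noteq> 0"
  then have "w' l \<notin> ?F" using x(2)[of "w' l"] w' by auto
  then have "l \<le> k" using l by (meson UnCI image_eqI greaterThanLessThan_iff not_le)
  then show "\<beta> l \<le> \<beta> k" using eigsysD(4)[OF B] k by blast
 qed
 finally show "\<alpha> k \<le> \<beta> k" using x(1) q xn by simp
 let ?F = "(w' ` {..<k} \<union> u ` {Suc k<..<Suc n}) \<union> {\<lambda>i. of_bool (i = n)}"
 have fin: "finite ?F" by simp
 have "card (w' ` {..<k} \<union> u ` {Suc k<..<Suc n}) \<le> k + (n - Suc k)"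
  by (rule order_trans[OF card_Un_images_le]) simp
 then have "card ?F < Suc n" using k card_Un_le[of "w' ` {..<k} \<union> u ` {Suc k<..<Suc n}" "{\<lambda>i. of_bool (i = n) :: real}"] by simp
 then obtain x where x: "(\<Sum>i<Suc n. (x i)\<^sup>2) > 0" "\<And>f. f \<in> ?F \<Longrightarrow> (\<Sum>i<Suc n. f i * x i) = 0"
  by (rule homogeneous_system_nontrivial[OF fin]) (rule that)
 have xn: "x n = 0" using x(2)[of "\<lambda>i. of_bool (i = n)"] en by blast
 have "\<beta> k * (\<Sum>i<n. (x i)\<^sup>2) \<le> qform n A x"
 proof (rule eigsys_qform_ge[OF B])
  fix l assume l: "l < n" "(\<Sum>i<n. w l i * x i) \<noteq> 0"
  then have "w' l \<notin> ?F" using x(2)[of "w' l"] w' by auto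
  then have "k \<le> l" using l by (meson UnCI image_eqI lessThan_iff not_le)
  then show "\<beta> k \<le> \<beta> l" using eigsysD(4)[OF B] l by blast
 qed
 also have "\<dots> = qform (Suc n) A x" using q xn by simp
 also have "\<dots> \<le> \<alpha> (Suc k) * (\<Sum>i<Suc n. (x i)\<^sup>2)"
  using x(2) k by (intro eigsys_qform_le_index[OF A]) auto
 finally show "\<beta> k \<le> \<alpha> (Suc k)" using x(1) q xn by simp
qed

text \<open>Interlacing lets the number of negative eigenvalues grow by at most one with the dimension;
 the sign of the determinant decides which case occurs.\<close>

lemma negative_eigenvalue_count_Suc:
 assumes A: "eigsys (Suc n) A \<alpha> u" and B: "eigsys n A \<beta> w"
  and nz: "det (mat (Suc n) (Suc n) (\<lambda>(i,j). A i j)) \<noteq> 0" "det (mat n n (\<lambda>(i,j). A i j)) \<noteq> 0"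
 shows "card {k. k < Suc n \<and> \<alpha> k < 0} = card {k. k < n \<and> \<beta> k < 0} +
  of_bool (det (mat (Suc n) (Suc n) (\<lambda>(i,j). A i j)) * det (mat n n (\<lambda>(i,j). A i j)) < 0)"
proof -
 have sg: "sgn (\<Prod>k<m. f k) = (-1) ^ card {k. k < m \<and> f k < 0}" if "(\<Prod>k<m. f k) \<noteq> 0" for m and f :: "nat \<Rightarrow> real"
  using that
 proof (induction m)
  case (Suc m)
  have eq: "{k. k < Suc m \<and> f k < 0} = (if f m < 0 then insert m {k. k < m \<and> f k < 0} else {k. k < m \<and> f k < 0})"
   by (auto simp: less_Suc_eq)
  show ?case using Suc by (auto simp: sgn_mult eq)
 qed simp
 let ?a = "card {k. k < Suc n \<and> \<alpha> k < 0}" and ?b = "card {k. k < n \<and> \<beta> k < 0}"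
 have 1: "?b \<le> ?a"
  by (rule card_mono) (use eigsys_cauchy(1)[OF A B] in fastforce)+
 \<comment> \<open>Indices are shifted by one: by the upper interlacing, a negative eigenvalue other
   than the lowest forces a negative one of the submatrix.\<close>
 have "{k. k < Suc n \<and> \<alpha> k < 0} \<subseteq> insert 0 (Suc ` {k. k < n \<and> \<beta> k < 0})"
 proof
  fix k assume "k \<in> {k. k < Suc n \<and> \<alpha> k < 0}"
  then show "k \<in> insert 0 (Suc ` {k. k < n \<and> \<beta> k < 0})"
   using eigsys_cauchy(2)[OF A B, of "k - 1"] by (cases k) auto
 qed
 then have "?a \<le> card (insert 0 (Suc ` {k. k < n \<and> \<beta> k < 0}))" by (intro card_mono) auto
 also have "\<dots> \<le> Suc (card (Suc ` {k. k < n \<and> \<beta> k < 0}))" by (rule card_insert_le_m1) auto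
 also have "\<dots> \<le> Suc ?b" by (simp add: card_image)
 finally have 2: "?a \<le> Suc ?b" .
 have "sgn (det (mat (Suc n) (Suc n) (\<lambda>(i,j). A i j))) = (-1) ^ ?a" "sgn (det (mat n n (\<lambda>(i,j). A i j))) = (-1) ^ ?b"
  using sg[of \<alpha> "Suc n"] sg[of \<beta> n] nz unfolding eigsys_det[OF A] eigsys_det[OF B] by blast+
 then have s: "sgn (det (mat (Suc n) (Suc n) (\<lambda>(i,j). A i j)) * det (mat n n (\<lambda>(i,j). A i j))) = (-1) ^ (?a + ?b)"
  by (simp add: sgn_mult power_add)
 from 1 2 have "?a = ?b \<or> ?a = Suc ?b" by auto
 then show ?thesis
 proof
  assume "?a = ?b"
  then have "sgn (det (mat (Suc n) (Suc n) (\<lambda>(i,j). A i j)) * det (mat n n (\<lambda>(i,j). A i j))) = 1"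
   using s by (simp add: power_add[symmetric] mult_2[symmetric])
  then show ?thesis using \<open>?a = ?b\<close> by (simp add: sgn_1_pos)
 next
  assume "?a = Suc ?b"
  then have "sgn (det (mat (Suc n) (Suc n) (\<lambda>(i,j). A i j)) * det (mat n n (\<lambda>(i,j). A i j))) = -1"
   using s by (simp add: power_add[symmetric] mult_2[symmetric])
  then show ?thesis using \<open>?a = Suc ?b\<close> by (simp add: sgn_1_neg)
 qed
qed

section \<open>Random diagonals: discrete Wegner and Minami estimates\<close>

text \<open>Klein's inequality \<open>tr f(B) \<ge> tr (f(A) + f'(A) (B - A))\<close> for a convex
  \<open>f\<close> with subgradient \<open>f'\<close>. The squared overlaps \<open>c i k\<close> of
  the two eigenbases form a doubly stochastic matrix, against which the tangent inequality is
  averaged.\<close>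

lemma eigsys_klein:
 assumes A: "eigsys n A \<alpha> u" and B: "eigsys n B \<beta> w"
  and sub: "\<And>x y. f y \<ge> f x + f' x * (y - x)"
 shows "(\<Sum>i<n. f (\<alpha> i) + f' (\<alpha> i) * (qform n B (u i) - \<alpha> i)) \<le> (\<Sum>k<n. f (\<beta> k))"
proof -
 define c where "c i k = (\<Sum>j<n. w k j * u i j)\<^sup>2" for i k
 have c1: "(\<Sum>k<n. c i k) = 1" if "i < n" for i
  using eigsys_parseval[OF B, of "u i" "u i"] eigsysD(1)[OF A that that] by (simp add: c_def power2_eq_square)
 have c2: "(\<Sum>i<n. c i k) = 1" if "k < n" for k
  using eigsys_parseval[OF A, of "w k" "w k"] eigsysD(1)[OF B that that] by (simp add: c_def power2_eq_square mult.commute)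
 have "f (\<alpha> i) + f' (\<alpha> i) * (qform n B (u i) - \<alpha> i) \<le> (\<Sum>k<n. c i k * f (\<beta> k))" if i: "i < n" for i
 proof -
  have q: "qform n B (u i) = (\<Sum>k<n. \<beta> k * c i k)" unfolding eigsys_qform[OF B] c_def ..
  have "f (\<alpha> i) + f' (\<alpha> i) * (qform n B (u i) - \<alpha> i) =
    f (\<alpha> i) * (\<Sum>k<n. c i k) + f' (\<alpha> i) * (\<Sum>k<n. \<beta> k * c i k) - f' (\<alpha> i) * \<alpha> i * (\<Sum>k<n. c i k)"
   unfolding c1[OF i] q by (simp add: algebra_simps)
  also have "\<dots> = (\<Sum>k<n. c i k * (f (\<alpha> i) + f' (\<alpha> i) * (\<beta> k - \<alpha> i)))"
   unfolding sum_distrib_left sum_subtractf[symmetric] sum.distrib[symmetric]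
   by (intro sum.cong) (auto simp: algebra_simps)
  also have "\<dots> \<le> (\<Sum>k<n. c i k * f (\<beta> k))"
   by (intro sum_mono mult_left_mono sub) (auto simp: c_def)
  finally show ?thesis .
 qed
 then have "(\<Sum>i<n. f (\<alpha> i) + f' (\<alpha> i) * (qform n B (u i) - \<alpha> i)) \<le> (\<Sum>i<n. \<Sum>k<n. c i k * f (\<beta> k))"
  by (intro sum_mono) auto
 also have "\<dots> = (\<Sum>k<n. (\<Sum>i<n. c i k) * f (\<beta> k))" unfolding sum_distrib_right by (rule sum.swap)
 also have "\<dots> = (\<Sum>k<n. f (\<beta> k))" using c2 by simp
 finally show ?thesis .
qed

lemma eigsys_qform_eigenvector:
 assumes A: "eigsys n A \<alpha> u" and k: "k < n"
 shows "qform n A (u k) = \<alpha> k"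
proof -
 have "qform n A (u k) = (\<Sum>l<n. \<alpha> l * (\<Sum>i<n. u l i * u k i)\<^sup>2)" by (rule eigsys_qform[OF A])
 also have "\<dots> = (\<Sum>l<n. of_bool (l = k) * \<alpha> l)"
  using eigsysD(1)[OF A _ k] by (intro sum.cong) (auto simp: power2_eq_square)
 finally show ?thesis using k by (simp only: sum_of_bool_delta)
qed

lemma qform_rank_one:
 assumes j: "j < n" and BA: "\<And>i l. i < n \<Longrightarrow> l < n \<Longrightarrow> B i l = A i l + t * of_bool (i = j \<and> l = j)"
 shows "qform n B x = qform n A x + t * (x j)\<^sup>2"
proof -
 have "qform n B x = qform n A x + (\<Sum>i<n. of_bool (i = j) * (\<Sum>l<n. of_bool (l = j) * (t * x i * x l)))"
  unfolding qform_def sum.distrib[symmetric] sum_distrib_left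
  by (intro sum.cong refl) (auto simp: BA algebra_simps)
 then show ?thesis using j by (simp only: sum_of_bool_delta) (simp add: power2_eq_square)
qed

text \<open>The spectral measure of the coordinate vector \<open>j\<close> on the half line above
  \<open>a\<close>.\<close>

definition mass_above :: "nat \<Rightarrow> (nat \<Rightarrow> real) \<Rightarrow> (nat \<Rightarrow> nat \<Rightarrow> real) \<Rightarrow> nat \<Rightarrow> real \<Rightarrow> real" where
 "mass_above n \<alpha> u j a = (\<Sum>k<n. of_bool (\<alpha> k > a) * (u k j)\<^sup>2)"

lemma mass_above_bounds:
 assumes A: "eigsys n A \<alpha> u" and j: "j < n"
 shows "0 \<le> mass_above n \<alpha> u j a" and "mass_above n \<alpha> u j a \<le> 1"
proof -
 show "0 \<le> mass_above n \<alpha> u j a" unfolding mass_above_def by (intro sum_nonneg) auto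
 have "mass_above n \<alpha> u j a \<le> (\<Sum>k<n. u k j * u k j)"
  unfolding mass_above_def by (intro sum_mono) (auto simp: power2_eq_square)
 then show "mass_above n \<alpha> u j a \<le> 1" using eigsysD(2)[OF A j j] by simp
qed

text \<open>Klein's inequality for the positive part of \<open>x - a\<close>, whose subgradient is
  the indicator of \<open>x > a\<close>, used in both directions. It is the finite-difference form
  of the rule that along \<open>A + t e e^T\<close> the trace of \<open>f\<close> has derivative
  equal to the mean of \<open>f'\<close> under the spectral measure of \<open>e\<close>.\<close>

lemma trace_positive_part_rank_one:
 assumes A: "eigsys n A \<alpha> u" and B: "eigsys n B \<beta> w" and j: "j < n"
  and BA: "\<And>i l. i < n \<Longrightarrow> l < n \<Longrightarrow> B i l = A i l + 1 * of_bool (i = j \<and> l = j)"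
 shows "mass_above n \<alpha> u j a \<le> (\<Sum>k<n. max (\<beta> k - a) 0) - (\<Sum>k<n. max (\<alpha> k - a) 0)"
  and "(\<Sum>k<n. max (\<beta> k - a) 0) - (\<Sum>k<n. max (\<alpha> k - a) 0) \<le> mass_above n \<beta> w j a"
proof -
 have sub: "max (x - a) 0 + of_bool (x > a) * (y - x) \<le> max (y - a) 0" for x y :: real by auto
 note q = qform_rank_one[OF j BA]
 have "(\<Sum>i<n. max (\<alpha> i - a) 0 + of_bool (\<alpha> i > a) * (u i j)\<^sup>2) \<le> (\<Sum>k<n. max (\<beta> k - a) 0)"
  using eigsys_klein[OF A B sub] by (simp add: q eigsys_qform_eigenvector[OF A])
 then show "mass_above n \<alpha> u j a \<le> (\<Sum>k<n. max (\<beta> k - a) 0) - (\<Sum>k<n. max (\<alpha> k - a) 0)"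
  unfolding mass_above_def sum.distrib by linarith
 have "qform n A (w k) = \<beta> k - (w k j)\<^sup>2" if "k < n" for k
  using q[of "w k"] eigsys_qform_eigenvector[OF B that] by simp
 then have "(\<Sum>i<n. max (\<beta> i - a) 0 + of_bool (\<beta> i > a) * (- (w i j)\<^sup>2)) \<le> (\<Sum>k<n. max (\<alpha> k - a) 0)"
  using eigsys_klein[OF B A sub] by simp
 then show "(\<Sum>k<n. max (\<beta> k - a) 0) - (\<Sum>k<n. max (\<alpha> k - a) 0) \<le> mass_above n \<beta> w j a"
  unfolding mass_above_def sum.distrib by (simp add: sum_negf)
qed

text \<open>A discrete form of spectral averaging.\<close>

lemma spectral_averaging:
 assumes E: "\<And>t. eigsys n (H t) (\<alpha> t) (u t)" and j: "j < n" and ab: "a \<le> b"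
  and H: "\<And>t i l. i < n \<Longrightarrow> l < n \<Longrightarrow> H t i l = H 0 i l + real t * of_bool (i = j \<and> l = j)"
 shows "(\<Sum>t<K. mass_above n (\<alpha> t) (u t) j a - mass_above n (\<alpha> t) (u t) j b) \<le> b - a + 1"
proof -
 have step: "H (Suc t) i l = H t i l + 1 * of_bool (i = j \<and> l = j)" if "i < n" "l < n" for t i l
  using H[OF that, of t] H[OF that, of "Suc t"] by (simp add: algebra_simps)
 \<comment> \<open>The increase of \<open>tr g\<close> in one unit step dominates the mass between
   \<open>a\<close> and \<open>b\<close>, except that the mass above \<open>b\<close> is taken after
   the step and that above \<open>a\<close> before it.\<close>
 define g where "g x = max (x - a) 0 - max (x - b) 0" for x :: real
 have gm: "g x \<le> g y" if "x \<le> y" for x y using that ab unfolding g_def by auto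
 have gb: "0 \<le> g x" "g x \<le> b - a" for x using ab unfolding g_def by auto
 let ?m = "\<lambda>t a. mass_above n (\<alpha> t) (u t) j a"
 have "(\<Sum>t<K. ?m t a - ?m (Suc t) b) \<le> (\<Sum>t<K. (\<Sum>k<n. g (\<alpha> (Suc t) k)) - (\<Sum>k<n. g (\<alpha> t k)))"
 proof (intro sum_mono)
  fix t
  show "?m t a - ?m (Suc t) b \<le> (\<Sum>k<n. g (\<alpha> (Suc t) k)) - (\<Sum>k<n. g (\<alpha> t k))"
   using trace_positive_part_rank_one(1)[OF E E j step, of t a]
    trace_positive_part_rank_one(2)[OF E E j step, of t b]
   unfolding g_def sum_subtractf by linarith
 qed
 also have "\<dots> = (\<Sum>k<n. g (\<alpha> K k)) - (\<Sum>k<n. g (\<alpha> 0 k))" by (rule sum_lessThan_telescope)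
 also have "\<dots> \<le> b - a"
 proof -
  obtain n' where n': "n = Suc n'" using j by (cases n) auto
  \<comment> \<open>Interlacing does not depend on the size \<open>K\<close> of the total change:
    every eigenvalue but the top one stays below the next old one, so \<open>tr g\<close> grows
    altogether by at most the range \<open>b - a\<close> of \<open>g\<close>.\<close>
  have il: "\<alpha> K k \<le> \<alpha> 0 (Suc k)" if "k < n'" for k
   using eigsys_rank_one(2)[OF E E j _ H, of K k] that n' by simp
  have "(\<Sum>k<n. g (\<alpha> K k)) = (\<Sum>k<n'. g (\<alpha> K k)) + g (\<alpha> K n')" unfolding n' by simp
  also have "\<dots> \<le> (\<Sum>k<n'. g (\<alpha> 0 (Suc k))) + (b - a)"
   by (intro add_mono sum_mono gm il gb) auto
  also have "\<dots> \<le> (\<Sum>k<n. g (\<alpha> 0 k)) + (b - a)"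
   unfolding n' sum.lessThan_Suc_shift using gb by simp
  finally show ?thesis by simp
 qed
 finally have 1: "(\<Sum>t<K. ?m t a) - (\<Sum>t<K. ?m (Suc t) b) \<le> b - a" unfolding sum_subtractf .
 \<comment> \<open>The shifted time index at \<open>b\<close> telescopes and costs at most the total
   mass 1; this is the summand 1 of the bound.\<close>
 have "(\<Sum>t<K. ?m (Suc t) b) - (\<Sum>t<K. ?m t b) = ?m K b - ?m 0 b"
  unfolding sum_subtractf[symmetric] by (rule sum_lessThan_telescope)
 also have "\<dots> \<le> 1" using mass_above_bounds[OF E j, of K b] mass_above_bounds[OF E j, of 0 b] by simp
 finally show ?thesis using 1 unfolding sum_subtractf by simp
qed

text \<open>Above any threshold the number of eigenvalues grows by 0 or 1; a count in a half-open
  interval is the difference of two such numbers.\<close>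

lemma rank_one_count:
 assumes A: "eigsys n A \<alpha> u" and B: "eigsys n B \<beta> w" and j: "j < n" and t: "t \<ge> 0"
  and BA: "\<And>i l. i < n \<Longrightarrow> l < n \<Longrightarrow> B i l = A i l + t * of_bool (i = j \<and> l = j)"
  and ab: "a \<le> b"
 shows "card {k. k < n \<and> a < \<alpha> k \<and> \<alpha> k \<le> b} \<le> card {k. k < n \<and> a < \<beta> k \<and> \<beta> k \<le> b} + 1"
  and "card {k. k < n \<and> a < \<beta> k \<and> \<beta> k \<le> b} \<le> card {k. k < n \<and> a < \<alpha> k \<and> \<alpha> k \<le> b} + 1"
proof -
 have 1: "card {k. k < n \<and> E < \<alpha> k} \<le> card {k. k < n \<and> E < \<beta> k}" for E
  using eigsys_rank_one(1)[OF A B j t BA] by (intro card_mono) (auto, meson less_le_trans)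
 have 2: "card {k. k < n \<and> E < \<beta> k} \<le> card {k. k < n \<and> E < \<alpha> k} + 1" for E
 proof -
  have "Suc ` {k. k < n \<and> E < \<beta> k} \<subseteq> insert n {k. k < n \<and> E < \<alpha> k}"
  proof
   fix k assume "k \<in> Suc ` {k. k < n \<and> E < \<beta> k}"
   then obtain l where "k = Suc l" "l < n" "E < \<beta> l" by auto
   then show "k \<in> insert n {k. k < n \<and> E < \<alpha> k}"
    using eigsys_rank_one(2)[OF A B j t BA, of l] by force
  qed
  then have "card (Suc ` {k. k < n \<and> E < \<beta> k}) \<le> card (insert n {k. k < n \<and> E < \<alpha> k})"
   by (intro card_mono) auto
  then show ?thesis by (simp add: card_image)
 qed
 have 3: "card {k. k < n \<and> a < f k} = card {k. k < n \<and> a < f k \<and> f k \<le> b} + card {k. k < n \<and> b < f k}"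
  for f :: "nat \<Rightarrow> real"
 proof -
  have "{k. k < n \<and> a < f k} = {k. k < n \<and> a < f k \<and> f k \<le> b} \<union> {k. k < n \<and> b < f k}" using ab by auto
  then show ?thesis by (simp add: card_Un_disjoint disjoint_iff)
 qed
 show "card {k. k < n \<and> a < \<alpha> k \<and> \<alpha> k \<le> b} \<le> card {k. k < n \<and> a < \<beta> k \<and> \<beta> k \<le> b} + 1"
  using 1[of a] 1[of b] 2[of b] 3[of \<alpha>] 3[of \<beta>] by linarith
 show "card {k. k < n \<and> a < \<beta> k \<and> \<beta> k \<le> b} \<le> card {k. k < n \<and> a < \<alpha> k \<and> \<alpha> k \<le> b} + 1"
  using 1[of b] 2[of a] 3[of \<alpha>] 3[of \<beta>] by linarith
qed

text \<open>Resampling coordinate \<open>j\<close> of a uniform assignment does not change its law,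
  because exchanging \<open>om j\<close> with the fresh value is an involution.\<close>

lemma sum_PiE_update:
 fixes f :: "(nat \<Rightarrow> nat) \<Rightarrow> real"
 assumes j: "j < n"
 shows "(\<Sum>om\<in>PiE {..<n} (\<lambda>_. {..<K}). \<Sum>t<K. f (om(j := t))) = real K * (\<Sum>om\<in>PiE {..<n} (\<lambda>_. {..<K}). f om)"
proof -
 let ?\<Omega> = "PiE {..<n} (\<lambda>_. {..<K})"
 have "(\<Sum>om\<in>?\<Omega>. \<Sum>t<K. f (om(j := t))) = (\<Sum>(om,t)\<in>?\<Omega> \<times> {..<K}. f (om(j := t)))"
  by (rule sum.cartesian_product)
 also have "\<dots> = (\<Sum>(om,t)\<in>?\<Omega> \<times> {..<K}. f om)"
  by (rule sum.reindex_bij_witness[of _ "\<lambda>(om,t). (om(j := t), om j)" "\<lambda>(om,t). (om(j := t), om j)"])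
   (use j in \<open>auto simp: PiE_def extensional_def Pi_def\<close>)
 also have "\<dots> = (\<Sum>om\<in>?\<Omega>. \<Sum>t<K. f om)" by (rule sum.cartesian_product[symmetric])
 finally show ?thesis by (simp add: sum_distrib_left)
qed

text \<open>A Minami-type bound: two eigenvalues in one interval cost a factor \<open>1 / K\<close>
  each. Interlacing decouples the two factors: the count before a diagonal entry is resampled
  controls the event after it.\<close>

lemma random_diagonal_two_eigenvalues:
 fixes S :: "nat \<Rightarrow> nat \<Rightarrow> real" and \<alpha> :: "(nat \<Rightarrow> nat) \<Rightarrow> nat \<Rightarrow> real"
 assumes E: "\<And>om. eigsys n (\<lambda>i l. S i l + of_bool (i = l) * real (om i)) (\<alpha> om) (u om)"
  and ab: "a \<le> b"
 shows "real (card {om\<in>PiE {..<n} (\<lambda>_. {..<K}). card {k. k < n \<and> a < \<alpha> om k \<and> \<alpha> om k \<le> b} \<ge> 2}) * real K ^ 2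
  \<le> (b - a + 1)\<^sup>2 * real n ^ 2 / 2 * real K ^ n"
proof -
 let ?\<Omega> = "PiE {..<n} (\<lambda>_. {..<K})"
 have fin: "finite ?\<Omega>" by (intro finite_PiE) auto
 define N where "N om = card {k. k < n \<and> a < \<alpha> om k \<and> \<alpha> om k \<le> b}" for om
 define P where "P om j = mass_above n (\<alpha> om) (u om) j a - mass_above n (\<alpha> om) (u om) j b" for om j
 let ?c = "b - a + 1"
 have c0: "?c \<ge> 0" using ab by simp
 have Peq: "P om j = (\<Sum>k<n. of_bool (a < \<alpha> om k \<and> \<alpha> om k \<le> b) * (u om k j)\<^sup>2)" for om j
  unfolding P_def mass_above_def sum_subtractf[symmetric] using ab by (intro sum.cong) auto
 have P0: "P om j \<ge> 0" for om j unfolding Peq by (intro sum_nonneg) auto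
 have PN: "(\<Sum>j<n. P om j) = real (N om)" for om
 proof -
  have "(\<Sum>j<n. P om j) = (\<Sum>k<n. of_bool (a < \<alpha> om k \<and> \<alpha> om k \<le> b) * (\<Sum>j<n. u om k j * u om k j))"
   unfolding Peq sum_distrib_left by (subst sum.swap) (simp add: power2_eq_square)
  also have "\<dots> = (\<Sum>k<n. of_bool (a < \<alpha> om k \<and> \<alpha> om k \<le> b))"
   using eigsysD(1)[OF E, of _ _ om] by (intro sum.cong) auto
  also have "\<dots> = real (N om)" unfolding N_def
   by (simp add: Int_def)
  finally show ?thesis .
 qed
 have upd: "S i l + of_bool (i = l) * real ((om(j := t)) i) =
   (S i l + of_bool (i = l) * real ((om(j := s)) i)) + (real t - real s) * of_bool (i = j \<and> l = j)" for om i l j t s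
  by auto
 have avg: "(\<Sum>t<K. P (om(j := t)) j) \<le> ?c" if j: "j < n" for om j
 proof -
  have H: "S i l + of_bool (i = l) * real ((om(j := t)) i) =
   (S i l + of_bool (i = l) * real ((om(j := 0)) i)) + real t * of_bool (i = j \<and> l = j)" for i l t by auto
  show ?thesis unfolding P_def
   using spectral_averaging[of n "\<lambda>t i l. S i l + of_bool (i = l) * real ((om(j := t)) i)"
    "\<lambda>t. \<alpha> (om(j := t))" "\<lambda>t. u (om(j := t))", OF E j ab H] .
 qed
 have var: "N (om(j := s)) \<le> N (om(j := t)) + 1" if j: "j < n" for om j s t
 proof (cases "s \<le> t")
  case True
  then show ?thesis unfolding N_def
   using rank_one_count(1)[OF E E j _ _ ab, of "real t - real s" "om(j := t)" "om(j := s)"] upd[of _ _ om j t s] by simp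
 next
  case False
  then show ?thesis unfolding N_def
   using rank_one_count(2)[OF E E j _ _ ab, of "real s - real t" "om(j := s)" "om(j := t)"] upd[of _ _ om j s t] by simp
 qed
 have card: "real (card ?\<Omega>) = real K ^ n" by (simp add: card_PiE)
 \<comment> \<open>The Wegner bound: with \<open>c = b - a + 1\<close> the expected count is at most
   \<open>n c / K\<close>, each coordinate contributing its averaged mass.\<close>
 have W: "real K * (\<Sum>om\<in>?\<Omega>. real (N om)) \<le> real n * ?c * real K ^ n"
 proof -
  have "real K * (\<Sum>om\<in>?\<Omega>. real (N om)) = (\<Sum>j<n. real K * (\<Sum>om\<in>?\<Omega>. P om j))"
   unfolding PN[symmetric] sum_distrib_left by (rule sum.swap)
  also have "\<dots> = (\<Sum>j<n. \<Sum>om\<in>?\<Omega>. \<Sum>t<K. P (om(j := t)) j)"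
   by (intro sum.cong refl sum_PiE_update[symmetric]) auto
  also have "\<dots> \<le> (\<Sum>j<n. \<Sum>om\<in>?\<Omega>. ?c)" by (intro sum_mono avg) auto
  also have "\<dots> = real n * ?c * real K ^ n" using card by (simp add: algebra_simps)
  finally show ?thesis .
 qed
 \<comment> \<open>After resampling entry \<open>j\<close>, a count of at least 2 forces a count of
   at least 1 before. That earlier count does not involve the fresh value \<open>t\<close>, so the
   mass can be averaged over \<open>t\<close> alone.\<close>
 have one: "real K * (\<Sum>om\<in>?\<Omega>. of_bool (N om \<ge> 2) * P om j) \<le> ?c * (\<Sum>om\<in>?\<Omega>. real (N om))" if j: "j < n" for j
 proof -
  have "real K * (\<Sum>om\<in>?\<Omega>. of_bool (N om \<ge> 2) * P om j) =
    (\<Sum>om\<in>?\<Omega>. \<Sum>t<K. of_bool (N (om(j := t)) \<ge> 2) * P (om(j := t)) j)"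
   by (rule sum_PiE_update[OF j, symmetric])
  also have "\<dots> \<le> (\<Sum>om\<in>?\<Omega>. \<Sum>t<K. real (N om) * P (om(j := t)) j)"
  proof (intro sum_mono mult_right_mono P0)
   fix om t
   show "of_bool (N (om(j := t)) \<ge> 2) \<le> real (N om)"
    using var[OF j, of om t "om j"] by (cases "N (om(j := t)) \<ge> 2") auto
  qed
  also have "\<dots> \<le> (\<Sum>om\<in>?\<Omega>. real (N om) * ?c)"
   unfolding sum_distrib_left[symmetric] by (intro sum_mono mult_left_mono avg[OF j]) auto
  finally show ?thesis by (simp add: sum_distrib_left mult.commute)
 qed
 \<comment> \<open>On the event the count is at least 2, which gains the factor 1/2.\<close>
 have "2 * real (card {om\<in>?\<Omega>. N om \<ge> 2}) = (\<Sum>om\<in>?\<Omega>. of_bool (N om \<ge> 2) * 2)"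
  using fin by (simp add: sum_distrib_right[symmetric] Int_def)
 also have "\<dots> \<le> (\<Sum>om\<in>?\<Omega>. of_bool (N om \<ge> 2) * real (N om))"
  by (intro sum_mono) auto
 also have "\<dots> = (\<Sum>j<n. \<Sum>om\<in>?\<Omega>. of_bool (N om \<ge> 2) * P om j)"
  unfolding PN[symmetric] sum_distrib_left by (rule sum.swap)
 finally have "2 * real (card {om\<in>?\<Omega>. N om \<ge> 2}) \<le> (\<Sum>j<n. \<Sum>om\<in>?\<Omega>. of_bool (N om \<ge> 2) * P om j)" .
 then have "real K * (2 * real (card {om\<in>?\<Omega>. N om \<ge> 2})) \<le> real K * (\<Sum>j<n. \<Sum>om\<in>?\<Omega>. of_bool (N om \<ge> 2) * P om j)"
  by (intro mult_left_mono) auto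
 also have "\<dots> \<le> (\<Sum>j<n. ?c * (\<Sum>om\<in>?\<Omega>. real (N om)))"
  unfolding sum_distrib_left[of "real K"] by (intro sum_mono) (use one in \<open>simp add: sum_distrib_left\<close>)
 also have "\<dots> = real n * ?c * (\<Sum>om\<in>?\<Omega>. real (N om))" by simp
 finally have "real K * (real K * (2 * real (card {om\<in>?\<Omega>. N om \<ge> 2}))) \<le> real K * (real n * ?c * (\<Sum>om\<in>?\<Omega>. real (N om)))"
  by (intro mult_left_mono) auto
 also have "\<dots> = real n * ?c * (real K * (\<Sum>om\<in>?\<Omega>. real (N om)))" by (simp only: mult_ac)
 also have "\<dots> \<le> real n * ?c * (real n * ?c * real K ^ n)"
  using c0 by (intro mult_left_mono W) auto
 finally show ?thesis unfolding N_def by (simp add: power2_eq_square mult_ac)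
qed

text \<open>Windows of length 2 with integer left ends cover the spectrum: a pair at distance at
  most 1 lies in the one starting at the ceiling of the smaller value minus 1. There are
  \<open>2 R + 2\<close> of them, each with the constant \<open>(2 + 1) ^ 2 / 2\<close>.\<close>

lemma random_diagonal_gap:
 fixes S :: "nat \<Rightarrow> nat \<Rightarrow> real" and \<alpha> :: "(nat \<Rightarrow> nat) \<Rightarrow> nat \<Rightarrow> real"
 assumes E: "\<And>om. eigsys n (\<lambda>i l. S i l + of_bool (i = l) * real (om i)) (\<alpha> om) (u om)"
  and R: "\<And>om k. om \<in> PiE {..<n} (\<lambda>_. {..<K}) \<Longrightarrow> k < n \<Longrightarrow> \<bar>\<alpha> om k\<bar> \<le> real R"
 shows "real (card {om\<in>PiE {..<n} (\<lambda>_. {..<K}). \<exists>k l. k < l \<and> l < n \<and> \<alpha> om l - \<alpha> om k \<le> 1}) * real K ^ 2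
  \<le> real (2 * R + 2) * (9 / 2 * real n ^ 2 * real K ^ n)"
proof -
 let ?\<Omega> = "PiE {..<n} (\<lambda>_. {..<K})"
 have fin: "finite ?\<Omega>" by (intro finite_PiE) auto
 let ?bad = "\<lambda>x::int. {om\<in>?\<Omega>. card {k. k < n \<and> real_of_int x < \<alpha> om k \<and> \<alpha> om k \<le> real_of_int x + 2} \<ge> 2}"
 have sub: "{om\<in>?\<Omega>. \<exists>k l. k < l \<and> l < n \<and> \<alpha> om l - \<alpha> om k \<le> 1} \<subseteq> (\<Union>x\<in>{- int R - 1 .. int R}. ?bad x)"
 proof safe
  fix om k l assume om: "om \<in> ?\<Omega>" and kl: "k < l" "l < n" "\<alpha> om l - \<alpha> om k \<le> 1"
  define x where "x = \<lceil>\<alpha> om k\<rceil> - 1"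
  have x: "real_of_int x < \<alpha> om k" "\<alpha> om k \<le> real_of_int x + 1" unfolding x_def by linarith+
  have "\<alpha> om k \<le> \<alpha> om l" using eigsysD(4)[OF E, of k l] kl by auto
  then have "{k, l} \<subseteq> {k. k < n \<and> real_of_int x < \<alpha> om k \<and> \<alpha> om k \<le> real_of_int x + 2}"
   using x kl by auto
  then have "card {k, l} \<le> card {k. k < n \<and> real_of_int x < \<alpha> om k \<and> \<alpha> om k \<le> real_of_int x + 2}"
   by (intro card_mono) auto
  then have "om \<in> ?bad x" using om kl by simp
  moreover have "x \<in> {- int R - 1 .. int R}"
   using R[OF om, of k] kl x by (auto simp: abs_le_iff)
  ultimately show "om \<in> (\<Union>x\<in>{- int R - 1 .. int R}. ?bad x)" by blast
 qed
 have "card {om\<in>?\<Omega>. \<exists>k l. k < l \<and> l < n \<and> \<alpha> om l - \<alpha> om k \<le> 1} \<le> card (\<Union>x\<in>{- int R - 1 .. int R}. ?bad x)"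
  using fin by (intro card_mono sub) auto
 also have "\<dots> \<le> (\<Sum>x\<in>{- int R - 1 .. int R}. card (?bad x))" by (rule card_UN_le) auto
 finally have "real (card {om\<in>?\<Omega>. \<exists>k l. k < l \<and> l < n \<and> \<alpha> om l - \<alpha> om k \<le> 1}) * real K ^ 2
   \<le> real (\<Sum>x\<in>{- int R - 1 .. int R}. card (?bad x)) * real K ^ 2"
  by (intro mult_right_mono) (simp only: of_nat_le_iff, simp)
 also have "\<dots> = (\<Sum>x\<in>{- int R - 1 .. int R}. real (card (?bad x)) * real K ^ 2)"
  by (simp only: of_nat_sum sum_distrib_right)
 also have "\<dots> \<le> (\<Sum>x\<in>{- int R - 1 .. int R}. 9 / 2 * real n ^ 2 * real K ^ n)"
 proof (intro sum_mono)
  fix x :: int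
  show "real (card (?bad x)) * real K ^ 2 \<le> 9 / 2 * real n ^ 2 * real K ^ n"
   using random_diagonal_two_eigenvalues[where K = K, OF E, of "real_of_int x" "real_of_int x + 2"] by simp
 qed
 also have "\<dots> = real (2 * R + 2) * (9 / 2 * real n ^ 2 * real K ^ n)" by (simp add: algebra_simps)
 finally show ?thesis .
qed

section \<open>Lifting in base b, leading minors and the sign count\<close>

definition shifted :: "int \<Rightarrow> (nat \<Rightarrow> nat \<Rightarrow> int) \<Rightarrow> int \<Rightarrow> nat \<Rightarrow> int mat" where
 "shifted b B s k = mat k k (\<lambda>(i,j). of_bool (i = j) + b * (B i j - of_bool (i = j) * s))"

lemma shifted_carrier [simp]: "shifted b B s k \<in> carrier_mat k k"
 unfolding shifted_def by simp

text \<open>For \<open>M = I + b G\<close> the vector \<open>r - M (r mod b)\<close> equals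
  \<open>b (r div b - G (r mod b))\<close>; this is its exact quotient by \<open>b\<close>, the
  residual once a digit has been removed. The value 0 outside the block keeps the rest of the array
  clear.\<close>

definition lift_step :: "int \<Rightarrow> (nat \<Rightarrow> nat \<Rightarrow> int) \<Rightarrow> int \<Rightarrow> nat \<Rightarrow> (nat \<Rightarrow> int) \<Rightarrow> nat \<Rightarrow> int" where
 "lift_step b B s k r i =
  (if i < k then r i div b - (\<Sum>j<k. (B i j - of_bool (i = j) * s) * (r j mod b)) else 0)"

text \<open>Dixon lifting with unit vector \<open>j\<close> as right-hand side, so the digits are
  those of column \<open>j\<close> of the inverse.\<close>

fun residual :: "int \<Rightarrow> (nat \<Rightarrow> nat \<Rightarrow> int) \<Rightarrow> int \<Rightarrow> nat \<Rightarrow> nat \<Rightarrow> nat \<Rightarrow> nat \<Rightarrow> int" where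
 "residual b B s k j 0 = (\<lambda>i. of_bool (i = j))"
| "residual b B s k j (Suc t) = lift_step b B s k (residual b B s k j t)"

definition lifted :: "int \<Rightarrow> (nat \<Rightarrow> nat \<Rightarrow> int) \<Rightarrow> int \<Rightarrow> nat \<Rightarrow> nat \<Rightarrow> nat \<Rightarrow> nat \<Rightarrow> int" where
 "lifted b B s k j t i = (\<Sum>u<t. b ^ u * (residual b B s k j u i mod b))"

text \<open>Since the matrix is the identity modulo \<open>b\<close>, the digits of the solution in base \<open>b\<close> are the
 residuals modulo \<open>b\<close>.\<close>

lemma lifted_invariant:
 assumes "i < k"
 shows "(\<Sum>l<k. shifted b B s k $$ (i,l) * lifted b B s k j t l) + b ^ t * residual b B s k j t i = of_bool (i = j)"
proof (induction t)
 case 0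
 then show ?case by (simp add: lifted_def)
next
 case (Suc t)
 let ?r = "residual b B s k j t"
 let ?G = "\<lambda>l. B i l - of_bool (i = l) * s"
 have "(\<Sum>l<k. shifted b B s k $$ (i,l) * (?r l mod b)) = (\<Sum>l<k. of_bool (i = l) * (?r l mod b) + b * (?G l * (?r l mod b)))"
  unfolding shifted_def using assms by (intro sum.cong) (auto simp: algebra_simps)
 also have "\<dots> = ?r i mod b + b * (\<Sum>l<k. ?G l * (?r l mod b))"
  unfolding sum.distrib sum_of_bool_delta(1)[OF assms] sum_distrib_left ..
 finally have e: "(\<Sum>l<k. shifted b B s k $$ (i,l) * (?r l mod b)) = ?r i mod b + b * (\<Sum>l<k. ?G l * (?r l mod b))" .
 have e2: "(\<Sum>l<k. shifted b B s k $$ (i,l) * lifted b B s k j (Suc t) l) =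
   (\<Sum>l<k. shifted b B s k $$ (i,l) * lifted b B s k j t l) + b ^ t * (\<Sum>l<k. shifted b B s k $$ (i,l) * (?r l mod b))"
  unfolding sum_distrib_left sum.distrib[symmetric] by (intro sum.cong) (auto simp: lifted_def algebra_simps)
 have "(\<Sum>l<k. shifted b B s k $$ (i,l) * lifted b B s k j (Suc t) l) + b ^ Suc t * residual b B s k j (Suc t) i =
   (\<Sum>l<k. shifted b B s k $$ (i,l) * lifted b B s k j t l) + b ^ t * ?r i"
 proof -
  have r: "residual b B s k j (Suc t) i = ?r i div b - (\<Sum>l<k. ?G l * (?r l mod b))"
   using assms by (simp add: lift_step_def)
  have d: "?r i mod b = ?r i - b * (?r i div b)" by (simp add: minus_mult_div_eq_mod)
  show ?thesis unfolding e2 e r d power_Suc by (simp add: algebra_simps)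
 qed
 also have "\<dots> = of_bool (i = j)" by (rule Suc)
 finally show ?case .
qed

text \<open>The invariant, multiplied by the adjugate from the left. An integer of known size, such
  as a minor or a cofactor, is thereby determined by finitely many digits of the inverse.\<close>

lemma lifted_adj:
 assumes i: "i < k" and j: "j < k"
 shows "b ^ t dvd det (shifted b B s k) * lifted b B s k j t i - adj_mat (shifted b B s k) $$ (i,j)"
proof -
 let ?M = "shifted b B s k" and ?y = "lifted b B s k j t" and ?r = "residual b B s k j t"
 let ?J = "adj_mat ?M"
 have M: "?M \<in> carrier_mat k k" by simp
 note J = adj_mat[OF M]
 have Jij: "(\<Sum>l<k. ?J $$ (i,l) * ?M $$ (l,h)) = of_bool (i = h) * det ?M" if "h < k" for h
 proof -
  have "(?J * ?M) $$ (i,h) = (det ?M \<cdot>\<^sub>m 1\<^sub>m k) $$ (i,h)" using J by simp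
  then show ?thesis using J(1) M i that by (simp add: scalar_prod_def atLeast0LessThan)
 qed
 have "(\<Sum>l<k. ?J $$ (i,l) * of_bool (l = j)) = (\<Sum>l<k. ?J $$ (i,l) * ((\<Sum>h<k. ?M $$ (l,h) * ?y h) + b ^ t * ?r l))"
  using lifted_invariant by (intro sum.cong) auto
 also have "\<dots> = (\<Sum>l<k. \<Sum>h<k. (?J $$ (i,l) * ?M $$ (l,h)) * ?y h) + b ^ t * (\<Sum>l<k. ?J $$ (i,l) * ?r l)"
  by (simp add: sum_distrib_left sum.distrib algebra_simps)
 also have "(\<Sum>l<k. \<Sum>h<k. (?J $$ (i,l) * ?M $$ (l,h)) * ?y h) = (\<Sum>h<k. (\<Sum>l<k. ?J $$ (i,l) * ?M $$ (l,h)) * ?y h)"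
  unfolding sum_distrib_right by (rule sum.swap)
 also have "\<dots> = (\<Sum>h<k. of_bool (i = h) * (det ?M * ?y h))" using Jij by (intro sum.cong) auto
 also have "\<dots> = det ?M * ?y i" by (rule sum_of_bool_delta(1)[OF i])
 finally have "(\<Sum>l<k. of_bool (l = j) * ?J $$ (i,l)) = det ?M * ?y i + b ^ t * (\<Sum>l<k. ?J $$ (i,l) * ?r l)"
  by (simp only: mult.commute)
 then have "det ?M * ?y i - ?J $$ (i,j) = b ^ t * (- (\<Sum>l<k. ?J $$ (i,l) * ?r l))"
  unfolding sum_of_bool_delta(2)[OF j] by simp
 then show ?thesis by (metis dvd_triv_left)
qed

text \<open>Together with \<open>lifted_adj\<close> this is Cramer's rule for the last diagonal
  entry of the inverse, the ratio of two consecutive leading minors.\<close>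

lemma adj_last_minor: "adj_mat (shifted b B s (Suc k)) $$ (k,k) = det (shifted b B s k)"
proof -
 have "mat_delete (shifted b B s (Suc k)) k k = shifted b B s k"
  unfolding mat_delete_def shifted_def by (intro eq_matI) auto
 then show ?thesis unfolding adj_mat_def by (simp add: cofactor_def shifted_def)
qed

text \<open>The first digit is that of the unit vector itself. Hence a lifted diagonal entry is
  invertible modulo powers of \<open>b\<close>, and 1 is a starting value for Newton's
  iteration.\<close>

lemma lifted_mod: "t > 0 \<Longrightarrow> b dvd lifted b B s k j t j - 1"
proof -
 assume "t > 0"
 then obtain t' where t: "t = Suc t'" by (cases t) auto
 have "lifted b B s k j t j - 1 = (1 mod b - 1) + b * (\<Sum>u<t'. b ^ u * (residual b B s k j (Suc u) j mod b))"
  unfolding lifted_def t sum.lessThan_Suc_shift by (simp add: sum_distrib_left mult.assoc)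
 moreover have "b dvd 1 mod b - 1" by (metis dvd_minus_iff minus_diff_eq minus_mod_eq_mult_div dvd_triv_left)
 ultimately show ?thesis by (metis dvd_add dvd_triv_left)
qed

text \<open>Consecutive leading minors are linked by \<open>lifted_adj\<close> with a single digit,
  so the claim passes from order \<open>k\<close> to \<open>Suc k\<close>. This is what excludes
  singular shifts.\<close>

lemma det_shifted_mod: "b dvd det (shifted b B s k) - 1"
proof (induction k)
 case 0
 then show ?case by (simp add: shifted_def)
next
 case (Suc k)
 let ?d = "det (shifted b B s (Suc k))" and ?y = "lifted b B s (Suc k) k 1 k"
 have "b dvd ?d * ?y - det (shifted b B s k)"
  using lifted_adj[of k "Suc k" k b 1 B s] by (simp add: adj_last_minor)
 moreover have "b dvd ?d * (?y - 1)" using lifted_mod[of 1 b B s "Suc k" k] by simp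
 ultimately have "b dvd ((?d * ?y - det (shifted b B s k)) - ?d * (?y - 1)) + (det (shifted b B s k) - 1)"
  by (rule dvd_add[OF dvd_diff Suc])
 then show ?case by (simp add: algebra_simps)
qed

lemma det_shifted_nonzero: "b \<ge> 2 \<Longrightarrow> det (shifted b B s k) \<noteq> 0"
 using det_shifted_mod[of b B s k] zdvd_imp_le[of b 1] by auto

lemma abs_det_le:
 fixes A :: "int mat"
 assumes A: "A \<in> carrier_mat k k" and E: "\<And>i j. i < k \<Longrightarrow> j < k \<Longrightarrow> \<bar>A $$ (i,j)\<bar> \<le> E" and E0: "E \<ge> 0"
 shows "\<bar>det A\<bar> \<le> (int k * E) ^ k"
proof -
 have "\<bar>det A\<bar> \<le> (\<Sum>p\<in>{p. p permutes {0..<k}}. \<bar>signof p * (\<Prod>i=0..<k. A $$ (i, p i))\<bar>)"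
  unfolding det_def'[OF A] by (rule sum_abs)
 also have "\<dots> \<le> (\<Sum>p\<in>{p. p permutes {0..<k}}. E ^ k)"
 proof (rule sum_mono)
  fix p assume "p \<in> {p. p permutes {0..<k}}"
  then have p: "p permutes {0..<k}" by simp
  have "\<bar>signof p * (\<Prod>i=0..<k. A $$ (i, p i))\<bar> = (\<Prod>i=0..<k. \<bar>A $$ (i, p i)\<bar>)"
   by (simp add: abs_mult abs_prod sign_def)
  also have "\<dots> \<le> (\<Prod>i=0..<k. E)"
   using permutes_in_image[OF p] by (intro prod_mono) (auto intro!: E)
  finally show "\<bar>signof p * (\<Prod>i=0..<k. A $$ (i, p i))\<bar> \<le> E ^ k" by simp
 qed
 also have "\<dots> = fact k * E ^ k" using card_permutations[of "{0..<k}" k] by simp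
 also have "\<dots> \<le> int k ^ k * E ^ k"
 proof (intro mult_right_mono)
  show "(fact k :: int) \<le> int k ^ k" using fact_le_power[of k, where 'a = int] by simp
 qed (use E0 in auto)
 finally show ?thesis by (simp add: power_mult_distrib)
qed

lemma abs_adj_le:
 fixes A :: "int mat"
 assumes A: "A \<in> carrier_mat k k" and E: "\<And>i j. i < k \<Longrightarrow> j < k \<Longrightarrow> \<bar>A $$ (i,j)\<bar> \<le> E" and E0: "E \<ge> 1"
  and ij: "i < k" "j < k"
 shows "\<bar>adj_mat A $$ (i,j)\<bar> \<le> (int k * E) ^ k"
proof -
 have "\<bar>adj_mat A $$ (i,j)\<bar> = \<bar>det (mat_delete A j i)\<bar>"
  using A ij by (simp add: adj_mat_def cofactor_def abs_mult power_abs)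
 also have "\<dots> \<le> (int (k - 1) * E) ^ (k - 1)"
  using A E0 by (intro abs_det_le mat_delete_carrier) (auto simp: mat_delete_def intro!: E)
 also have "\<dots> \<le> (int k * E) ^ (k - 1)" using E0 by (intro power_mono mult_right_mono) auto
 also have "\<dots> \<le> (int k * E) ^ k"
 proof (rule power_increasing)
  show "1 \<le> int k * E" using E0 ij mult_mono[of 1 "int k" 1 E] by simp
 qed simp
 finally show ?thesis .
qed

lemma symmetric_residue:
 fixes N y v :: int
 assumes "N dvd v - y" and "- N \<le> 2 * y" and "2 * y < N" and "even N"
 shows "(v + N div 2) mod N - N div 2 = y"
proof -
 have "(v + N div 2) mod N = (y + N div 2) mod N"
  using assms(1) by (metis mod_eq_dvd_iff mod_add_left_eq)
 also have "\<dots> = y + N div 2" using assms(2-4) by (intro mod_pos_pos_trivial) auto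
 finally show ?thesis by simp
qed

lemma eigsys_affine:
 assumes "eigsys n B \<alpha> u" and "b > 0"
 shows "eigsys n (\<lambda>i j. of_bool (i = j) * c + b * B i j) (\<lambda>k. c + b * \<alpha> k) u"
proof -
 have "of_bool (i = j) * c + b * B i j = (\<Sum>k<n. (c + b * \<alpha> k) * u k i * u k j)" if ij: "i < n" "j < n" for i j
 proof -
  have "(\<Sum>k<n. (c + b * \<alpha> k) * u k i * u k j) = c * (\<Sum>k<n. u k i * u k j) + b * (\<Sum>k<n. \<alpha> k * u k i * u k j)"
   unfolding sum_distrib_left sum.distrib[symmetric] by (intro sum.cong) (auto simp: algebra_simps)
  then show ?thesis using eigsysD(2,3)[OF assms(1) ij] by simp
 qed
 then show ?thesis using eigsysD[OF assms(1)] assms(2) unfolding eigsys_def by auto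
qed

definition sign_changes :: "int \<Rightarrow> (nat \<Rightarrow> nat \<Rightarrow> int) \<Rightarrow> int \<Rightarrow> nat \<Rightarrow> nat" where
 "sign_changes b B s n = card {k. k < n \<and> det (shifted b B s k) * det (shifted b B s (Suc k)) < 0}"

lemma sign_changes_Suc:
 "sign_changes b B s (Suc n) = sign_changes b B s n + of_bool (det (shifted b B s n) * det (shifted b B s (Suc n)) < 0)"
proof -
 have "{k. k < Suc n \<and> det (shifted b B s k) * det (shifted b B s (Suc k)) < 0} =
  {k. k < n \<and> det (shifted b B s k) * det (shifted b B s (Suc k)) < 0} \<union>
  (if det (shifted b B s n) * det (shifted b B s (Suc n)) < 0 then {n} else {})"
  by (auto simp: less_Suc_eq)
 then show ?thesis unfolding sign_changes_def by auto
qed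

text \<open>Jacobi's signature rule: the next leading submatrix has one more negative eigenvalue
  exactly at a sign change of the minors. No minor vanishes, so there is no degenerate case; in
  return the eigenvalues below \<open>s - 1 / b\<close> are counted instead of those below
  \<open>s\<close>.\<close>

lemma sign_changes_count:
 assumes sym: "\<And>i j. i < n \<Longrightarrow> j < n \<Longrightarrow> B i j = B j i" and b: "b \<ge> 2"
  and E: "eigsys n (\<lambda>i j. real_of_int (B i j)) \<alpha> u"
 shows "card {k. k < n \<and> 1 + b * (\<alpha> k - s) < 0} = sign_changes b B s n"
proof -
 let ?M = "\<lambda>i j. of_bool (i = j) * (1 - real_of_int b * s) + real_of_int b * real_of_int (B i j)"
 have det: "det (mat k k (\<lambda>(i,j). ?M i j)) = real_of_int (det (shifted b B s k))" for k
 proof -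
  have "mat k k (\<lambda>(i,j). ?M i j) = map_mat real_of_int (shifted b B s k)"
   unfolding shifted_def by (intro eq_matI) (auto simp: algebra_simps)
  then show ?thesis by (simp only: of_int_hom.hom_det)
 qed
 have main: "card {l. l < k \<and> \<beta> l < 0} = sign_changes b B s k"
  if "k \<le> n" "eigsys k ?M \<beta> w" for k \<beta> w
  using that
 proof (induction k arbitrary: \<beta> w)
  case (Suc k)
  have "\<And>i j. i < k \<Longrightarrow> j < k \<Longrightarrow> ?M i j = ?M j i" using sym Suc.prems(1) by auto
  then obtain \<gamma> z where g: "eigsys k ?M \<gamma> z" using eigsys_exists[of k ?M] by blast
  have d: "det (mat k k (\<lambda>(i,j). ?M i j)) \<noteq> 0" for k
   unfolding det using det_shifted_nonzero[OF b] by simp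
  have "card {l. l < Suc k \<and> \<beta> l < 0} = card {l. l < k \<and> \<gamma> l < 0} +
   of_bool (det (mat (Suc k) (Suc k) (\<lambda>(i,j). ?M i j)) * det (mat k k (\<lambda>(i,j). ?M i j)) < 0)"
   by (rule negative_eigenvalue_count_Suc[OF Suc.prems(2) g d d])
  also have "card {l. l < k \<and> \<gamma> l < 0} = sign_changes b B s k" using Suc g by simp
  finally show ?case unfolding sign_changes_Suc det
   by (simp only: of_int_mult[symmetric] of_int_less_0_iff mult.commute)
 qed (simp add: sign_changes_def)
 have "eigsys n ?M (\<lambda>k. (1 - real_of_int b * s) + b * \<alpha> k) u"
  by (rule eigsys_affine[OF E]) (use b in auto)
 from main[OF order_refl this] show ?thesis by (simp add: algebra_simps)
qed

section \<open>Inverse iteration and rounding\<close>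

lemma L2_set_sum_diff_sq: "(L2_set f S)\<^sup>2 = (\<Sum>i\<in>S. (f i)\<^sup>2)"
 unfolding L2_set_def by (simp add: sum_nonneg)

lemma L2_set_diff_le: "L2_set (\<lambda>i. f i - g i) S \<le> L2_set f S + L2_set g S"
 using L2_set_triangle_ineq[of f "\<lambda>i. - g i" S] by (simp add: L2_set_def)

lemma L2_set_scale: "L2_set (\<lambda>i. c * f i) S = \<bar>c\<bar> * L2_set f S"
 unfolding L2_set_def by (simp add: power_mult_distrib sum_distrib_left[symmetric] real_sqrt_mult)

lemma eigsys_expand:
 assumes E: "eigsys n B \<alpha> u" and i: "i < n"
 shows "(\<Sum>k<n. (\<Sum>l<n. u k l * z l) * u k i) = z i"
proof -
 have "(\<Sum>k<n. (\<Sum>l<n. u k l * z l) * u k i) = (\<Sum>k<n. \<Sum>l<n. (u k l * u k i) * z l)"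
  unfolding sum_distrib_right by (intro sum.cong refl) (simp add: mult_ac)
 also have "\<dots> = (\<Sum>l<n. (\<Sum>k<n. u k l * u k i) * z l)" unfolding sum_distrib_right by (rule sum.swap)
 also have "\<dots> = (\<Sum>l<n. of_bool (l = i) * z l)" using eigsysD(2)[OF E _ i] by simp
 also have "\<dots> = z i" by (rule sum_of_bool_delta(2)[OF i])
 finally show ?thesis .
qed

text \<open>The count at \<open>s\<close> leaves the value 0 possible, but then the determinant of
  the shifted matrix would vanish. The count at \<open>s + 1\<close> gives the upper end, since
  raising the shift by one lowers the value by \<open>b\<close>.\<close>

lemma shift_bracket:
 assumes sym: "\<And>i j. i < n \<Longrightarrow> j < n \<Longrightarrow> B i j = B j i" and b: "b \<ge> 2"
  and E: "eigsys n (\<lambda>i j. real_of_int (B i j)) \<alpha> u" and i: "i < n"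
  and s: "sign_changes b B s n \<le> i" "i < sign_changes b B (s + 1) n"
 shows "0 < 1 + b * (\<alpha> i - s)" and "1 + b * (\<alpha> i - s) < b"
proof -
 have b0: "real_of_int b > 0" using b by simp
 have "0 \<le> 1 + b * (\<alpha> i - s)"
 proof (rule ccontr)
  assume neg: "\<not> ?thesis"
  have "{..i} \<subseteq> {k. k < n \<and> 1 + b * (\<alpha> k - s) < 0}"
  proof
   fix k assume "k \<in> {..i}"
   then have "\<alpha> k \<le> \<alpha> i" "k < n" using eigsysD(4)[OF E _ i] i by auto
   moreover from this have "b * (\<alpha> k - s) \<le> b * (\<alpha> i - s)" using b0 by (intro mult_left_mono) auto
   ultimately show "k \<in> {k. k < n \<and> 1 + b * (\<alpha> k - s) < 0}" using neg by simp
  qed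
  then have "card {..i} \<le> card {k. k < n \<and> 1 + b * (\<alpha> k - s) < 0}" by (intro card_mono) auto
  then show False using sign_changes_count[OF sym b E, of s] s by simp
 qed
 moreover have "1 + b * (\<alpha> i - s) \<noteq> 0"
 proof
  assume z: "1 + b * (\<alpha> i - s) = 0"
  have "eigsys n (\<lambda>i j. of_bool (i = j) * (1 - real_of_int b * s) + real_of_int b * real_of_int (B i j)) (\<lambda>k. (1 - real_of_int b * s) + b * \<alpha> k) u"
   by (rule eigsys_affine[OF E b0])
  then have "det (mat n n (\<lambda>(i,j). of_bool (i = j) * (1 - real_of_int b * s) + real_of_int b * real_of_int (B i j))) =
    (\<Prod>k<n. (1 - real_of_int b * s) + b * \<alpha> k)" by (rule eigsys_det)
  also have "\<dots> = 0" using z i by (intro prod_zero) (auto simp: algebra_simps)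
  also have "mat n n (\<lambda>(i,j). of_bool (i = j) * (1 - real_of_int b * s) + real_of_int b * real_of_int (B i j)) = map_mat real_of_int (shifted b B s n)"
   unfolding shifted_def by (intro eq_matI) (auto simp: algebra_simps)
  finally have "real_of_int (det (shifted b B s n)) = 0" by (simp only: of_int_hom.hom_det)
  then show False using det_shifted_nonzero[OF b] by simp
 qed
 ultimately show "0 < 1 + b * (\<alpha> i - s)" by linarith
 show "1 + b * (\<alpha> i - s) < b"
 proof (rule ccontr)
  assume "\<not> ?thesis"
  then have ge: "1 + b * (\<alpha> i - (s + 1)) \<ge> 0" by (simp add: algebra_simps)
  have "{k. k < n \<and> 1 + b * (\<alpha> k - (s + 1)) < 0} \<subseteq> {..<i}"
  proof
   fix k assume k: "k \<in> {k. k < n \<and> 1 + b * (\<alpha> k - (s + 1)) < 0}"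
   show "k \<in> {..<i}"
   proof (rule ccontr)
    assume "k \<notin> {..<i}"
    then have "\<alpha> i \<le> \<alpha> k" using eigsysD(4)[OF E] k by auto
    then have "b * (\<alpha> i - (s + 1)) \<le> b * (\<alpha> k - (s + 1))" using b0 by (intro mult_left_mono) auto
    then show False using k ge by simp
   qed
  qed
  then have "card {k. k < n \<and> 1 + b * (\<alpha> k - (s + 1)) < 0} \<le> card {..<i}" by (intro card_mono) auto
  then show False using sign_changes_count[OF sym b E, of "s + 1"] s by simp
 qed
qed

text \<open>One step of inverse iteration, started at the best coordinate vector. The gap makes the
 component along \<open>u i\<close> dominate.\<close>

lemma inverse_iteration:
 fixes B :: "nat \<Rightarrow> nat \<Rightarrow> int" and F b :: real
 assumes n: "n > 0" and E: "eigsys n (\<lambda>i j. of_bool (i = j) * c + b * real_of_int (B i j)) \<theta> u" and i: "i < n"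
  and F: "F \<ge> 8 * n" "F \<ge> 2" and b: "b > 0"
  and th: "0 < \<theta> i" "\<theta> i < b" and gap: "\<And>k. k < n \<Longrightarrow> k \<noteq> i \<Longrightarrow> \<bar>\<theta> k\<bar> \<ge> b * F / 2"
  and d: "d \<noteq> 0"
  and sol: "\<And>j k. j < n \<Longrightarrow> k < n \<Longrightarrow> (\<Sum>l<n. (of_bool (k = l) * c + b * real_of_int (B k l)) * Z l j) = d * of_bool (k = j)"
  and jj: "jj < n" "\<And>j. j < n \<Longrightarrow> Z j j * d \<le> max 0 (Z jj jj * d)"
 shows "\<exists>\<sigma>\<in>{-1,1}. L2_set (\<lambda>k. Z k jj / L2_set (\<lambda>k. Z k jj) {..<n} - \<sigma> * u i k) {..<n} \<le> 8 * real n / F"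
  and "L2_set (\<lambda>k. Z k jj) {..<n} > 0"
proof -
 have F0: "F > 0" using F by simp
 have bF: "b * F / 2 > 0" using b F0 by simp
 have th0: "\<theta> k \<noteq> 0" if "k < n" for k using gap[OF that] bF th by (cases "k = i") auto
 \<comment> \<open>The coefficient of column \<open>j\<close> along \<open>u k\<close>. As
   \<open>Z\<close> is \<open>d\<close> times the inverse, it is
   \<open>d * u k j / \<theta> k\<close>.\<close>
 define cc where "cc k j = (\<Sum>l<n. u k l * Z l j)" for k j
 have cc: "cc k j = d * u k j / \<theta> k" if "k < n" "j < n" for k j
 proof -
  have "\<theta> k * cc k j = (\<Sum>h<n. u k h * (\<Sum>l<n. (of_bool (h = l) * c + b * real_of_int (B h l)) * Z l j))"
   unfolding cc_def by (rule eigsys_apply[OF E that(1), symmetric])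
  also have "\<dots> = (\<Sum>h<n. of_bool (h = j) * (d * u k h))"
   using sol[OF that(2)] by (intro sum.cong) (auto simp: of_bool_def)
  also have "\<dots> = d * u k j" by (rule sum_of_bool_delta(2)[OF that(2)])
  finally show ?thesis using th0[OF that(1)] by (simp add: field_simps)
 qed
 have Zx: "Z k j = (\<Sum>h<n. cc h j * u h k)" if "k < n" for k j
  unfolding cc_def using eigsys_expand[OF E that, of "\<lambda>l. Z l j"] by simp
 have col1: "(\<Sum>h<n. (u h j)\<^sup>2) = 1" if "j < n" for j using eigsysD(2)[OF E that that] by (simp add: power2_eq_square)
 have row1: "(\<Sum>j<n. (u h j)\<^sup>2) = 1" if "h < n" for h using eigsysD(1)[OF E that that] by (simp add: power2_eq_square)
 \<comment> \<open>The diagonal of the inverse. Multiplied by \<open>d ^ 2\<close> it is the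
   quantity \<open>Z j j * d\<close> that the selection compares, which avoids a division and is
   independent of the sign of \<open>d\<close>.\<close>
 define X where "X j = (\<Sum>h<n. (u h j)\<^sup>2 / \<theta> h)" for j
 have ZX: "Z j j * d = d\<^sup>2 * X j" if "j < n" for j
  unfolding Zx[OF that] X_def sum_distrib_left sum_distrib_right
  using cc[OF _ that] by (intro sum.cong) (auto simp: power2_eq_square)
 have small: "\<bar>1 / \<theta> h\<bar> \<le> 2 / (b * F)" if "h < n" "h \<noteq> i" for h
  using gap[OF that] bF by (simp add: field_simps abs_mult)
 have Xd: "\<bar>X j - (u i j)\<^sup>2 / \<theta> i\<bar> \<le> 2 / (b * F)" if j: "j < n" for j
 proof -
  have "X j = (u i j)\<^sup>2 / \<theta> i + (\<Sum>h\<in>{..<n} - {i}. (u h j)\<^sup>2 / \<theta> h)"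
   unfolding X_def using i by (subst sum.remove[of _ i]) auto
  then have "X j - (u i j)\<^sup>2 / \<theta> i = (\<Sum>h\<in>{..<n} - {i}. (u h j)\<^sup>2 / \<theta> h)" by simp
  then have "\<bar>X j - (u i j)\<^sup>2 / \<theta> i\<bar> \<le> (\<Sum>h\<in>{..<n} - {i}. \<bar>(u h j)\<^sup>2 / \<theta> h\<bar>)" by (simp only: sum_abs)
  also have "\<dots> \<le> (\<Sum>h\<in>{..<n} - {i}. (u h j)\<^sup>2 * (2 / (b * F)))"
  proof (rule sum_mono)
   fix h assume "h \<in> {..<n} - {i}"
   then have "(u h j)\<^sup>2 * \<bar>1 / \<theta> h\<bar> \<le> (u h j)\<^sup>2 * (2 / (b * F))" using small by (intro mult_left_mono) auto
   then show "\<bar>(u h j)\<^sup>2 / \<theta> h\<bar> \<le> (u h j)\<^sup>2 * (2 / (b * F))" by (simp add: abs_divide)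
  qed
  also have "\<dots> \<le> (\<Sum>h<n. (u h j)\<^sup>2 * (2 / (b * F)))" using b F0 by (intro sum_mono2) auto
  also have "\<dots> = 2 / (b * F)" using col1[OF j] unfolding sum_distrib_right[symmetric] by simp
  finally show ?thesis .
 qed
 \<comment> \<open>The trace of the inverse is almost \<open>1 / \<theta> i\<close> or more; so the
   largest diagonal entry has about the \<open>n\<close>-th part of it.\<close>
 have sumX: "(\<Sum>j<n. X j) \<ge> 1 / \<theta> i - n * (2 / (b * F))"
 proof -
  have "(\<Sum>j<n. X j) \<ge> (\<Sum>j<n. (u i j)\<^sup>2 / \<theta> i - 2 / (b * F))"
  proof (rule sum_mono)
   fix j assume "j \<in> {..<n}"
   then have "\<bar>X j - (u i j)\<^sup>2 / \<theta> i\<bar> \<le> 2 / (b * F)" using Xd by simp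
   then show "(u i j)\<^sup>2 / \<theta> i - 2 / (b * F) \<le> X j" by linarith
  qed
  moreover have "(\<Sum>j<n. (u i j)\<^sup>2 / \<theta> i - 2 / (b * F)) = 1 / \<theta> i - n * (2 / (b * F))"
   using row1[OF i] by (simp add: sum_subtractf sum_divide_distrib[symmetric])
  ultimately show ?thesis by simp
 qed
 have Xmax: "X j \<le> max 0 (X jj)" if "j < n" for j
 proof -
  have "d\<^sup>2 * X j \<le> max 0 (d\<^sup>2 * X jj)" using jj(2)[OF that] unfolding ZX[OF that] ZX[OF jj(1)] .
  also have "\<dots> = d\<^sup>2 * max 0 (X jj)" by (simp add: max_mult_distrib_left)
  finally show ?thesis using d by simp
 qed
 have nF: "n * (2 / (b * F)) \<le> 1 / (4 * b)" using F(1) b F0 by (simp add: field_simps)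
 have bi: "1 / b < 1 / \<theta> i" using th b by (simp add: field_simps)
 have "(\<Sum>j<n. X j) \<le> n * max 0 (X jj)" using sum_mono[of "{..<n}" X "\<lambda>_. max 0 (X jj)"] Xmax by simp
 then have nX: "1 / \<theta> i - n * (2 / (b * F)) \<le> n * max 0 (X jj)" using sumX by linarith
 have "1 / \<theta> i - n * (2 / (b * F)) > 0"
 proof -
  have "1 / (4 * b) \<le> 1 / b" using b by (simp add: field_simps)
  then show ?thesis using nF bi by linarith
 qed
 then have "max 0 (X jj) > 0" using nX n by (metis less_le_trans zero_less_mult_pos of_nat_0_less_iff)
 then have Xp: "max 0 (X jj) = X jj" by simp
 define a where "a = \<bar>u i jj\<bar>"
 have asq: "a\<^sup>2 = (u i jj)\<^sup>2" unfolding a_def by simp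
 have "1 / \<theta> i - n * (2 / (b * F)) \<le> n * (a\<^sup>2 / \<theta> i + 2 / (b * F))"
  using nX Xd[OF jj(1)] mult_left_mono[of "X jj" "a\<^sup>2 / \<theta> i + 2 / (b * F)" n] unfolding Xp asq by (simp add: abs_le_iff)
 then have "1 / \<theta> i \<le> n * a\<^sup>2 / \<theta> i + 2 * (n * (2 / (b * F)))" by (simp add: algebra_simps)
 then have "1 / \<theta> i \<le> n * a\<^sup>2 / \<theta> i + 1 / (2 * b)" using nF by linarith
 also have "1 / (2 * b) \<le> 1 / (2 * \<theta> i)" using th b by (simp add: field_simps)
 \<comment> \<open>The selected coordinate of \<open>u i\<close> has square at least
   \<open>1 / (2 n)\<close>, half of the average over all coordinates.\<close>
 finally have a2: "n * a\<^sup>2 \<ge> 1 / 2" using th by (simp add: field_simps)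
 have a0: "a \<ge> 0" unfolding a_def by simp
 have apos: "a > 0" using a2 a0 by (cases "a = 0") auto
 \<comment> \<open>Weaker than \<open>sqrt (2 n)\<close>, but free of roots:
   \<open>a \<le> 1\<close> gives \<open>a ^ 2 \<le> a\<close>.\<close>
 have an: "1 / a \<le> 2 * n"
 proof -
  have a1: "a \<le> 1"
  proof -
   have "a\<^sup>2 \<le> (\<Sum>h<n. (u h jj)\<^sup>2)" unfolding asq using i by (intro member_le_sum) auto
   then show ?thesis using col1[OF jj(1)] a0 by (simp add: power_le_one_iff abs_square_le_1)
  qed
  then have "n * a\<^sup>2 \<le> n * a" using a0 by (intro mult_left_mono) (auto simp: power2_eq_square mult_left_le)
  then show ?thesis using a2 apos by (simp add: field_simps)
 qed
 let ?z = "\<lambda>k. Z k jj" and ?c = "cc i jj"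
 \<comment> \<open>The part of the column orthogonal to \<open>u i\<close>. By the gap its norm is
   at most \<open>2 |d| / (b F)\<close>, whereas the component along \<open>u i\<close> is
   \<open>|d| a / \<theta> i\<close> with \<open>\<theta> i < b\<close>.\<close>
 define w where "w k = Z k jj - ?c * u i k" for k
 define N where "N = L2_set ?z {..<n}"
 have cabs: "\<bar>?c\<bar> = \<bar>d\<bar> * a / \<theta> i" using cc[OF i jj(1)] th unfolding a_def by (simp add: abs_mult)
 have cpos: "\<bar>?c\<bar> > 0" unfolding cabs using d apos th by simp
 have w2: "(\<Sum>k<n. (w k)\<^sup>2) = (\<Sum>h\<in>{..<n} - {i}. (cc h jj)\<^sup>2)"
 proof -
  have uw: "(\<Sum>k<n. u h k * w k) = (if h = i then 0 else cc h jj)" if "h < n" for h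
  proof -
   have "(\<Sum>k<n. u h k * w k) = cc h jj - ?c * (\<Sum>k<n. u h k * u i k)"
    unfolding w_def cc_def[of h] by (simp add: right_diff_distrib sum_subtractf sum_distrib_left mult_ac)
   then show ?thesis using eigsysD(1)[OF E that i] by auto
  qed
  have "(\<Sum>k<n. (w k)\<^sup>2) = (\<Sum>h<n. (\<Sum>k<n. u h k * w k)\<^sup>2)"
   using eigsys_parseval[OF E, of w w] by (simp add: power2_eq_square)
  also have "\<dots> = (\<Sum>h<n. (if h = i then 0 else (cc h jj)\<^sup>2))" using uw by (intro sum.cong) auto
  also have "\<dots> = (\<Sum>h\<in>{..<n} - {i}. (cc h jj)\<^sup>2)" using i by (subst sum.remove[of _ i]) auto
  finally show ?thesis .
 qed
 have wle: "L2_set w {..<n} \<le> \<bar>d\<bar> * (2 / (b * F))"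
 proof -
  have "(\<Sum>h\<in>{..<n} - {i}. (cc h jj)\<^sup>2) \<le> (\<Sum>h\<in>{..<n} - {i}. (u h jj)\<^sup>2 * (\<bar>d\<bar> * (2 / (b * F)))\<^sup>2)"
  proof (rule sum_mono)
   fix h assume h: "h \<in> {..<n} - {i}"
   have "(cc h jj)\<^sup>2 = (u h jj)\<^sup>2 * (\<bar>d\<bar> * \<bar>1 / \<theta> h\<bar>)\<^sup>2"
    using cc[of h jj] h jj(1) by (simp add: power_mult_distrib power_divide)
   also have "\<dots> \<le> (u h jj)\<^sup>2 * (\<bar>d\<bar> * (2 / (b * F)))\<^sup>2"
    using small[of h] h by (intro mult_left_mono power_mono) auto
   finally show "(cc h jj)\<^sup>2 \<le> (u h jj)\<^sup>2 * (\<bar>d\<bar> * (2 / (b * F)))\<^sup>2" .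
  qed
  also have "\<dots> \<le> (\<Sum>h<n. (u h jj)\<^sup>2 * (\<bar>d\<bar> * (2 / (b * F)))\<^sup>2)" by (intro sum_mono2) auto
  also have "\<dots> = (\<bar>d\<bar> * (2 / (b * F)))\<^sup>2" using col1[OF jj(1)] unfolding sum_distrib_right[symmetric] by simp
  finally have "(\<Sum>k<n. (w k)\<^sup>2) \<le> (\<bar>d\<bar> * (2 / (b * F)))\<^sup>2" unfolding w2 .
  then show ?thesis unfolding L2_set_def using b F0 by (intro real_le_lsqrt) (auto simp: sum_nonneg)
 qed
 have N2: "N\<^sup>2 = ?c\<^sup>2 + (\<Sum>k<n. (w k)\<^sup>2)"
 proof -
  have "N\<^sup>2 = (\<Sum>h<n. (cc h jj)\<^sup>2)"
   unfolding N_def L2_set_sum_diff_sq cc_def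
   using eigsys_parseval[OF E, of ?z ?z] by (simp add: power2_eq_square)
  then show ?thesis unfolding w2 using i by (subst (asm) sum.remove[of _ i]) auto
 qed
 have N0: "N \<ge> 0" unfolding N_def by (rule L2_set_nonneg)
 have Nc: "\<bar>?c\<bar> \<le> N"
  by (rule power2_le_imp_le) (use N2 N0 in \<open>auto simp: sum_nonneg\<close>)
 then show Npos: "L2_set (\<lambda>k. Z k jj) {..<n} > 0" using cpos unfolding N_def by linarith
 define \<sigma> where "\<sigma> = sgn ?c"
 have sg: "\<sigma> \<in> {-1,1}" "?c = \<sigma> * \<bar>?c\<bar>" "\<bar>\<sigma>\<bar> = 1" using cpos unfolding \<sigma>_def by (auto simp: sgn_if)
 have u1: "L2_set (u i) {..<n} = 1" unfolding L2_set_def using row1[OF i] by simp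
 \<comment> \<open>Normalising by \<open>N\<close> instead of the component along \<open>u i\<close>
   costs the norm of the orthogonal part once more; hence the factor 2 below.\<close>
 have Nw: "N - \<bar>?c\<bar> \<le> L2_set w {..<n}"
 proof -
  have "?z = (\<lambda>k. w k + ?c * u i k)" unfolding w_def by auto
  then have "N \<le> L2_set w {..<n} + L2_set (\<lambda>k. ?c * u i k) {..<n}"
   unfolding N_def by (metis L2_set_triangle_ineq)
  then show ?thesis unfolding L2_set_scale u1 by simp
 qed
 have "L2_set (\<lambda>k. Z k jj / N - \<sigma> * u i k) {..<n} = (1 / N) * L2_set (\<lambda>k. w k - (\<sigma> * (N - \<bar>?c\<bar>)) * u i k) {..<n}"
 proof -
  have "Z k jj / N - \<sigma> * u i k = (1 / N) * (w k - (\<sigma> * (N - \<bar>?c\<bar>)) * u i k)" for k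
  proof -
   have "w k - (\<sigma> * (N - \<bar>?c\<bar>)) * u i k = Z k jj - N * (\<sigma> * u i k)"
    unfolding w_def using sg(2) by (simp add: algebra_simps)
   then show ?thesis using Npos unfolding N_def[symmetric] by (simp add: field_simps)
  qed
  then have fe: "(\<lambda>k. Z k jj / N - \<sigma> * u i k) = (\<lambda>k. (1 / N) * (w k - (\<sigma> * (N - \<bar>?c\<bar>)) * u i k))" by blast
  show ?thesis unfolding fe L2_set_scale using Npos unfolding N_def[symmetric] by simp
 qed
 also have "\<dots> \<le> (1 / N) * (L2_set w {..<n} + (N - \<bar>?c\<bar>))"
  using L2_set_diff_le[of w "\<lambda>k. (\<sigma> * (N - \<bar>?c\<bar>)) * u i k" "{..<n}"] Npos Nc sg(3)
  unfolding L2_set_scale u1 N_def[symmetric] by (intro mult_left_mono) (auto simp: abs_mult)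
 also have "\<dots> \<le> (1 / N) * (2 * L2_set w {..<n})" using Nw Npos unfolding N_def[symmetric] by (intro mult_left_mono) auto
 also have "\<dots> \<le> (1 / \<bar>?c\<bar>) * (2 * (\<bar>d\<bar> * (2 / (b * F))))"
  using Nc cpos wle by (intro mult_mono) (auto simp: field_simps L2_set_nonneg)
 also have "\<dots> = (\<theta> i / b) * (4 / F) * (1 / a)" unfolding cabs using d by (simp add: field_simps)
 also have "\<dots> \<le> 1 * (4 / F) * (2 * n)"
  using th b F0 an apos by (intro mult_mono) (auto simp: field_simps)
 finally have fin: "L2_set (\<lambda>k. Z k jj / N - \<sigma> * u i k) {..<n} \<le> 8 * real n / F" by simp
 show "\<exists>\<sigma>\<in>{-1,1}. L2_set (\<lambda>k. Z k jj / L2_set (\<lambda>k. Z k jj) {..<n} - \<sigma> * u i k) {..<n} \<le> 8 * real n / F"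
  by (rule bexI[OF _ sg(1)]) (use fin N_def in simp)
qed

text \<open>\<open>rt\<close> is the integer square root of \<open>P ^ 2\<close> times the squared
  norm, so \<open>z P ^ 2 div rt\<close> approximates \<open>P z / N\<close> in integers. Of the
  three units \<open>1 / P\<close> the floor takes one and the replacement of \<open>N P\<close> by
  \<open>rt\<close>, which is at least \<open>P / 2\<close>, takes two. A nonzero integer vector has
  \<open>N \<ge> 1\<close>.\<close>

lemma normalization_rounding:
 fixes z :: "nat \<Rightarrow> int" and rt P :: int
 assumes P: "P \<ge> 2" and S: "(\<Sum>k<n. (z k)\<^sup>2) > 0" and rt: "rt \<ge> 0" "rt\<^sup>2 \<le> (\<Sum>k<n. (z k)\<^sup>2) * P\<^sup>2" "(\<Sum>k<n. (z k)\<^sup>2) * P\<^sup>2 < (rt + 1)\<^sup>2"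
  and k: "k < n"
 shows "\<bar>real_of_int ((z k * P\<^sup>2) div rt) / P - z k / L2_set (\<lambda>k. real_of_int (z k)) {..<n}\<bar> \<le> 3 / P"
proof -
 define N where "N = L2_set (\<lambda>k. real_of_int (z k)) {..<n}"
 define SS where "SS = (\<Sum>k<n. (z k)\<^sup>2)"
 note S = S[folded SS_def] and rt = rt[folded SS_def]
 have N2: "N\<^sup>2 = real_of_int SS" unfolding N_def L2_set_sum_diff_sq SS_def by simp
 have N0: "N \<ge> 0" unfolding N_def by (rule L2_set_nonneg)
 have "real_of_int SS \<ge> 1" using S by simp
 then have N1: "N \<ge> 1" using N2 N0 by (intro power2_le_imp_le[of 1 N]) auto
 have P0: "real_of_int P > 0" using P by simp
 have "real_of_int (rt\<^sup>2) \<le> real_of_int (SS * P\<^sup>2)" using rt(2) by (simp only: of_int_le_iff)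
 then have "(real_of_int rt)\<^sup>2 \<le> (N * P)\<^sup>2" by (simp add: power_mult_distrib N2)
 then have up: "rt \<le> N * P" by (rule power2_le_imp_le) (use N0 P0 in simp)
 have "real_of_int (SS * P\<^sup>2) < real_of_int ((rt + 1)\<^sup>2)" using rt(3) by (simp only: of_int_less_iff)
 then have "(N * P)\<^sup>2 < (real_of_int rt + 1)\<^sup>2" by (simp add: power_mult_distrib N2)
 then have lo: "N * P < real_of_int rt + 1" by (rule power2_less_imp_less) (use rt(1) in simp)
 have NP: "N * P \<ge> P" using N1 P0 by (simp add: mult_le_cancel_right1)
 have rp: "rt \<ge> P / 2" using lo NP P by linarith
 have r0: "real_of_int rt > 0" using rp P0 by linarith
 have zk: "\<bar>real_of_int (z k)\<bar> \<le> N"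
 proof (rule power2_le_imp_le[OF _ N0])
  have "(real_of_int (z k))\<^sup>2 \<le> (\<Sum>k<n. (real_of_int (z k))\<^sup>2)" using k by (intro member_le_sum) auto
  then show "\<bar>real_of_int (z k)\<bar>\<^sup>2 \<le> N\<^sup>2" unfolding N2 SS_def by simp
 qed
 have 1: "\<bar>real_of_int ((z k * P\<^sup>2) div rt) - z k * P\<^sup>2 / rt\<bar> \<le> 1"
 proof -
  have "real_of_int ((z k * P\<^sup>2) div rt) = real_of_int \<lfloor>real_of_int (z k * P\<^sup>2) / real_of_int rt\<rfloor>" by (simp only: floor_divide_of_int_eq)
  then show ?thesis by simp linarith
 qed
 have "real_of_int ((z k * P\<^sup>2) div rt) / P - z k / N = (real_of_int ((z k * P\<^sup>2) div rt) - z k * P\<^sup>2 / rt) / P + z k * (P / rt - 1 / N)"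
  using P0 by (simp add: field_simps power2_eq_square)
 also have "\<bar>\<dots>\<bar> \<le> \<bar>(real_of_int ((z k * P\<^sup>2) div rt) - z k * P\<^sup>2 / rt) / P\<bar> + \<bar>z k * (P / rt - 1 / N)\<bar>" by (rule abs_triangle_ineq)
 also have "\<bar>(real_of_int ((z k * P\<^sup>2) div rt) - z k * P\<^sup>2 / rt) / P\<bar> \<le> 1 / P"
  using 1 P0 by (simp add: abs_divide divide_right_mono)
 also have "\<bar>z k * (P / rt - 1 / N)\<bar> \<le> 2 / P"
 proof -
  have "P / rt - 1 / N = (N * P - rt) / (rt * N)" using r0 N1 by (simp add: field_simps)
  then have "\<bar>P / rt - 1 / N\<bar> \<le> 1 / (rt * N)" using up lo r0 N1 by (simp add: abs_divide divide_right_mono)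
  then have "\<bar>z k * (P / rt - 1 / N)\<bar> \<le> N * (1 / (rt * N))" unfolding abs_mult using zk N0 by (intro mult_mono) auto
  also have "\<dots> = 1 / rt" using N1 by simp
  also have "\<dots> \<le> 2 / P" using rp r0 P0 by (simp add: field_simps)
  finally show ?thesis .
 qed
 finally show ?thesis unfolding N_def by simp
qed

lemma eigsys_cong:
 "eigsys n A \<alpha> u \<Longrightarrow> (\<And>i j. i < n \<Longrightarrow> j < n \<Longrightarrow> A i j = B i j) \<Longrightarrow> (\<And>k. k < n \<Longrightarrow> \<alpha> k = \<beta> k) \<Longrightarrow> eigsys n B \<beta> u"
 unfolding eigsys_def by simp

lemma L2_set_le_const:
 assumes "\<And>k. k < n \<Longrightarrow> \<bar>f k\<bar> \<le> c"
 shows "L2_set f {..<n} \<le> real n * c"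
proof -
 have "L2_set f {..<n} \<le> (\<Sum>k<n. \<bar>f k\<bar>)" by (rule L2_set_le_sum_abs)
 also have "\<dots> \<le> (\<Sum>k<n. c)" by (intro sum_mono assms) auto
 finally show ?thesis by simp
qed

lemma abs_sum_mult_le_L2: "\<bar>\<Sum>i<n. f i * g i\<bar> \<le> L2_set f {..<n} * L2_set g {..<n}"
proof -
 have "\<bar>\<Sum>i<n. f i * g i\<bar> \<le> (\<Sum>i<n. \<bar>f i\<bar> * \<bar>g i\<bar>)" unfolding abs_mult[symmetric] by (rule sum_abs)
 also have "\<dots> \<le> L2_set f {..<n} * L2_set g {..<n}" by (rule L2_set_mult_ineq)
 finally show ?thesis .
qed

lemma eigsys_row_norm: "eigsys n A \<alpha> u \<Longrightarrow> i < n \<Longrightarrow> L2_set (u i) {..<n} = 1"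
 using eigsysD(1)[of n A \<alpha> u i i] by (simp add: L2_set_def power2_eq_square)

lemma eigsys_abs_le:
 assumes E: "eigsys n A \<alpha> u" and k: "k < n" and W: "(\<Sum>i<n. \<Sum>j<n. \<bar>A i j\<bar>) \<le> W"
 shows "\<bar>\<alpha> k\<bar> \<le> W"
proof -
 have u1: "\<bar>u k i\<bar> \<le> 1" if "i < n" for i
 proof -
  have "(u k i)\<^sup>2 \<le> (\<Sum>i<n. (u k i)\<^sup>2)" using that by (intro member_le_sum) auto
  also have "\<dots> = 1" using eigsysD(1)[OF E k k] by (simp add: power2_eq_square)
  finally show ?thesis by (simp add: abs_square_le_1)
 qed
 have "\<bar>\<alpha> k\<bar> = \<bar>qform n A (u k)\<bar>" using eigsys_qform_eigenvector[OF E k] by simp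
 also have "\<dots> \<le> (\<Sum>i<n. \<Sum>j<n. \<bar>u k i * A i j * u k j\<bar>)"
  unfolding qform_def by (rule order_trans[OF sum_abs sum_mono[OF sum_abs]])
 also have "\<dots> \<le> (\<Sum>i<n. \<Sum>j<n. \<bar>A i j\<bar>)"
 proof (intro sum_mono)
  fix i j assume "i \<in> {..<n}" "j \<in> {..<n}"
  then have "\<bar>u k i\<bar> * \<bar>A i j\<bar> * \<bar>u k j\<bar> \<le> 1 * \<bar>A i j\<bar> * 1" using u1 by (intro mult_mono) auto
  then show "\<bar>u k i * A i j * u k j\<bar> \<le> \<bar>A i j\<bar>" by (simp add: abs_mult)
 qed
 finally show ?thesis using W by simp
qed

section \<open>Error analysis for the perturbed matrix\<close>

text \<open>\<open>Q\<close> dominates the dimension, the entries and \<open>1 / eps\<close>. The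
  exponent in \<open>Q ^ 9 \<le> F\<close> leaves room for the losses: the vectors are off by
  \<open>9 n / F\<close>, the residual multiplies this by the norm of \<open>A\<close>, at most
  \<open>Q\<close>, and the result has to stay below \<open>1 / Q\<close>.\<close>

locale perturbed =
 fixes n :: nat and A :: "nat \<Rightarrow> nat \<Rightarrow> int" and D :: "nat \<Rightarrow> int" and F :: int and Q eps :: real
  and lam :: "nat \<Rightarrow> real" and v0 :: "nat \<Rightarrow> nat \<Rightarrow> real" and \<beta> :: "nat \<Rightarrow> real" and u :: "nat \<Rightarrow> nat \<Rightarrow> real"
 assumes n0: "n > 0" and sym: "i < n \<Longrightarrow> j < n \<Longrightarrow> A i j = A j i"
  and AQ: "(\<Sum>i<n. \<Sum>j<n. \<bar>real_of_int (A i j)\<bar>) \<le> Q" and nQ: "real n \<le> Q" and Q4: "Q \<ge> 4" and FQ: "Q ^ 9 \<le> real_of_int F"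
  and eps: "1 / Q \<le> eps"
  and D: "i < n \<Longrightarrow> 0 \<le> D i" "i < n \<Longrightarrow> D i < F ^ 2"
  and lam: "eigsys n (\<lambda>i j. real_of_int (A i j)) lam v0"
  and beta: "eigsys n (\<lambda>i j. real_of_int (F ^ 3 * A i j) + of_bool (i = j) * real_of_int (D i)) \<beta> u"
begin

text \<open>\<open>F\<close> times the matrix with eigenvalues \<open>\<beta>\<close>: gaps above 1
  become gaps above \<open>F\<close>, whereas an integer shift locates an eigenvalue within
  1.\<close>

definition Bp :: "nat \<Rightarrow> nat \<Rightarrow> int" where
 "Bp i j = F ^ 4 * A i j + of_bool (i = j) * (F * D i)"

abbreviation "Fr \<equiv> real_of_int F"

lemma Fbig: "Fr \<ge> 262144" "Fr > 0" "F > 0" "Q ^ 7 * n * Q \<le> Fr" "Q\<^sup>2 \<le> Fr"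
proof -
 have "(4::real) ^ 9 \<le> Q ^ 9" using Q4 by (intro power_mono) auto
 then show 1: "Fr \<ge> 262144" using FQ by simp
 then show "Fr > 0" by simp
 then show "F > 0" by simp
 have "Q ^ 7 * n * Q \<le> Q ^ 7 * Q * Q" using nQ Q4 by (intro mult_right_mono mult_left_mono) auto
 then show "Q ^ 7 * n * Q \<le> Fr" using FQ by (simp add: eval_nat_numeral)
 have "Q ^ 2 \<le> Q ^ 9" using Q4 by (intro power_increasing) auto
 then show "Q\<^sup>2 \<le> Fr" using FQ by linarith
qed

lemma alpha: "eigsys n (\<lambda>i j. real_of_int (Bp i j)) (\<lambda>k. Fr * \<beta> k) u"
 by (rule eigsys_cong[OF eigsys_affine[OF beta Fbig(2), of 0]]) (auto simp: Bp_def algebra_simps eval_nat_numeral)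

lemma Bp_sym: "i < n \<Longrightarrow> j < n \<Longrightarrow> Bp i j = Bp j i"
 unfolding Bp_def using sym by auto

lemma alpha_le: "k < n \<Longrightarrow> \<bar>Fr * \<beta> k\<bar> \<le> 2 * Fr ^ 4 * Q"
proof -
 assume k: "k < n"
 have "(\<Sum>i<n. \<Sum>j<n. \<bar>real_of_int (Bp i j)\<bar>) \<le> (\<Sum>i<n. \<Sum>j<n. Fr ^ 4 * \<bar>real_of_int (A i j)\<bar> + of_bool (i = j) * Fr ^ 3)"
 proof (intro sum_mono)
  fix i j assume ij: "i \<in> {..<n}" "j \<in> {..<n}"
  have "Fr * real_of_int (D i) \<le> Fr * Fr ^ 2" using D[of i] ij Fbig
   by (intro mult_left_mono) (auto simp flip: of_int_power)
  then have "\<bar>of_bool (i = j) * (Fr * real_of_int (D i))\<bar> \<le> of_bool (i = j) * Fr ^ 3"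
   using D[of i] ij Fbig by (auto simp: eval_nat_numeral abs_mult)
  moreover have "\<bar>real_of_int (Bp i j)\<bar> \<le> \<bar>Fr ^ 4 * real_of_int (A i j)\<bar> + \<bar>of_bool (i = j) * (Fr * real_of_int (D i))\<bar>"
   unfolding Bp_def using abs_triangle_ineq[of "Fr ^ 4 * real_of_int (A i j)" "of_bool (i = j) * (Fr * real_of_int (D i))"] by simp
  ultimately show "\<bar>real_of_int (Bp i j)\<bar> \<le> Fr ^ 4 * \<bar>real_of_int (A i j)\<bar> + of_bool (i = j) * Fr ^ 3"
   using Fbig by (simp add: abs_mult)
 qed
 also have "\<dots> = Fr ^ 4 * (\<Sum>i<n. \<Sum>j<n. \<bar>real_of_int (A i j)\<bar>) + n * Fr ^ 3"
  by (simp add: sum.distrib sum_distrib_left sum_of_bool_delta)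
 also have "\<dots> \<le> Fr ^ 4 * Q + Q * Fr ^ 3" using AQ nQ Fbig by (intro add_mono mult_left_mono mult_right_mono) auto
 also have "Q * Fr ^ 3 \<le> Fr ^ 4 * Q" using Fbig Q4 mult_right_mono[of 1 Fr "Q * Fr ^ 3"] by (simp add: eval_nat_numeral algebra_simps)
 finally have "(\<Sum>i<n. \<Sum>j<n. \<bar>real_of_int (Bp i j)\<bar>) \<le> 2 * Fr ^ 4 * Q" by (simp add: mult_ac)
 then show ?thesis using eigsys_abs_le[OF alpha k] by simp
qed

text \<open>The spectrum lies within \<open>2 F ^ 4 Q\<close>, inside \<open>F ^ 5\<close> even with
  a margin of 1; bisection starts from these two shifts.\<close>

lemma bracket: "sign_changes (F ^ 8) Bp (- (F ^ 5)) n = 0" "sign_changes (F ^ 8) Bp (F ^ 5) n = n"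
proof -
 have b: "F ^ 8 \<ge> 2" using Fbig(1) power_increasing[of 1 8 F] by simp
 have "1 \<le> F ^ 8" using b by linarith
 then have b1: "real_of_int (F ^ 8) \<ge> 1" by (simp only: of_int_1_le_iff)
 have lt: "2 * Fr ^ 4 * Q + 1 < Fr ^ 5"
 proof -
  have "4 * Q \<le> Q * Q" using Q4 by (intro mult_right_mono) auto
  then have "2 * Q + 1 < Fr" using Q4 Fbig(5) unfolding power2_eq_square by linarith
  then have "(2 * Q + 1) * Fr ^ 4 < Fr * Fr ^ 4" using Fbig by (intro mult_strict_right_mono) auto
  moreover have "1 \<le> Fr ^ 4" using Fbig by (simp add: one_le_power)
  ultimately show ?thesis by (simp add: algebra_simps eval_nat_numeral)
 qed
 have 1: "\<not> 1 + real_of_int (F ^ 8) * (Fr * \<beta> k - real_of_int (- (F ^ 5))) < 0" if "k < n" for k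
 proof -
  have "Fr * \<beta> k - real_of_int (- (F ^ 5)) \<ge> 0" using alpha_le[OF that] lt by (simp add: abs_le_iff)
  then show ?thesis using b1 by (simp add: mult_nonneg_nonneg add_nonneg_nonneg not_less)
 qed
 have 2: "1 + real_of_int (F ^ 8) * (Fr * \<beta> k - real_of_int (F ^ 5)) < 0" if "k < n" for k
 proof -
  have "Fr * \<beta> k - real_of_int (F ^ 5) < - 1" using alpha_le[OF that] lt by (simp add: abs_le_iff)
  then have "real_of_int (F ^ 8) * (Fr * \<beta> k - real_of_int (F ^ 5)) < real_of_int (F ^ 8) * (- 1)" using b1 by (intro mult_strict_left_mono) auto
  then show ?thesis using b1 by linarith
 qed
 have e: "{k. k < n \<and> 1 + real_of_int (F ^ 8) * (Fr * \<beta> k - real_of_int (- (F ^ 5))) < 0} = {}" using 1 by blast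
 show "sign_changes (F ^ 8) Bp (- (F ^ 5)) n = 0"
  using sign_changes_count[OF Bp_sym b alpha, of "- (F ^ 5)"] unfolding e by simp
 have e2: "{k. k < n \<and> 1 + real_of_int (F ^ 8) * (Fr * \<beta> k - real_of_int (F ^ 5)) < 0} = {..<n}" using 2 by blast
 show "sign_changes (F ^ 8) Bp (F ^ 5) n = n"
  using sign_changes_count[OF Bp_sym b alpha, of "F ^ 5"] unfolding e2 by simp
qed

text \<open>Two errors of at most \<open>1 / F\<close> each: that of the integer shift, divided by
  \<open>F ^ 4\<close>, and that of the perturbation, which after division by \<open>F ^ 3\<close>
  is a diagonal with entries between 0 and \<open>1 / F\<close>, so that Weyl's inequality applies
  in both directions.\<close>

lemma eigenvalue_error:
 assumes i: "i < n" and s: "sign_changes (F ^ 8) Bp s n \<le> i" "i < sign_changes (F ^ 8) Bp (s + 1) n"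
 shows "\<bar>Fr * \<beta> i - s\<bar> \<le> 1" and "\<bar>lam i - s / Fr ^ 4\<bar> \<le> eps"
proof -
 have b: "F ^ 8 \<ge> 2" using Fbig(1) power_increasing[of 1 8 F] by simp
 have "0 < F ^ 8" using b by linarith
 then have b0: "real_of_int (F ^ 8) > 0" by (simp only: of_int_0_less_iff)
 note br = shift_bracket[OF Bp_sym b alpha i s]
 have "real_of_int (F ^ 8) * (Fr * \<beta> i - s) < real_of_int (F ^ 8) * 1" using br(2) by simp
 then have 1: "Fr * \<beta> i - s < 1" using b0 mult_less_cancel_left_pos by blast
 have "real_of_int (F ^ 8) * (-1) \<le> real_of_int (F ^ 8) * (Fr * \<beta> i - s)" using br(1) b by linarith
 then have "- 1 \<le> Fr * \<beta> i - s" using b0 mult_le_cancel_left_pos by blast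
 then show ab: "\<bar>Fr * \<beta> i - s\<bar> \<le> 1" using 1 by linarith
 have E: "eigsys n (\<lambda>i j. real_of_int (A i j) + of_bool (i = j) * (D i / Fr ^ 3)) (\<lambda>k. \<beta> k / Fr ^ 3) u"
  by (rule eigsys_cong[OF eigsys_affine[OF beta, of "1 / Fr ^ 3" 0]]) (use Fbig in \<open>auto simp: field_simps\<close>)
 have q: "qform n (\<lambda>i j. real_of_int (A i j) + of_bool (i = j) * (D i / Fr ^ 3)) x =
   qform n (\<lambda>i j. real_of_int (A i j)) x + (\<Sum>i<n. D i / Fr ^ 3 * (x i)\<^sup>2)" for x
 proof -
  have "qform n (\<lambda>i j. real_of_int (A i j) + of_bool (i = j) * (D i / Fr ^ 3)) x =
   qform n (\<lambda>i j. real_of_int (A i j)) x + (\<Sum>i<n. \<Sum>j<n. of_bool (i = j) * (x i * (D i / Fr ^ 3) * x j))"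
   unfolding qform_def sum.distrib[symmetric] by (intro sum.cong refl) (simp add: algebra_simps)
  also have "(\<Sum>i<n. \<Sum>j<n. of_bool (i = j) * (x i * (D i / Fr ^ 3) * x j)) = (\<Sum>i<n. x i * (D i / Fr ^ 3) * x i)"
   by (intro sum.cong refl sum_of_bool_delta) simp
  finally show ?thesis by (simp add: power2_eq_square mult_ac)
 qed
 have Dq: "0 \<le> (\<Sum>i<n. D i / Fr ^ 3 * (x i)\<^sup>2)" "(\<Sum>i<n. D i / Fr ^ 3 * (x i)\<^sup>2) \<le> 1 / Fr * (\<Sum>i<n. (x i)\<^sup>2)" for x
 proof -
  show "0 \<le> (\<Sum>i<n. D i / Fr ^ 3 * (x i)\<^sup>2)" using D Fbig by (intro sum_nonneg mult_nonneg_nonneg divide_nonneg_nonneg) auto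
  have "D i / Fr ^ 3 \<le> 1 / Fr" if "i < n" for i
  proof -
   have "real_of_int (D i) \<le> Fr ^ 2" using D[OF that] by (simp flip: of_int_power)
   then show ?thesis using Fbig by (simp add: field_simps eval_nat_numeral)
  qed
  then show "(\<Sum>i<n. D i / Fr ^ 3 * (x i)\<^sup>2) \<le> 1 / Fr * (\<Sum>i<n. (x i)\<^sup>2)"
   unfolding sum_distrib_left by (intro sum_mono mult_right_mono) auto
 qed
 have w1: "lam i \<le> \<beta> i / Fr ^ 3 + 0" by (rule eigsys_weyl[OF lam E i]) (use q Dq(1) in simp)
 have w2: "\<beta> i / Fr ^ 3 \<le> lam i + 1 / Fr" by (rule eigsys_weyl[OF E lam i]) (use q Dq(2) in simp)
 have "\<bar>\<beta> i / Fr ^ 3 - s / Fr ^ 4\<bar> = \<bar>Fr * \<beta> i - s\<bar> / Fr ^ 4"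
 proof -
  have "\<beta> i / Fr ^ 3 - s / Fr ^ 4 = (Fr * \<beta> i - s) / Fr ^ 4" using Fbig by (simp add: field_simps eval_nat_numeral)
  then show ?thesis using Fbig by (simp add: abs_divide)
 qed
 also have "\<dots> \<le> 1 / Fr ^ 4" using ab Fbig by (intro divide_right_mono) auto
 also have "\<dots> \<le> 1 / Fr" using Fbig power_increasing[of 1 4 Fr] by (intro divide_left_mono) auto
 finally have 3: "\<bar>\<beta> i / Fr ^ 3 - s / Fr ^ 4\<bar> \<le> 1 / Fr" .
 have "2 / Fr \<le> 1 / Q"
 proof -
  have "2 * Q \<le> Q\<^sup>2" using Q4 by (simp add: power2_eq_square)
  then show ?thesis using Fbig Q4 by (simp add: field_simps)
 qed
 then show "\<bar>lam i - s / Fr ^ 4\<bar> \<le> eps" using w1 w2 3 eps by (simp add: abs_le_iff)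
qed

text \<open>The other \<open>\<theta> k\<close> are at least \<open>b F\<close> away from
  \<open>\<theta> i\<close>, which lies between 0 and \<open>b\<close>; hence they are at least
  \<open>b F / 2\<close> in absolute value. Inverse iteration contributes \<open>8 n / F\<close>,
  and the rounding at precision \<open>F ^ 4\<close> fits into the remaining
  \<open>n / F\<close>.\<close>

lemma eigenvector_error:
 assumes gap: "\<And>k l. k < l \<Longrightarrow> l < n \<Longrightarrow> \<beta> l - \<beta> k > 1"
  and i: "i < n" and s: "sign_changes (F ^ 8) Bp s n \<le> i" "i < sign_changes (F ^ 8) Bp (s + 1) n"
  and jj: "jj < n" "\<And>j. j < n \<Longrightarrow> adj_mat (shifted (F ^ 8) Bp s n) $$ (j,j) * det (shifted (F ^ 8) Bp s n)
    \<le> max 0 (adj_mat (shifted (F ^ 8) Bp s n) $$ (jj,jj) * det (shifted (F ^ 8) Bp s n))"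
  and rt: "0 \<le> rt" "rt\<^sup>2 \<le> (\<Sum>k<n. (adj_mat (shifted (F ^ 8) Bp s n) $$ (k,jj))\<^sup>2) * F ^ 8"
   "(\<Sum>k<n. (adj_mat (shifted (F ^ 8) Bp s n) $$ (k,jj))\<^sup>2) * F ^ 8 < (rt + 1)\<^sup>2"
 shows "\<exists>\<sigma>\<in>{-1,1}. L2_set (\<lambda>k. real_of_int ((adj_mat (shifted (F ^ 8) Bp s n) $$ (k,jj) * F ^ 8) div rt) / Fr ^ 4 - \<sigma> * u i k) {..<n}
  \<le> 9 * real n / Fr"
proof -
 let ?M = "shifted (F ^ 8) Bp s n"
 let ?Z = "\<lambda>k j. real_of_int (adj_mat ?M $$ (k,j))" and ?d = "real_of_int (det ?M)"
 have b: "F ^ 8 \<ge> 2" using Fbig(1) power_increasing[of 1 8 F] by simp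
 define bb where "bb = real_of_int (F ^ 8)"
 have "0 < F ^ 8" using b by linarith
 then have b0: "bb > 0" unfolding bb_def by (simp only: of_int_0_less_iff)
 define \<theta> where "\<theta> k = (1 - bb * s) + bb * (Fr * \<beta> k)" for k
 have E: "eigsys n (\<lambda>i j. of_bool (i = j) * (1 - bb * s) + bb * real_of_int (Bp i j)) \<theta> u"
  unfolding \<theta>_def by (rule eigsys_affine[OF alpha b0])
 have th: "0 < \<theta> i" "\<theta> i < bb"
  using shift_bracket[OF Bp_sym b alpha i s] unfolding \<theta>_def bb_def by (simp_all add: algebra_simps)
 have gap': "\<bar>\<theta> k\<bar> \<ge> bb * Fr / 2" if k: "k < n" "k \<noteq> i" for k
 proof -
  have "\<bar>\<beta> k - \<beta> i\<bar> \<ge> 1" using gap[of k i] gap[of i k] k i by (cases "k < i") auto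
  then have "bb * Fr * 1 \<le> bb * Fr * \<bar>\<beta> k - \<beta> i\<bar>" using b0 Fbig by (intro mult_left_mono) auto
  also have "\<dots> = \<bar>\<theta> k - \<theta> i\<bar>"
  proof -
   have "\<theta> k - \<theta> i = bb * Fr * (\<beta> k - \<beta> i)" unfolding \<theta>_def by (simp add: algebra_simps)
   then show ?thesis using b0 Fbig(2) by (simp add: abs_mult)
  qed
  finally have "bb * Fr \<le> \<bar>\<theta> k\<bar> + bb" using th by linarith
  moreover have "bb * 2 \<le> bb * Fr" using b0 Fbig by (intro mult_left_mono) auto
  ultimately show ?thesis by linarith
 qed
 have sol: "(\<Sum>l<n. (of_bool (k = l) * (1 - bb * s) + bb * real_of_int (Bp k l)) * ?Z l j) = ?d * of_bool (k = j)" if "j < n" "k < n" for j k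
 proof -
  have "(?M * adj_mat ?M) $$ (k,j) = (det ?M \<cdot>\<^sub>m 1\<^sub>m n) $$ (k,j)" using adj_mat[OF shifted_carrier] by simp
  then have e: "(\<Sum>l<n. ?M $$ (k,l) * adj_mat ?M $$ (l,j)) = det ?M * of_bool (k = j)"
   using adj_mat(1)[OF shifted_carrier, of "F ^ 8" Bp s n] that shifted_carrier[of "F ^ 8" Bp s n]
   by (auto simp: scalar_prod_def atLeast0LessThan)
  have "(\<Sum>l<n. (of_bool (k = l) * (1 - bb * s) + bb * real_of_int (Bp k l)) * ?Z l j) =
    real_of_int (\<Sum>l<n. ?M $$ (k,l) * adj_mat ?M $$ (l,j))"
   unfolding of_int_sum of_int_mult using that by (intro sum.cong refl) (simp add: shifted_def bb_def algebra_simps)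
  then show ?thesis unfolding e by simp
 qed
 have jj': "?Z j j * ?d \<le> max 0 (?Z jj jj * ?d)" if "j < n" for j
 proof -
  have "real_of_int (adj_mat ?M $$ (j,j) * det ?M) \<le> real_of_int (max 0 (adj_mat ?M $$ (jj,jj) * det ?M))"
   using jj(2)[OF that] by (simp only: of_int_le_iff)
  then show ?thesis by (simp add: of_int_max)
 qed
 have dn: "?d \<noteq> 0" using det_shifted_nonzero[OF b] by simp
 have F8: "Fr \<ge> real (8 * n)" "Fr \<ge> 2"
 proof -
  have "8 * real n \<le> Q * Q * Q" using nQ Q4 mult_mono[of 4 Q 4 Q] mult_mono[of 16 "Q * Q" "real n" Q] by simp
  also have "\<dots> = Q ^ 3" by (simp add: eval_nat_numeral)
  also have "\<dots> \<le> Q ^ 9" using Q4 by (intro power_increasing) auto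
  finally show "Fr \<ge> real (8 * n)" using FQ by simp
 qed (use Fbig in simp)
 note inv0 = inverse_iteration[where n = n and c = "1 - bb * s" and b = bb and B = Bp and \<theta> = \<theta> and u = u and i = i and F = Fr and d = "?d" and Z = "?Z" and jj = jj, OF n0 E i F8 b0 th]
 let ?N = "L2_set (\<lambda>k. ?Z k jj) {..<n}"
 have inv: "\<exists>\<sigma>\<in>{-1,1}. L2_set (\<lambda>k. ?Z k jj / ?N - \<sigma> * u i k) {..<n} \<le> 8 * real n / Fr" "?N > 0"
  by (rule inv0; (erule (1) gap' | rule dn | erule (1) sol | rule jj(1) | erule jj'))+
 obtain \<sigma> where sg: "\<sigma> \<in> {-1,1}" "L2_set (\<lambda>k. ?Z k jj / ?N - \<sigma> * u i k) {..<n} \<le> 8 * real n / Fr"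
  using inv(1) by blast
 have "?N\<^sup>2 > 0" using inv(2) by simp
 then have S: "(\<Sum>k<n. (adj_mat ?M $$ (k,jj))\<^sup>2) > 0"
  unfolding L2_set_sum_diff_sq by (simp flip: of_int_power of_int_sum)
 have P2: "F ^ 4 \<ge> 2" using Fbig power_increasing[of 1 4 F] by simp
 have F48: "(F ^ 4)\<^sup>2 = F ^ 8" by (simp add: power_mult[symmetric])
 have rnd: "\<bar>real_of_int ((adj_mat ?M $$ (k,jj) * F ^ 8) div rt) / Fr ^ 4 - ?Z k jj / ?N\<bar> \<le> 3 / Fr ^ 4" if "k < n" for k
  using normalization_rounding[OF P2 S rt(1), unfolded F48, OF rt(2,3) that] by simp
 have "L2_set (\<lambda>k. real_of_int ((adj_mat ?M $$ (k,jj) * F ^ 8) div rt) / Fr ^ 4 - \<sigma> * u i k) {..<n} \<le>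
  L2_set (\<lambda>k. real_of_int ((adj_mat ?M $$ (k,jj) * F ^ 8) div rt) / Fr ^ 4 - ?Z k jj / ?N) {..<n} + L2_set (\<lambda>k. ?Z k jj / ?N - \<sigma> * u i k) {..<n}"
  using L2_set_triangle_ineq[of "\<lambda>k. real_of_int ((adj_mat ?M $$ (k,jj) * F ^ 8) div rt) / Fr ^ 4 - ?Z k jj / ?N" "\<lambda>k. ?Z k jj / ?N - \<sigma> * u i k" "{..<n}"] by simp
 also have "\<dots> \<le> real n * (3 / Fr ^ 4) + 8 * real n / Fr" by (intro add_mono L2_set_le_const rnd sg) auto
 also have "real n * (3 / Fr ^ 4) \<le> real n * (1 / Fr)"
 proof (intro mult_left_mono)
  have "Fr ^ 1 \<le> Fr ^ 3" using Fbig(1) by (intro power_increasing) auto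
  then have "3 \<le> Fr ^ 3" using Fbig(1) unfolding power_one_right by linarith
  then show "3 / Fr ^ 4 \<le> 1 / Fr" using Fbig by (simp add: field_simps eval_nat_numeral)
 qed simp
 finally show ?thesis using sg(1) by (intro bexI[of _ \<sigma>]) (auto simp: field_simps)
qed

text \<open>\<open>A - s / F ^ 4\<close> is \<open>(Bp - s) / F ^ 4\<close> minus the diagonal
  \<open>D / F ^ 3\<close>. On the eigenvector itself \<open>Bp - s\<close> has norm at most 1; its
  full norm, at most \<open>5 F ^ 4 Q\<close>, counts only on the small error
  \<open>e\<close>.\<close>

lemma output_quality:
 fixes s :: int
 assumes i: "i < n" and ab: "\<bar>Fr * \<beta> i - s\<bar> \<le> 1"
  and v: "\<sigma> \<in> {-1,1}" "L2_set (\<lambda>k. v k - \<sigma> * u i k) {..<n} \<le> 9 * real n / Fr"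
 shows "(\<Sum>k<n. v k * v k) \<in> {1 - eps..1 + eps}"
  and "sqrt (\<Sum>k<n. ((\<Sum>l<n. real_of_int (A k l) * v l) - s / Fr ^ 4 * v k)\<^sup>2) \<le> eps"
proof -
 define e where "e k = v k - \<sigma> * u i k" for k
 define \<eta> where "\<eta> = 9 * real n / Fr"
 have eta: "L2_set e {..<n} \<le> \<eta>" using v(2) unfolding e_def \<eta>_def .
 have eta0: "\<eta> \<ge> 0" unfolding \<eta>_def using Fbig by simp
 have s1: "\<bar>\<sigma>\<bar> = 1" using v(1) by auto
 have u1: "L2_set (\<lambda>k. \<sigma> * u i k) {..<n} = 1" unfolding L2_set_scale s1 eigsys_row_norm[OF beta i] by simp
 have etaQ: "\<eta> * Q ^ 6 \<le> 1"
 proof -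
  have "9 * real n * Q ^ 6 \<le> Q ^ 7 * n * Q"
   using mult_right_mono[of 9 "Q * Q" "real n * Q ^ 6"] mult_mono[of 4 Q 4 Q] Q4 by (simp add: eval_nat_numeral algebra_simps)
  then show ?thesis using Fbig unfolding \<eta>_def by (simp add: field_simps)
 qed
 have etas: "\<eta> * (64 * Q) \<le> 1 / Q"
 proof -
  have "64 * Q\<^sup>2 \<le> Q ^ 6"
  proof -
   have "(4::real) ^ 4 \<le> Q ^ 4" using Q4 by (intro power_mono) auto
   then have "64 * Q\<^sup>2 \<le> Q ^ 4 * Q\<^sup>2" using Q4 by (intro mult_right_mono) auto
   then show ?thesis by (simp add: power_add[symmetric])
  qed
  then have "\<eta> * (64 * Q\<^sup>2) \<le> 1" using etaQ eta0 mult_left_mono[of "64 * Q\<^sup>2" "Q ^ 6" \<eta>] by linarith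
  then show ?thesis using Q4 by (simp add: field_simps power2_eq_square)
 qed
 have eQ: "\<eta> \<le> \<eta> * Q" "\<eta> * Q \<le> 1 / (64 * Q)" using eta0 Q4 mult_left_mono[of 1 Q \<eta>] etas by (auto simp: field_simps)
 have Q1: "1 / (64 * Q) \<le> 1 / 64" using Q4 by (simp add: field_simps)
 have eta1: "\<eta> \<le> 1 / 64" using eQ Q1 by linarith
 have vL: "L2_set v {..<n} \<le> 1 + \<eta>"
  using L2_set_triangle_ineq[of "\<lambda>k. \<sigma> * u i k" e "{..<n}"] u1 eta unfolding e_def by simp
 have "L2_set (\<lambda>k. v k - e k) {..<n} \<le> L2_set v {..<n} + L2_set e {..<n}" by (rule L2_set_diff_le)
 then have vl: "1 - \<eta> \<le> L2_set v {..<n}" using u1 eta unfolding e_def by simp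
 have vv: "(\<Sum>k<n. v k * v k) = (L2_set v {..<n})\<^sup>2" unfolding L2_set_sum_diff_sq by (simp add: power2_eq_square)
 have sq: "(1 - \<eta>)\<^sup>2 = 1 - 2 * \<eta> + \<eta> * \<eta>" "(1 + \<eta>)\<^sup>2 = 1 + 2 * \<eta> + \<eta> * \<eta>" by (simp_all add: power2_eq_square algebra_simps)
 have "(1 - \<eta>)\<^sup>2 \<le> (L2_set v {..<n})\<^sup>2" using vl eta1 by (intro power_mono) auto
 moreover have "(L2_set v {..<n})\<^sup>2 \<le> (1 + \<eta>)\<^sup>2" using vL by (intro power_mono) (auto simp: L2_set_nonneg)
 moreover have "\<eta> * \<eta> \<le> \<eta>" using eta0 eta1 by (simp add: mult_left_le)
 ultimately have "1 - 3 * \<eta> \<le> (\<Sum>k<n. v k * v k)" "(\<Sum>k<n. v k * v k) \<le> 1 + 3 * \<eta>"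
  unfolding vv sq using eta0 zero_le_square[of \<eta>] by linarith+
 moreover have "3 * \<eta> \<le> eps" using etas eQ(1) eta0 eps by (simp add: field_simps)
 ultimately show "(\<Sum>k<n. v k * v k) \<in> {1 - eps..1 + eps}" by simp
 define G :: "(nat \<Rightarrow> real) \<Rightarrow> nat \<Rightarrow> real" where "G y k = (\<Sum>l<n. real_of_int (Bp k l) * y l) - real_of_int s * y k" for y k
 \<comment> \<open>\<open>G\<close> is diagonal in the basis \<open>u\<close>, so only the
   eigenvalues whose eigenvectors occur in \<open>y\<close> enter the bound.\<close>
 have Gn: "L2_set (G y) {..<n} \<le> C * L2_set y {..<n}" if C: "C \<ge> 0" "\<And>k. k < n \<Longrightarrow> (\<Sum>l<n. u k l * y l) \<noteq> 0 \<Longrightarrow> \<bar>Fr * \<beta> k - s\<bar> \<le> C" for y C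
 proof -
  have g: "(\<Sum>h<n. u k h * G y h) = (Fr * \<beta> k - s) * (\<Sum>l<n. u k l * y l)" if "k < n" for k
  proof -
   have "(\<Sum>h<n. u k h * G y h) = (\<Sum>h<n. u k h * (\<Sum>l<n. real_of_int (Bp h l) * y l)) - s * (\<Sum>h<n. u k h * y h)"
    unfolding G_def right_diff_distrib sum_subtractf sum_distrib_left by (simp add: mult_ac)
   then show ?thesis using eigsys_apply[OF alpha that] by (simp add: algebra_simps)
  qed
  have "(L2_set (G y) {..<n})\<^sup>2 = (\<Sum>k<n. ((Fr * \<beta> k - s) * (\<Sum>l<n. u k l * y l))\<^sup>2)"
   unfolding L2_set_sum_diff_sq using eigsys_parseval[OF alpha, of "G y" "G y"] g by (simp add: power2_eq_square)
  also have "\<dots> \<le> (\<Sum>k<n. C\<^sup>2 * (\<Sum>l<n. u k l * y l)\<^sup>2)"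
  proof (rule sum_mono)
   fix k assume k: "k \<in> {..<n}"
   show "((Fr * \<beta> k - s) * (\<Sum>l<n. u k l * y l))\<^sup>2 \<le> C\<^sup>2 * (\<Sum>l<n. u k l * y l)\<^sup>2"
   proof (cases "(\<Sum>l<n. u k l * y l) = 0")
    case False
    then have "(Fr * \<beta> k - s)\<^sup>2 \<le> C\<^sup>2" using C(2)[of k] k C(1) by (intro abs_le_square_iff[THEN iffD1]) simp
    then show ?thesis unfolding power_mult_distrib by (intro mult_right_mono) auto
   qed simp
  qed
  also have "\<dots> = (C * L2_set y {..<n})\<^sup>2"
   unfolding power_mult_distrib L2_set_sum_diff_sq sum_distrib_left[symmetric]
   using eigsys_parseval[OF alpha, of y y] by (simp add: power2_eq_square)
  finally show ?thesis by (rule power2_le_imp_le) (use C in \<open>simp add: L2_set_nonneg\<close>)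
 qed
 have sle: "\<bar>real_of_int s\<bar> \<le> 2 * Fr ^ 4 * Q + 1" using ab alpha_le[OF i] by linarith
 have F4: "1 \<le> Fr ^ 4" using Fbig by (simp add: one_le_power)
 have F4Q: "1 \<le> Fr ^ 4 * Q" using F4 Q4 mult_mono[of 1 "Fr ^ 4" 1 Q] by simp
 have Ge: "L2_set (G e) {..<n} \<le> (5 * Fr ^ 4 * Q) * \<eta>"
 proof -
  have "L2_set (G e) {..<n} \<le> (5 * Fr ^ 4 * Q) * L2_set e {..<n}"
  proof (rule Gn)
   fix k assume "k < n"
   then have "\<bar>Fr * \<beta> k - s\<bar> \<le> 2 * Fr ^ 4 * Q + (2 * Fr ^ 4 * Q + 1)" using alpha_le sle by (smt (verit))
   then show "\<bar>Fr * \<beta> k - s\<bar> \<le> 5 * Fr ^ 4 * Q" using F4Q by linarith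
  qed (use F4Q in linarith)
  also have "\<dots> \<le> (5 * Fr ^ 4 * Q) * \<eta>" by (rule mult_left_mono[OF eta]) (use F4Q in linarith)
  finally show ?thesis .
 qed
 have Gu: "L2_set (G (\<lambda>k. \<sigma> * u i k)) {..<n} \<le> 1"
 proof -
  have "L2_set (G (\<lambda>k. \<sigma> * u i k)) {..<n} \<le> 1 * L2_set (\<lambda>k. \<sigma> * u i k) {..<n}"
  proof (rule Gn)
   fix k assume k: "k < n" "(\<Sum>l<n. u k l * (\<sigma> * u i l)) \<noteq> 0"
   have "(\<Sum>l<n. u k l * (\<sigma> * u i l)) = \<sigma> * (\<Sum>l<n. u k l * u i l)" by (simp add: sum_distrib_left mult_ac)
   then have "k = i" using k eigsysD(1)[OF beta k(1) i] by (cases "k = i") auto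
   then show "\<bar>Fr * \<beta> k - s\<bar> \<le> 1" using ab by simp
  qed simp
  then show ?thesis using u1 by simp
 qed
 have Gv: "L2_set (G v) {..<n} \<le> 1 + 5 * Fr ^ 4 * Q * \<eta>"
 proof -
  have "G v = (\<lambda>k. G (\<lambda>k. \<sigma> * u i k) k + G e k)"
   unfolding G_def e_def by (rule ext) (simp add: algebra_simps sum.distrib sum_subtractf)
  then have "L2_set (G v) {..<n} \<le> L2_set (G (\<lambda>k. \<sigma> * u i k)) {..<n} + L2_set (G e) {..<n}"
   by (metis L2_set_triangle_ineq)
  then show ?thesis using Gu Ge by simp
 qed
 have Dv: "L2_set (\<lambda>k. D k / Fr ^ 3 * v k) {..<n} \<le> 1 / Fr * L2_set v {..<n}"
 proof -
  have "L2_set (\<lambda>k. D k / Fr ^ 3 * v k) {..<n} \<le> L2_set (\<lambda>k. 1 / Fr * \<bar>v k\<bar>) {..<n}"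
   unfolding L2_set_def
  proof (intro real_sqrt_le_mono sum_mono)
   fix k assume k: "k \<in> {..<n}"
   have "real_of_int (D k) \<le> Fr ^ 2" using D[of k] k by (simp flip: of_int_power)
   then have "D k / Fr ^ 3 \<le> 1 / Fr" using Fbig by (simp add: field_simps eval_nat_numeral)
   moreover have "0 \<le> D k / Fr ^ 3" using D[of k] k Fbig by simp
   ultimately have "(D k / Fr ^ 3 * \<bar>v k\<bar>)\<^sup>2 \<le> (1 / Fr * \<bar>v k\<bar>)\<^sup>2" by (intro power_mono mult_right_mono mult_nonneg_nonneg) auto
   then show "(D k / Fr ^ 3 * v k)\<^sup>2 \<le> (1 / Fr * \<bar>v k\<bar>)\<^sup>2" by (simp only: power_mult_distrib power2_abs)
  qed
  also have "\<dots> = 1 / Fr * L2_set v {..<n}" unfolding L2_set_scale using Fbig by (simp add: L2_set_def)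
  finally show ?thesis .
 qed
 have "sqrt (\<Sum>k<n. ((\<Sum>l<n. real_of_int (A k l) * v l) - s / Fr ^ 4 * v k)\<^sup>2) =
   L2_set (\<lambda>k. 1 / Fr ^ 4 * G v k - D k / Fr ^ 3 * v k) {..<n}"
  unfolding L2_set_def
 proof (intro arg_cong[where f = sqrt] sum.cong refl)
  fix k assume k: "k \<in> {..<n}"
  have "(\<Sum>l<n. real_of_int (Bp k l) * v l) = Fr ^ 4 * (\<Sum>l<n. real_of_int (A k l) * v l) + (\<Sum>l<n. of_bool (k = l) * (Fr * D k * v l))"
   unfolding Bp_def sum_distrib_left sum.distrib[symmetric] by (intro sum.cong) (auto simp: algebra_simps)
  also have "(\<Sum>l<n. of_bool (k = l) * (Fr * D k * v l)) = Fr * D k * v k" using k by (intro sum_of_bool_delta) simp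
  finally have "1 / Fr ^ 4 * G v k - D k / Fr ^ 3 * v k = (\<Sum>l<n. real_of_int (A k l) * v l) - s / Fr ^ 4 * v k"
   unfolding G_def using Fbig by (simp add: field_simps eval_nat_numeral)
  then show "((\<Sum>l<n. real_of_int (A k l) * v l) - s / Fr ^ 4 * v k)\<^sup>2 = (1 / Fr ^ 4 * G v k - D k / Fr ^ 3 * v k)\<^sup>2" by simp
 qed
 also have "\<dots> \<le> 1 / Fr ^ 4 * L2_set (G v) {..<n} + 1 / Fr * L2_set v {..<n}"
  using L2_set_diff_le[of "\<lambda>k. 1 / Fr ^ 4 * G v k" "\<lambda>k. D k / Fr ^ 3 * v k" "{..<n}"] Dv Fbig
  unfolding L2_set_scale by simp
 also have "\<dots> \<le> 1 / Fr ^ 4 * (1 + 5 * Fr ^ 4 * Q * \<eta>) + 1 / Fr * (1 + \<eta>)"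
  using Gv vL Fbig by (intro add_mono mult_left_mono) auto
 finally have up: "sqrt (\<Sum>k<n. ((\<Sum>l<n. real_of_int (A k l) * v l) - s / Fr ^ 4 * v k)\<^sup>2) \<le>
  1 / Fr ^ 4 * (1 + 5 * Fr ^ 4 * Q * \<eta>) + 1 / Fr * (1 + \<eta>)" .
 have "1 / Fr ^ 4 * (1 + 5 * Fr ^ 4 * Q * \<eta>) = 1 / Fr ^ 4 + 5 * Q * \<eta>" using Fbig(2) by (simp add: field_simps)
 moreover have "1 / Fr ^ 4 \<le> 1 / Fr"
 proof (rule divide_left_mono)
  have "Fr ^ 1 \<le> Fr ^ 4" using Fbig(1) by (intro power_increasing) auto
  then show "Fr \<le> Fr ^ 4" by simp
 qed (use Fbig(2) in auto)
 moreover have "1 / Fr \<le> \<eta>" unfolding \<eta>_def using n0 Fbig(2) by (intro divide_right_mono) auto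
 ultimately have "sqrt (\<Sum>k<n. ((\<Sum>l<n. real_of_int (A k l) * v l) - s / Fr ^ 4 * v k)\<^sup>2) \<le> \<eta> + 5 * Q * \<eta> + 1 / Fr * (1 + \<eta>)"
  using up by linarith
 also have "1 / Fr * (1 + \<eta>) \<le> \<eta> * 2"
 proof -
  have "1 / Fr \<le> \<eta>" unfolding \<eta>_def using n0 Fbig by (intro divide_right_mono) auto
  then show ?thesis using eta0 eta1 Fbig by (intro mult_mono) auto
 qed
 also have "\<eta> + 5 * Q * \<eta> + \<eta> * 2 \<le> \<eta> * (64 * Q)"
  using eQ(1) eta0 Q4 by (simp add: algebra_simps)
 finally show "sqrt (\<Sum>k<n. ((\<Sum>l<n. real_of_int (A k l) * v l) - s / Fr ^ 4 * v k)\<^sup>2) \<le> eps" using etas eps by linarith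
qed

text \<open>Both vectors are near members, up to sign, of one orthonormal basis; the scalar product
  is therefore at most \<open>2 \<eta> + \<eta> ^ 2\<close> without the two vectors ever being
  compared.\<close>

lemma output_orthogonal:
 assumes ij: "i < n" "j < n" "i \<noteq> j"
  and v: "\<sigma> \<in> {-1,1}" "L2_set (\<lambda>k. v k - \<sigma> * u i k) {..<n} \<le> 9 * real n / Fr"
  and w: "\<tau> \<in> {-1,1}" "L2_set (\<lambda>k. w k - \<tau> * u j k) {..<n} \<le> 9 * real n / Fr"
 shows "\<bar>\<Sum>k<n. v k * w k\<bar> \<le> eps"
proof -
 define \<eta> where "\<eta> = 9 * real n / Fr"
 define e where "e k = v k - \<sigma> * u i k" for k
 define f where "f k = w k - \<tau> * u j k" for k
 have ef: "L2_set e {..<n} \<le> \<eta>" "L2_set f {..<n} \<le> \<eta>" using v(2) w(2) unfolding e_def f_def \<eta>_def by auto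
 have eta0: "\<eta> \<ge> 0" unfolding \<eta>_def using Fbig by simp
 have s1: "\<bar>\<sigma>\<bar> = 1" "\<bar>\<tau>\<bar> = 1" using v(1) w(1) by auto
 have u1: "L2_set (\<lambda>k. \<sigma> * u i k) {..<n} = 1" "L2_set (\<lambda>k. \<tau> * u j k) {..<n} = 1"
  unfolding L2_set_scale s1 eigsys_row_norm[OF beta ij(1)] eigsys_row_norm[OF beta ij(2)] by simp_all
 have o: "(\<Sum>k<n. (\<sigma> * u i k) * (\<tau> * u j k)) = 0"
 proof -
  have "(\<Sum>k<n. (\<sigma> * u i k) * (\<tau> * u j k)) = \<sigma> * \<tau> * (\<Sum>k<n. u i k * u j k)" by (simp add: sum_distrib_left mult_ac)
  then show ?thesis using eigsysD(1)[OF beta ij(1,2)] ij(3) by simp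
 qed
 have "(\<Sum>k<n. v k * w k) = (\<Sum>k<n. (\<sigma> * u i k) * (\<tau> * u j k)) + (\<Sum>k<n. (\<sigma> * u i k) * f k) + (\<Sum>k<n. e k * (\<tau> * u j k)) + (\<Sum>k<n. e k * f k)"
  unfolding sum.distrib[symmetric] e_def f_def by (intro sum.cong refl) (simp add: algebra_simps)
 then have "\<bar>\<Sum>k<n. v k * w k\<bar> \<le> \<bar>\<Sum>k<n. (\<sigma> * u i k) * f k\<bar> + \<bar>\<Sum>k<n. e k * (\<tau> * u j k)\<bar> + \<bar>\<Sum>k<n. e k * f k\<bar>"
  unfolding o by linarith
 also have "\<dots> \<le> 1 * \<eta> + \<eta> * 1 + \<eta> * \<eta>"
 proof (intro add_mono)
  show "\<bar>\<Sum>k<n. (\<sigma> * u i k) * f k\<bar> \<le> 1 * \<eta>" using abs_sum_mult_le_L2[of "\<lambda>k. \<sigma> * u i k" f n] ef u1 by simp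
  show "\<bar>\<Sum>k<n. e k * (\<tau> * u j k)\<bar> \<le> \<eta> * 1" using abs_sum_mult_le_L2[of e "\<lambda>k. \<tau> * u j k" n] ef u1 by simp
  show "\<bar>\<Sum>k<n. e k * f k\<bar> \<le> \<eta> * \<eta>"
   by (rule order_trans[OF abs_sum_mult_le_L2 mult_mono[OF ef]]) (auto simp: L2_set_nonneg eta0)
 qed
 also have "\<dots> \<le> eps"
 proof -
  have "27 * (real n * Q) \<le> Q ^ 7 * n * Q"
  proof -
   have "(4::real) ^ 7 \<le> Q ^ 7" using Q4 by (intro power_mono) auto
   then have "27 * (real n * Q) \<le> Q ^ 7 * (real n * Q)" using Q4 by (intro mult_right_mono) auto
   then show ?thesis by (simp add: mult_ac)
  qed
  then have "27 * (real n * Q) \<le> Fr" using Fbig(4) by linarith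
  then have e3: "3 * \<eta> \<le> 1 / Q" unfolding \<eta>_def using Fbig(2) Q4 by (simp add: field_simps)
  moreover have "1 / Q \<le> 1" using Q4 by (simp add: field_simps)
  ultimately have "\<eta> \<le> 1" using eta0 by linarith
  then have "\<eta> * \<eta> \<le> \<eta>" using eta0 by (simp add: mult_left_le)
  then show ?thesis using e3 eps by linarith
 qed
 finally show ?thesis .
qed

end

section \<open>Structured programs and their compilation\<close>

text \<open>\<open>Loop K a c\<close> repeats \<open>c\<close> while cell \<open>a\<close> is
  positive. The bound \<open>K\<close> is an annotation for the cost analysis that never reaches the
  machine code, so it may depend on the input although the program does not.\<close>

datatype cmd =
  Ins ram_instr
 | Seq cmd cmd (infixr ";;" 60)
 | Cond nat cmd cmd
 | Loop nat nat cmd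

fun clen :: "cmd \<Rightarrow> nat" where
 "clen (Ins I) = 1"
| "clen (c1 ;; c2) = clen c1 + clen c2"
| "clen (Cond a c1 c2) = clen c1 + clen c2 + 2"
| "clen (Loop K a c) = clen c + 3"

text \<open>\<open>q\<close> is the absolute address of the code, as jump targets are absolute. The
  machine has conditional jumps only; \<open>JumpPos 0\<close> is unconditional because cell 0 holds
  1 throughout. The else branch precedes the other one, since the jump is taken on a positive
  cell.\<close>

fun comp :: "nat \<Rightarrow> cmd \<Rightarrow> ram_program" where
 "comp q (Ins I) = [I]"
| "comp q (c1 ;; c2) = comp q c1 @ comp (q + clen c1) c2"
| "comp q (Cond a c1 c2) = [JumpPos a (q + 2 + clen c2)] @ comp (q + 1) c2 @
  [JumpPos 0 (q + 2 + clen c2 + clen c1)] @ comp (q + 2 + clen c2) c1"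
| "comp q (Loop K a c) = [JumpPos a (q + 2), JumpPos 0 (q + 3 + clen c)] @ comp (q + 2) c @ [JumpPos 0 q]"

lemma length_comp [simp]: "length (comp q c) = clen c"
 by (induction q c rule: comp.induct) auto

definition code_at :: "ram_program \<Rightarrow> nat \<Rightarrow> ram_program \<Rightarrow> bool" where
 "code_at P q is \<longleftrightarrow> (\<forall>i < length is. q + i < length P \<and> P ! (q + i) = is ! i)"

lemma code_at_append: "code_at P q (xs @ ys) \<longleftrightarrow> code_at P q xs \<and> code_at P (q + length xs) ys"
proof -
 have "(\<forall>i < length xs + length ys. R i) \<longleftrightarrow> (\<forall>i < length xs. R i) \<and> (\<forall>i < length ys. R (length xs + i))" for R
 proof (intro iffI conjI allI impI)
  fix i assume h: "(\<forall>i < length xs. R i) \<and> (\<forall>i < length ys. R (length xs + i))" and i: "i < length xs + length ys"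
  show "R i"
  proof (cases "i < length xs")
   case False
   then have "R (length xs + (i - length xs))" using h i by (metis add_less_cancel_left le_add_diff_inverse linorder_not_less)
   then show ?thesis using False by simp
  qed (use h in auto)
 qed auto
 then show ?thesis unfolding code_at_def by (simp add: nth_append add.assoc)
qed

lemma code_at_Cons: "code_at P q (I # is) \<longleftrightarrow> q < length P \<and> P ! q = I \<and> code_at P (Suc q) is"
 using code_at_append[of P q "[I]" "is"] by (simp add: code_at_def)

text \<open>Unlike \<open>ram_run\<close>, this starts anywhere and peels off the first step, which
  suits induction along the program text.\<close>

fun runk :: "ram_program \<Rightarrow> (nat \<Rightarrow> int) \<Rightarrow> nat \<Rightarrow> ram_config \<Rightarrow> ram_config pmf" where
 "runk P x 0 \<sigma> = return_pmf \<sigma>"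
| "runk P x (Suc t) \<sigma> = bind_pmf (ram_step P x \<sigma>) (runk P x t)"

lemma runk_add: "runk P x (s + t) \<sigma> = bind_pmf (runk P x s \<sigma>) (runk P x t)"
proof (induction s arbitrary: \<sigma>)
 case (Suc s)
 have "runk P x (s + t) = (\<lambda>\<sigma>. bind_pmf (runk P x s \<sigma>) (runk P x t))" using Suc by blast
 then show ?case by (simp add: bind_assoc_pmf)
qed (simp add: bind_return_pmf)

lemma ram_run_eq_runk: "ram_run P x t = runk P x t ram_init"
proof (induction t)
 case (Suc t)
 have "runk P x (t + 1) ram_init = bind_pmf (runk P x t ram_init) (runk P x 1)" by (rule runk_add)
 moreover have "runk P x 1 = ram_step P x"
 proof
  fix \<sigma>
  have "runk P x 0 = return_pmf" by (rule ext) simp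
  then show "runk P x 1 \<sigma> = ram_step P x \<sigma>" by (simp add: bind_return_pmf')
 qed
 ultimately show ?case using Suc by simp
qed simp

lemma runk_halted: "ram_halted P \<sigma> \<Longrightarrow> runk P x t \<sigma> = return_pmf \<sigma>"
 by (induction t) (auto simp: ram_step_def ram_step_coin_def map_pmf_const bind_return_pmf)

text \<open>The law after \<open>t\<close> steps is a point mass, so this describes stretches of the
  run on which the coins have no effect.\<close>

definition reach :: "ram_program \<Rightarrow> (nat \<Rightarrow> int) \<Rightarrow> ram_config \<Rightarrow> ram_config \<Rightarrow> bool" where
 "reach P x \<sigma> \<sigma>' \<longleftrightarrow> (\<exists>t. runk P x t \<sigma> = return_pmf \<sigma>')"

lemma reach_refl: "reach P x \<sigma> \<sigma>"
 unfolding reach_def by (rule exI[of _ 0]) simp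

lemma reach_trans: "reach P x \<sigma> \<sigma>' \<Longrightarrow> reach P x \<sigma>' \<sigma>'' \<Longrightarrow> reach P x \<sigma> \<sigma>''"
 unfolding reach_def by (metis runk_add bind_return_pmf)

lemma reach_step: "(\<And>coin. ram_step_coin P x coin \<sigma> = \<sigma>') \<Longrightarrow> reach P x \<sigma> \<sigma>'"
 unfolding reach_def by (rule exI[of _ 1]) (simp add: ram_step_def map_pmf_const bind_return_pmf)

text \<open>The run from a configuration halts after drawing \<open>M\<close> relevant coins, which form the binary
 digits of a number below \<open>2 ^ M\<close>.\<close>

definition ends :: "ram_program \<Rightarrow> (nat \<Rightarrow> int) \<Rightarrow> ram_config \<Rightarrow> nat \<Rightarrow> (nat \<Rightarrow> ram_config \<Rightarrow> bool) \<Rightarrow> bool" where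
 "ends P x \<sigma> M \<Phi> \<longleftrightarrow> (\<exists>t0 g. (\<forall>t\<ge>t0. runk P x t \<sigma> = map_pmf g (pmf_of_set {..<2 ^ M})) \<and> (\<forall>z<2 ^ M. \<Phi> z (g z)))"

lemma ends_halted: "ram_halted P \<sigma> \<Longrightarrow> \<Phi> 0 \<sigma> \<Longrightarrow> ends P x \<sigma> 0 \<Phi>"
 unfolding ends_def
 by (intro exI[of _ 0] exI[of _ "\<lambda>_. \<sigma>"]) (auto simp: runk_halted map_pmf_const)

lemma ends_reach:
 assumes "reach P x \<sigma> \<sigma>'" and "ends P x \<sigma>' M \<Phi>"
 shows "ends P x \<sigma> M \<Phi>"
proof -
 obtain s where s: "runk P x s \<sigma> = return_pmf \<sigma>'" using assms(1) unfolding reach_def by blast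
 obtain t0 g where g: "\<And>t. t \<ge> t0 \<Longrightarrow> runk P x t \<sigma>' = map_pmf g (pmf_of_set {..<2 ^ M})" "\<forall>z<2 ^ M. \<Phi> z (g z)"
  using assms(2) unfolding ends_def by blast
 have "runk P x t \<sigma> = map_pmf g (pmf_of_set {..<2 ^ M})" if "t \<ge> s + t0" for t
 proof -
  have "runk P x (s + (t - s)) \<sigma> = runk P x (t - s) \<sigma>'" unfolding runk_add s by (simp add: bind_return_pmf)
  then show ?thesis using g(1)[of "t - s"] that by simp
 qed
 then show ?thesis unfolding ends_def using g(2) by blast
qed

text \<open>The halves below and above \<open>2 ^ M\<close> are the two outcomes of the coin, each
  of weight 1/2 and uniform in itself.\<close>

lemma pmf_of_set_double:
 "bind_pmf (bernoulli_pmf (1/2)) (\<lambda>b. map_pmf (\<lambda>z. z + of_bool b * 2 ^ M) (pmf_of_set {..<2 ^ M})) =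
  (pmf_of_set {..<2 ^ Suc M} :: nat pmf)"
proof (rule pmf_eqI)
 fix i :: nat
 have "0 \<in> {..<(2::nat) ^ M}" "0 \<in> {..<(2::nat) ^ Suc M}" by auto
 then have ne: "{..<(2::nat) ^ M} \<noteq> {}" "{..<(2::nat) ^ Suc M} \<noteq> {}" by blast+
 have p0: "pmf (map_pmf (\<lambda>z. z + 0) (pmf_of_set {..<2 ^ M})) i = indicator {..<2 ^ M} i / 2 ^ M"
  by (simp add: pmf_of_set[OF ne(1)])
 have p1: "pmf (map_pmf (\<lambda>z. z + 2 ^ M) (pmf_of_set {..<2 ^ M})) i = indicator {2 ^ M..<2 ^ Suc M} i / 2 ^ M"
 proof -
  have "map_pmf (\<lambda>z::nat. z + 2 ^ M) (pmf_of_set {..<2 ^ M}) = pmf_of_set ((\<lambda>z. z + 2 ^ M) ` {..<2 ^ M})"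
   by (rule map_pmf_of_set_inj) (use ne in \<open>auto simp: inj_on_def\<close>)
  also have "(\<lambda>z::nat. z + 2 ^ M) ` {..<2 ^ M} = {2 ^ M..<2 ^ Suc M}"
   using image_add_atLeastLessThan'[of "2 ^ M" 0 "2 ^ M :: nat"] by (simp add: atLeast0LessThan mult_2)
  finally have e: "map_pmf (\<lambda>z::nat. z + 2 ^ M) (pmf_of_set {..<2 ^ M}) = pmf_of_set {2 ^ M..<2 ^ Suc M}" .
  have "{2 ^ M..<2 ^ Suc M :: nat} \<noteq> {}" by simp
  then show ?thesis unfolding e by (subst pmf_of_set) auto
 qed
 have "pmf (bind_pmf (bernoulli_pmf (1/2)) (\<lambda>b. map_pmf (\<lambda>z. z + of_bool b * 2 ^ M) (pmf_of_set {..<2 ^ M}))) i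
  = 1 / 2 * (indicator {2 ^ M..<2 ^ Suc M} i / 2 ^ M) + 1 / 2 * (indicator {..<2 ^ M} i / 2 ^ M)"
  using p0 p1 by (simp add: pmf_bind integral_measure_pmf[where A = UNIV] UNIV_bool)
 also have "\<dots> = indicator {..<2 ^ Suc M} i / 2 ^ Suc M" by (auto simp: indicator_def)
 also have "\<dots> = pmf (pmf_of_set {..<2 ^ Suc M}) i" by (subst pmf_of_set[OF ne(2)]) auto
 finally show "pmf (bind_pmf (bernoulli_pmf (1/2)) (\<lambda>b. map_pmf (\<lambda>z. z + of_bool b * 2 ^ M) (pmf_of_set {..<2 ^ M}))) i
  = pmf (pmf_of_set {..<2 ^ Suc M}) i" .
qed

text \<open>The coin tossed first becomes the most significant bit, which matches a program that
  doubles its number before it adds the next coin.\<close>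

lemma ends_flip:
 assumes "\<And>b. ends P x (ram_step_coin P x b \<sigma>) M (\<lambda>z. \<Phi> (z + of_bool b * 2 ^ M))"
 shows "ends P x \<sigma> (Suc M) \<Phi>"
proof -
 obtain t0 g where g: "\<And>b t. t \<ge> t0 b \<Longrightarrow> runk P x t (ram_step_coin P x b \<sigma>) = map_pmf (g b) (pmf_of_set {..<2 ^ M})"
   "\<And>b z. z < 2 ^ M \<Longrightarrow> \<Phi> (z + of_bool b * 2 ^ M) (g b z)"
  using assms unfolding ends_def by metis
 define h where "h z = (if z < 2 ^ M then g False z else g True (z - 2 ^ M))" for z
 have "runk P x t \<sigma> = map_pmf h (pmf_of_set {..<2 ^ Suc M})" if t: "t \<ge> Suc (max (t0 True) (t0 False))" for t
 proof -
  obtain t' where t': "t = Suc t'" using t by (cases t) auto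
  have "0 \<in> {..<(2::nat) ^ M}" by simp
  then have ne: "{..<(2::nat) ^ M} \<noteq> {}" by blast
  have "runk P x t \<sigma> = bind_pmf (bernoulli_pmf (1/2)) (\<lambda>b. runk P x t' (ram_step_coin P x b \<sigma>))"
   unfolding t' by (simp add: ram_step_def bind_map_pmf)
  also have "\<dots> = bind_pmf (bernoulli_pmf (1/2)) (\<lambda>b. map_pmf h (map_pmf (\<lambda>z. z + of_bool b * 2 ^ M) (pmf_of_set {..<2 ^ M})))"
  proof (intro bind_pmf_cong refl)
   fix b
   have "t' \<ge> t0 b" using t t' by (cases b) auto
   then have "runk P x t' (ram_step_coin P x b \<sigma>) = map_pmf (g b) (pmf_of_set {..<2 ^ M})" by (rule g(1))
   also have "\<dots> = map_pmf h (map_pmf (\<lambda>z. z + of_bool b * 2 ^ M) (pmf_of_set {..<2 ^ M}))"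
    unfolding pmf.map_comp by (intro pmf.map_cong refl) (use ne in \<open>auto simp: h_def\<close>)
   finally show "runk P x t' (ram_step_coin P x b \<sigma>) = \<dots>" .
  qed
  also have "\<dots> = map_pmf h (pmf_of_set {..<2 ^ Suc M})"
   unfolding map_bind_pmf[symmetric] pmf_of_set_double ..
  finally show ?thesis .
 qed
 moreover have "\<Phi> z (h z)" if "z < 2 ^ Suc M" for z
  using g(2)[of z False] g(2)[of "z - 2 ^ M" True] that unfolding h_def by auto
 ultimately show ?thesis unfolding ends_def by blast
qed

fun plain :: "ram_instr \<Rightarrow> bool" where
 "plain (Flip d) = False"
| "plain (JumpPos a l) = False"
| "plain _ = True"

lemma bits_le: "\<bar>v\<bar> < 2 ^ b \<Longrightarrow> bits v \<le> b + 1"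
proof -
 assume v: "\<bar>v\<bar> < 2 ^ b"
 have "nat \<bar>v\<bar> < 2 ^ b" using v by (simp add: nat_less_iff)
 then show ?thesis unfolding bits_def by (simp add: floorlog_le_iff)
qed

lemma bits_one: "bits 1 = 2"
 unfolding bits_def by (simp add: floorlog_def)

section \<open>Cost semantics and weakest preconditions\<close>

text \<open>Each cell \<open>i\<close> has a fixed width \<open>bnd i\<close>. Under this discipline
  the cost of an instruction is bounded by its text and the space by the widths, so neither needs
  the values computed. \<open>wA\<close> bounds the widths of the cells reached by
  \<open>Load\<close>, whose address is known only at run time.\<close>

locale bounded_ram =
 fixes x :: "nat \<Rightarrow> int" and bnd :: "nat \<Rightarrow> nat" and wA xb MB :: nat
 assumes xb: "bits (x i) \<le> xb"
  and MB: "(\<And>i. \<bar>m i\<bar> < 2 ^ bnd i) \<Longrightarrow> mem_bits m \<le> MB"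
begin

definition fits :: "(nat \<Rightarrow> int) \<Rightarrow> bool" where
 "fits m \<longleftrightarrow> (\<forall>i. \<bar>m i\<bar> < 2 ^ bnd i)"

fun icost :: "ram_instr \<Rightarrow> nat" where
 "icost (Const d k) = bits k"
| "icost (Add d a b) = (bnd a + 1) + (bnd b + 1)"
| "icost (Sub d a b) = (bnd a + 1) + (bnd b + 1)"
| "icost (Mul d a b) = (bnd a + 1) * (bnd b + 1)"
| "icost (Div d a b) = (bnd a + 1) * (bnd b + 1)"
| "icost (Load d a) = (bnd a + 1) + (wA + 1)"
| "icost (Store a s) = (bnd a + 1) + (bnd s + 1)"
| "icost (Input d a) = (bnd a + 1) + xb"
| "icost (Output a s) = (bnd a + 1) + (bnd s + 1)"
| "icost (Flip d) = 1"
| "icost (JumpPos a l) = bnd a + 1"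

fun side :: "ram_instr \<Rightarrow> (nat \<Rightarrow> int) \<Rightarrow> (nat \<Rightarrow> int option) \<Rightarrow> bool" where
 "side (Load d a) m w = (bnd (nat (m a)) \<le> wA)"
| "side (Output a s) m w = (w (nat (m a)) = None)"
| "side _ m w = True"

text \<open>Every memory on the way has to respect the widths and to keep cell 0. The coin argument
  is a dummy, as \<open>plain\<close> excludes \<open>Flip\<close>; coins are tossed only in the
  loop treated by \<open>ends_flip_loop\<close>. The annotation \<open>K\<close> is consumed as
  fuel.\<close>

inductive exec :: "cmd \<Rightarrow> (nat \<Rightarrow> int) \<times> (nat \<Rightarrow> int option) \<Rightarrow> (nat \<Rightarrow> int) \<times> (nat \<Rightarrow> int option) \<Rightarrow> bool" where
 exec_Ins: "plain I \<Longrightarrow> side I m w \<Longrightarrow> fits (instr_mem I x False m) \<Longrightarrow> instr_mem I x False m 0 = m 0 \<Longrightarrow>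
  exec (Ins I) (m, w) (instr_mem I x False m, instr_outp I m w)"
| exec_Seq: "exec c1 s s' \<Longrightarrow> exec c2 s' s'' \<Longrightarrow> exec (c1 ;; c2) s s''"
| exec_CondT: "m a > 0 \<Longrightarrow> exec c1 (m, w) s' \<Longrightarrow> exec (Cond a c1 c2) (m, w) s'"
| exec_CondF: "\<not> m a > 0 \<Longrightarrow> exec c2 (m, w) s' \<Longrightarrow> exec (Cond a c1 c2) (m, w) s'"
| exec_LoopF: "\<not> m a > 0 \<Longrightarrow> exec (Loop K a c) (m, w) (m, w)"
| exec_LoopT: "m a > 0 \<Longrightarrow> exec c (m, w) s' \<Longrightarrow> exec (Loop K a c) s' s'' \<Longrightarrow> exec (Loop (Suc K) a c) (m, w) s''"

text \<open>The constant 2 for \<open>Cond\<close> and \<open>Loop\<close> is \<open>bits 1\<close>,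
  the price of an unconditional jump on cell 0. Both branches of a conditional are charged.\<close>

fun tbound :: "cmd \<Rightarrow> nat" where
 "tbound (Ins I) = icost I"
| "tbound (c1 ;; c2) = tbound c1 + tbound c2"
| "tbound (Cond a c1 c2) = (bnd a + 1) + tbound c1 + tbound c2 + 2"
| "tbound (Loop K a c) = K * ((bnd a + 1) + tbound c + 2) + (bnd a + 1) + 2"

lemma icost_bound:
 assumes "fits m" "plain I" "side I m w"
 shows "instr_cost I x m \<le> icost I"
proof -
 have b: "bits (m i) \<le> bnd i + 1" for i using assms(1) unfolding fits_def by (blast intro: bits_le)
 have l: "bits (m i) \<le> wA + 1" if "bnd i \<le> wA" for i using b[of i] that by linarith
 show ?thesis using assms(2,3)
  by (cases I) (auto intro!: add_mono mult_mono b l xb simp del: One_nat_def add_Suc_right add_2_eq_Suc')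
qed

lemma exec_inv: "exec c s s' \<Longrightarrow> fits (fst s) \<Longrightarrow> fits (fst s') \<and> fst s' 0 = fst s 0"
 by (induction rule: exec.induct) auto

definition steps_within :: "ram_config \<Rightarrow> nat \<Rightarrow> ram_config \<Rightarrow> bool" where
 "steps_within \<sigma> T \<sigma>' \<longleftrightarrow> bit_ops \<sigma>' \<le> bit_ops \<sigma> + T \<and> peak_space \<sigma>' \<le> max (peak_space \<sigma>) MB"

lemma steps_within_trans: "steps_within \<sigma> T \<sigma>' \<Longrightarrow> steps_within \<sigma>' T' \<sigma>'' \<Longrightarrow> steps_within \<sigma> (T + T') \<sigma>''"
 unfolding steps_within_def by auto

lemma steps_within_mono: "steps_within \<sigma> T \<sigma>' \<Longrightarrow> T \<le> T' \<Longrightarrow> steps_within \<sigma> T' \<sigma>'"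
 unfolding steps_within_def by auto

lemma reach_jump:
 assumes "pc \<sigma> < length P" "P ! pc \<sigma> = JumpPos a l" "fits (mem \<sigma>)"
 shows "\<exists>\<sigma>'. reach P x \<sigma> \<sigma>' \<and> steps_within \<sigma> (bits (mem \<sigma> a)) \<sigma>' \<and> pc \<sigma>' = (if mem \<sigma> a > 0 then l else Suc (pc \<sigma>)) \<and>
  mem \<sigma>' = mem \<sigma> \<and> outp \<sigma>' = outp \<sigma>"
proof -
 have "mem_bits (mem \<sigma>) \<le> MB" using MB assms(3) unfolding fits_def by blast
 then show ?thesis
  by (intro exI[of _ "ram_step_coin P x False \<sigma>"] conjI reach_step)
   (use assms in \<open>auto simp: ram_step_coin_def ram_halted_def steps_within_def Let_def\<close>)
qed

text \<open>A simulation by induction on the execution. The test of a loop, its body, the jump back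
  and the remaining iterations are separate stretches, whose costs add up to the bound for one more
  iteration.\<close>

lemma exec_compiled:
 assumes "exec c s s'" and "fits (fst s)" and "fst s 0 = 1" and "code_at P q (comp q c)"
  and "pc \<sigma> = q" and "mem \<sigma> = fst s" and "outp \<sigma> = snd s"
 shows "\<exists>\<sigma>'. reach P x \<sigma> \<sigma>' \<and> steps_within \<sigma> (tbound c) \<sigma>' \<and> pc \<sigma>' = q + clen c \<and> mem \<sigma>' = fst s' \<and> outp \<sigma>' = snd s'"
 using assms
proof (induction arbitrary: q \<sigma> rule: exec.induct)
 case (exec_Ins I m w)
 let ?\<sigma> = "ram_step_coin P x False \<sigma>"
 have h: "\<not> ram_halted P \<sigma>" "P ! pc \<sigma> = I"
  using exec_Ins.prems unfolding ram_halted_def by (auto simp: code_at_Cons)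
 have cn: "instr_mem I x True m = instr_mem I x False m" using exec_Ins(1) by (cases I) auto
 have mb: "mem_bits (instr_mem I x False m) \<le> MB" using MB exec_Ins(3) unfolding fits_def by blast
 have cost: "instr_cost I x m \<le> icost I" using icost_bound[of m I w] exec_Ins by simp
 have pcI: "instr_pc P I m w q = Suc q" using exec_Ins(1,2) by (cases I) auto
 have "ram_step_coin P x coin \<sigma> = ?\<sigma>" for coin
  using h exec_Ins.prems by (cases coin) (simp_all add: ram_step_coin_def cn Let_def)
 then have "reach P x \<sigma> ?\<sigma>" by (rule reach_step)
 then show ?case
  by (intro exI[of _ ?\<sigma>]) (use h exec_Ins.prems mb cost pcI in
   \<open>auto simp: ram_step_coin_def Let_def steps_within_def\<close>)
next
 case (exec_Seq c1 s s' c2 s'')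
 have code: "code_at P q (comp q c1)" "code_at P (q + clen c1) (comp (q + clen c1) c2)"
  using exec_Seq.prems by (auto simp: code_at_append)
 obtain \<sigma>' where 1: "reach P x \<sigma> \<sigma>'" "steps_within \<sigma> (tbound c1) \<sigma>'" "pc \<sigma>' = q + clen c1" "mem \<sigma>' = fst s'" "outp \<sigma>' = snd s'"
  using exec_Seq.IH(1)[OF exec_Seq.prems(1,2) code(1)] exec_Seq.prems by blast
 have inv: "fits (fst s')" "fst s' 0 = 1" using exec_inv[OF exec_Seq(1)] exec_Seq.prems by auto
 obtain \<sigma>'' where 2: "reach P x \<sigma>' \<sigma>''" "steps_within \<sigma>' (tbound c2) \<sigma>''" "pc \<sigma>'' = q + clen c1 + clen c2" "mem \<sigma>'' = fst s''" "outp \<sigma>'' = snd s''"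
  using exec_Seq.IH(2)[OF inv code(2)] 1 by blast
 show ?case using 1 2 reach_trans steps_within_trans by (intro exI[of _ \<sigma>'']) (auto simp: add.assoc)
next
 case (exec_CondT m a c1 w s' c2)
 let ?r = "q + 2 + clen c2"
 have code: "P ! q = JumpPos a ?r" "q < length P" "code_at P ?r (comp ?r c1)"
  using exec_CondT.prems by (auto simp: code_at_append code_at_Cons)
 have b: "bits (m a) \<le> bnd a + 1" using exec_CondT.prems bits_le unfolding fits_def by auto
 obtain \<sigma>1 where 1: "reach P x \<sigma> \<sigma>1" "steps_within \<sigma> (bits (m a)) \<sigma>1" "pc \<sigma>1 = ?r" "mem \<sigma>1 = m" "outp \<sigma>1 = w"
  using reach_jump[of \<sigma> P a ?r] code exec_CondT by auto
 obtain \<sigma>2 where 2: "reach P x \<sigma>1 \<sigma>2" "steps_within \<sigma>1 (tbound c1) \<sigma>2" "pc \<sigma>2 = ?r + clen c1" "mem \<sigma>2 = fst s'" "outp \<sigma>2 = snd s'"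
  using exec_CondT.IH[of ?r \<sigma>1] code exec_CondT.prems 1 by auto
 have "steps_within \<sigma> (tbound (Cond a c1 c2)) \<sigma>2"
  using steps_within_mono[OF steps_within_trans[OF 1(2) 2(2)]] b by simp
 then show ?case using reach_trans[OF 1(1) 2(1)] 2 by (intro exI[of _ \<sigma>2]) auto
next
 case (exec_CondF m a c2 w s' c1)
 let ?r = "q + 2 + clen c2"
 have code: "P ! q = JumpPos a ?r" "q < length P" "code_at P (Suc q) (comp (Suc q) c2)"
  "P ! (Suc q + clen c2) = JumpPos 0 (?r + clen c1)" "Suc q + clen c2 < length P"
  using exec_CondF.prems by (auto simp: code_at_append code_at_Cons)
 have b: "bits (m a) \<le> bnd a + 1" using exec_CondF.prems bits_le unfolding fits_def by auto
 obtain \<sigma>1 where 1: "reach P x \<sigma> \<sigma>1" "steps_within \<sigma> (bits (m a)) \<sigma>1" "pc \<sigma>1 = Suc q" "mem \<sigma>1 = m" "outp \<sigma>1 = w"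
  using reach_jump[of \<sigma> P a ?r] code exec_CondF by auto
 obtain \<sigma>2 where 2: "reach P x \<sigma>1 \<sigma>2" "steps_within \<sigma>1 (tbound c2) \<sigma>2" "pc \<sigma>2 = Suc q + clen c2" "mem \<sigma>2 = fst s'" "outp \<sigma>2 = snd s'"
  using exec_CondF.IH[of "Suc q" \<sigma>1] code exec_CondF.prems 1 by auto
 have inv: "fits (fst s')" "fst s' 0 = 1" using exec_inv[OF exec_CondF(2)] exec_CondF.prems by auto
 obtain \<sigma>3 where 3: "reach P x \<sigma>2 \<sigma>3" "steps_within \<sigma>2 2 \<sigma>3" "pc \<sigma>3 = ?r + clen c1" "mem \<sigma>3 = fst s'" "outp \<sigma>3 = snd s'"
  using reach_jump[of \<sigma>2 P 0 "?r + clen c1"] code 2 inv by (auto simp: bits_one)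
 have "steps_within \<sigma> (tbound (Cond a c1 c2)) \<sigma>3"
  using steps_within_mono[OF steps_within_trans[OF steps_within_trans[OF 1(2) 2(2)] 3(2)]] b by simp
 then show ?case using reach_trans[OF reach_trans[OF 1(1) 2(1)] 3(1)] 3 by (intro exI[of _ \<sigma>3]) auto
next
 case (exec_LoopF m a K c w)
 have code: "P ! q = JumpPos a (q + 2)" "q < length P" "P ! Suc q = JumpPos 0 (q + 3 + clen c)" "Suc q < length P"
  using exec_LoopF.prems by (auto simp: code_at_append code_at_Cons)
 have b: "bits (m a) \<le> bnd a + 1" using exec_LoopF.prems bits_le unfolding fits_def by auto
 obtain \<sigma>1 where 1: "reach P x \<sigma> \<sigma>1" "steps_within \<sigma> (bits (m a)) \<sigma>1" "pc \<sigma>1 = Suc q" "mem \<sigma>1 = m" "outp \<sigma>1 = w"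
  using reach_jump[of \<sigma> P a "q + 2"] code exec_LoopF by auto
 obtain \<sigma>3 where 3: "reach P x \<sigma>1 \<sigma>3" "steps_within \<sigma>1 2 \<sigma>3" "pc \<sigma>3 = q + 3 + clen c" "mem \<sigma>3 = m" "outp \<sigma>3 = w"
  using reach_jump[of \<sigma>1 P 0 "q + 3 + clen c"] code 1 exec_LoopF.prems by (auto simp: bits_one)
 have "steps_within \<sigma> (tbound (Loop K a c)) \<sigma>3"
  using steps_within_mono[OF steps_within_trans[OF 1(2) 3(2)]] b by simp
 then show ?case using reach_trans[OF 1(1) 3(1)] 3 by (intro exI[of _ \<sigma>3]) auto
next
 case (exec_LoopT m a c w s' K s'')
 have code: "P ! q = JumpPos a (q + 2)" "q < length P" "code_at P (q + 2) (comp (q + 2) c)"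
  "P ! (q + 2 + clen c) = JumpPos 0 q" "q + 2 + clen c < length P"
  using exec_LoopT.prems by (auto simp: code_at_append code_at_Cons)
 have b: "bits (m a) \<le> bnd a + 1" using exec_LoopT.prems bits_le unfolding fits_def by auto
 obtain \<sigma>1 where 1: "reach P x \<sigma> \<sigma>1" "steps_within \<sigma> (bits (m a)) \<sigma>1" "pc \<sigma>1 = q + 2" "mem \<sigma>1 = m" "outp \<sigma>1 = w"
  using reach_jump[of \<sigma> P a "q + 2"] code exec_LoopT by auto
 obtain \<sigma>2 where 2: "reach P x \<sigma>1 \<sigma>2" "steps_within \<sigma>1 (tbound c) \<sigma>2" "pc \<sigma>2 = q + 2 + clen c" "mem \<sigma>2 = fst s'" "outp \<sigma>2 = snd s'"
  using exec_LoopT.IH(1)[of "q + 2" \<sigma>1] code exec_LoopT.prems 1 by auto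
 have inv: "fits (fst s')" "fst s' 0 = 1" using exec_inv[OF exec_LoopT(2)] exec_LoopT.prems by auto
 obtain \<sigma>3 where 3: "reach P x \<sigma>2 \<sigma>3" "steps_within \<sigma>2 2 \<sigma>3" "pc \<sigma>3 = q" "mem \<sigma>3 = fst s'" "outp \<sigma>3 = snd s'"
  using reach_jump[of \<sigma>2 P 0 q] code 2 inv by (auto simp: bits_one)
 obtain \<sigma>4 where 4: "reach P x \<sigma>3 \<sigma>4" "steps_within \<sigma>3 (tbound (Loop K a c)) \<sigma>4" "pc \<sigma>4 = q + clen (Loop K a c)" "mem \<sigma>4 = fst s''" "outp \<sigma>4 = snd s''"
  using exec_LoopT.IH(2)[of q \<sigma>3] exec_LoopT.prems 3 inv by auto
 have "steps_within \<sigma> (tbound (Loop (Suc K) a c)) \<sigma>4"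
  using steps_within_mono[OF steps_within_trans[OF steps_within_trans[OF steps_within_trans[OF 1(2) 2(2)] 3(2)] 4(2)]] b by simp
 then show ?case using reach_trans[OF reach_trans[OF reach_trans[OF 1(1) 2(1)] 3(1)] 4(1)] 4 by (intro exI[of _ \<sigma>4]) auto
qed

text \<open>The widths and cell 0 are hypotheses inside the definition: they persist along every
  execution, so loop invariants do not have to carry them.\<close>

definition wp :: "cmd \<Rightarrow> ((nat \<Rightarrow> int) \<Rightarrow> (nat \<Rightarrow> int option) \<Rightarrow> bool) \<Rightarrow> (nat \<Rightarrow> int) \<Rightarrow> (nat \<Rightarrow> int option) \<Rightarrow> bool" where
 "wp c Q m w \<longleftrightarrow> (fits m \<longrightarrow> m 0 = 1 \<longrightarrow> (\<exists>m' w'. exec c (m, w) (m', w') \<and> Q m' w'))"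

lemma fits_upd: "fits m \<Longrightarrow> \<bar>v\<bar> < 2 ^ bnd d \<Longrightarrow> fits (m(d := v))"
 unfolding fits_def by auto

lemma wp_Ins:
 assumes "plain I" "m 0 = 1 \<Longrightarrow> side I m w \<and> (fits m \<longrightarrow> fits (instr_mem I x False m)) \<and> instr_mem I x False m 0 = m 0"
  and "m 0 = 1 \<Longrightarrow> Q (instr_mem I x False m) (instr_outp I m w)"
 shows "wp (Ins I) Q m w"
 unfolding wp_def using exec_Ins assms by blast

lemma wp_Const: "d \<noteq> 0 \<Longrightarrow> \<bar>k\<bar> < 2 ^ bnd d \<Longrightarrow> Q (m(d := k)) w \<Longrightarrow> wp (Ins (Const d k)) Q m w"
 by (rule wp_Ins) (auto intro: fits_upd)
lemma wp_Add: "d \<noteq> 0 \<Longrightarrow> \<bar>m a + m b\<bar> < 2 ^ bnd d \<Longrightarrow> Q (m(d := m a + m b)) w \<Longrightarrow> wp (Ins (Add d a b)) Q m w"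
 by (rule wp_Ins) (auto intro: fits_upd)
lemma wp_Sub: "d \<noteq> 0 \<Longrightarrow> \<bar>m a - m b\<bar> < 2 ^ bnd d \<Longrightarrow> Q (m(d := m a - m b)) w \<Longrightarrow> wp (Ins (Sub d a b)) Q m w"
 by (rule wp_Ins) (auto intro: fits_upd)
lemma wp_Mul: "d \<noteq> 0 \<Longrightarrow> \<bar>m a * m b\<bar> < 2 ^ bnd d \<Longrightarrow> Q (m(d := m a * m b)) w \<Longrightarrow> wp (Ins (Mul d a b)) Q m w"
 by (rule wp_Ins) (auto intro: fits_upd)
lemma wp_Div: "d \<noteq> 0 \<Longrightarrow> \<bar>m a div m b\<bar> < 2 ^ bnd d \<Longrightarrow> Q (m(d := m a div m b)) w \<Longrightarrow> wp (Ins (Div d a b)) Q m w"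
 by (rule wp_Ins) (auto intro: fits_upd)
lemma wp_Load: "d \<noteq> 0 \<Longrightarrow> bnd (nat (m a)) \<le> wA \<Longrightarrow> \<bar>m (nat (m a))\<bar> < 2 ^ bnd d \<Longrightarrow>
  Q (m(d := m (nat (m a)))) w \<Longrightarrow> wp (Ins (Load d a)) Q m w"
 by (rule wp_Ins) (auto intro: fits_upd)
lemma wp_Store: "nat (m a) \<noteq> 0 \<Longrightarrow> \<bar>m s\<bar> < 2 ^ bnd (nat (m a)) \<Longrightarrow> Q (m(nat (m a) := m s)) w \<Longrightarrow> wp (Ins (Store a s)) Q m w"
 by (rule wp_Ins) (auto intro: fits_upd)
lemma wp_Input: "d \<noteq> 0 \<Longrightarrow> \<bar>x (nat (m a))\<bar> < 2 ^ bnd d \<Longrightarrow> Q (m(d := x (nat (m a)))) w \<Longrightarrow> wp (Ins (Input d a)) Q m w"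
 by (rule wp_Ins) (auto intro: fits_upd)
lemma wp_Output: "w (nat (m a)) = None \<Longrightarrow> Q m (w(nat (m a) := Some (m s))) \<Longrightarrow> wp (Ins (Output a s)) Q m w"
 by (rule wp_Ins) auto

lemma wp_Seq: "wp c1 (wp c2 Q) m w \<Longrightarrow> wp (c1 ;; c2) Q m w"
 unfolding wp_def using exec_inv[of c1] exec_Seq[of c1] by (metis fst_conv)

lemma wp_Cond: "(m a > 0 \<Longrightarrow> wp c1 Q m w) \<Longrightarrow> (\<not> m a > 0 \<Longrightarrow> wp c2 Q m w) \<Longrightarrow> wp (Cond a c1 c2) Q m w"
 unfolding wp_def using exec_CondT exec_CondF by metis

lemma wp_mono: "wp c Q m w \<Longrightarrow> (\<And>m' w'. Q m' w' \<Longrightarrow> Q' m' w') \<Longrightarrow> wp c Q' m w"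
 unfolding wp_def by blast

text \<open>Cell \<open>0\<close> holds the constant \<open>1\<close> in every reachable state.\<close>

lemma wp_one: "(m 0 = 1 \<Longrightarrow> wp c Q m w) \<Longrightarrow> wp c Q m w"
 unfolding wp_def by blast

lemma wp_post_one: "wp c Q m w \<Longrightarrow> wp c (\<lambda>m' w'. m' 0 = 1 \<and> Q m' w') m w"
 unfolding wp_def using exec_inv[of c] by (metis fst_conv)

text \<open>\<open>L\<close> is the exact number of iterations, \<open>K\<close> the annotated
  bound. The invariant at \<open>L\<close> itself has to make the guard fail, so termination is part
  of the counting.\<close>

lemma wp_Loop:
 assumes "I 0 m w" and "L \<le> K"
  and step: "\<And>k m w. k < L \<Longrightarrow> I k m w \<Longrightarrow> m a > 0 \<and> wp c (I (Suc k)) m w"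
  and final: "\<And>m w. I L m w \<Longrightarrow> \<not> m a > 0 \<and> Q m w"
 shows "wp (Loop K a c) Q m w"
proof -
 have "wp (Loop K a c) Q m w" if "I k m w" "k \<le> L" "L - k \<le> K" for k m w
  using that
 proof (induction "L - k" arbitrary: k m w K)
  case 0
  then have "\<not> m a > 0" "Q m w" using final[of m w] by auto
  then show ?case unfolding wp_def using exec_LoopF by blast
 next
  case (Suc d)
  have kL: "k < L" using Suc(2) by simp
  obtain K' where K': "K = Suc K'" using Suc.prems Suc(2) by (cases K) auto
  have h: "m a > 0" "wp c (I (Suc k)) m w" using step[OF kL Suc.prems(1)] by auto
  show ?case unfolding wp_def
  proof (intro impI)
   assume f: "fits m" "m 0 = 1"
   obtain m' w' where e: "exec c (m, w) (m', w')" "I (Suc k) m' w'"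
    using h(2) f unfolding wp_def by blast
   have f': "fits m'" "m' 0 = 1" using exec_inv[OF e(1)] f by auto
   have "wp (Loop K' a c) Q m' w'"
    by (rule Suc.hyps(1)[of "Suc k"]) (use Suc(2) kL e Suc.prems K' in auto)
   then obtain m'' w'' where "exec (Loop K' a c) (m', w') (m'', w'')" "Q m'' w''"
    using f' unfolding wp_def by blast
   then show "\<exists>m' w'. exec (Loop K a c) (m, w) (m', w') \<and> Q m' w'"
    unfolding K' using exec_LoopT[OF h(1) e(1)] by blast
  qed
 qed
 then show ?thesis using assms(1,2) by simp
qed

lemma ends_wp:
 assumes "wp c Q m w" and "fits m" and "m 0 = 1" and "code_at P q (comp q c)"
  and "pc \<sigma> = q" "mem \<sigma> = m" "outp \<sigma> = w"
  and "\<And>\<sigma>'. pc \<sigma>' = q + clen c \<Longrightarrow> Q (mem \<sigma>') (outp \<sigma>') \<Longrightarrow> fits (mem \<sigma>') \<Longrightarrow> mem \<sigma>' 0 = 1 \<Longrightarrow>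
   steps_within \<sigma> (tbound c) \<sigma>' \<Longrightarrow> ends P x \<sigma>' M \<Phi>"
 shows "ends P x \<sigma> M \<Phi>"
proof -
 obtain m' w' where e: "exec c (m, w) (m', w')" "Q m' w'" using assms(1-3) unfolding wp_def by blast
 have inv: "fits m'" "m' 0 = 1" using exec_inv[OF e(1)] assms(2,3) by auto
 obtain \<sigma>' where "reach P x \<sigma> \<sigma>'" "steps_within \<sigma> (tbound c) \<sigma>'" "pc \<sigma>' = q + clen c" "mem \<sigma>' = m'" "outp \<sigma>' = w'"
  using exec_compiled[OF e(1), of P q \<sigma>] assms by auto
 then show ?thesis using ends_reach assms(8)[of \<sigma>'] e inv by auto
qed

lemma ends_flip_loop:
 assumes code: "code_at P q (comp q (Loop K a (Ins (Flip d) ;; c)))" and d: "d \<noteq> 0"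
  and step: "\<And>k z m w. k < N \<Longrightarrow> I k z m w \<Longrightarrow> m a > 0 \<and> 1 < (2::int) ^ bnd d \<and>
   (\<forall>b. wp c (I (Suc k) (2 * z + of_bool b)) (m(d := of_bool b)) w)"
  and fin: "\<And>z m w. I N z m w \<Longrightarrow> \<not> m a > 0"
  and final: "\<And>z \<sigma>'. z < 2 ^ N \<Longrightarrow> pc \<sigma>' = q + clen c + 4 \<Longrightarrow> I N z (mem \<sigma>') (outp \<sigma>') \<Longrightarrow> fits (mem \<sigma>') \<Longrightarrow>
   mem \<sigma>' 0 = 1 \<Longrightarrow> steps_within \<sigma> (N * (bnd a + 1 + 1 + tbound c + 2) + bnd a + 3) \<sigma>' \<Longrightarrow> ends P x \<sigma>' 0 (\<lambda>_. \<Phi> z)"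
  and start: "pc \<sigma> = q" "I 0 0 (mem \<sigma>) (outp \<sigma>)" "fits (mem \<sigma>)" "mem \<sigma> 0 = 1"
 shows "ends P x \<sigma> N \<Phi>"
proof -
 let ?T = "bnd a + 1 + 1 + tbound c + 2"
 have cd: "P ! q = JumpPos a (q + 2)" "q < length P" "P ! Suc q = JumpPos 0 (q + clen c + 4)" "Suc q < length P"
  "P ! (q + 2) = Flip d" "q + 2 < length P" "code_at P (q + 3) (comp (q + 3) c)"
  "P ! (q + 3 + clen c) = JumpPos 0 q" "q + 3 + clen c < length P"
  using code by (auto simp: code_at_append code_at_Cons add.commute add.left_commute numeral_3_eq_3)
 have "ends P x \<tau> M (\<lambda>z'. \<Phi> (z * 2 ^ M + z'))"
  if "M + k = N" "z < 2 ^ k" "pc \<tau> = q" "I k z (mem \<tau>) (outp \<tau>)" "fits (mem \<tau>)" "mem \<tau> 0 = 1" "steps_within \<sigma> (k * ?T) \<tau>" for M k z \<tau>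
  using that
 proof (induction M arbitrary: k z \<tau>)
  case 0
  have np: "\<not> mem \<tau> a > 0" using fin[of z "mem \<tau>" "outp \<tau>"] 0 by simp
  have b: "bits (mem \<tau> a) \<le> bnd a + 1" using 0 bits_le unfolding fits_def by auto
  obtain \<tau>1 where 1: "reach P x \<tau> \<tau>1" "steps_within \<tau> (bits (mem \<tau> a)) \<tau>1" "pc \<tau>1 = Suc q" "mem \<tau>1 = mem \<tau>" "outp \<tau>1 = outp \<tau>"
   using reach_jump[of \<tau> P a "q + 2"] cd 0 np by auto
  obtain \<tau>2 where 2: "reach P x \<tau>1 \<tau>2" "steps_within \<tau>1 2 \<tau>2" "pc \<tau>2 = q + clen c + 4" "mem \<tau>2 = mem \<tau>" "outp \<tau>2 = outp \<tau>"
   using reach_jump[of \<tau>1 P 0 "q + clen c + 4"] cd 1 0 by (auto simp: bits_one)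
  have "steps_within \<sigma> (N * ?T + bnd a + 3) \<tau>2"
   using steps_within_mono[OF steps_within_trans[OF steps_within_trans[OF 0(7) 1(2)] 2(2)]] b 0(1) by simp
  then have "ends P x \<tau>2 0 (\<lambda>_. \<Phi> z)" using final[of z \<tau>2] 0 2 by simp
  then have "ends P x \<tau>2 0 (\<lambda>z'. \<Phi> (z * 2 ^ 0 + z'))" unfolding ends_def by simp
  then show ?case using ends_reach[OF reach_trans[OF 1(1) 2(1)]] by blast
 next
  case (Suc M)
  have k: "k < N" using Suc.prems by simp
  note st = step[OF k Suc.prems(4)]
  have b: "bits (mem \<tau> a) \<le> bnd a + 1" using Suc.prems bits_le unfolding fits_def by auto
  obtain \<tau>1 where 1: "reach P x \<tau> \<tau>1" "steps_within \<tau> (bits (mem \<tau> a)) \<tau>1" "pc \<tau>1 = q + 2" "mem \<tau>1 = mem \<tau>" "outp \<tau>1 = outp \<tau>"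
   using reach_jump[of \<tau> P a "q + 2"] cd Suc.prems st by auto
  have "ends P x (ram_step_coin P x co \<tau>1) M (\<lambda>z'. \<Phi> (z * 2 ^ Suc M + (z' + of_bool co * 2 ^ M)))" for co
  proof -
   let ?\<tau> = "ram_step_coin P x co \<tau>1"
   let ?m = "(mem \<tau>)(d := of_bool co)"
   have fm: "fits ?m" using Suc.prems(5) st by (intro fits_upd) auto
   then have mb: "mem_bits ?m \<le> MB" using MB unfolding fits_def by blast
   have s: "pc ?\<tau> = q + 3" "mem ?\<tau> = ?m" "outp ?\<tau> = outp \<tau>" "steps_within \<tau>1 1 ?\<tau>"
    using cd 1 mb by (auto simp: ram_step_coin_def ram_halted_def Let_def steps_within_def)
   have "wp c (I (Suc k) (2 * z + of_bool co)) ?m (outp \<tau>)" using st by blast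
   then show ?thesis
   proof (rule ends_wp[OF _ fm _ cd(7) s(1-3)])
    show "?m 0 = 1" using Suc.prems(6) d by simp
    fix \<tau>2 assume 2: "pc \<tau>2 = q + 3 + clen c" "I (Suc k) (2 * z + of_bool co) (mem \<tau>2) (outp \<tau>2)" "fits (mem \<tau>2)" "mem \<tau>2 0 = 1"
     "steps_within ?\<tau> (tbound c) \<tau>2"
    obtain \<tau>3 where 3: "reach P x \<tau>2 \<tau>3" "steps_within \<tau>2 2 \<tau>3" "pc \<tau>3 = q" "mem \<tau>3 = mem \<tau>2" "outp \<tau>3 = outp \<tau>2"
     using reach_jump[of \<tau>2 P 0 q] cd 2 by (auto simp: bits_one)
    have w: "steps_within \<sigma> (Suc k * ?T) \<tau>3"
     using steps_within_mono[OF steps_within_trans[OF steps_within_trans[OF steps_within_trans[OF steps_within_trans[OF Suc.prems(7) 1(2)] s(4)] 2(5)] 3(2)]] b by simp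
    have lt: "2 * z + of_bool co < 2 ^ Suc k" using Suc.prems(2) by (cases co) auto
    have "ends P x \<tau>3 M (\<lambda>z'. \<Phi> ((2 * z + of_bool co) * 2 ^ M + z'))"
     by (rule Suc.IH[of "Suc k"]) (use Suc.prems(1) lt 2 3 w in auto)
    also have "(\<lambda>z'. \<Phi> ((2 * z + of_bool co) * 2 ^ M + z')) = (\<lambda>z'. \<Phi> (z * 2 ^ Suc M + (z' + of_bool co * 2 ^ M)))"
     by (intro ext arg_cong[where f = \<Phi>]) (simp add: algebra_simps)
    finally show "ends P x \<tau>2 M (\<lambda>z'. \<Phi> (z * 2 ^ Suc M + (z' + of_bool co * 2 ^ M)))"
     using ends_reach[OF 3(1)] by blast
   qed
  qed
  then have "ends P x \<tau>1 (Suc M) (\<lambda>z'. \<Phi> (z * 2 ^ Suc M + z'))" by (rule ends_flip)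
  then show ?case using ends_reach[OF 1(1)] by blast
 qed
 from this[of N 0 0 \<sigma>] show ?thesis using start by (simp add: steps_within_def)
qed

end

text \<open>A marker for subgoals that symbolic execution solves by simplifying the left-hand side.\<close>

definition ev :: "'a \<Rightarrow> 'a \<Rightarrow> bool" where "ev t v \<longleftrightarrow> t = v"

lemma ev_refl: "ev t t" unfolding ev_def ..

context bounded_ram begin

text \<open>All these rules have exactly three \<open>ev\<close> premises, two of them dummies here,
  so that one and the same sequence of proof steps executes any instruction symbolically. The width
  conditions come last and are collected until the end.\<close>

lemma wp_Const_ev: "ev k v \<Longrightarrow> ev (0::nat) a1 \<Longrightarrow> ev (0::nat) a2 \<Longrightarrow> Q (m(d := v)) w \<Longrightarrow> d \<noteq> 0 \<and> \<bar>v\<bar> < 2 ^ bnd d \<Longrightarrow> wp (Ins (Const d k)) Q m w"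
 unfolding ev_def by (auto intro: wp_Const)
lemma wp_Add_ev: "ev (m a) va \<Longrightarrow> ev (m b) vb \<Longrightarrow> ev (va + vb) v \<Longrightarrow> Q (m(d := v)) w \<Longrightarrow> d \<noteq> 0 \<and> \<bar>v\<bar> < 2 ^ bnd d \<Longrightarrow> wp (Ins (Add d a b)) Q m w"
 unfolding ev_def by (auto intro: wp_Add)
lemma wp_Sub_ev: "ev (m a) va \<Longrightarrow> ev (m b) vb \<Longrightarrow> ev (va - vb) v \<Longrightarrow> Q (m(d := v)) w \<Longrightarrow> d \<noteq> 0 \<and> \<bar>v\<bar> < 2 ^ bnd d \<Longrightarrow> wp (Ins (Sub d a b)) Q m w"
 unfolding ev_def by (auto intro: wp_Sub)
lemma wp_Mul_ev: "ev (m a) va \<Longrightarrow> ev (m b) vb \<Longrightarrow> ev (va * vb) v \<Longrightarrow> Q (m(d := v)) w \<Longrightarrow> d \<noteq> 0 \<and> \<bar>v\<bar> < 2 ^ bnd d \<Longrightarrow> wp (Ins (Mul d a b)) Q m w"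
 unfolding ev_def by (auto intro: wp_Mul)
lemma wp_Div_ev: "ev (m a) va \<Longrightarrow> ev (m b) vb \<Longrightarrow> ev (va div vb) v \<Longrightarrow> Q (m(d := v)) w \<Longrightarrow> d \<noteq> 0 \<and> \<bar>v\<bar> < 2 ^ bnd d \<Longrightarrow> wp (Ins (Div d a b)) Q m w"
 unfolding ev_def by (auto intro: wp_Div)
lemma wp_Load_ev: "ev (m a) va \<Longrightarrow> ev (nat va) ad \<Longrightarrow> ev (m ad) v \<Longrightarrow> Q (m(d := v)) w \<Longrightarrow> d \<noteq> 0 \<and> bnd ad \<le> wA \<and> \<bar>v\<bar> < 2 ^ bnd d \<Longrightarrow>
  wp (Ins (Load d a)) Q m w"
 unfolding ev_def by (auto intro: wp_Load)
lemma wp_Store_ev: "ev (m a) va \<Longrightarrow> ev (m s) v \<Longrightarrow> ev (nat va) ad \<Longrightarrow> Q (m(ad := v)) w \<Longrightarrow> ad \<noteq> 0 \<and> \<bar>v\<bar> < 2 ^ bnd ad \<Longrightarrow>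
  wp (Ins (Store a s)) Q m w"
 unfolding ev_def by (auto intro: wp_Store)
lemma wp_Input_ev: "ev (m a) va \<Longrightarrow> ev (nat va) ad \<Longrightarrow> ev (x ad) v \<Longrightarrow> Q (m(d := v)) w \<Longrightarrow> d \<noteq> 0 \<and> \<bar>v\<bar> < 2 ^ bnd d \<Longrightarrow>
  wp (Ins (Input d a)) Q m w"
 unfolding ev_def by (auto intro: wp_Input)
lemma wp_Output_ev: "ev (m a) va \<Longrightarrow> ev (m s) v \<Longrightarrow> ev (nat va) ad \<Longrightarrow> Q m (w(ad := Some v)) \<Longrightarrow> w ad = None \<Longrightarrow>
  wp (Ins (Output a s)) Q m w"
 unfolding ev_def by (auto intro: wp_Output)

lemmas wps = wp_Const_ev wp_Add_ev wp_Sub_ev wp_Mul_ev wp_Div_ev wp_Load_ev wp_Store_ev wp_Input_ev wp_Output_ev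

end

section \<open>The program\<close>

text \<open>Word cells, big cells and three arrays of words. Width 0 further on forces those cells
  to hold 0, so the memory in use is finite, and only 24 cells have the large width.\<close>

definition cell_bits :: "nat \<Rightarrow> nat \<Rightarrow> nat \<Rightarrow> nat \<Rightarrow> nat" where
 "cell_bits n w b i = (if i < 40 then w else if i < 64 then b else if i < 64 + 3 * n then w else 0)"

lemma cell_bits_simps [simp]:
 "i < 40 \<Longrightarrow> cell_bits n w b i = w"
 "40 \<le> i \<Longrightarrow> i < 64 \<Longrightarrow> cell_bits n w b i = b"
 "64 \<le> i \<Longrightarrow> i < 64 + 3 * n \<Longrightarrow> cell_bits n w b i = w"
 unfolding cell_bits_def by auto

abbreviation "NOP \<equiv> Ins (Const 20 0)"
abbreviation "CPY d a \<equiv> Ins (Add d a 31)"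
abbreviation "INC d \<equiv> Ins (Add d d 0)"
abbreviation "DEC d \<equiv> Ins (Sub d d 0)"

text \<open>
 Word cells: 0 the constant one, 1 \<open>n\<close>, 2 the number of entries, 3 \<open>F\<close>, 4 \<open>F ^ 4\<close>, 5 the digit base
 \<open>F ^ 8\<close>, 6 \<open>2 * n\<close>, 7 the array base 64, 8 the sign changes, 9 the shift, 10 the dimension, 11 and 12
 row and column, 21 the eigenvalue index, 22 and 23 the bisection interval, 26 the selected column,
 28 the output pointer, 29 the output precision, 31 the constant zero.
 Big cells: 40 the lifted entry, 41 the modulus, 42 the inverse, 44 the determinant, 45 the symmetric
 residue, 46 the squared norm, 48 the square root, 50 the random bits.
 The arrays for residuals, digits and scaled perturbation start at 64, \<open>64 + n\<close> and \<open>64 + 2 * n\<close>.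
\<close>

definition "pass_diag n = Loop n 14 (
 Ins (Load 16 15) ;; Ins (Div 17 16 5) ;; Ins (Mul 18 17 5) ;; Ins (Sub 18 16 18) ;;
 Ins (Add 19 15 1) ;; Ins (Store 19 18) ;; Ins (Add 19 19 1) ;; Ins (Load 20 19) ;;
 Ins (Sub 20 20 9) ;; Ins (Mul 20 20 18) ;; Ins (Sub 17 17 20) ;; Ins (Store 15 17) ;; INC 15 ;; DEC 14)"

text \<open>The sparse part of one lifting step, streamed from the input. Only the row is tested
  against the current dimension; an entry with its column outside the leading block meets a zero
  digit.\<close>

definition "pass_entries nz = Loop nz 14 (
 Ins (Input 16 15) ;; INC 15 ;; Ins (Input 17 15) ;; INC 15 ;; Ins (Input 18 15) ;; INC 15 ;;
 Ins (Sub 19 10 16) ;;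
 Cond 19 (Ins (Add 19 7 1) ;; Ins (Add 19 19 17) ;; Ins (Load 20 19) ;; Ins (Mul 20 20 18) ;; Ins (Mul 20 20 4) ;;
  Ins (Add 19 7 16) ;; Ins (Load 17 19) ;; Ins (Sub 17 17 20) ;; Ins (Store 19 17)) NOP ;;
 DEC 14)"

definition "lift_pass n nz = CPY 15 7 ;; CPY 14 1 ;; pass_diag n ;; Ins (Const 15 2) ;; CPY 14 2 ;; pass_entries nz"

definition "clear_array n = CPY 15 7 ;; CPY 14 1 ;; Loop n 14 (Ins (Store 15 31) ;; INC 15 ;; DEC 14)"

text \<open>A full column of the inverse would consist of \<open>n\<close> big numbers. The
  residuals are single words, and only the digits of the one coordinate named in cell 11 are
  accumulated; any other entry takes a new lifting. The \<open>2 n\<close> digits in base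
  \<open>F ^ 8\<close> give the modulus \<open>F ^ (16 n)\<close>.\<close>

definition "lift_entry n nz = clear_array n ;; Ins (Add 15 7 12) ;; Ins (Store 15 0) ;; Ins (Const 40 0) ;; Ins (Const 41 1) ;;
 CPY 13 6 ;;
 Loop (2 * n) 13 (lift_pass n nz ;; Ins (Add 15 7 1) ;; Ins (Add 15 15 11) ;; Ins (Load 16 15) ;; Ins (Mul 43 41 16) ;;
  Ins (Add 40 40 43) ;; Ins (Mul 41 41 5) ;; DEC 13)"

text \<open>Leaves \<open>Y X mod N - 1\<close> in cell 43. This value is the loop guard, and 1
  minus it is the Newton factor \<open>2 - Y X\<close> modulo \<open>N\<close>.\<close>

definition "inverse_test = Ins (Mul 43 40 42) ;; Ins (Div 51 43 41) ;; Ins (Mul 51 51 41) ;; Ins (Sub 43 43 51) ;; DEC 43"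

definition "invert_mod K = Ins (Const 42 1) ;; inverse_test ;;
 Loop K 43 (Ins (Sub 51 0 43) ;; Ins (Mul 42 42 51) ;; Ins (Div 51 42 41) ;; Ins (Mul 51 51 41) ;; Ins (Sub 42 42 51) ;;
  inverse_test)"

definition "sym_residue = Ins (Const 51 2) ;; Ins (Div 52 41 51) ;; Ins (Add 43 43 52) ;; Ins (Div 51 43 41) ;; Ins (Mul 51 51 41) ;;
 Ins (Sub 43 43 51) ;; Ins (Sub 45 43 52)"

text \<open>The next minor is the present one divided by the lifted entry, modulo
  \<open>F ^ (16 n)\<close>; being small, it is the balanced residue. A sign change shows in the
  negated product of two neighbours, so no more than two minors are kept.\<close>

definition "inertia n nz K = Ins (Const 8 0) ;; Ins (Const 44 1) ;; Ins (Const 10 0) ;; CPY 24 1 ;;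
 Loop n 24 (CPY 11 10 ;; CPY 12 10 ;; INC 10 ;; lift_entry n nz ;; invert_mod K ;; Ins (Mul 43 44 42) ;; sym_residue ;;
  Ins (Mul 43 44 45) ;; Ins (Sub 43 31 43) ;; Cond 43 (INC 8) NOP ;; CPY 44 45 ;; DEC 24)"

definition "adj_entry n nz = lift_entry n nz ;; Ins (Mul 43 44 40) ;; sym_residue"

text \<open>The final call of \<open>inertia\<close> reinstates the determinant for the chosen shift
  in cell 44 and the full dimension in cell 10; the adjugate entries are computed from
  these.\<close>

definition "bisect n nz K Kb = Ins (Mul 23 4 3) ;; Ins (Sub 22 31 23) ;; Ins (Sub 25 23 22) ;; DEC 25 ;;
 Loop Kb 25 (Ins (Add 9 22 23) ;; Ins (Const 16 2) ;; Ins (Div 9 9 16) ;; inertia n nz K ;; Ins (Sub 16 8 21) ;;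
  Cond 16 (CPY 23 9) (CPY 22 9) ;; Ins (Sub 25 23 22) ;; DEC 25) ;;
 CPY 9 22 ;; inertia n nz K"

definition "select_column n nz = Ins (Const 47 0) ;; Ins (Const 26 0) ;; Ins (Const 27 0) ;; CPY 24 1 ;;
 Loop n 24 (CPY 11 27 ;; CPY 12 27 ;; adj_entry n nz ;; Ins (Mul 43 45 44) ;; Ins (Sub 51 43 47) ;;
  Cond 51 (CPY 47 43 ;; CPY 26 27) NOP ;; INC 27 ;; DEC 24)"

definition "square_norm n nz = Ins (Const 46 0) ;; Ins (Const 27 0) ;; CPY 24 1 ;; CPY 12 26 ;;
 Loop n 24 (CPY 11 27 ;; adj_entry n nz ;; Ins (Mul 43 45 45) ;; Ins (Add 46 46 43) ;; INC 27 ;; DEC 24)"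

text \<open>Bit by bit from the top. Cell 41 still holds the modulus \<open>F ^ (16 n)\<close>, so
  the trial bit starts at \<open>F ^ (16 n + 8)\<close>, a power of two.\<close>

definition "square_root K = Ins (Mul 46 46 5) ;; Ins (Const 48 0) ;; Ins (Mul 49 41 5) ;;
 Loop K 49 (Ins (Add 51 48 49) ;; Ins (Mul 43 51 51) ;; Ins (Sub 43 43 46) ;; Cond 43 NOP (CPY 48 51) ;;
  Ins (Const 51 2) ;; Ins (Div 49 49 51))"

text \<open>Every entry is lifted a second time: the column was not stored while its norm was
  summed, and the output cannot serve as storage.\<close>

definition "write_vector n nz = Ins (Const 27 0) ;; CPY 24 1 ;;
 Loop n 24 (CPY 11 27 ;; adj_entry n nz ;; Ins (Mul 43 45 5) ;; Ins (Div 43 43 48) ;; Ins (Output 28 43) ;;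
  INC 28 ;; INC 27 ;; DEC 24)"

definition "eigenpairs n nz K Kb Ks = Ins (Const 21 0) ;; Ins (Add 28 1 0) ;; Ins (Output 31 29) ;; CPY 33 1 ;;
 Loop n 33 (bisect n nz K Kb ;; Ins (Add 16 21 0) ;; Ins (Output 16 9) ;; select_column n nz ;; square_norm n nz ;; square_root Ks ;;
  write_vector n nz ;; INC 21 ;; DEC 33)"

definition "unpack n = Ins (Mul 43 3 3) ;; Ins (Add 15 7 1) ;; Ins (Add 15 15 1) ;; CPY 14 1 ;;
 Loop n 14 (Ins (Div 51 50 43) ;; Ins (Mul 42 51 43) ;; Ins (Sub 42 50 42) ;; Ins (Mul 42 42 3) ;; Ins (Store 15 42) ;;
  CPY 50 51 ;; INC 15 ;; DEC 14)"

text \<open>Finds the scale of the instance: the sum of the absolute entries, the least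
  \<open>2 ^ e\<close> with \<open>\<epsilon> 2 ^ e \<ge> 1\<close>, recognised by the first
  positive cell of \<epsilon>, and from them \<open>Q = 2 ^ q\<close> and \<open>F = Q ^ ph\<close>.
  Cell 53 gets the number of coins, \<open>2 n\<close> times the exponent of 2 in
  \<open>F\<close>.\<close>

definition "preparation nz Ke Kq ph =
 Ins (Const 32 0) ;; Ins (Const 15 4) ;; CPY 14 2 ;; Ins (Const 17 3) ;;
 Loop nz 14 (Ins (Input 16 15) ;; Cond 16 (Ins (Add 32 32 16)) (Ins (Sub 32 32 16)) ;; Ins (Add 15 15 17) ;; DEC 14) ;;
 Ins (Const 17 2) ;; Ins (Sub 15 15 17) ;; Ins (Input 16 15) ;; Ins (Const 34 1) ;; Ins (Sub 35 0 16) ;;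
 Loop Ke 35 (Ins (Add 34 34 34) ;; INC 15 ;; Ins (Input 16 15) ;; Ins (Sub 35 0 16)) ;;
 Ins (Add 36 1 32) ;; Ins (Add 36 36 34) ;; Ins (Const 37 1) ;; Ins (Const 30 0) ;; Ins (Sub 35 36 37) ;;
 Loop Kq 35 (Ins (Add 37 37 37) ;; INC 30 ;; Ins (Sub 35 36 37)) ;;
 Ins (Const 3 1) ;; Ins (Const 14 (int ph)) ;; Loop ph 14 (Ins (Mul 3 3 37) ;; DEC 14) ;;
 Ins (Const 16 (4 * int ph)) ;; Ins (Mul 29 16 30) ;; Ins (Mul 16 3 3) ;; Ins (Mul 4 16 16) ;; Ins (Mul 5 4 4) ;;
 Ins (Add 6 1 1) ;; Ins (Const 7 64) ;; Ins (Const 17 (2 * int ph)) ;; Ins (Mul 16 17 30) ;; Ins (Mul 53 16 1) ;; Ins (Const 50 0)"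

text \<open>The answer for the zero matrix. It has a branch of its own because for
  \<open>U = 0\<close> the quantity \<open>log_size\<close> does not see
  \<open>1 / \<epsilon>\<close>, so not even the search for the first digit of \<epsilon> would be
  affordable.\<close>

definition "write_identity n = Ins (Output 31 31) ;; CPY 15 0 ;; CPY 14 1 ;;
 Loop n 14 (Ins (Output 15 31) ;; INC 15 ;; DEC 14) ;;
 CPY 16 1 ;;
 Loop n 16 (CPY 14 1 ;;
  Loop n 14 (Ins (Sub 18 14 16) ;; Ins (Mul 18 18 18) ;; Ins (Sub 18 0 18) ;;
   Cond 18 (Ins (Output 15 0)) (Ins (Output 15 31)) ;; INC 15 ;; DEC 14) ;;
  DEC 16)"

definition "prologue nz Ke Kq ph = Ins (Const 31 0) ;; Ins (Input 1 31) ;; Ins (Input 2 0) ;; Ins (Const 53 0) ;;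
 Cond 2 (preparation nz Ke Kq ph) NOP"

definition "flip_body = Ins (Add 50 50 50) ;; Ins (Add 50 50 54) ;; DEC 53"

definition "epilogue n nz K Kb Ks n' = Cond 2 (unpack n ;; eigenpairs n nz K Kb Ks) (write_identity n')"

section \<open>Correctness of the program\<close>

text \<open>\<open>D\<close> is the perturbation that the coins encode, fixed in advance; the phases
  before it is unpacked are the same for all \<open>D\<close>. \<open>ents\<close> says that summing
  over the listed entries is multiplication by \<open>A\<close>.\<close>

locale eig_ram = bounded_ram x "cell_bits n wB nB" wB xb MB for x n wB nB xb MB +
 fixes nz :: nat and row col :: "nat \<Rightarrow> nat" and val :: "nat \<Rightarrow> int"
  and A :: "nat \<Rightarrow> nat \<Rightarrow> int" and D :: "nat \<Rightarrow> int" and F :: int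
 assumes wB: "F ^ 30 \<le> (2::int) ^ wB" and nB: "(2::int) ^ nB = F ^ (40 * n + 40)"
  and F: "F \<ge> 1000" and evenF: "even F" and n0: "n > 0" and nF: "int n * int n \<le> F" and nzF: "nz \<le> n * n"
  and inputs: "l < nz \<Longrightarrow> x (2 + 3 * l) = int (row l)" "l < nz \<Longrightarrow> x (3 + 3 * l) = int (col l)"
   "l < nz \<Longrightarrow> x (4 + 3 * l) = val l"
  and rc: "l < nz \<Longrightarrow> row l < n" "l < nz \<Longrightarrow> col l < n"
  and vals: "(\<Sum>l<nz. \<bar>val l\<bar>) \<le> F"
  and ents: "i < n \<Longrightarrow> (\<Sum>l<nz. of_bool (row l = i) * (val l * c (col l))) = (\<Sum>j<n. A i j * c j)"
  and D: "i < n \<Longrightarrow> 0 \<le> D i" "i < n \<Longrightarrow> D i < F ^ 2"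
begin

text \<open>Sizes are tracked as exponents of \<open>F\<close>: products add exponents, and a sum
  costs one more because \<open>2 \<le> F\<close>. Exponents below 30 fit into words, those below
  \<open>40 n + 40\<close> into big cells.\<close>

definition mag :: "nat \<Rightarrow> int \<Rightarrow> bool" where
 "mag k v \<longleftrightarrow> \<bar>v\<bar> \<le> F ^ k"

lemma Fpos: "F > 0" "F \<ge> 1" "F \<noteq> 0" using F by auto

lemma mag_mono: "mag k v \<Longrightarrow> k \<le> l \<Longrightarrow> mag l v"
 unfolding mag_def using power_increasing[of k l F] Fpos by linarith

lemma mag_add: "mag k a \<Longrightarrow> mag l b \<Longrightarrow> mag (Suc (max k l)) (a + b)"
proof -
 assume a: "mag k a" and b: "mag l b"
 let ?m = "max k l"
 have "\<bar>a\<bar> \<le> F ^ ?m" "\<bar>b\<bar> \<le> F ^ ?m" using mag_mono[OF a, of ?m] mag_mono[OF b, of ?m] unfolding mag_def by auto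
 moreover have "2 * F ^ ?m \<le> F * F ^ ?m" using F by (intro mult_right_mono) auto
 ultimately show ?thesis unfolding mag_def by simp
qed

lemma mag_minus: "mag k a \<Longrightarrow> mag k (- a)" unfolding mag_def by simp

lemma mag_sub: "mag k a \<Longrightarrow> mag l b \<Longrightarrow> mag (Suc (max k l)) (a - b)"
 using mag_add[of k a l "- b"] mag_minus by simp

lemma mag_mul: "mag k a \<Longrightarrow> mag l b \<Longrightarrow> mag (k + l) (a * b)"
 unfolding mag_def abs_mult power_add by (intro mult_mono) auto

lemma mag_div: "mag k a \<Longrightarrow> b > 0 \<Longrightarrow> mag k (a div b)"
proof -
 assume a: "mag k a" and b: "b > 0"
 have "\<bar>a div b\<bar> \<le> \<bar>a\<bar>"
 proof (cases "a \<ge> 0")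
  case True
  then show ?thesis using b zdiv_mono2[of a 1 b] pos_imp_zdiv_nonneg_iff[OF b, of a] by simp
 next
  case False
  then have "a div b \<ge> a" using b zdiv_mono2_neg[of a 1 b] by simp
  moreover have "a div b \<le> 0" using False b div_nonpos_pos_le0[of a b] by simp
  ultimately show ?thesis by simp
 qed
 then show ?thesis using a unfolding mag_def by simp
qed

lemma mag_pow: "mag k (F ^ k)" unfolding mag_def using Fpos by simp

lemma mag_mod: "mag k (a mod F ^ k)"
 unfolding mag_def using Fpos pos_mod_bound[of "F ^ k" a] pos_mod_sign[of "F ^ k" a] by (simp add: less_imp_le)

lemma mag_num: "\<bar>v\<bar> \<le> 1000 \<Longrightarrow> mag 1 v" unfolding mag_def using F by simp

lemma mag_n: "k \<le> int n * int n \<Longrightarrow> k \<ge> 0 \<Longrightarrow> mag 1 k" unfolding mag_def using nF by simp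

lemma n_le: "int n \<le> int n * int n" using n0 by (cases n) auto

lemma mag_nat: "k \<le> n \<Longrightarrow> mag 1 (int k)"
 using n_le by (intro mag_n) auto

lemma mag_idx: "i \<le> 64 + 3 * n \<Longrightarrow> mag 2 (int i)"
proof -
 assume "i \<le> 64 + 3 * n"
 then have "int i \<le> 64 + 3 * F" using nF n_le by linarith
 also have "\<dots> \<le> F * F" using mult_right_mono[of 4 F F] F by linarith
 finally show ?thesis unfolding mag_def by (simp add: power2_eq_square)
qed

lemma small: "mag k v \<Longrightarrow> k < 30 \<Longrightarrow> \<bar>v\<bar> < 2 ^ wB"
 unfolding mag_def using power_strict_increasing[of k 30 F] F wB by linarith

lemma big: "mag k v \<Longrightarrow> k < 40 * n + 40 \<Longrightarrow> \<bar>v\<bar> < 2 ^ nB"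
 unfolding mag_def nB using power_strict_increasing[of k "40 * n + 40" F] F by linarith

lemma wbn: "2000 + 20 * (int n * int n) < 2 ^ wB" "2000 + 20 * int n < 2 ^ wB" "2000 + 20 * n < 2 ^ wB"
proof -
 have "2000 + 20 * (int n * int n) \<le> 2000 + 20 * F" using nF by simp
 also have "\<dots> \<le> F * F" using mult_right_mono[of 1000 F F] F by linarith
 also have "\<dots> < 2 ^ wB" using small[of 2 "F ^ 2"] mag_pow[of 2] by (simp add: power2_eq_square)
 finally show *: "2000 + 20 * (int n * int n) < 2 ^ wB" .
 show **: "2000 + 20 * int n < 2 ^ wB" using * n_le by linarith
 have "int (2000 + 20 * n) < int (2 ^ wB)" using ** by simp
 then show "2000 + 20 * n < 2 ^ wB" by (simp only: of_nat_less_iff)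
qed

definition core :: "(nat \<Rightarrow> int) \<Rightarrow> bool" where
 "core m \<longleftrightarrow> m 31 = 0 \<and> m 1 = int n \<and> m 2 = int nz \<and> m 3 = F \<and> m 4 = F ^ 4 \<and> m 5 = F ^ 8 \<and> m 6 = 2 * int n \<and> m 7 = 64 \<and>
  (\<forall>i<n. m (64 + 2 * n + i) = F * D i)"

lemma coreD:
 assumes "core m"
 shows "m 31 = 0" "m (Suc 0) = int n" "m 2 = int nz" "m 3 = F" "m 4 = F ^ 4" "m 5 = F ^ 8" "m 6 = 2 * int n" "m 7 = 64"
 using assms unfolding core_def by auto

lemma core_upd [simp]:
 "d \<notin> {1,2,3,4,5,6,7,31} \<Longrightarrow> d < 64 + 2 * n \<Longrightarrow> core (m(d := v)) = core m"
 unfolding core_def by auto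

text \<open>A frame condition for the first 64 cells; the arrays are described separately.\<close>

definition same :: "nat set \<Rightarrow> (nat \<Rightarrow> int) \<Rightarrow> (nat \<Rightarrow> int) \<Rightarrow> bool" where
 "same X m m' \<longleftrightarrow> (\<forall>i<64. i \<notin> X \<longrightarrow> m' i = m i)"

lemma sameD: "same X m m' \<Longrightarrow> i < 64 \<Longrightarrow> i \<notin> X \<Longrightarrow> m' i = m i"
 unfolding same_def by blast

lemma same_refl [simp]: "same X m m" unfolding same_def by simp

lemma same_upd [simp]: "d \<in> X \<or> 64 \<le> d \<Longrightarrow> same X m m' \<Longrightarrow> same X m (m'(d := v))"
 unfolding same_def by auto

lemma same_trans: "same X m m' \<Longrightarrow> same Y m' m'' \<Longrightarrow> X \<union> Y \<subseteq> Z \<Longrightarrow> same Z m m''"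
 unfolding same_def by (metis UnI1 UnI2 in_mono)

lemma wp_pass_diag:
 assumes "core m" "m 15 = 64" "m 14 = int n" "mag 5 (m 9)" "\<forall>i<n. m (64 + i) = r i \<and> mag 15 (r i)"
 shows "wp (pass_diag n) (\<lambda>m' w'. w' = w \<and> core m' \<and> same {14..20} m m' \<and>
  (\<forall>i<n. m' (64 + i) = r i div F ^ 8 - (F * D i - m 9) * (r i mod F ^ 8)) \<and> (\<forall>i<n. m' (64 + n + i) = r i mod F ^ 8)) m w"
 unfolding pass_diag_def
proof (rule wp_Loop[where L = n and I = "\<lambda>k m' w'. w' = w \<and> core m' \<and> same {14..20} m m' \<and> m' 15 = 64 + int k \<and> m' 14 = int n - int k \<and>
  (\<forall>i<n. m' (64 + i) = (if i < k then r i div F ^ 8 - (F * D i - m 9) * (r i mod F ^ 8) else r i)) \<and>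
  (\<forall>i<k. m' (64 + n + i) = r i mod F ^ 8)"])
 fix k m' w'
 assume k: "k < n"
 assume I: "w' = w \<and> core m' \<and> same {14..20} m m' \<and> m' 15 = 64 + int k \<and> m' 14 = int n - int k \<and>
  (\<forall>i<n. m' (64 + i) = (if i < k then r i div F ^ 8 - (F * D i - m 9) * (r i mod F ^ 8) else r i)) \<and>
  (\<forall>i<k. m' (64 + n + i) = r i mod F ^ 8)"
 have m9: "m' 9 = m 9" using I sameD[of "{14..20}" m m' 9] by simp
 have rk: "m' (64 + k) = r k" "mag 15 (r k)" using I k assms(5) by auto
 have dk: "m' (64 + 2 * n + k) = F * D k" using I k unfolding core_def by auto
 have a1: "nat (64 + int k) = 64 + k" "nat (64 + int k + int n) = 64 + n + k" "nat (2 * int n + (64 + int k)) = 64 + 2 * n + k"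
  by linarith+
 have c: "r k - r k div F ^ 8 * F ^ 8 = r k mod F ^ 8" by (simp add: minus_div_mult_eq_mod)
 have b1: "mag 15 (r k div F ^ 8)" using mag_div[OF rk(2)] Fpos by simp
 have b2: "mag 8 (r k mod F ^ 8)" by (rule mag_mod)
 have b3: "mag 3 (F * D k)" using mag_mul[OF mag_pow[of 1], of 2 "D k"] D[OF k] unfolding mag_def by (simp add: numeral_3_eq_3 numeral_2_eq_2)
 have b4: "mag 6 (F * D k - m 9)" using mag_sub[OF b3 assms(4)] by simp
 have b5: "mag 14 ((F * D k - m 9) * (r k mod F ^ 8))" using mag_mul[OF b4 b2] by simp
 have b6: "mag 16 (r k div F ^ 8 - (F * D k - m 9) * (r k mod F ^ 8))" using mag_sub[OF b1 b5] by simp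
 have b7: "mag 23 (r k div F ^ 8 * F ^ 8)" using mag_mul[OF b1 mag_pow[of 8]] by simp
 have z: "m' 15 = 64 + int k" "m' 14 = int n - int k" "core m'" "same {14..20} m m'" "w' = w" using I by auto
 have nn: "n \<noteq> 0" using n0 by simp
 note [simp] = z coreD[OF z(3)] m9 rk(1) dk a1 c nn
 show "m' 14 > 0 \<and> wp (Ins (Load 16 15) ;; Ins (Div 17 16 5) ;; Ins (Mul 18 17 5) ;; Ins (Sub 18 16 18) ;;
   Ins (Add 19 15 1) ;; Ins (Store 19 18) ;; Ins (Add 19 19 1) ;; Ins (Load 20 19) ;;
   Ins (Sub 20 20 9) ;; Ins (Mul 20 20 18) ;; Ins (Sub 17 17 20) ;; Ins (Store 15 17) ;; INC 15 ;; DEC 14)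
  (\<lambda>m' w'. w' = w \<and> core m' \<and> same {14..20} m m' \<and> m' 15 = 64 + int (Suc k) \<and> m' 14 = int n - int (Suc k) \<and>
  (\<forall>i<n. m' (64 + i) = (if i < Suc k then r i div F ^ 8 - (F * D i - m 9) * (r i mod F ^ 8) else r i)) \<and>
  (\<forall>i<Suc k. m' (64 + n + i) = r i mod F ^ 8)) m' w'"
  apply (intro conjI)
  subgoal using k by simp
  apply (rule wp_one)
  apply ((rule wp_Seq)?, rule wps, (simp?, rule ev_refl), (simp?, rule ev_refl), (simp?, rule ev_refl))+
  subgoal using I k by (auto simp: less_Suc_eq)
  using k by (simp_all add: small[OF rk(2)] small[OF b1] small[OF b2] small[OF b3] small[OF b4] small[OF b5] small[OF b6] small[OF b7]
   ) (use wbn k in linarith)+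
qed (use assms in \<open>auto\<close>)

definition Bm :: "nat \<Rightarrow> nat \<Rightarrow> int" where
 "Bm i j = F ^ 4 * A i j + of_bool (i = j) * (F * D i)"

text \<open>Prefixes of the sum occur as intermediate contents of a cell, so they need the bound
  too; the sum of all absolute entries, at most \<open>F\<close>, controls them uniformly.\<close>

lemma partial_sum_le:
 assumes "\<And>j. j < n \<Longrightarrow> mag 8 (c j)" and "k \<le> nz"
 shows "mag 9 (\<Sum>l<k. of_bool (row l = i) * (val l * c (col l)))"
proof -
 have "\<bar>\<Sum>l<k. of_bool (row l = i) * (val l * c (col l))\<bar> \<le> (\<Sum>l<k. \<bar>val l\<bar> * F ^ 8)"
 proof (rule order_trans[OF sum_abs sum_mono])
  fix l assume "l \<in> {..<k}"
  then have "l < nz" using assms(2) by simp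
  then have "\<bar>c (col l)\<bar> \<le> F ^ 8" using assms(1)[OF rc(2)] unfolding mag_def by simp
  then show "\<bar>of_bool (row l = i) * (val l * c (col l))\<bar> \<le> \<bar>val l\<bar> * F ^ 8"
   using Fpos by (auto simp: abs_mult intro: mult_left_mono)
 qed
 also have "\<dots> = (\<Sum>l<k. \<bar>val l\<bar>) * F ^ 8" by (simp add: sum_distrib_right)
 also have "\<dots> \<le> (\<Sum>l<nz. \<bar>val l\<bar>) * F ^ 8"
  using assms(2) Fpos by (intro mult_right_mono sum_mono2) auto
 also have "\<dots> \<le> F * F ^ 8" using vals Fpos by (intro mult_right_mono) auto
 finally show ?thesis unfolding mag_def by (simp add: eval_nat_numeral)
qed

lemma abs_val: "l < nz \<Longrightarrow> mag 1 (val l)"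
proof -
 assume l: "l < nz"
 have "\<bar>val l\<bar> \<le> (\<Sum>l<nz. \<bar>val l\<bar>)" using l by (intro member_le_sum) auto
 then show ?thesis using vals unfolding mag_def by simp
qed

lemma wp_pass_entries:
 assumes "core m" "m 15 = 2" "m 14 = int nz" "m 10 = int kk" "kk \<le> n"
  and arr: "\<forall>i<n. m (64 + i) = g i \<and> mag 15 (g i)" "\<forall>i<n. m (64 + n + i) = c i \<and> mag 8 (c i)"
 shows "wp (pass_entries nz) (\<lambda>m' w'. w' = w \<and> core m' \<and> same {14..20} m m' \<and>
  (\<forall>i<n. m' (64 + i) = g i - of_bool (i < kk) * (F ^ 4 * (\<Sum>l<nz. of_bool (row l = i) * (val l * c (col l))))) \<and>
  (\<forall>i<n. m' (64 + n + i) = c i)) m w"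
proof -
 define PS where "PS k i = (\<Sum>l<k. of_bool (row l = i) * (val l * c (col l)))" for k i
 have nxt: "PS (Suc k) i = PS k i + of_bool (row k = i) * (val k * c (col k))" for k i unfolding PS_def by simp
 have PS0: "PS 0 i = 0" for i unfolding PS_def by simp
 show ?thesis unfolding PS_def[symmetric] pass_entries_def
proof (rule wp_Loop[where L = nz and I = "\<lambda>k m' w'. w' = w \<and> core m' \<and> same {14..20} m m' \<and> m' 15 = 2 + 3 * int k \<and> m' 14 = int nz - int k \<and>
  (\<forall>i<n. m' (64 + i) = g i - of_bool (i < kk) * (F ^ 4 * PS k i)) \<and>
  (\<forall>i<n. m' (64 + n + i) = c i)"])
 fix k m' w'
 assume k: "k < nz"
 assume I: "w' = w \<and> core m' \<and> same {14..20} m m' \<and> m' 15 = 2 + 3 * int k \<and> m' 14 = int nz - int k \<and>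
  (\<forall>i<n. m' (64 + i) = g i - of_bool (i < kk) * (F ^ 4 * PS k i)) \<and>
  (\<forall>i<n. m' (64 + n + i) = c i)"
 have m10: "m' 10 = int kk" using I sameD[of "{14..20}" m m' 10] assms(4) by simp
 have rck: "row k < n" "col k < n" using rc[OF k] by auto
 have xs: "x (2 + 3 * k) = int (row k)" "x (3 + 3 * k) = int (col k)" "x (4 + 3 * k) = val k" using inputs[OF k] by auto
 have a1: "nat (2 + 3 * int k) = 2 + 3 * k" "nat (3 + 3 * int k) = 3 + 3 * k" "nat (4 + 3 * int k) = 4 + 3 * k"
  "nat (64 + int n + int (col k)) = 64 + n + col k" "nat (64 + int (row k)) = 64 + row k" by linarith+
 have ck: "m' (64 + n + col k) = c (col k)" using I rck by simp
 define P where "P = PS k (row k)"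
 have gk: "m' (64 + row k) = g (row k) - of_bool (row k < kk) * (F ^ 4 * P)" using I rck unfolding P_def by simp
 have mc: "mag 8 (c j)" if "j < n" for j using arr(2) that by simp
 have b1: "mag 1 (val k)" by (rule abs_val[OF k])
 have b2: "mag 9 (c (col k) * val k)" using mag_mul[OF mc[OF rck(2)] b1] by simp
 have b3: "mag 13 (c (col k) * val k * F ^ 4)" using mag_mul[OF b2 mag_pow[of 4]] by simp
 have bP: "mag 9 P" unfolding P_def PS_def by (rule partial_sum_le[OF mc]) (use k in auto)
 have b4: "mag 13 (F ^ 4 * P)" using mag_mul[OF mag_pow[of 4] bP] by simp
 have b5: "mag 16 (g (row k) - F ^ 4 * P)" using mag_sub[OF _ b4, of 15 "g (row k)"] arr(1) rck by simp
 have b6: "mag 17 (g (row k) - F ^ 4 * P - c (col k) * val k * F ^ 4)" using mag_sub[OF b5 b3] by simp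
 have kn: "int k < int n * int n" "int nz \<le> int n * int n" using k nzF by (metis of_nat_less_iff of_nat_mult less_le_trans, metis of_nat_le_iff of_nat_mult)
 have kkn: "int kk \<le> int n" "int (row k) < int n" "int (col k) < int n" using assms(5) rck by auto
 have z: "m' 15 = 2 + 3 * int k" "m' 14 = int nz - int k" "core m'" "same {14..20} m m'" "w' = w" using I by auto
 have xs': "x (Suc (Suc (3 * k))) = int (row k)" using xs(1) by simp
 note [simp] = z coreD[OF z(3)] m10 xs xs' a1 ck gk
 note sm = small[OF mc[OF rck(2)]] small[OF b1] small[OF b2] small[OF b3] small[OF b5] small[OF b6]
 show "m' 14 > 0 \<and> wp (Ins (Input 16 15) ;; INC 15 ;; Ins (Input 17 15) ;; INC 15 ;; Ins (Input 18 15) ;; INC 15 ;;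
 Ins (Sub 19 10 16) ;;
 Cond 19 (Ins (Add 19 7 1) ;; Ins (Add 19 19 17) ;; Ins (Load 20 19) ;; Ins (Mul 20 20 18) ;; Ins (Mul 20 20 4) ;;
  Ins (Add 19 7 16) ;; Ins (Load 17 19) ;; Ins (Sub 17 17 20) ;; Ins (Store 19 17)) NOP ;;
 DEC 14)
  (\<lambda>m' w'. w' = w \<and> core m' \<and> same {14..20} m m' \<and> m' 15 = 2 + 3 * int (Suc k) \<and> m' 14 = int nz - int (Suc k) \<and>
  (\<forall>i<n. m' (64 + i) = g i - of_bool (i < kk) * (F ^ 4 * PS (Suc k) i)) \<and>
  (\<forall>i<n. m' (64 + n + i) = c i)) m' w'"
  apply (intro conjI)
  subgoal using k by simp
  apply (rule wp_one)
  apply ((rule wp_Seq)?, rule wps, (simp?, rule ev_refl), (simp?, rule ev_refl), (simp?, rule ev_refl))+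
  apply (rule wp_Seq, rule wp_Cond)
  subgoal
   apply ((rule wp_Seq)?, rule wps, (simp?, rule ev_refl), (simp?, rule ev_refl), (simp?, rule ev_refl))+
   subgoal using I rck by (auto simp: nxt P_def ring_distribs)
   using rck by (simp_all add: sm) (use wbn k kn kkn in linarith)+
  subgoal
   apply ((rule wp_Seq)?, rule wps, (simp?, rule ev_refl), (simp?, rule ev_refl), (simp?, rule ev_refl))+
   subgoal using I rck by (auto simp: nxt)
   by simp_all (use wbn k kn kkn in linarith)+
  by (simp_all add: sm) (use wbn k kn kkn rck in linarith)+
qed (use assms PS0 in \<open>auto\<close>)
qed

end

context eig_ram begin

lemma nzb: "int nz < 2 ^ wB" "nz < 2 ^ wB"
proof -
 have "int nz \<le> int n * int n" using nzF by (metis of_nat_le_iff of_nat_mult)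
 then show *: "int nz < 2 ^ wB" using wbn(1) by linarith
 have "int nz < int (2 ^ wB)" using * by simp
 then show "nz < 2 ^ wB" by (simp only: of_nat_less_iff)
qed

text \<open>Division by the base \<open>F ^ 8\<close> takes exponent 15 to 7; this is why the
  residuals do not grow from digit to digit.\<close>

lemma mag_residual_div: "mag 15 v \<Longrightarrow> mag 7 (v div F ^ 8)"
proof -
 assume v: "mag 15 v"
 have e: "F ^ 15 = F ^ 7 * F ^ 8" by (simp add: power_add[symmetric])
 have p: "F ^ 8 > 0" using Fpos by simp
 have "v div F ^ 8 \<le> (F ^ 7 * F ^ 8) div F ^ 8" using v p unfolding mag_def e by (intro zdiv_mono1) auto
 moreover have "(- (F ^ 7) * F ^ 8) div F ^ 8 \<le> v div F ^ 8" using v p unfolding mag_def e by (intro zdiv_mono1) auto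
 moreover have "(F ^ 7 * F ^ 8) div F ^ 8 = F ^ 7" "(- (F ^ 7) * F ^ 8) div F ^ 8 = - (F ^ 7)"
  using p nonzero_mult_div_cancel_right[of "F ^ 8" "F ^ 7"] nonzero_mult_div_cancel_right[of "F ^ 8" "- (F ^ 7)"] by auto
 ultimately have "v div F ^ 8 \<le> F ^ 7" "- (F ^ 7) \<le> v div F ^ 8" by simp_all
 then show ?thesis unfolding mag_def by linarith
qed

lemma mag_sub3: "mag k a \<Longrightarrow> mag k b \<Longrightarrow> mag k c \<Longrightarrow> mag (Suc k) (a - b - c)"
proof -
 assume "mag k a" "mag k b" "mag k c"
 moreover have "3 * F ^ k \<le> F * F ^ k" using F by (intro mult_right_mono) auto
 ultimately show ?thesis unfolding mag_def by simp
qed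

lemma mag_FD: "i < n \<Longrightarrow> mag 3 (F * D i)"
proof -
 assume i: "i < n"
 have "mag 2 (D i)" using D[OF i] unfolding mag_def by simp
 then show ?thesis using mag_mul[OF mag_pow[of 1], of 2 "D i"] by (simp add: numeral_3_eq_3)
qed

text \<open>The program splits a row into its diagonal part and a sum over the nonzero entries of
  the whole matrix. Columns outside the block contribute nothing, as their residuals vanish.\<close>

lemma lift_step_eq:
 assumes "kk \<le> n" "i < n" "\<And>j. kk \<le> j \<Longrightarrow> j < n \<Longrightarrow> r j = 0"
 shows "r i div F ^ 8 - (F * D i - s) * (r i mod F ^ 8) -
   of_bool (i < kk) * (F ^ 4 * (\<Sum>l<nz. of_bool (row l = i) * (val l * (r (col l) mod F ^ 8)))) =
  lift_step (F ^ 8) Bm s kk r i"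
proof (cases "i < kk")
 case False
 then show ?thesis using assms by (simp add: lift_step_def)
next
 case True
 let ?c = "\<lambda>j. r j mod F ^ 8"
 have "(\<Sum>j<kk. (Bm i j - of_bool (i = j) * s) * ?c j) =
   F ^ 4 * (\<Sum>j<kk. A i j * ?c j) + (\<Sum>j<kk. of_bool (i = j) * ((F * D i - s) * ?c j))"
  unfolding sum_distrib_left sum.distrib[symmetric] Bm_def by (intro sum.cong) (auto simp: algebra_simps)
 also have "(\<Sum>j<kk. of_bool (i = j) * ((F * D i - s) * ?c j)) = (F * D i - s) * ?c i"
  by (rule sum_of_bool_delta(1)[OF True])
 also have "(\<Sum>j<kk. A i j * ?c j) = (\<Sum>j<n. A i j * ?c j)"
  by (rule sum.mono_neutral_left) (use assms in auto)
 also have "\<dots> = (\<Sum>l<nz. of_bool (row l = i) * (val l * ?c (col l)))" by (rule ents[OF assms(2), symmetric])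
 finally show ?thesis using True by (simp add: lift_step_def)
qed

lemma wp_lift_pass:
 assumes "core m" "mag 5 (m 9)" "m 10 = int kk" "kk \<le> n"
  and arr: "\<forall>i<n. m (64 + i) = r i \<and> mag 15 (r i)" and r0: "\<And>j. kk \<le> j \<Longrightarrow> j < n \<Longrightarrow> r j = 0"
 shows "wp (lift_pass n nz) (\<lambda>m' w'. w' = w \<and> core m' \<and> same {14..20} m m' \<and>
  (\<forall>i<n. m' (64 + i) = lift_step (F ^ 8) Bm (m 9) kk r i \<and> mag 15 (lift_step (F ^ 8) Bm (m 9) kk r i)) \<and>
  (\<forall>i<n. m' (64 + n + i) = r i mod F ^ 8)) m w"
proof -
 let ?g = "\<lambda>i. r i div F ^ 8 - (F * D i - m 9) * (r i mod F ^ 8)"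
 have b14: "mag 14 ((F * D i - m 9) * (r i mod F ^ 8))" if "i < n" for i
  using mag_mul[OF mag_sub[OF mag_FD[OF that] assms(2)] mag_mod[of 8 "r i"]] by simp
 have b7: "mag 7 (r i div F ^ 8)" if "i < n" for i using arr that mag_residual_div by simp
 have g15: "mag 15 (?g i)" if "i < n" for i using mag_sub[OF b7[OF that] b14[OF that]] by simp
 define P where "P i = (\<Sum>l<nz. of_bool (row l = i) * (val l * (r (col l) mod F ^ 8)))" for i
 have "mag 9 (P i)" for i
  unfolding P_def by (rule partial_sum_le[where c = "\<lambda>j. r j mod F ^ 8", OF mag_mod order_refl])
 then have b13: "mag 13 (F ^ 4 * P i)" for i using mag_mul[OF mag_pow[of 4], of 9 "P i"] by simp
 have b0: "mag 14 (of_bool Z * v)" if "mag 13 v" for Z v using mag_mono[OF that, of 14] Fpos by (cases Z) (auto simp: mag_def)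
 have le: "?g i - of_bool (i < kk) * (F ^ 4 * P i) = lift_step (F ^ 8) Bm (m 9) kk r i" if "i < n" for i
  unfolding P_def by (rule lift_step_eq[where r = r and s = "m 9", OF assms(4) that r0])
 \<comment> \<open>Three terms of exponent at most 14 combine to 15, the bound assumed for
   \<open>r\<close>; so it is invariant under lifting.\<close>
 have fin: "mag 15 (lift_step (F ^ 8) Bm (m 9) kk r i)" if "i < n" for i
  unfolding le[OF that, symmetric]
  using mag_sub3[OF mag_mono[OF b7[OF that], of 14] b14[OF that] b0[OF b13]] by simp
 note [simp] = coreD[OF assms(1)] assms(1)
 show ?thesis
  unfolding lift_pass_def
  apply ((rule wp_Seq)?, rule wps, (simp?, rule ev_refl), (simp?, rule ev_refl), (simp?, rule ev_refl))
  apply ((rule wp_Seq)?, rule wps, (simp?, rule ev_refl), (simp?, rule ev_refl), (simp?, rule ev_refl))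
  apply (rule wp_Seq)
  apply (rule wp_mono[OF wp_pass_diag[where r = r]])
  subgoal by simp
  subgoal by simp
  subgoal by simp
  subgoal using assms(2) by simp
  subgoal using arr by simp
  subgoal for m1 w1
   apply (elim conjE)
   subgoal premises p
   proof -
    note c1 = coreD[OF p(2)]
    have m10: "m1 10 = int kk" using sameD[OF p(3), of 10] assms(3) by simp
    note [simp] = c1 p(2) m10
    have sm: "same {14..20} m (m1(15 := 2, 14 := int nz))"
     by (rule same_trans[OF _ same_upd[OF _ same_upd[OF _ p(3)]], of "{14..20}"]) auto
    show ?thesis
     apply ((rule wp_Seq)?, rule wps, (simp?, rule ev_refl), (simp?, rule ev_refl), (simp?, rule ev_refl))
     apply ((rule wp_Seq)?, rule wps, (simp?, rule ev_refl), (simp?, rule ev_refl), (simp?, rule ev_refl))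
     apply (rule wp_mono[OF wp_pass_entries[where kk = kk and g = ?g and c = "\<lambda>i. r i mod F ^ 8"]])
     subgoal by simp
     subgoal by simp
     subgoal by simp
     subgoal by simp
     subgoal by (rule assms(4))
     subgoal using p(4) g15 by simp
     subgoal using p(5) mag_mod by simp
     subgoal for m2 w2
      unfolding P_def[symmetric] using p(1) fin le same_trans[OF sm, of "{14..20}" m2 "{14..20}"] by simp
     subgoal using nzb by simp
     subgoal using wbn by simp
     done
   qed
   done
  subgoal using wbn n_le by simp
  subgoal using wbn by simp
  done
qed

lemma wp_clear_array:
 assumes "core m"
 shows "wp (clear_array n) (\<lambda>m' w'. w' = w \<and> core m' \<and> same {14..20} m m' \<and> (\<forall>i<n. m' (64 + i) = 0)) m w"
proof -
 note [simp] = coreD[OF assms] assms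
 show ?thesis
  unfolding clear_array_def
  apply ((rule wp_Seq)?, rule wps, (simp?, rule ev_refl), (simp?, rule ev_refl), (simp?, rule ev_refl))
  apply ((rule wp_Seq)?, rule wps, (simp?, rule ev_refl), (simp?, rule ev_refl), (simp?, rule ev_refl))
  apply (rule wp_Loop[where L = n and I = "\<lambda>k m' w'. w' = w \<and> core m' \<and> same {14..20} m m' \<and> m' 15 = 64 + int k \<and> m' 14 = int n - int k \<and>
   (\<forall>i<k. m' (64 + i) = 0)"])
  subgoal by simp
  subgoal by simp
  subgoal for k m' w'
   apply (elim conjE)
   subgoal premises p
   proof -
    have a: "nat (64 + int k) = 64 + k" by linarith
    note [simp] = coreD[OF p(3)] p(2-6) a
    show ?thesis
     apply (rule conjI)
     subgoal using p(1) by simp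
     apply (rule wp_one)
     apply ((rule wp_Seq)?, rule wps, (simp?, rule ev_refl), (simp?, rule ev_refl), (simp?, rule ev_refl))+
     subgoal using p by (auto simp: less_Suc_eq)
     using p(1) by simp_all (use wbn p(1) in linarith)+
   qed
   done
  subgoal by simp
  subgoal using wbn n_le by simp
  subgoal using wbn by simp
  done
qed

lemma lifted_bounds: "b > 0 \<Longrightarrow> 0 \<le> lifted b B s k j t i \<and> lifted b B s k j t i < b ^ t"
proof (induction t)
 case (Suc t)
 let ?d = "residual b B s k j t i mod b"
 have d: "0 \<le> ?d" "?d \<le> b - 1" using Suc.prems pos_mod_bound[of b] by (auto simp: zle_diff1_eq)
 have "b ^ t * ?d \<le> b ^ t * (b - 1)" using d Suc.prems by (intro mult_left_mono) auto
 then show ?case using Suc d by (auto simp: lifted_def algebra_simps)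
qed (simp add: lifted_def)

lemma wp_lift_entry:
 assumes "core m" "mag 5 (m 9)" "m 10 = int kk" "kk \<le> n" "m 11 = int i0" "i0 < kk" "m 12 = int j0" "j0 < kk"
 shows "wp (lift_entry n nz) (\<lambda>m' w'. w' = w \<and> core m' \<and> same ({13..20} \<union> {40,41,43}) m m' \<and>
  m' 40 = lifted (F ^ 8) Bm (m 9) kk j0 (2 * n) i0 \<and> m' 41 = F ^ (16 * n)) m w"
proof -
 let ?r = "residual (F ^ 8) Bm (m 9) kk j0"
 let ?y = "\<lambda>t. lifted (F ^ 8) Bm (m 9) kk j0 t i0"
 let ?X = "{13..20} \<union> {40,41,43::nat}"
 have r0: "?r t j = 0" if "kk \<le> j" for t j using that assms(8) by (cases t) (auto simp: lift_step_def)
 have r1: "mag 15 (?r 0 i)" for i using Fpos by (simp add: mag_def)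
 have my: "mag (8 * t) (?y t)" for t using lifted_bounds[of "F ^ 8" Bm "m 9" kk j0 t i0] Fpos by (simp add: mag_def power_mult)
 have i0n: "i0 < n" "j0 < n" using assms by auto
 note [simp] = coreD[OF assms(1)] assms(1)
 show ?thesis
  unfolding lift_entry_def
  apply (rule wp_Seq, rule wp_mono[OF wp_clear_array])
  subgoal by simp
  subgoal for m1 w1
   apply (elim conjE)
   subgoal premises p
   proof -
    have c: "m1 9 = m 9" "m1 10 = int kk" "m1 11 = int i0" "m1 12 = int j0"
     using sameD[OF p(3)] assms by auto
    have a: "nat (64 + int j0) = 64 + j0" by linarith
    have s1: "same ?X m m1" by (rule same_trans[OF p(3), of "{}"]) auto
    note [simp] = coreD[OF p(2)] p(1,2) c a
    show ?thesis
     apply (rule wp_one)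
     apply ((rule wp_Seq)?, rule wps, (simp?, rule ev_refl), (simp?, rule ev_refl), (simp?, rule ev_refl))
     apply ((rule wp_Seq)?, rule wps, (simp?, rule ev_refl), (simp?, rule ev_refl), (simp?, rule ev_refl))
     apply ((rule wp_Seq)?, rule wps, (simp?, rule ev_refl), (simp?, rule ev_refl), (simp?, rule ev_refl))
     apply ((rule wp_Seq)?, rule wps, (simp?, rule ev_refl), (simp?, rule ev_refl), (simp?, rule ev_refl))
     apply ((rule wp_Seq)?, rule wps, (simp?, rule ev_refl), (simp?, rule ev_refl), (simp?, rule ev_refl))
     apply (rule wp_Loop[where L = "2 * n" and I = "\<lambda>t m' w'. w' = w \<and> core m' \<and> same ?X m m' \<and> m' 13 = 2 * int n - int t \<and>
      m' 40 = ?y t \<and> m' 41 = F ^ (8 * t) \<and> (\<forall>i<n. m' (64 + i) = ?r t i \<and> mag 15 (?r t i))"])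
     subgoal using p(4) s1 r1 i0n by (auto simp: lifted_def)
     subgoal by simp
     subgoal for t m' w'
      apply (elim conjE)
      subgoal premises q
      proof -
       have c': "m' 9 = m 9" "m' 10 = int kk" "m' 11 = int i0"
        using sameD[OF q(5)] assms by auto
       note [simp] = coreD[OF q(4)] q(3,4,6) c'
       have bY: "mag (8 * t + 8) (F ^ (8 * t) * (?r t i0 mod F ^ 8))" using mag_mul[OF mag_pow mag_mod] .
       have ly: "?y (Suc t) = ?y t + F ^ (8 * t) * (?r t i0 mod F ^ 8)" by (simp add: lifted_def power_mult)
       have byy: "mag (8 * Suc t) (?y t + F ^ (8 * t) * (?r t i0 mod F ^ 8))"
        using my[of "Suc t"] by (simp add: lifted_def power_mult)
       have bp: "mag (8 * t + 8) (F ^ (8 * t) * F ^ 8)" using mag_mul[OF mag_pow mag_pow] .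
       have tn: "8 * t + 8 < 40 * n + 40" using q(2) by simp
       show ?thesis
        apply (rule conjI)
        subgoal using q(2) by simp
        apply (rule wp_Seq, rule wp_mono[OF wp_lift_pass[where kk = kk and r = "?r t"]])
        subgoal by simp
        subgoal using assms(2) by simp
        subgoal by simp
        subgoal by (rule assms(4))
        subgoal using q(9) by simp
        subgoal using r0 by simp
        subgoal for m2 w2
         apply (elim conjE)
         subgoal premises u
         proof -
          have d: "m2 11 = int i0" "m2 13 = 2 * int n - int t" "m2 40 = ?y t" "m2 41 = F ^ (8 * t)"
           using sameD[OF u(3)] q by auto
          have a: "nat (64 + int n + int i0) = 64 + n + i0" by linarith
          have ci: "m2 (64 + n + i0) = ?r t i0 mod F ^ 8" using u(5) i0n by simp
          have s2: "same ?X m m2" by (rule same_trans[OF q(5) u(3)]) auto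
          have u4: "\<forall>i<n. m2 (64 + i) = ?r (Suc t) i \<and> mag 15 (?r (Suc t) i)" using u(4) c' by simp
          note [simp] = coreD[OF u(2)] u(1,2) d a ci
          show ?thesis
           apply (rule wp_one)
           apply ((rule wp_Seq)?, rule wps, (simp?, rule ev_refl), (simp?, rule ev_refl), (simp?, rule ev_refl))+
           subgoal using s2 u4 ly by (simp add: power_add)
           using i0n q(2) by (simp_all add: big[OF bY tn] big[OF byy] big[OF bp tn] small[OF mag_mod[of 8]])
            (use wbn q(2) i0n in linarith)+
         qed
         done
        done
      qed
      done
     subgoal by (simp add: mult.assoc)
     subgoal using wbn by simp
     subgoal using big[of 0 1] by (simp add: mag_def)
     subgoal by simp
     subgoal using i0n small[of 0 1] by (simp add: mag_def)
     using i0n wbn by simp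
   qed
   done
  done
qed

end

text \<open>For the error \<open>e = 1 - Y X\<close> the new error is \<open>e ^ 2\<close>; the
  reductions modulo \<open>N\<close> only add multiples of \<open>N\<close>.\<close>

lemma newton_inverse_step:
 fixes N Y X e :: int
 assumes "N dvd (1 - Y * X) - e"
 shows "N dvd (1 - Y * ((X * (2 - Y * X mod N)) mod N)) - e ^ 2"
proof -
 define q1 where "q1 = (Y * X) div N"
 define q2 where "q2 = (X * (2 - Y * X mod N)) div N"
 have 1: "Y * X mod N = Y * X - N * q1" unfolding q1_def by (simp add: minus_mult_div_eq_mod)
 have 2: "(X * (2 - Y * X mod N)) mod N = X * (2 - (Y * X - N * q1)) - N * q2"
  unfolding q2_def 1[symmetric] by (simp add: minus_mult_div_eq_mod)
 have "(1 - Y * ((X * (2 - Y * X mod N)) mod N)) - e ^ 2 =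
   ((1 - Y * X) - e) * ((1 - Y * X) + e) + N * (Y * q2 - Y * X * q1)"
  unfolding 2 by (simp add: algebra_simps power2_eq_square)
 then show ?thesis using assms by (metis dvd_add dvd_mult2 dvd_triv_left)
qed

context eig_ram begin

lemma mag_div_mul: "mag k v \<Longrightarrow> j \<le> k \<Longrightarrow> mag (Suc k) (v div F ^ j * F ^ j)"
 using mag_sub[of k v k "v mod F ^ j"] mag_mono[OF mag_mod, of j k v] by (simp add: minus_mod_eq_div_mult)

lemma mag_mod_le: "j \<le> k \<Longrightarrow> mag k (v mod F ^ j)"
 using mag_mono[OF mag_mod] .

lemma wp_inverse_test:
 assumes "m 40 = Y" "m 41 = F ^ (16 * n)" "m 42 = X" "mag (16 * n) Y" "mag (16 * n) X"
  and Q: "\<And>v. Q (m(43 := Y * X mod F ^ (16 * n) - 1, 51 := v)) w"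
 shows "wp inverse_test Q m w"
proof -
 let ?N = "F ^ (16 * n)"
 have b1: "mag (32 * n) (Y * X)" using mag_mul[OF assms(4,5)] by simp
 have b2: "mag (32 * n) (Y * X div ?N)" using mag_div[OF b1] Fpos by simp
 have b3: "mag (Suc (32 * n)) (Y * X div ?N * ?N)" using mag_div_mul[OF b1, of "16 * n"] by simp
 have b4: "mag (32 * n) (Y * X mod ?N)" by (rule mag_mod_le) simp
 have b5: "mag (Suc (Suc (32 * n))) (Y * X mod ?N - 1)"
  using mag_mono[OF mag_sub[OF b4 mag_num[of 1]], of "Suc (Suc (32 * n))"] by simp
 note [simp] = assms(1-3) minus_div_mult_eq_mod
 have Q': "Q (m(43 := Y * X, 51 := v', 51 := v, 43 := u, 43 := Y * X mod ?N - 1)) w" for v v' u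
 proof -
  have "m(43 := Y * X, 51 := v', 51 := v, 43 := u, 43 := Y * X mod ?N - 1) = m(43 := Y * X mod ?N - 1, 51 := v)" by auto
  then show ?thesis using Q by simp
 qed
 show ?thesis unfolding inverse_test_def
  apply (rule wp_one)
  apply ((rule wp_Seq)?, rule wps, (simp?, rule ev_refl), (simp?, rule ev_refl), (simp?, rule ev_refl))+
  subgoal by (rule Q')
  by (simp_all add: big[OF b1] big[OF b2] big[OF b3] big[OF b4] big[OF b5])
qed

text \<open>The start 1 has the error \<open>1 - Y\<close>, a multiple of \<open>F ^ 8\<close>.
  After \<open>l\<close> steps the error is its power with exponent \<open>2 ^ l\<close>, which
  \<open>F ^ (16 n)\<close> divides once \<open>2 ^ l \<ge> 2 n\<close>.\<close>

lemma wp_invert_mod: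
 assumes "core m" "m 40 = Y" "m 41 = F ^ (16 * n)" "0 \<le> Y" "Y < F ^ (16 * n)" "F ^ 8 dvd Y - 1" and K: "2 * n \<le> 2 ^ K"
 shows "wp (invert_mod K) (\<lambda>m' w'. w' = w \<and> core m' \<and> same {42,43,51} m m' \<and> 0 \<le> m' 42 \<and> m' 42 < F ^ (16 * n) \<and>
  F ^ (16 * n) dvd Y * m' 42 - 1) m w"
proof -
 let ?N = "F ^ (16 * n)"
 have N1: "?N > 1" using F n0 by (intro one_less_power) auto
 have N0: "?N > 0" using N1 by simp
 have mY: "mag (16 * n) Y" using assms(4,5) unfolding mag_def by simp
 have m1: "mag (16 * n) 1" using N1 unfolding mag_def by simp
 \<comment> \<open>The loop stops at the first exact inverse, which may come early; so the number of
   iterations is the least \<open>l\<close> that works, and \<open>K\<close> only bounds it.\<close>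
 define L where "L = (LEAST l. ?N dvd (1 - Y) ^ (2 ^ l))"
 have dK: "?N dvd (1 - Y) ^ (2 ^ K)"
 proof -
  have "F ^ 8 dvd 1 - Y" using assms(6) by (metis dvd_minus_iff minus_diff_eq)
  then have "(F ^ 8) ^ (2 ^ K) dvd (1 - Y) ^ (2 ^ K)" by (rule dvd_power_same)
  moreover have "?N dvd (F ^ 8) ^ (2 ^ K)" unfolding power_mult[symmetric] using K by (intro le_imp_power_dvd) simp
  ultimately show ?thesis using dvd_trans by blast
 qed
 have L: "?N dvd (1 - Y) ^ (2 ^ L)" "L \<le> K" "\<And>l. l < L \<Longrightarrow> \<not> ?N dvd (1 - Y) ^ (2 ^ l)"
  unfolding L_def using LeastI[of "\<lambda>l. ?N dvd (1 - Y) ^ (2 ^ l)", OF dK] Least_le[of "\<lambda>l. ?N dvd (1 - Y) ^ (2 ^ l)", OF dK]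
   not_less_Least by blast+
 let ?I = "\<lambda>l m' w'. w' = w \<and> core m' \<and> same {42,43,51} m m' \<and> 0 \<le> m' 42 \<and> m' 42 < ?N \<and> m' 43 = Y * m' 42 mod ?N - 1 \<and>
   ?N dvd (1 - Y * m' 42) - (1 - Y) ^ (2 ^ l)"
 have res: "(?N dvd (1 - Y) ^ (2 ^ l)) = (Y * X mod ?N = 1)" if "?N dvd (1 - Y * X) - (1 - Y) ^ (2 ^ l)" for X l
 proof -
  have "(?N dvd (1 - Y) ^ (2 ^ l)) = (?N dvd 1 - Y * X)"
   using that by (metis dvd_diff_right_iff dvd_diff_left_iff)
  also have "\<dots> = (Y * X mod ?N = 1)"
   using N1 by (metis dvd_minus_iff minus_diff_eq mod_eq_dvd_iff mod_pos_pos_trivial zero_le_one)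
  finally show ?thesis .
 qed
 \<comment> \<open>The guard \<open>Y X mod N - 1\<close> has to be positive until the inverse is
   reached. Residue 0 is impossible because \<open>Y X\<close> is 1 modulo \<open>F\<close>, and
   residue 1 means that the inverse has been found.\<close>
 have pos: "Y * X mod ?N > 0" if "?N dvd (1 - Y * X) - (1 - Y) ^ (2 ^ l)" for X l
 proof (rule ccontr)
  assume "\<not> Y * X mod ?N > 0"
  then have "Y * X mod ?N = 0" using pos_mod_sign[OF N0, of "Y * X"] by linarith
  then have "?N dvd Y * X" by (simp add: dvd_eq_mod_eq_0)
  moreover have "F dvd ?N" using n0 by (simp add: dvd_power)
  ultimately have 1: "F dvd Y * X" "F dvd (1 - Y * X) - (1 - Y) ^ (2 ^ l)" using that dvd_trans by blast+
  have "F dvd 1 - Y" using assms(6) by (metis dvd_minus_iff minus_diff_eq dvd_trans dvd_power zero_less_numeral)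
  then have "F dvd (1 - Y) ^ (2 ^ l)" by (meson dvd_trans dvd_power pos2 zero_less_power)
  then have "F dvd 1 - Y * X" using 1(2) dvd_diff_right_iff dvd_diff_left_iff by blast
  then have "F dvd 1" using 1(1) dvd_diff_left_iff by blast
  then show False using F by simp
 qed
 note [simp] = assms(1,2,3)
 show ?thesis
  unfolding invert_mod_def
  apply ((rule wp_Seq)?, rule wps, (simp?, rule ev_refl), (simp?, rule ev_refl), (simp?, rule ev_refl))
  apply (rule wp_Seq, rule wp_inverse_test[where Y = Y and X = 1])
  subgoal by simp
  subgoal by simp
  subgoal by simp
  subgoal by (rule mY)
  subgoal by (rule m1)
  apply (rule wp_Loop[where L = L and I = ?I])
  subgoal using N1 by simp
  subgoal by (rule L(2))
  subgoal for v l m' w'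
   apply (elim conjE)
   subgoal premises p
   proof -
    define X where "X = m' 42"
    have cY: "m' 40 = Y" "m' 41 = ?N" "m' 42 = X" using sameD[OF p(4)] X_def by auto
    have mX: "mag (16 * n) X" using p(5,6) unfolding mag_def X_def by simp
    have b0: "mag (Suc (16 * n)) (2 - Y * X mod ?N)"
    proof -
     have "2 * ?N \<le> F * ?N" using F N0 by (intro mult_right_mono) auto
     then show ?thesis using pos_mod_bound[OF N0, of "Y * X"] pos_mod_sign[OF N0, of "Y * X"] N1
      unfolding mag_def power_Suc by linarith
    qed
    have b1: "mag (Suc (32 * n)) (X * (2 - Y * X mod ?N))" using mag_mul[OF mX b0] by simp
    have b2: "mag (Suc (32 * n)) (X * (2 - Y * X mod ?N) div ?N)" using mag_div[OF b1] N0 by simp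
    have b3: "mag (Suc (Suc (32 * n))) (X * (2 - Y * X mod ?N) div ?N * ?N)" using mag_div_mul[OF b1, of "16 * n"] by simp
    have b4: "mag (16 * n) (X * (2 - Y * X mod ?N) mod ?N)" by (rule mag_mod)
    have t: "m' 43 = Y * X mod ?N - 1" using p(7) X_def by simp
    have t0: "m' 43 > 0" using pos[OF p(8)] res[OF p(8)] L(3)[OF p(1)] p(7) by auto
    have st: "?N dvd (1 - Y * (X * (2 - Y * X mod ?N) mod ?N)) - (1 - Y) ^ (2 * 2 ^ l)"
     using newton_inverse_step[OF p(8)] unfolding X_def by (simp add: power_mult[symmetric] mult.commute)
    note [simp] = cY t p(2,3) minus_div_mult_eq_mod
    show ?thesis
     apply (rule conjI)
     subgoal by (rule t0)
     apply (rule wp_one)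
     apply ((rule wp_Seq)?, rule wps, (simp?, rule ev_refl), (simp?, rule ev_refl), (simp?, rule ev_refl))
     apply ((rule wp_Seq)?, rule wps, (simp?, rule ev_refl), (simp?, rule ev_refl), (simp?, rule ev_refl))
     apply ((rule wp_Seq)?, rule wps, (simp?, rule ev_refl), (simp?, rule ev_refl), (simp?, rule ev_refl))
     apply ((rule wp_Seq)?, rule wps, (simp?, rule ev_refl), (simp?, rule ev_refl), (simp?, rule ev_refl))
     apply ((rule wp_Seq)?, rule wps, (simp?, rule ev_refl), (simp?, rule ev_refl), (simp?, rule ev_refl))
     apply (rule wp_inverse_test[where Y = Y and X = "X * (2 - Y * X mod ?N) mod ?N"])
     subgoal by simp
     subgoal by simp
     subgoal by simp
     subgoal by (rule mY)
     subgoal by (rule b4)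
     subgoal using p(4) N0 st by simp
     by (simp_all add: big[OF b0] big[OF b1] big[OF b2] big[OF b3] big[OF b4])
   qed
   done
  subgoal for v m' w'
   apply (elim conjE)
   subgoal premises p
   proof -
    have "Y * m' 42 mod ?N = 1" using res[OF p(7)] L(1) by simp
    then have "?N dvd Y * m' 42 - 1" by (metis mod_eq_dvd_iff mod_mod_trivial)
    then show ?thesis using p \<open>Y * m' 42 mod ?N = 1\<close> by simp
   qed
   done
  using big[OF m1] by simp
qed

lemma wp_sym_residue:
 assumes "core m" "m 43 = v" "m 41 = F ^ (16 * n)" "mag (32 * n) v"
  and y: "F ^ (16 * n) dvd v - y" "\<bar>y\<bar> \<le> F ^ (14 * n)"
 shows "wp sym_residue (\<lambda>m' w'. w' = w \<and> core m' \<and> same {43,45,51,52} m m' \<and> m' 45 = y) m w"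
proof -
 let ?N = "F ^ (16 * n)"
 have N0: "?N > 0" using Fpos by simp
 have evN: "even ?N" using evenF n0 by simp
 have "2 * F ^ (14 * n) < F * F ^ (14 * n)" using F by (intro mult_strict_right_mono) auto
 also have "\<dots> \<le> ?N" unfolding power_Suc[symmetric] using n0 Fpos by (intro power_increasing) auto
 finally have lt: "2 * \<bar>y\<bar> < ?N" using y(2) by linarith
 have r: "(v + ?N div 2) mod ?N - ?N div 2 = y"
  by (rule symmetric_residue[OF y(1) _ _ evN]) (use lt in linarith)+
 have b1: "mag (16 * n) (?N div 2)" using mag_div[OF mag_pow] by simp
 have b2: "mag (Suc (32 * n)) (v + ?N div 2)" using mag_mono[OF mag_add[OF assms(4) b1], of "Suc (32 * n)"] by simp
 have b3: "mag (Suc (32 * n)) ((v + ?N div 2) div ?N)" using mag_div[OF b2] N0 by simp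
 have b4: "mag (Suc (Suc (32 * n))) ((v + ?N div 2) div ?N * ?N)" using mag_div_mul[OF b2, of "16 * n"] by simp
 have b5: "mag (16 * n) ((v + ?N div 2) mod ?N)" by (rule mag_mod)
 have b6: "mag (14 * n) y" using y(2) unfolding mag_def .
 note [simp] = assms(1-3) r minus_div_mult_eq_mod
 show ?thesis unfolding sym_residue_def
  apply ((rule wp_Seq)?, rule wps, (simp?, rule ev_refl), (simp?, rule ev_refl), (simp?, rule ev_refl))+
  subgoal by simp
  using big[OF mag_num[of 2]] by (simp_all add: big[OF b1] big[OF b2] big[OF b3] big[OF b4] big[OF b5] big[OF b6])
qed

lemma A_le: "i < n \<Longrightarrow> j < n \<Longrightarrow> \<bar>A i j\<bar> \<le> F"
proof -
 assume i: "i < n" and j: "j < n"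
 have "A i j = (\<Sum>l<n. of_bool (l = j) * A i l)" by (rule sum_of_bool_delta(2)[OF j, symmetric])
 also have "\<dots> = (\<Sum>l<nz. of_bool (row l = i) * (val l * of_bool (col l = j)))"
  using ents[OF i, of "\<lambda>l. of_bool (l = j)"] by (simp only: mult.commute)
 finally have "\<bar>A i j\<bar> \<le> (\<Sum>l<nz. \<bar>of_bool (row l = i) * (val l * of_bool (col l = j))\<bar>)" by (simp only: sum_abs)
 also have "\<dots> \<le> (\<Sum>l<nz. \<bar>val l\<bar>)" by (intro sum_mono) auto
 finally show ?thesis using vals by simp
qed

lemma shifted_entry_le:
 assumes "mag 5 s" "i < k" "j < k" "k \<le> n"
 shows "\<bar>shifted (F ^ 8) Bm s k $$ (i,j)\<bar> \<le> 4 * F ^ 13"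
proof -
 have "\<bar>Bm i j\<bar> \<le> \<bar>F ^ 4 * A i j\<bar> + \<bar>of_bool (i = j) * (F * D i)\<bar>" unfolding Bm_def by (rule abs_triangle_ineq)
 also have "\<bar>F ^ 4 * A i j\<bar> \<le> F ^ 4 * F" using A_le[of i j] assms Fpos unfolding abs_mult by (intro mult_mono) auto
 also have "\<bar>of_bool (i = j) * (F * D i)\<bar> \<le> F ^ 3" using mag_FD[of i] assms Fpos unfolding mag_def by auto
 also have "F ^ 3 \<le> F ^ 5" using Fpos by (intro power_increasing) auto
 finally have "\<bar>Bm i j\<bar> \<le> 2 * F ^ 5" by (simp add: eval_nat_numeral)
 then have "\<bar>Bm i j - of_bool (i = j) * s\<bar> \<le> 3 * F ^ 5" using assms(1) Fpos unfolding mag_def by auto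
 then have "\<bar>F ^ 8 * (Bm i j - of_bool (i = j) * s)\<bar> \<le> F ^ 8 * (3 * F ^ 5)"
  using Fpos unfolding abs_mult by (intro mult_mono) auto
 also have "\<dots> = 3 * F ^ 13" by (simp add: power_add[symmetric])
 finally have "\<bar>of_bool (i = j) + F ^ 8 * (Bm i j - of_bool (i = j) * s)\<bar> \<le> 1 + 3 * F ^ 13" by auto
 moreover have "F ^ 13 \<ge> 1" using Fpos by (simp add: one_le_power)
 ultimately show ?thesis unfolding shifted_def using assms by simp
qed

lemma n4F: "int n * 4 \<le> F"
proof (cases "n \<le> 4")
 case True
 then show ?thesis using F by linarith
next
 case False
 then have "int n * 4 \<le> int n * int n" by (intro mult_left_mono) auto
 then show ?thesis using nF by linarith
qed

text \<open>Bounds the minors and cofactors of matrices with entries up to \<open>4 F ^ 13\<close>,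
  by \<open>4 n \<le> F\<close>. The modulus \<open>F ^ (16 n)\<close> is more than twice as large,
  so balanced residues recover them exactly.\<close>

lemma mag_power_bound: "k \<le> n \<Longrightarrow> (int k * (4 * F ^ 13)) ^ k \<le> F ^ (14 * n)"
proof -
 assume k: "k \<le> n"
 have "int k * (4 * F ^ 13) = (int k * 4) * F ^ 13" by simp
 also have "\<dots> \<le> F * F ^ 13" using n4F k Fpos by (intro mult_right_mono) auto
 finally have "int k * (4 * F ^ 13) \<le> F ^ 14" by (simp add: eval_nat_numeral)
 then have "(int k * (4 * F ^ 13)) ^ k \<le> (F ^ 14) ^ k" using Fpos by (intro power_mono) auto
 also have "\<dots> \<le> (F ^ 14) ^ n" using k Fpos by (intro power_increasing) (auto simp: one_le_power)
 finally show ?thesis by (simp add: power_mult[symmetric])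
qed

lemma det_le: "mag 5 s \<Longrightarrow> k \<le> n \<Longrightarrow> \<bar>det (shifted (F ^ 8) Bm s k)\<bar> \<le> F ^ (14 * n)"
proof -
 assume a: "mag 5 s" "k \<le> n"
 have "\<bar>det (shifted (F ^ 8) Bm s k)\<bar> \<le> (int k * (4 * F ^ 13)) ^ k"
  using shifted_entry_le[OF a(1) _ _ a(2)] Fpos by (intro abs_det_le[OF shifted_carrier]) auto
 then show ?thesis using mag_power_bound[OF a(2)] by simp
qed

lemma adj_le: "mag 5 s \<Longrightarrow> i < n \<Longrightarrow> j < n \<Longrightarrow> \<bar>adj_mat (shifted (F ^ 8) Bm s n) $$ (i,j)\<bar> \<le> F ^ (14 * n)"
proof -
 assume a: "mag 5 s" "i < n" "j < n"
 have "1 \<le> F ^ 13" using Fpos by (simp add: one_le_power)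
 then have "1 \<le> 4 * F ^ 13" by linarith
 then have "\<bar>adj_mat (shifted (F ^ 8) Bm s n) $$ (i,j)\<bar> \<le> (int n * (4 * F ^ 13)) ^ n"
  using a shifted_entry_le[OF a(1)] by (intro abs_adj_le[OF shifted_carrier]) auto
 then show ?thesis using mag_power_bound[of n] by simp
qed

lemma wp_inertia:
 assumes "core m" "mag 5 (m 9)" and K: "2 * n \<le> 2 ^ K"
 shows "wp (inertia n nz K) (\<lambda>m' w'. w' = w \<and> core m' \<and> same ({8} \<union> {10..20} \<union> {24} \<union> {40..45} \<union> {51,52}) m m' \<and>
  m' 8 = int (sign_changes (F ^ 8) Bm (m 9) n) \<and> m' 44 = det (shifted (F ^ 8) Bm (m 9) n) \<and> m' 10 = int n) m w"
proof -
 let ?X = "{8} \<union> {10..20} \<union> {24} \<union> {40..45} \<union> {51,52::nat}"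
 let ?d = "\<lambda>k. det (shifted (F ^ 8) Bm (m 9) k)" and ?sc = "\<lambda>k. sign_changes (F ^ 8) Bm (m 9) k"
 let ?N = "F ^ (16 * n)"
 have d0: "?d 0 = 1" by (simp add: shifted_def)
 have sc0: "?sc 0 = 0" by (simp add: sign_changes_def)
 have scn: "?sc k \<le> k" for k
  using card_mono[of "{..<k}" "{l. l < k \<and> ?d l * ?d (Suc l) < 0}"] unfolding sign_changes_def by auto
 have md: "mag (14 * n) (?d k)" if "k \<le> n" for k using det_le[OF assms(2) that] unfolding mag_def .
 note [simp] = assms(1) coreD[OF assms(1)]
 show ?thesis unfolding inertia_def
  apply ((rule wp_Seq)?, rule wps, (simp?, rule ev_refl), (simp?, rule ev_refl), (simp?, rule ev_refl))
  apply ((rule wp_Seq)?, rule wps, (simp?, rule ev_refl), (simp?, rule ev_refl), (simp?, rule ev_refl))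
  apply ((rule wp_Seq)?, rule wps, (simp?, rule ev_refl), (simp?, rule ev_refl), (simp?, rule ev_refl))
  apply ((rule wp_Seq)?, rule wps, (simp?, rule ev_refl), (simp?, rule ev_refl), (simp?, rule ev_refl))
  apply (rule wp_Loop[where L = n and I = "\<lambda>k m' w'. w' = w \<and> core m' \<and> same ?X m m' \<and> m' 24 = int n - int k \<and> m' 10 = int k \<and>
   m' 44 = ?d k \<and> m' 8 = int (?sc k)"])
  subgoal by (simp add: d0 sc0)
  subgoal by simp
  subgoal for k m' w'
   apply (elim conjE)
   subgoal premises p
   proof -
    have c9: "m' 9 = m 9" using sameD[OF p(4), of 9] by simp
    note [simp] = p(2,3,5-8) coreD[OF p(3)] c9
    have kn: "int k < int n" "k < n" using p(1) by auto
    show ?thesis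
     apply (rule conjI)
     subgoal using p(1) by simp
     apply (rule wp_one)
     apply ((rule wp_Seq)?, rule wps, (simp?, rule ev_refl), (simp?, rule ev_refl), (simp?, rule ev_refl))
     apply ((rule wp_Seq)?, rule wps, (simp?, rule ev_refl), (simp?, rule ev_refl), (simp?, rule ev_refl))
     apply ((rule wp_Seq)?, rule wps, (simp?, rule ev_refl), (simp?, rule ev_refl), (simp?, rule ev_refl))
     apply (rule wp_Seq, rule wp_mono[OF wp_lift_entry[where kk = "Suc k" and ?i0.0 = k and ?j0.0 = k]])
     subgoal by simp
     subgoal using assms(2) by simp
     subgoal by simp
     subgoal using p(1) by simp
     subgoal by simp
     subgoal by simp
     subgoal by simp
     subgoal by simp
     subgoal for m1 w1
      apply (elim conjE)
      subgoal premises q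
      proof -
       let ?Y = "lifted (F ^ 8) Bm (m 9) (Suc k) k (2 * n) k"
       have s1: "same ?X m m1" by (rule same_trans[OF _ q(4), of ?X]) (use p(4) in auto)
       have c1: "m1 24 = int n - int k" "m1 10 = 1 + int k" "m1 44 = ?d k" "m1 8 = int (?sc k)"
        using sameD[OF q(4)] by auto
       have Y: "0 \<le> ?Y" "?Y < ?N" using lifted_bounds[of "F ^ 8" Bm "m 9" "Suc k" k "2 * n" k] Fpos
        by (auto simp: power_mult[symmetric])
       have Y1: "F ^ 8 dvd ?Y - 1" using n0 by (intro lifted_mod) simp
       have dv: "?N dvd ?d (Suc k) * ?Y - ?d k"
        using lifted_adj[of k "Suc k" k "F ^ 8" "2 * n" Bm "m 9"] by (simp add: adj_last_minor power_mult[symmetric])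
       note [simp] = q(2,3) coreD[OF q(3)] c1
       show ?thesis
        apply (rule wp_Seq, rule wp_mono[OF wp_invert_mod[where Y = ?Y]])
        subgoal by simp
        subgoal using q(5) by simp
        subgoal using q(6) by simp
        subgoal by (rule Y(1))
        subgoal by (rule Y(2))
        subgoal by (rule Y1)
        subgoal by (rule K)
        subgoal for m2 w2
         apply (elim conjE)
         subgoal premises r
         proof -
          define Z where "Z = m2 42"
          have c2: "m2 24 = int n - int k" "m2 10 = 1 + int k" "m2 44 = ?d k" "m2 8 = int (?sc k)" "m2 41 = ?N"
           using sameD[OF r(3)] q(6) by auto
          have s2: "same ?X m m2" by (rule same_trans[OF s1 r(3)]) auto
          have mZ: "mag (16 * n) Z" using r(4,5) unfolding mag_def Z_def by simp
          have b1: "mag (32 * n) (?d k * Z)"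
           using mag_mono[OF mag_mul[OF md mZ], of k "32 * n"] p(1) by simp
          \<comment> \<open>Division by the lifted entry: modulo \<open>F ^ (16 n)\<close> the
            product of \<open>?Y\<close> and \<open>Z\<close> is 1, and
            \<open>?d (Suc k) * ?Y\<close> is \<open>?d k\<close>.\<close>
          have dv2: "?N dvd ?d k * Z - ?d (Suc k)"
          proof -
           have "?d k * Z - ?d (Suc k) = ?d (Suc k) * (?Y * Z - 1) - Z * (?d (Suc k) * ?Y - ?d k)"
            by (simp add: algebra_simps)
           then show ?thesis using dv r(6) unfolding Z_def by (metis dvd_diff dvd_mult)
          qed
          note [simp] = r(1,2) coreD[OF r(2)] c2 Z_def[symmetric]
          show ?thesis
           apply ((rule wp_Seq)?, rule wps, (simp?, rule ev_refl), (simp?, rule ev_refl), (simp?, rule ev_refl))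
           apply (rule wp_Seq, rule wp_mono[OF wp_sym_residue[where v = "?d k * Z" and y = "?d (Suc k)"]])
           subgoal by simp
           subgoal by simp
           subgoal by simp
           subgoal by (rule b1)
           subgoal by (rule dv2)
           subgoal using det_le[OF assms(2), of "Suc k"] p(1) by simp
           subgoal for m3 w3
            apply (elim conjE)
            subgoal premises t
            proof -
             have c3: "m3 24 = int n - int k" "m3 10 = 1 + int k" "m3 44 = ?d k" "m3 8 = int (?sc k)"
              using sameD[OF t(3)] by auto
             have s3: "same ?X m m3" by (rule same_trans[OF _ t(3), of ?X]) (use s2 in auto)
             have b2: "mag (28 * n) (?d k * ?d (Suc k))" using mag_mul[OF md md, of k "Suc k"] p(1) by simp
             note b3 = mag_minus[OF b2]
             have sk: "?sc (Suc k) = ?sc k + of_bool (?d k * ?d (Suc k) < 0)" by (rule sign_changes_Suc)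
             have b4: "\<bar>?d (Suc k)\<bar> < 2 ^ nB" using big[OF md[of "Suc k"]] p(1) by simp
             have b5: "int (?sc k) \<le> int k" using scn[of k] by simp
             note [simp] = t(1,2,4) coreD[OF t(2)] c3
             show ?thesis
              apply (rule wp_one)
              apply ((rule wp_Seq)?, rule wps, (simp?, rule ev_refl), (simp?, rule ev_refl), (simp?, rule ev_refl))
              apply ((rule wp_Seq)?, rule wps, (simp?, rule ev_refl), (simp?, rule ev_refl), (simp?, rule ev_refl))
              apply (rule wp_Seq, rule wp_Cond)
              subgoal
               apply ((rule wp_Seq)?, rule wps, (simp?, rule ev_refl), (simp?, rule ev_refl), (simp?, rule ev_refl))+
               subgoal using s3 by (simp add: sk)
               using b4 by simp_all (use wbn kn b5 in linarith)+
              subgoal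
               apply ((rule wp_Seq)?, rule wps, (simp?, rule ev_refl), (simp?, rule ev_refl), (simp?, rule ev_refl))+
               subgoal using s3 by (simp add: sk)
               using b4 by simp_all (use wbn kn b5 in linarith)+
              using big[OF b2] big[OF b3] by simp_all
            qed
            done
           using big[OF b1] by simp
         qed
         done
        done
      qed
      done
     using wbn kn by simp_all
   qed
   done
  subgoal by simp
  subgoal using wbn n_le by simp
  subgoal by simp
  subgoal using big[of 0 1] by (simp add: mag_def)
  using wbn by simp
qed

lemma wp_adj_entry:
 assumes "core m" "mag 5 (m 9)" "m 10 = int n" "m 11 = int i0" "i0 < n" "m 12 = int j0" "j0 < n"
  "m 44 = det (shifted (F ^ 8) Bm (m 9) n)"
 shows "wp (adj_entry n nz) (\<lambda>m' w'. w' = w \<and> core m' \<and> same ({13..20} \<union> {40,41,43,45,51,52}) m m' \<and>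
  m' 45 = adj_mat (shifted (F ^ 8) Bm (m 9) n) $$ (i0,j0) \<and> m' 41 = F ^ (16 * n)) m w"
proof -
 let ?d = "det (shifted (F ^ 8) Bm (m 9) n)" and ?Y = "lifted (F ^ 8) Bm (m 9) n j0 (2 * n) i0"
 have md: "mag (14 * n) ?d" using det_le[OF assms(2)] unfolding mag_def by simp
 have mY: "mag (16 * n) ?Y"
  using lifted_bounds[of "F ^ 8" Bm "m 9" n j0 "2 * n" i0] Fpos unfolding mag_def by (auto simp: power_mult[symmetric])
 have b: "mag (32 * n) (?d * ?Y)" using mag_mono[OF mag_mul[OF md mY], of "32 * n"] by simp
 have dv: "F ^ (16 * n) dvd ?d * ?Y - adj_mat (shifted (F ^ 8) Bm (m 9) n) $$ (i0,j0)"
  using lifted_adj[OF assms(5,7), of "F ^ 8" "2 * n" Bm "m 9"] by (simp add: power_mult[symmetric])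
 show ?thesis unfolding adj_entry_def
  apply (rule wp_Seq, rule wp_mono[OF wp_lift_entry[OF assms(1-3) order_refl assms(4-7)]])
  subgoal for m1 w1
   apply (elim conjE)
   subgoal premises q
   proof -
    have c1: "m1 44 = ?d" using sameD[OF q(3), of 44] assms(8) by simp
    note [simp] = q(1,2,4,5) c1
    show ?thesis
     apply ((rule wp_Seq)?, rule wps, (simp?, rule ev_refl), (simp?, rule ev_refl), (simp?, rule ev_refl))
     apply (rule wp_mono[OF wp_sym_residue[where v = "?d * ?Y" and y = "adj_mat (shifted (F ^ 8) Bm (m 9) n) $$ (i0,j0)"]])
     subgoal by simp
     subgoal by simp
     subgoal by simp
     subgoal by (rule b)
     subgoal by (rule dv)
     subgoal by (rule adj_le[OF assms(2,5,7)])
     subgoal for m2 w2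
      apply (elim conjE)
      subgoal premises t
      proof -
       have "m2 41 = F ^ (16 * n)" using sameD[OF t(3), of 41] by simp
       moreover have "same ({13..20} \<union> {40,41,43,45,51,52}) m m2"
        by (rule same_trans[OF same_upd[OF _ q(3)] t(3)]) auto
       ultimately show ?thesis using t by simp
      qed
      done
     using big[OF b] by simp
   qed
   done
  done
qed

end

context eig_ram begin

abbreviation "sc s \<equiv> sign_changes (F ^ 8) Bm s n"
abbreviation "dt s \<equiv> det (shifted (F ^ 8) Bm s n)"
abbreviation "ad s i j \<equiv> adj_mat (shifted (F ^ 8) Bm s n) $$ (i,j)"

lemma wp_bisect:
 assumes "core m" "m 21 = int i" "i < n" and K: "2 * n \<le> 2 ^ K" and L: "2 * F ^ 5 = 2 ^ L"
  and br: "sc (- (F ^ 5)) \<le> i" "i < sc (F ^ 5)"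
 shows "wp (bisect n nz K L) (\<lambda>m' w'. w' = w \<and> core m' \<and> same ({8..20} \<union> {22..25} \<union> {40..45} \<union> {51,52}) m m' \<and>
  mag 5 (m' 9) \<and> sc (m' 9) \<le> i \<and> i < sc (m' 9 + 1) \<and> m' 44 = dt (m' 9) \<and> m' 10 = int n) m w"
proof -
 let ?X = "{8..20} \<union> {22..25} \<union> {40..45} \<union> {51,52::nat}"
 have b1: "mag 5 (F ^ 5)" "mag 5 (- (F ^ 5))" using mag_pow[of 5] mag_minus by auto
 have b2: "mag 6 (F ^ 5 + F ^ 5)" using mag_add[OF b1(1) b1(1)] by simp
 have F5: "F ^ 4 * F = F ^ 5" by (simp add: eval_nat_numeral)
 have F51: "F ^ 5 \<ge> 1" using Fpos by (simp add: one_le_power)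
 have b3: "\<bar>2 * F ^ 5\<bar> < 2 ^ wB" "\<bar>2 * F ^ 5 - 1\<bar> < 2 ^ wB" using small[OF b2] F51 by auto
 note [simp] = assms(1,2) coreD[OF assms(1)] F5
 show ?thesis unfolding bisect_def
  apply (rule wp_one)
  apply ((rule wp_Seq)?, rule wps, (simp?, rule ev_refl), (simp?, rule ev_refl), (simp?, rule ev_refl))
  apply ((rule wp_Seq)?, rule wps, (simp?, rule ev_refl), (simp?, rule ev_refl), (simp?, rule ev_refl))
  apply ((rule wp_Seq)?, rule wps, (simp?, rule ev_refl), (simp?, rule ev_refl), (simp?, rule ev_refl))
  apply ((rule wp_Seq)?, rule wps, (simp?, rule ev_refl), (simp?, rule ev_refl), (simp?, rule ev_refl))
  \<comment> \<open>The interval has length exactly \<open>2 ^ (L - k)\<close>, since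
    \<open>2 F ^ 5\<close> is a power of two; it is halved without remainder and reaches length 1
    after exactly \<open>L\<close> rounds.\<close>
  apply (rule wp_Seq, rule wp_Loop[where L = L and I = "\<lambda>k m' w'. w' = w \<and> core m' \<and> same ?X m m' \<and> sc (m' 22) \<le> i \<and> i < sc (m' 23) \<and>
   m' 23 - m' 22 = 2 ^ (L - k) \<and> - (F ^ 5) \<le> m' 22 \<and> m' 23 \<le> F ^ 5 \<and> m' 25 = m' 23 - m' 22 - 1"])
  subgoal using br L by simp
  subgoal by simp
  subgoal for k m' w'
   apply (elim conjE)
   subgoal premises p
   proof -
    define lo where "lo = m' 22"
    obtain j where j: "L - k = Suc j" using p(2) by (cases "L - k") auto
    have h: "m' 22 = lo" "m' 23 = lo + 2 * 2 ^ j" using p(8) j unfolding lo_def by auto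
    have h25: "m' 25 = 2 * 2 ^ j - 1" using p(11) h by simp
    have c: "m' 21 = int i" using sameD[OF p(5), of 21] by simp
    have mid: "(lo + (lo + 2 * 2 ^ j)) div 2 = lo + 2 ^ j" by simp
    have jk: "L - Suc k = j" using j by simp
    have lb: "- (F ^ 5) \<le> lo" "lo + 2 * 2 ^ j \<le> F ^ 5" using p(9,10) h by auto
    have j0: "(2::int) ^ j \<ge> 1" by simp
    have lb': "lo + 2 ^ j \<le> F ^ 5" "- (F ^ 5) \<le> lo + 2 ^ j" using lb j0 by linarith+
    have ml: "mag 5 lo" "mag 5 (lo + 2 * 2 ^ j)" "mag 5 (lo + 2 ^ j)" using lb j0 unfolding mag_def by linarith+
    have ms: "mag 6 (lo + (lo + 2 * 2 ^ j))" using mag_add[OF ml(1,2)] by simp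
    have md: "\<bar>2 ^ j\<bar> < (2::int) ^ wB" "\<bar>2 ^ j - 1\<bar> < (2::int) ^ wB" using b3 lb j0 by linarith+
    note [simp] = p(3,4) coreD[OF p(4)] h h25 c mid
    show ?thesis
     apply (rule conjI)
     subgoal unfolding h25 using j0 by linarith
     apply ((rule wp_Seq)?, rule wps, (simp?, rule ev_refl), (simp?, rule ev_refl), (simp?, rule ev_refl))
     apply ((rule wp_Seq)?, rule wps, (simp?, rule ev_refl), (simp?, rule ev_refl), (simp?, rule ev_refl))
     apply ((rule wp_Seq)?, rule wps, (simp?, rule ev_refl), (simp?, rule ev_refl), (simp?, rule ev_refl))
     apply (rule wp_Seq, rule wp_mono[OF wp_inertia[OF _ _ K]])
     subgoal by simp
     subgoal using ml(3) by simp
     subgoal for m1 w1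
      apply (elim conjE)
      subgoal premises q
      proof -
       have c1: "m1 21 = int i" "m1 22 = lo" "m1 23 = lo + 2 * 2 ^ j" "m1 9 = lo + 2 ^ j"
        using sameD[OF q(3)] by auto
       have q8: "m1 8 = int (sc (lo + 2 ^ j))" using q(4) by simp
       have s1: "same ?X m m1" by (rule same_trans[OF same_upd[OF _ same_upd[OF _ same_upd[OF _ p(5)]]] q(3)]) auto
       have scn: "sc (lo + 2 ^ j) \<le> n"
        using card_mono[of "{..<n}" "{l. l < n \<and> det (shifted (F ^ 8) Bm (lo + 2 ^ j) l) * det (shifted (F ^ 8) Bm (lo + 2 ^ j) (Suc l)) < 0}"]
        unfolding sign_changes_def by auto
       have bb: "int (sc (lo + 2 ^ j)) \<le> int n" "int i < int n" using scn assms(3) by auto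
       note [simp] = q(1,2) coreD[OF q(2)] c1 q8
       show ?thesis
        apply (rule wp_one)
        apply ((rule wp_Seq)?, rule wps, (simp?, rule ev_refl), (simp?, rule ev_refl), (simp?, rule ev_refl))
        apply (rule wp_Seq, rule wp_Cond)
        subgoal
         apply ((rule wp_Seq)?, rule wps, (simp?, rule ev_refl), (simp?, rule ev_refl), (simp?, rule ev_refl))+
         subgoal using s1 p(6) lb lb' h by (simp add: jk)
         using small[OF ml(3)] md by simp_all
        subgoal
         apply ((rule wp_Seq)?, rule wps, (simp?, rule ev_refl), (simp?, rule ev_refl), (simp?, rule ev_refl))+
         subgoal using s1 p(7) lb lb' h by (simp add: jk)
         using small[OF ml(3)] md by simp_all
        using wbn bb by simp
      qed
      done
     subgoal using small[OF ml(3)] by simp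
     subgoal using wbn by simp
     subgoal using small[OF ms] by simp
     done
   qed
   done
  subgoal for m' w'
   apply (elim conjE)
   subgoal premises p
   proof -
    have h: "m' 23 = m' 22 + 1" "m' 25 = 0" using p(7,10) by auto
    have ml: "mag 5 (m' 22)" using p(8,9) h F51 unfolding mag_def by linarith
    note [simp] = p(2,3) coreD[OF p(3)]
    show ?thesis
     apply (rule conjI)
     subgoal using h by simp
     apply ((rule wp_Seq)?, rule wps, (simp?, rule ev_refl), (simp?, rule ev_refl), (simp?, rule ev_refl))
     apply (rule wp_mono[OF wp_inertia[OF _ _ K]])
     subgoal by simp
     subgoal using ml by simp
     subgoal for m1 w1
      apply (elim conjE)
      subgoal premises q
      proof -
       have c1: "m1 9 = m' 22" using sameD[OF q(3), of 9] by simp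
       have s1: "same ?X m m1" by (rule same_trans[OF same_upd[OF _ p(4)] q(3)]) auto
       show ?thesis using q c1 s1 ml p(5,6) h by simp
      qed
      done
     using small[OF ml] by simp
   qed
   done
  using b3 small[OF b1(1)] F51 by simp_all
qed

lemma wp_select_column:
 assumes "core m" "mag 5 (m 9)" "m 10 = int n" "m 44 = dt (m 9)"
 shows "wp (select_column n nz) (\<lambda>m' w'. w' = w \<and> core m' \<and> same ({11..20} \<union> {24,26,27} \<union> {40,41,43,45,47,51,52}) m m' \<and>
  (\<exists>jj<n. m' 26 = int jj \<and> (\<forall>j<n. ad (m 9) j j * dt (m 9) \<le> max 0 (ad (m 9) jj jj * dt (m 9))))) m w"
proof -
 let ?X = "{11..20} \<union> {24,26,27} \<union> {40,41,43,45,47,51,52::nat}"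
 let ?d = "dt (m 9)" and ?a = "ad (m 9)"
 have md: "mag (14 * n) ?d" using det_le[OF assms(2)] unfolding mag_def by simp
 have ma: "mag (14 * n) (?a i j)" if "i < n" "j < n" for i j using adj_le[OF assms(2) that] unfolding mag_def .
 have mv: "mag (28 * n) (?a j j * ?d)" if "j < n" for j using mag_mul[OF ma[OF that that] md] by simp
 note [simp] = assms(1,3,4) coreD[OF assms(1)]
 show ?thesis unfolding select_column_def
  apply ((rule wp_Seq)?, rule wps, (simp?, rule ev_refl), (simp?, rule ev_refl), (simp?, rule ev_refl))
  apply ((rule wp_Seq)?, rule wps, (simp?, rule ev_refl), (simp?, rule ev_refl), (simp?, rule ev_refl))
  apply ((rule wp_Seq)?, rule wps, (simp?, rule ev_refl), (simp?, rule ev_refl), (simp?, rule ev_refl))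
  apply ((rule wp_Seq)?, rule wps, (simp?, rule ev_refl), (simp?, rule ev_refl), (simp?, rule ev_refl))
  \<comment> \<open>The best value so far starts at 0 with column 0 as default, which is why the
    invariant compares it with a maximum with 0.\<close>
  apply (rule wp_Loop[where L = n and I = "\<lambda>k m' w'. w' = w \<and> core m' \<and> same ?X m m' \<and> m' 24 = int n - int k \<and> m' 27 = int k \<and>
   (\<forall>j<k. ?a j j * ?d \<le> m' 47) \<and> 0 \<le> m' 47 \<and> mag (28 * n) (m' 47) \<and> (\<exists>jj<n. m' 26 = int jj \<and> m' 47 \<le> max 0 (?a jj jj * ?d))"])
  subgoal using n0 Fpos by (auto simp: mag_def)
  subgoal by simp
  subgoal for k m' w'
   apply (elim conjE)
   subgoal premises p
   proof -
    define best where "best = m' 47"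
    obtain jj where jj: "jj < n" "m' 26 = int jj" "best \<le> max 0 (?a jj jj * ?d)" using p(10) unfolding best_def by blast
    have c: "m' 9 = m 9" "m' 10 = int n" "m' 44 = ?d" using sameD[OF p(4)] by auto
    have mb: "mag (28 * n) best" using p(9) unfolding best_def .
    note [simp] = p(2,3,5,6) coreD[OF p(3)] c
    show ?thesis
     apply (rule conjI)
     subgoal using p(1) by simp
     apply ((rule wp_Seq)?, rule wps, (simp?, rule ev_refl), (simp?, rule ev_refl), (simp?, rule ev_refl))
     apply ((rule wp_Seq)?, rule wps, (simp?, rule ev_refl), (simp?, rule ev_refl), (simp?, rule ev_refl))
     apply (rule wp_Seq, rule wp_mono[OF wp_adj_entry[where ?i0.0 = k and ?j0.0 = k]])
     subgoal by simp
     subgoal using assms(2) by simp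
     subgoal by simp
     subgoal by simp
     subgoal by (rule p(1))
     subgoal by simp
     subgoal by (rule p(1))
     subgoal by simp
     subgoal for m1 w1
      apply (elim conjE)
      subgoal premises q
      proof -
       have c1: "m1 24 = int n - int k" "m1 27 = int k" "m1 47 = best" "m1 26 = int jj" "m1 44 = ?d"
        using sameD[OF q(3)] jj best_def by auto
       have q4: "m1 45 = ?a k k" using q(4) by simp
       have s1: "same ?X m m1" by (rule same_trans[OF same_upd[OF _ same_upd[OF _ p(4)]] q(3)]) auto
       have kn: "int k < int n" using p(1) by simp
       have msub: "mag (Suc (28 * n)) (?a k k * ?d - best)" using mag_sub[OF mv[OF p(1)] mb] by simp
       note bg = big[OF mv[OF p(1)]] big[OF msub]
       have pj: "\<forall>j<k. ?a j j * ?d \<le> best" "0 \<le> best" using p(7,8) unfolding best_def by auto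
       note [simp] = q(1,2) coreD[OF q(2)] c1 q4
       show ?thesis
        apply (rule wp_one)
        apply ((rule wp_Seq)?, rule wps, (simp?, rule ev_refl), (simp?, rule ev_refl), (simp?, rule ev_refl))
        apply ((rule wp_Seq)?, rule wps, (simp?, rule ev_refl), (simp?, rule ev_refl), (simp?, rule ev_refl))
        apply (rule wp_Seq, rule wp_Cond)
        subgoal
         apply ((rule wp_Seq)?, rule wps, (simp?, rule ev_refl), (simp?, rule ev_refl), (simp?, rule ev_refl))+
         subgoal using s1 pj mv[OF p(1)] p(1) by (auto simp: less_Suc_eq)
         using bg by simp_all (use wbn kn in linarith)+
        subgoal
         apply ((rule wp_Seq)?, rule wps, (simp?, rule ev_refl), (simp?, rule ev_refl), (simp?, rule ev_refl))+
         subgoal using s1 pj mb jj by (auto simp: less_Suc_eq)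
         using wbn kn by simp_all
        using bg by simp_all
      qed
      done
     subgoal using wbn p(1) by simp
     using wbn p(1) by simp
   qed
   done
  subgoal for m' w'
   apply (elim conjE exE)
   subgoal premises p for jj
   proof -
    have "\<forall>j<n. ?a j j * ?d \<le> max 0 (?a jj jj * ?d)" using p(6,11) by (meson order_trans)
    then have "\<exists>jj<n. m' 26 = int jj \<and> (\<forall>j<n. ?a j j * ?d \<le> max 0 (?a jj jj * ?d))" using p(9,10) by blast
    then show ?thesis using p(1-4) by simp
   qed
   done
  using wbn n_le by simp_all
qed

lemma sum_squares_le:
 assumes "mag 5 s" "j < n" "k \<le> n"
 shows "mag (28 * n + 1) (\<Sum>l<k. (ad s l j)\<^sup>2)" and "0 \<le> (\<Sum>l<k. (ad s l j)\<^sup>2)"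
proof -
 show nn: "0 \<le> (\<Sum>l<k. (ad s l j)\<^sup>2)" by (intro sum_nonneg) auto
 have "(\<Sum>l<k. (ad s l j)\<^sup>2) \<le> (\<Sum>l<k. (F ^ (14 * n))\<^sup>2)"
 proof (rule sum_mono)
  fix l assume "l \<in> {..<k}"
  then have "\<bar>ad s l j\<bar> \<le> F ^ (14 * n)" using adj_le[OF assms(1) _ assms(2)] assms(3) by simp
  then show "(ad s l j)\<^sup>2 \<le> (F ^ (14 * n))\<^sup>2" using Fpos by (intro abs_le_square_iff[THEN iffD1]) simp
 qed
 also have "\<dots> = int k * F ^ (28 * n)" by (simp add: power_mult[symmetric])
 also have "\<dots> \<le> F * F ^ (28 * n)" using n4F assms(3) Fpos by (intro mult_right_mono) auto
 finally show "mag (28 * n + 1) (\<Sum>l<k. (ad s l j)\<^sup>2)" using nn unfolding mag_def by simp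
qed

lemma wp_square_norm:
 assumes "core m" "mag 5 (m 9)" "m 10 = int n" "m 44 = dt (m 9)" "m 26 = int jj" "jj < n"
 shows "wp (square_norm n nz) (\<lambda>m' w'. w' = w \<and> core m' \<and> same ({11..20} \<union> {24,27} \<union> {40,41,43,45,46,51,52}) m m' \<and>
  m' 12 = int jj \<and> m' 41 = F ^ (16 * n) \<and> m' 46 = (\<Sum>k<n. (ad (m 9) k jj)\<^sup>2)) m w"
proof -
 let ?X = "{11..20} \<union> {24,27} \<union> {40,41,43,45,46,51,52::nat}"
 let ?d = "dt (m 9)" and ?a = "ad (m 9)"
 have jn: "int jj < int n" using assms(6) by simp
 note [simp] = assms(1,3,4,5) coreD[OF assms(1)]
 show ?thesis unfolding square_norm_def
  apply ((rule wp_Seq)?, rule wps, (simp?, rule ev_refl), (simp?, rule ev_refl), (simp?, rule ev_refl))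
  apply ((rule wp_Seq)?, rule wps, (simp?, rule ev_refl), (simp?, rule ev_refl), (simp?, rule ev_refl))
  apply ((rule wp_Seq)?, rule wps, (simp?, rule ev_refl), (simp?, rule ev_refl), (simp?, rule ev_refl))
  apply ((rule wp_Seq)?, rule wps, (simp?, rule ev_refl), (simp?, rule ev_refl), (simp?, rule ev_refl))
  \<comment> \<open>Cell 41 holds the modulus only after the first lifting. The square root reads it
    afterwards, and \<open>n > 0\<close> ensures that a lifting takes place.\<close>
  apply (rule wp_Loop[where L = n and I = "\<lambda>k m' w'. w' = w \<and> core m' \<and> same ?X m m' \<and> m' 24 = int n - int k \<and> m' 27 = int k \<and>
   m' 12 = int jj \<and> (k > 0 \<longrightarrow> m' 41 = F ^ (16 * n)) \<and> m' 46 = (\<Sum>l<k. (?a l jj)\<^sup>2)"])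
  subgoal by simp
  subgoal by simp
  subgoal for k m' w'
   apply (elim conjE)
   subgoal premises p
   proof -
    have c: "m' 9 = m 9" "m' 10 = int n" "m' 44 = ?d" using sameD[OF p(4)] by auto
    note [simp] = p(2,3,5,6,7) coreD[OF p(3)] c
    show ?thesis
     apply (rule conjI)
     subgoal using p(1) by simp
     apply ((rule wp_Seq)?, rule wps, (simp?, rule ev_refl), (simp?, rule ev_refl), (simp?, rule ev_refl))
     apply (rule wp_Seq, rule wp_mono[OF wp_adj_entry[where ?i0.0 = k and ?j0.0 = jj]])
     subgoal by simp
     subgoal using assms(2) by simp
     subgoal by simp
     subgoal by simp
     subgoal by (rule p(1))
     subgoal by simp
     subgoal by (rule assms(6))
     subgoal by simp
     subgoal for m1 w1
      apply (elim conjE)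
      subgoal premises q
      proof -
       define S where "S = (\<Sum>l<k. (?a l jj)\<^sup>2)"
       have c1: "m1 24 = int n - int k" "m1 27 = int k" "m1 46 = S" "m1 12 = int jj"
        using sameD[OF q(3)] p(9) S_def by auto
       have q4: "m1 45 = ?a k jj" using q(4) by simp
       have s1: "same ?X m m1" by (rule same_trans[OF same_upd[OF _ p(4)] q(3)]) auto
       have kn: "int k < int n" "k < n" using p(1) by auto
       have b1: "mag (28 * n) (?a k jj * ?a k jj)"
        using mag_mul[of "14 * n" "?a k jj" "14 * n" "?a k jj"] adj_le[OF assms(2) p(1) assms(6)] unfolding mag_def by simp
       have b2: "mag (28 * n + 1) (S + ?a k jj * ?a k jj)"
        using sum_squares_le(1)[OF assms(2,6), of "Suc k"] p(1) unfolding S_def by (simp add: power2_eq_square)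
       note [simp] = q(1,2,5) coreD[OF q(2)] c1 q4
       show ?thesis
        apply (rule wp_one)
        apply ((rule wp_Seq)?, rule wps, (simp?, rule ev_refl), (simp?, rule ev_refl), (simp?, rule ev_refl))+
        subgoal using s1 by (simp add: S_def power2_eq_square)
        using big[OF b1] big[OF b2] by simp_all (use wbn kn in linarith)+
      qed
      done
     using wbn p(1) by simp
   qed
   done
  subgoal using n0 by simp
  using wbn n_le jn assms(6) by simp_all
qed

lemma wp_square_root:
 assumes "core m" "m 41 = F ^ (16 * n)" "m 46 = S" "0 \<le> S" "mag (28 * n + 1) S" and e: "F ^ (16 * n + 8) = 2 ^ e" and Ks: "Suc e \<le> Ks"
 shows "wp (square_root Ks) (\<lambda>m' w'. w' = w \<and> core m' \<and> same {20,43,46,48,49,51} m m' \<and>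
  0 \<le> m' 48 \<and> (m' 48)\<^sup>2 \<le> S * F ^ 8 \<and> S * F ^ 8 < (m' 48 + 1)\<^sup>2) m w"
proof -
 let ?X = "{20,43,46,48,49,51::nat}"
 let ?S = "S * F ^ 8"
 have bS: "mag (28 * n + 9) ?S" using mag_mul[OF assms(5) mag_pow[of 8]] by (simp add: add.commute)
 have S0: "0 \<le> ?S" using assms(4) Fpos by simp
 \<comment> \<open>The sum of squares is at most \<open>F ^ (28 n + 1)\<close>, so the root of its
   multiple by \<open>F ^ 8\<close> is below the starting bit \<open>2 ^ e\<close>.\<close>
 have SN: "?S < (2 ^ e)\<^sup>2"
 proof -
  have "?S \<le> F ^ (28 * n + 9)" using bS S0 unfolding mag_def by simp
  also have "\<dots> < F ^ (32 * n + 16)" using F by (intro power_strict_increasing) auto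
  also have "\<dots> = (2 ^ e)\<^sup>2" unfolding e[symmetric] by (simp add: power_mult[symmetric] algebra_simps)
  finally show ?thesis .
 qed
 have F168: "F ^ (16 * n) * F ^ 8 = 2 ^ e" using e by (simp add: power_add)
 have be: "mag (16 * n + 8) (2 ^ e)" using mag_pow[of "16 * n + 8"] e by simp
 note [simp] = assms(1,2,3) coreD[OF assms(1)] F168
 show ?thesis unfolding square_root_def
  apply ((rule wp_Seq)?, rule wps, (simp?, rule ev_refl), (simp?, rule ev_refl), (simp?, rule ev_refl))
  apply ((rule wp_Seq)?, rule wps, (simp?, rule ev_refl), (simp?, rule ev_refl), (simp?, rule ev_refl))
  apply ((rule wp_Seq)?, rule wps, (simp?, rule ev_refl), (simp?, rule ev_refl), (simp?, rule ev_refl))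
  \<comment> \<open>The trial bit is written as \<open>2 ^ (Suc e - k) div 2\<close>, because in the
    last state it becomes \<open>1 div 2 = 0\<close>, which ends the loop.\<close>
  apply (rule wp_Loop[where L = "Suc e" and I = "\<lambda>k m' w'. w' = w \<and> core m' \<and> same ?X m m' \<and> m' 46 = ?S \<and> m' 49 = 2 ^ (Suc e - k) div 2 \<and>
   0 \<le> m' 48 \<and> (m' 48)\<^sup>2 \<le> ?S \<and> ?S < (m' 48 + 2 ^ (Suc e - k))\<^sup>2"])
  subgoal using S0 SN by (simp add: power_mult_distrib)
  subgoal by (rule Ks)
  subgoal for k m' w'
   apply (elim conjE)
   subgoal premises p
   proof -
    define rt where "rt = m' 48"
    define j where "j = e - k"
    have j: "Suc e - k = Suc j" "Suc e - Suc k = j" using p(1) unfolding j_def by auto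
    have r: "0 \<le> rt" "rt\<^sup>2 \<le> ?S" "?S < (rt + 2 * 2 ^ j)\<^sup>2" using p(7-9) j unfolding rt_def by auto
    have h: "m' 48 = rt" "m' 49 = 2 ^ j" using p(6) j rt_def by auto
    have j0: "(2::int) ^ j \<ge> 1" "(2::int) ^ j \<le> 2 ^ e" unfolding j_def by auto
    have "rt\<^sup>2 < (2 ^ e)\<^sup>2" using r(2) SN by linarith
    then have rte: "rt < 2 ^ e" by (rule power2_less_imp_less) simp
    have b1: "mag (16 * n + 8) rt" "mag (16 * n + 8) (2 ^ j)" using rte r(1) j0 be unfolding mag_def by linarith+
    have b2: "mag (16 * n + 9) (rt + 2 ^ j)" using mag_add[OF b1] by (simp add: add.commute)
    have b3: "mag (32 * n + 18) ((rt + 2 ^ j) * (rt + 2 ^ j))" using mag_mul[OF b2 b2] by simp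
    have b4: "mag (32 * n + 19) ((rt + 2 ^ j) * (rt + 2 ^ j) - ?S)" using mag_mono[OF mag_sub[OF b3 bS], of "32 * n + 19"] by simp
    have b5: "mag (16 * n + 8) (2 ^ j div 2)" using mag_div[OF b1(2)] by simp
    have b6: "mag (16 * n + 8) 2" using mag_mono[OF mag_num[of 2]] by simp
    note bg = big[OF b2] big[OF b3] big[OF b4] big[OF b5] big[OF b6]
    note [simp] = p(2,3,5) coreD[OF p(3)] h
    show ?thesis
     apply (rule conjI)
     subgoal by simp
     apply ((rule wp_Seq)?, rule wps, (simp?, rule ev_refl), (simp?, rule ev_refl), (simp?, rule ev_refl))
     apply ((rule wp_Seq)?, rule wps, (simp?, rule ev_refl), (simp?, rule ev_refl), (simp?, rule ev_refl))
     apply ((rule wp_Seq)?, rule wps, (simp?, rule ev_refl), (simp?, rule ev_refl), (simp?, rule ev_refl))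
     apply (rule wp_Seq, rule wp_Cond)
     subgoal
      apply ((rule wp_Seq)?, rule wps, (simp?, rule ev_refl), (simp?, rule ev_refl), (simp?, rule ev_refl))+
      subgoal using p(4) r by (simp add: j j_def[symmetric] power2_eq_square)
      using bg wbn by simp_all
     subgoal
      apply ((rule wp_Seq)?, rule wps, (simp?, rule ev_refl), (simp?, rule ev_refl), (simp?, rule ev_refl))+
      subgoal using p(4) r j0 by (simp add: j j_def[symmetric] power2_eq_square algebra_simps)
      using bg by simp_all
     using bg by simp_all
   qed
   done
  subgoal by simp
  using big[OF bS] big[OF be] by simp_all
qed

lemma wp_write_vector:
 assumes "core m" "mag 5 (m 9)" "m 10 = int n" "m 44 = dt (m 9)" "m 12 = int jj" "jj < n" "m 48 = rt" "0 < rt"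
  "m 28 = int base" "base \<le> 1 + n * n" "\<And>k. k < n \<Longrightarrow> w (base + k) = None"
 shows "wp (write_vector n nz) (\<lambda>m' w'. core m' \<and> same ({11..20} \<union> {24,27,28} \<union> {40,41,43,45,51,52}) m m' \<and>
  m' 28 = int (base + n) \<and> (\<forall>k<n. w' (base + k) = Some ((ad (m 9) k jj * F ^ 8) div rt)) \<and>
  (\<forall>c. c < base \<or> base + n \<le> c \<longrightarrow> w' c = w c)) m w"
proof -
 let ?X = "{11..20} \<union> {24,27,28} \<union> {40,41,43,45,51,52::nat}"
 let ?d = "dt (m 9)" and ?a = "ad (m 9)"
 have bn: "int base \<le> 1 + int n * int n" using assms(10) by (metis of_nat_1 of_nat_add of_nat_le_iff of_nat_mult)
 note [simp] = assms(1,3,4,5,7) coreD[OF assms(1)]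
 show ?thesis unfolding write_vector_def
  apply ((rule wp_Seq)?, rule wps, (simp?, rule ev_refl), (simp?, rule ev_refl), (simp?, rule ev_refl))
  apply ((rule wp_Seq)?, rule wps, (simp?, rule ev_refl), (simp?, rule ev_refl), (simp?, rule ev_refl))
  apply (rule wp_Loop[where L = n and I = "\<lambda>k m' w'. core m' \<and> same ?X m m' \<and> m' 24 = int n - int k \<and> m' 27 = int k \<and>
   m' 12 = int jj \<and> m' 28 = int (base + k) \<and> (\<forall>l<k. w' (base + l) = Some ((?a l jj * F ^ 8) div rt)) \<and>
   (\<forall>c. c < base \<or> base + k \<le> c \<longrightarrow> w' c = w c)"])
  subgoal using assms(9) by simp
  subgoal by simp
  subgoal for k m' w'
   apply (elim conjE)
   subgoal premises p
   proof -
    have c: "m' 9 = m 9" "m' 10 = int n" "m' 44 = ?d" "m' 48 = rt" using sameD[OF p(3)] by auto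
    note [simp] = p(2,4,5,6) coreD[OF p(2)] c
    show ?thesis
     apply (rule conjI)
     subgoal using p(1) by simp
     apply ((rule wp_Seq)?, rule wps, (simp?, rule ev_refl), (simp?, rule ev_refl), (simp?, rule ev_refl))
     apply (rule wp_Seq, rule wp_mono[OF wp_adj_entry[where ?i0.0 = k and ?j0.0 = jj]])
     subgoal by simp
     subgoal using assms(2) by simp
     subgoal by simp
     subgoal by simp
     subgoal by (rule p(1))
     subgoal by simp
     subgoal by (rule assms(6))
     subgoal by simp
     subgoal for m1 w1
      apply (elim conjE)
      subgoal premises q
      proof -
       have c1: "m1 24 = int n - int k" "m1 27 = int k" "m1 12 = int jj" "m1 28 = int (base + k)" "m1 48 = rt"
        using sameD[OF q(3)] p(7) by auto
       have q4: "m1 45 = ?a k jj" using q(4) by simp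
       have s1: "same ?X m m1" by (rule same_trans[OF same_upd[OF _ p(3)] q(3)]) auto
       have kn: "int k < int n" "k < n" using p(1) by auto
       have b1: "mag (14 * n + 8) (?a k jj * F ^ 8)"
        using mag_mul[of "14 * n" "?a k jj", OF _ mag_pow[of 8]] adj_le[OF assms(2) p(1) assms(6)] unfolding mag_def by simp
       have b2: "mag (14 * n + 8) (?a k jj * F ^ 8 div rt)" using mag_div[OF b1 assms(8)] .
       have nn: "nat (int base + int k) = base + k" by simp
       have wn: "w' (base + k) = None" using p(9) assms(11)[OF p(1)] by simp
       note [simp] = q(1,2) coreD[OF q(2)] c1 q4 nn
       show ?thesis
        apply (rule wp_one)
        apply ((rule wp_Seq)?, rule wps, (simp?, rule ev_refl), (simp?, rule ev_refl), (simp?, rule ev_refl))+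
        subgoal using s1 p(8,9) by (auto simp: less_Suc_eq)
        using big[OF b1] big[OF b2] wn by simp_all (use wbn kn bn n_le in linarith)+
      qed
      done
     using wbn p(1) by simp
   qed
   done
  subgoal by simp
  using wbn n_le by simp_all
qed

end

context eig_ram begin

text \<open>The interface to the analysis: the integer hypotheses of \<open>eigenvalue_error\<close>
  and \<open>eigenvector_error\<close>, read off the output cells.\<close>

definition eigenpair_output :: "(nat \<Rightarrow> int option) \<Rightarrow> nat \<Rightarrow> bool" where
 "eigenpair_output w i \<longleftrightarrow> (\<exists>s jj rt. sc s \<le> i \<and> i < sc (s + 1) \<and> w (1 + i) = Some s \<and>
  jj < n \<and> (\<forall>j<n. ad s j j * dt s \<le> max 0 (ad s jj jj * dt s)) \<and>
  0 \<le> rt \<and> rt\<^sup>2 \<le> (\<Sum>k<n. (ad s k jj)\<^sup>2) * F ^ 8 \<and> (\<Sum>k<n. (ad s k jj)\<^sup>2) * F ^ 8 < (rt + 1)\<^sup>2 \<and>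
  (\<forall>k<n. w (1 + n + n * i + k) = Some ((ad s k jj * F ^ 8) div rt)))"

lemma F8: "F ^ 8 \<ge> 2"
 using F power_increasing[of 1 8 F] by simp

text \<open>The product of the shifted matrix with this column has the nonzero determinant as its
  coordinate \<open>j\<close>. Hence the square root is positive and the division in
  \<open>write_vector\<close> is meaningful.\<close>

lemma adj_column_nonzero:
 assumes "j < n"
 shows "(\<Sum>k<n. (ad s k j)\<^sup>2) > 0"
proof -
 let ?M = "shifted (F ^ 8) Bm s n"
 have "(?M * adj_mat ?M) $$ (j,j) = (det ?M \<cdot>\<^sub>m 1\<^sub>m n) $$ (j,j)" using adj_mat[OF shifted_carrier] by simp
 then have "(\<Sum>k<n. ?M $$ (j,k) * ad s k j) = dt s"
  using adj_mat(1)[OF shifted_carrier, of "F ^ 8" Bm s n] assms shifted_carrier[of "F ^ 8" Bm s n]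
  by (auto simp: scalar_prod_def atLeast0LessThan)
 then have "(\<Sum>k<n. ?M $$ (j,k) * ad s k j) \<noteq> 0" using det_shifted_nonzero[OF F8] by simp
 then obtain k where "k < n" "?M $$ (j,k) * ad s k j \<noteq> 0" by (meson lessThan_iff sum.not_neutral_contains_not_neutral)
 then show ?thesis by (intro sum_pos2[of _ k]) auto
qed

lemma wp_eigenpairs:
 assumes "core m" "m 29 = int p" "w = (\<lambda>_. None)" and K: "2 * n \<le> 2 ^ K" and L: "2 * F ^ 5 = 2 ^ L"
  and e: "F ^ (16 * n + 8) = 2 ^ e" and br: "sc (- (F ^ 5)) = 0" "sc (F ^ 5) = n"
 shows "wp (eigenpairs n nz K L (Suc e)) (\<lambda>m' w'. w' 0 = Some (int p) \<and> (\<forall>i<n. eigenpair_output w' i)) m w"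
proof -
 note [simp] = assms(1,2) coreD[OF assms(1)]
 show ?thesis unfolding eigenpairs_def
  apply (rule wp_one)
  apply ((rule wp_Seq)?, rule wps, (simp?, rule ev_refl), (simp?, rule ev_refl), (simp?, rule ev_refl))
  apply ((rule wp_Seq)?, rule wps, (simp?, rule ev_refl), (simp?, rule ev_refl), (simp?, rule ev_refl))
  apply ((rule wp_Seq)?, rule wps, (simp?, rule ev_refl), (simp?, rule ev_refl), (simp?, rule ev_refl))
  apply ((rule wp_Seq)?, rule wps, (simp?, rule ev_refl), (simp?, rule ev_refl), (simp?, rule ev_refl))
  \<comment> \<open>Output cells can be written only once, so the invariant also records the empty
    ones: the eigenvalue cells still to come and all vector cells from the pointer on.\<close>
  apply (rule wp_Loop[where L = n and I = "\<lambda>i m' w'. core m' \<and> m' 33 = int n - int i \<and> m' 21 = int i \<and> m' 28 = int (1 + n + n * i) \<and>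
   w' 0 = Some (int p) \<and> (\<forall>l<i. eigenpair_output w' l) \<and> (\<forall>c. 0 < c \<and> i < c \<and> c < 1 + n \<longrightarrow> w' c = None) \<and> (\<forall>c\<ge>1 + n + n * i. w' c = None)"])
  subgoal using assms(3) by simp
  subgoal by simp
  subgoal for i m' w'
   apply (elim conjE)
   subgoal premises p
   proof -
    have i: "i < n" using p(2) .
    note [simp] = p(3,4,5) coreD[OF p(3)]
    have bi: "sc (- (F ^ 5)) \<le> i" "i < sc (F ^ 5)" using br i by auto
    show ?thesis
     apply (rule conjI)
     subgoal using i by simp
     apply (rule wp_Seq, rule wp_mono[OF wp_bisect[OF p(3,5) i K L bi]])
     subgoal for m1 w1
      apply (elim conjE)
      subgoal premises q
      proof -
       define s where "s = m1 9"
       have c1: "m1 9 = s" "m1 10 = int n" "m1 44 = dt s" "m1 21 = int i" "m1 28 = int (1 + n + n * i)" "m1 33 = int n - int i"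
        using q sameD[OF q(3)] p s_def by auto
       have ms: "mag 5 s" using q(4) s_def by simp
       have nn: "nat (int i + 1) = 1 + i" by simp
       have wi: "w' (Suc i) = None" using p(9) i by simp
       note [simp] = q(1,2) coreD[OF q(2)] c1 nn
       show ?thesis
        apply (rule wp_one)
        apply ((rule wp_Seq)?, rule wps, (simp?, rule ev_refl), (simp?, rule ev_refl), (simp?, rule ev_refl))
        apply ((rule wp_Seq)?, rule wps, (simp?, rule ev_refl), (simp?, rule ev_refl), (simp?, rule ev_refl))
        apply (rule wp_Seq, rule wp_mono[OF wp_select_column])
        subgoal by simp
        subgoal using ms by simp
        subgoal by simp
        subgoal by simp
        subgoal for m2 w2
         apply (elim conjE exE)
         subgoal premises r for jj
         proof -
          have c2: "m2 9 = s" "m2 10 = int n" "m2 44 = dt s" "m2 21 = int i" "m2 28 = int (1 + n + n * i)" "m2 33 = int n - int i"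
           using sameD[OF r(4)] by auto
          have r5: "jj < n" "\<forall>j<n. ad s j j * dt s \<le> max 0 (ad s jj jj * dt s)" using r by auto
          note [simp] = r(2,3,6) coreD[OF r(3)] c2
          show ?thesis
           apply (rule wp_Seq, rule wp_mono[OF wp_square_norm[where jj = jj]])
           subgoal by simp
           subgoal using ms by simp
           subgoal by simp
           subgoal by simp
           subgoal by simp
           subgoal by (rule r5)
           subgoal for m3 w3
            apply (elim conjE)
            subgoal premises t
            proof -
             define S where "S = (\<Sum>k<n. (ad s k jj)\<^sup>2)"
             have c3: "m3 9 = s" "m3 10 = int n" "m3 44 = dt s" "m3 21 = int i" "m3 28 = int (1 + n + n * i)" "m3 33 = int n - int i"
              using sameD[OF t(3)] by auto
             have t6: "m3 46 = S" using t(6) S_def by simp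
             have S0: "S > 0" using adj_column_nonzero[OF r5(1)] S_def by simp
             have Sm: "mag (28 * n + 1) S" using sum_squares_le(1)[OF ms r5(1), of n] S_def by simp
             note [simp] = t(1,2,4) coreD[OF t(2)] c3
             show ?thesis
              apply (rule wp_Seq, rule wp_mono[OF wp_square_root[where S = S, OF _ t(5) t6 _ Sm e order_refl]])
              subgoal by simp
              subgoal using S0 by simp
              subgoal for m4 w4
               apply (elim conjE)
               subgoal premises v
               proof -
                define rt where "rt = m4 48"
                have c4: "m4 9 = s" "m4 10 = int n" "m4 44 = dt s" "m4 21 = int i" "m4 28 = int (1 + n + n * i)" "m4 33 = int n - int i"
                 "m4 12 = int jj" "m4 48 = rt"
                 using sameD[OF v(3)] rt_def by auto
                have rt: "0 \<le> rt" "rt\<^sup>2 \<le> S * F ^ 8" "S * F ^ 8 < (rt + 1)\<^sup>2" using v(4-6) rt_def by auto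
                have "S * F ^ 8 \<ge> 1 * 1" using S0 Fpos by (intro mult_mono) (auto simp: one_le_power)
                then have rt0: "0 < rt" using rt(1,3) by (cases "rt = 0") auto
                have nb: "1 + n + n * i \<le> 1 + n * n"
                proof -
                 have "n * Suc i \<le> n * n" using i by (intro mult_le_mono2) simp
                 then show ?thesis by simp
                qed
                let ?w = "w'(1 + i := Some s)"
                note [simp] = v(1,2) coreD[OF v(2)] c4
                have wv: "?w (1 + n + n * i + k) = None" if "k < n" for k using p(10) i by simp
                show ?thesis
                 apply (rule wp_Seq, rule wp_mono[OF wp_write_vector[where jj = jj and rt = rt and base = "1 + n + n * i"]])
                 subgoal by simp
                 subgoal using ms by simp
                 subgoal by simp
                 subgoal by simp
                 subgoal by simp
                 subgoal by (rule r5)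
                 subgoal by simp
                 subgoal by (rule rt0)
                 subgoal by simp
                 subgoal by (rule nb)
                 subgoal for k using wv[of k] by simp
                 subgoal for m5 w5
                  apply (elim conjE)
                  subgoal premises y
                  proof -
                   have c5: "m5 21 = int i" "m5 33 = int n - int i" using sameD[OF y(2)] by auto
                   have w5: "w5 c = ?w c" if "c < 1 + n + n * i \<or> 1 + n + n * Suc i \<le> c" for c
                    using y(5) that by (auto simp: algebra_simps)
                   have n1: "w5 (1 + i) = Some s" using w5[of "1 + i"] i by simp
                   have n2: "\<forall>k<n. w5 (1 + n + n * i + k) = Some ((ad s k jj * F ^ 8) div rt)" using y(4) by simp
                   have n3: "sc s \<le> i" "i < sc (s + 1)" using q(5,6) by simp_all
                   have new: "eigenpair_output w5 i" unfolding eigenpair_output_def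
                    by (rule exI[of _ s], rule exI[of _ jj], rule exI[of _ rt])
                     (intro conjI n1 n2 n3 r5 rt(1) rt(2)[unfolded S_def] rt(3)[unfolded S_def])
                   have old: "eigenpair_output w5 l" if l: "l < i" for l
                   proof -
                    have nl: "n * Suc l \<le> n * i" using l by (intro mult_le_mono2) simp
                    have "w5 (1 + l) = w' (1 + l)" using w5[of "1 + l"] l i by simp
                    moreover have "w5 (1 + n + n * l + k) = w' (1 + n + n * l + k)" if "k < n" for k
                     using w5[of "1 + n + n * l + k"] that nl i by simp
                    ultimately show ?thesis using p(8) l unfolding eigenpair_output_def by simp
                   qed
                   have fin: "\<forall>l<Suc i. eigenpair_output w5 l" using new old by (auto simp: less_Suc_eq)
                   have f0: "w5 0 = Some (int p)" using w5[of 0] p(7) by simp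
                   have f1: "\<forall>c. 0 < c \<and> Suc i < c \<and> c < 1 + n \<longrightarrow> w5 c = None" using w5 p(9) by auto
                   have f2: "\<forall>c\<ge>1 + n + n * Suc i. w5 c = None" using w5 p(10) i by auto
                   have in': "int i < int n" using i by simp
                   have y28: "m5 28 = int (1 + n + n * Suc i)" using y(3) by (simp add: algebra_simps)
                   note [simp] = y(1) coreD[OF y(1)] c5
                   show ?thesis
                    apply (rule wp_one)
                    apply ((rule wp_Seq)?, rule wps, (simp?, rule ev_refl), (simp?, rule ev_refl), (simp?, rule ev_refl))+
                    subgoal using fin f0 f1 f2 y28 by simp
                    by simp_all (use wbn in' in linarith)+
                  qed
                  done
                 done
               qed
               done
              done
            qed
            done
           done
         qed
         done
        subgoal using wi by simp
        using wbn i by simp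
      qed
      done
     done
   qed
   done
  subgoal by simp
  using wbn n_le assms(3) by simp_all
qed

text \<open>What holds of \<open>core\<close> before the perturbation has been unpacked: the array
  of the \<open>F * D i\<close> is not there yet.\<close>

definition scalars :: "(nat \<Rightarrow> int) \<Rightarrow> bool" where
 "scalars m \<longleftrightarrow> m 31 = 0 \<and> m 1 = int n \<and> m 2 = int nz \<and> m 3 = F \<and> m 4 = F ^ 4 \<and> m 5 = F ^ 8 \<and> m 6 = 2 * int n \<and> m 7 = 64"

lemma scalarsD:
 assumes "scalars m"
 shows "m 31 = 0" "m (Suc 0) = int n" "m 2 = int nz" "m 3 = F" "m 4 = F ^ 4" "m 5 = F ^ 8" "m 6 = 2 * int n" "m 7 = 64"
 using assms unfolding scalars_def by auto

lemma scalars_upd [simp]: "d \<notin> {1,2,3,4,5,6,7,31} \<Longrightarrow> scalars (m(d := v)) = scalars m"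
 unfolding scalars_def by auto

lemma wp_unpack:
 assumes "scalars m" "m 50 = z" "0 \<le> z" "z < F ^ (2 * n)" "\<And>i. i < n \<Longrightarrow> D i = z div (F\<^sup>2) ^ i mod F\<^sup>2"
 shows "wp (unpack n) (\<lambda>m' w'. w' = w \<and> core m' \<and> same {14,15,42,43,50,51} m m') m w"
proof -
 let ?X = "{14,15,42,43,50,51::nat}"
 have mz: "mag (2 * n) z" using assms(3,4) unfolding mag_def by simp
 note [simp] = assms(1,2) scalarsD[OF assms(1)]
 have b2: "mag 2 (F * F)" using mag_mul[OF mag_pow[of 1] mag_pow[of 1]] by (simp add: numeral_2_eq_2)
 show ?thesis unfolding unpack_def
  apply ((rule wp_Seq)?, rule wps, (simp?, rule ev_refl), (simp?, rule ev_refl), (simp?, rule ev_refl))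
  apply ((rule wp_Seq)?, rule wps, (simp?, rule ev_refl), (simp?, rule ev_refl), (simp?, rule ev_refl))
  apply ((rule wp_Seq)?, rule wps, (simp?, rule ev_refl), (simp?, rule ev_refl), (simp?, rule ev_refl))
  apply ((rule wp_Seq)?, rule wps, (simp?, rule ev_refl), (simp?, rule ev_refl), (simp?, rule ev_refl))
  apply (rule wp_Loop[where L = n and I = "\<lambda>k m' w'. w' = w \<and> scalars m' \<and> same ?X m m' \<and> m' 14 = int n - int k \<and> m' 15 = 64 + 2 * int n + int k \<and>
   m' 43 = F\<^sup>2 \<and> m' 50 = z div (F\<^sup>2) ^ k \<and> (\<forall>i<k. m' (64 + 2 * n + i) = F * D i)"])
  subgoal by (simp add: power2_eq_square)
  subgoal by simp
  subgoal for k m' w'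
   apply (elim conjE)
   subgoal premises p
   proof -
    define y where "y = z div (F\<^sup>2) ^ k"
    have my: "mag (2 * n) y" unfolding y_def using mag_div[OF mz] Fpos by simp
    have b1: "mag (2 * n) (y div F\<^sup>2)" using mag_div[OF my] Fpos by simp
    have b3: "mag (2 * n + 2) (y div F\<^sup>2 * F\<^sup>2)" using mag_mul[OF b1 mag_pow] .
    have b4: "mag 2 (y mod F\<^sup>2)" by (rule mag_mod)
    have b5: "mag 3 (y mod F\<^sup>2 * F)" using mag_mul[OF b4 mag_pow[of 1]] by (simp add: numeral_3_eq_3)
    have Dk: "D k = y mod F\<^sup>2" using assms(5)[OF p(1)] unfolding y_def .
    have nxt: "y div F\<^sup>2 = z div (F\<^sup>2) ^ Suc k" unfolding y_def power_Suc2
     by (rule zdiv_zmult2_eq[symmetric]) simp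
    have a: "nat (64 + 2 * int n + int k) = 64 + 2 * n + k" by linarith
    have p8: "m' 50 = y" using p(8) y_def by simp
    have kn: "int k < int n" using p(1) by simp
    note [simp] = p(2,3,5,6,7) scalarsD[OF p(3)] a p8 minus_div_mult_eq_mod
    show ?thesis
     apply (rule conjI)
     subgoal using p(1) by simp
     apply (rule wp_one)
     apply ((rule wp_Seq)?, rule wps, (simp?, rule ev_refl), (simp?, rule ev_refl), (simp?, rule ev_refl))+
     subgoal using p(4,9) nxt Dk by (auto simp: less_Suc_eq)
     using p(1) by (simp_all add: big[OF b1] big[OF b3] big[OF b4] big[OF b5] small[OF b5]) (use wbn kn in linarith)+
   qed
   done
  subgoal for m' w' unfolding core_def scalars_def by auto
  using wbn n_le big[OF b2] by simp_all
qed

text \<open>\<open>e\<close> and \<open>q\<close> enter through the loop tests that find them: the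
  first positive cell of \<epsilon>, and the first power of two that reaches the sum of
  \<open>n\<close>, the absolute entries and \<open>2 ^ e\<close>.\<close>

lemma wp_preparation:
 assumes "m 31 = 0" "m (Suc 0) = int n" "m 2 = int nz"
  and e: "\<And>k. k < e \<Longrightarrow> x (2 + 3 * nz + k) \<le> 0" "x (2 + 3 * nz + e) > 0" "\<And>k. k \<le> e \<Longrightarrow> \<bar>x (2 + 3 * nz + k)\<bar> + 1 < 2 ^ wB" "int e \<le> F"
  and q: "\<And>k. k < q \<Longrightarrow> 2 ^ k < int n + (\<Sum>l<nz. \<bar>val l\<bar>) + 2 ^ e" "int n + (\<Sum>l<nz. \<bar>val l\<bar>) + 2 ^ e \<le> 2 ^ q" "int q \<le> F"
  and Fq: "F = (2 ^ q) ^ ph" "4 * int ph \<le> F" "0 < ph"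
 shows "wp (preparation nz e q ph) (\<lambda>m' w'. w' = w \<and> scalars m' \<and> m' 29 = int (4 * ph * q) \<and> m' 50 = 0 \<and> m' 53 = int (2 * ph * q * n)) m w"
proof -
 define W where "W k = (\<Sum>l<k. \<bar>val l\<bar>)" for k
 have Ws: "W (Suc k) = W k + \<bar>val k\<bar>" for k unfolding W_def by simp
 have W0: "0 \<le> W k" for k unfolding W_def by (intro sum_nonneg) auto
 have Wm: "mag 1 (W k)" if "k \<le> nz" for k
 proof -
  have "W k \<le> W nz" unfolding W_def using that by (intro sum_mono2) auto
  then show ?thesis using W0[of k] vals unfolding mag_def W_def by simp
 qed
 have nzn: "int nz \<le> int n * int n" using nzF by (metis of_nat_le_iff of_nat_mult)
 have QF: "2 ^ q \<le> F" unfolding Fq(1) using Fq(3) self_le_power[of "(2::int) ^ q" ph] by simp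
 have EF: "(2::int) ^ e \<le> F" using q(2) W0[of nz] QF unfolding W_def by linarith
 have wF: "F ^ 20 < 2 ^ wB" using small[OF mag_pow[of 20]] by simp
 have F1: "F \<le> F ^ 20" using power_increasing[of 1 20 F] Fpos by simp
 have F4: "10 * F + 1000 < 2 ^ wB"
 proof -
  have "10 * F + 1000 \<le> 11 * F" using F by simp
  also have "\<dots> \<le> F * F" using F by (intro mult_right_mono) auto
  also have "\<dots> \<le> F ^ 20" using power_increasing[of 2 20 F] Fpos by (simp add: power2_eq_square)
  finally show ?thesis using wF by linarith
 qed
 have NW: "int n + W nz \<le> F" "int n + W nz + 2 ^ e \<le> 2 ^ q" using q(2) QF unfolding W_def[symmetric] by (smt (verit) zero_le_power)+
 note q1 = q(1)[folded W_def]
 have wB0: "0 < wB" using F4 F by (cases wB) auto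
 have "int ph < 2 ^ wB" using F4 Fq(2) F by linarith
 then have phw: "ph < 2 ^ wB" by (metis of_nat_less_iff of_nat_numeral of_nat_power)
 note [simp] = assms(1-3)
 show ?thesis unfolding preparation_def
  apply (rule wp_one)
  apply ((rule wp_Seq)?, rule wps, (simp?, rule ev_refl), (simp?, rule ev_refl), (simp?, rule ev_refl))
  apply ((rule wp_Seq)?, rule wps, (simp?, rule ev_refl), (simp?, rule ev_refl), (simp?, rule ev_refl))
  apply ((rule wp_Seq)?, rule wps, (simp?, rule ev_refl), (simp?, rule ev_refl), (simp?, rule ev_refl))
  apply ((rule wp_Seq)?, rule wps, (simp?, rule ev_refl), (simp?, rule ev_refl), (simp?, rule ev_refl))
  apply (rule wp_Seq, rule wp_Loop[where L = nz and I = "\<lambda>k m' w'. w' = w \<and> same {14..20} (m(32 := m' 32)) m' \<and> m' 15 = 4 + 3 * int k \<and>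
   m' 14 = int nz - int k \<and> m' 17 = 3 \<and> m' 32 = W k"])
  subgoal by (auto simp: W_def same_def)
  subgoal by simp
  subgoal for k m' w'
   apply (elim conjE)
   subgoal premises p
   proof -
    have a: "nat (4 + 3 * int k) = 4 + 3 * k" by linarith
    have xv: "x (4 + 3 * k) = val k" using inputs(3)[OF p(2)] .
    have kn: "int k < int nz" using p(2) by simp
    have b: "mag 1 (W k)" "mag 1 (W (Suc k))" using Wm p(2) by auto
    have c: "m' i = m i" if "i < 64" "i \<notin> {14..20}" "i \<noteq> 32" for i using sameD[OF p(4), of i] that by simp
    note [simp] = p(3,5-8) a xv
    show ?thesis
     apply (rule conjI)
     subgoal using p(2) by simp
     apply (rule wp_one)
     apply ((rule wp_Seq)?, rule wps, (simp?, rule ev_refl), (simp?, rule ev_refl), (simp?, rule ev_refl))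
     apply (rule wp_Seq, rule wp_Cond)
     subgoal
      apply ((rule wp_Seq)?, rule wps, (simp?, rule ev_refl), (simp?, rule ev_refl), (simp?, rule ev_refl))+
      subgoal by (auto simp: Ws same_def c)
      using small[OF b(2)] p(2) by (simp_all add: Ws) (use wbn kn nzn in linarith)+
     subgoal
      apply ((rule wp_Seq)?, rule wps, (simp?, rule ev_refl), (simp?, rule ev_refl), (simp?, rule ev_refl))+
      subgoal by (auto simp: Ws same_def c)
      using small[OF b(2)] p(2) by (simp_all add: Ws) (use wbn kn nzn in linarith)+
     using small[OF abs_val[OF p(2)]] by simp
   qed
   done
  subgoal for m1 w1
   apply (elim conjE)
   subgoal premises p
   proof -
    have c: "m1 i = m i" if "i < 64" "i \<notin> {14..20}" "i \<noteq> 32" for i using sameD[OF p(3), of i] that by simp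
    have cs: "m1 31 = 0" "m1 (Suc 0) = int n" "m1 2 = int nz" using c by auto
    have a: "nat (2 + 3 * int nz) = 2 + 3 * nz" by linarith
    have m1: "\<bar>x (2 + 3 * nz)\<bar> < 2 ^ wB" "\<bar>1 - x (2 + 3 * nz)\<bar> < 2 ^ wB" using e(3)[of 0] by auto
    have x': "x (Suc (Suc (3 * nz))) = x (2 + 3 * nz)" by simp
    note [simp] = p(2,4-7) cs a
    show ?thesis
     apply (rule conjI)
     subgoal by simp
     apply (rule wp_one)
     apply ((rule wp_Seq)?, rule wps, (simp?, rule ev_refl), (simp?, rule ev_refl), (simp?, rule ev_refl))
     apply ((rule wp_Seq)?, rule wps, (simp?, rule ev_refl), (simp?, rule ev_refl), (simp?, rule ev_refl))
     apply ((rule wp_Seq)?, rule wps, (simp?, rule ev_refl), (simp?, rule ev_refl), (simp?, rule ev_refl))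
     apply ((rule wp_Seq)?, rule wps, (simp?, rule ev_refl), (simp?, rule ev_refl), (simp?, rule ev_refl))
     apply ((rule wp_Seq)?, rule wps, (simp?, rule ev_refl), (simp?, rule ev_refl), (simp?, rule ev_refl))
     apply (rule wp_Seq, rule wp_Loop[where L = e and I = "\<lambda>k m' w'. w' = w \<and> m' 31 = 0 \<and> m' (Suc 0) = int n \<and> m' 2 = int nz \<and> m' 32 = W nz \<and>
      m' 15 = 2 + 3 * int nz + int k \<and> m' 34 = 2 ^ k \<and> m' 35 = 1 - x (2 + 3 * nz + k)"])
     subgoal by simp
     subgoal by simp
     subgoal for k m' w'
      apply (elim conjE)
      subgoal premises r
      proof -
       have a2: "nat (3 + 3 * int nz + int k) = 2 + 3 * nz + Suc k" "nat (3 + (3 * int nz + int k)) = Suc (Suc (Suc (3 * nz + k)))" by linarith+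
       have ml: "\<bar>x (2 + 3 * nz + Suc k)\<bar> < 2 ^ wB" "\<bar>1 - x (2 + 3 * nz + Suc k)\<bar> < 2 ^ wB" using e(3)[of "Suc k"] r(2) by auto
       have pk: "(2::int) ^ k \<le> 2 ^ e" using r(2) by (intro power_increasing) auto
       have ke: "int k < int e" using r(2) by simp
       note [simp] = r(3-) a2
       show ?thesis
        apply (rule conjI)
        subgoal using e(1)[OF r(2)] by simp
        apply (rule wp_one)
        apply ((rule wp_Seq)?, rule wps, (simp?, rule ev_refl), (simp?, rule ev_refl), (simp?, rule ev_refl))+
        subgoal by simp
        using ml by simp_all (use wbn F4 EF pk ke e(4) nzn in linarith)+
      qed
      done
     subgoal for m' w'
      apply (elim conjE)
      subgoal premises r
      proof -
       note [simp] = r(2-)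
       show ?thesis
        apply (rule conjI)
        subgoal using e(2) by simp
        apply ((rule wp_Seq)?, rule wps, (simp?, rule ev_refl), (simp?, rule ev_refl), (simp?, rule ev_refl))
        apply ((rule wp_Seq)?, rule wps, (simp?, rule ev_refl), (simp?, rule ev_refl), (simp?, rule ev_refl))
        apply ((rule wp_Seq)?, rule wps, (simp?, rule ev_refl), (simp?, rule ev_refl), (simp?, rule ev_refl))
        apply ((rule wp_Seq)?, rule wps, (simp?, rule ev_refl), (simp?, rule ev_refl), (simp?, rule ev_refl))
        apply ((rule wp_Seq)?, rule wps, (simp?, rule ev_refl), (simp?, rule ev_refl), (simp?, rule ev_refl))
        apply (rule wp_Seq, rule wp_Loop[where L = q and I = "\<lambda>k m' w'. w' = w \<and> m' 31 = 0 \<and> m' (Suc 0) = int n \<and> m' 2 = int nz \<and>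
         m' 36 = int n + W nz + 2 ^ e \<and> m' 37 = 2 ^ k \<and> m' 30 = int k \<and> m' 35 = int n + W nz + 2 ^ e - 2 ^ k"])
        subgoal by simp
        subgoal by simp
        subgoal for k m2 w2
         apply (elim conjE)
         subgoal premises t
         proof -
          have pk: "(2::int) ^ k * 2 \<le> 2 ^ q" "(2::int) ^ k > 0"
           using t(1) power_increasing[of "Suc k" q "2::int"] by (auto simp: mult.commute)
          have kq: "int k < int q" using t(1) by simp
          have Z: "0 \<le> int n + W nz + 2 ^ e" using W0[of nz] by simp
          note [simp] = t(2-)
          show ?thesis
           apply (rule conjI)
           subgoal using q1[OF t(1)] by simp
           apply (rule wp_one)
           apply ((rule wp_Seq)?, rule wps, (simp?, rule ev_refl), (simp?, rule ev_refl), (simp?, rule ev_refl))+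
           subgoal by (simp add: algebra_simps)
           by simp_all (use F4 pk kq q(3) QF NW Z in linarith)+
         qed
         done
        subgoal for m2 w2
         apply (elim conjE)
         subgoal premises t
         proof -
          note [simp] = t(1-)
          show ?thesis
           apply (rule conjI)
           subgoal using NW by simp
           apply ((rule wp_Seq)?, rule wps, (simp?, rule ev_refl), (simp?, rule ev_refl), (simp?, rule ev_refl))
           apply ((rule wp_Seq)?, rule wps, (simp?, rule ev_refl), (simp?, rule ev_refl), (simp?, rule ev_refl))
           apply (rule wp_Seq, rule wp_Loop[where L = ph and I = "\<lambda>k m' w'. w' = w \<and> m' 31 = 0 \<and> m' (Suc 0) = int n \<and> m' 2 = int nz \<and>
            m' 37 = 2 ^ q \<and> m' 30 = int q \<and> m' 3 = (2 ^ q) ^ k \<and> m' 14 = int ph - int k"])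
           subgoal by simp
           subgoal by simp
           subgoal for k m3 w3
            apply (elim conjE)
            subgoal premises v
            proof -
             have "((2::int) ^ q) ^ Suc k \<le> F" unfolding Fq(1) using v(1) by (intro power_increasing) (auto simp: one_le_power)
             then have pk: "((2::int) ^ q) ^ k * 2 ^ q \<le> F" "0 \<le> ((2::int) ^ q) ^ k * 2 ^ q" by (auto simp: mult.commute)
             have kp: "int k < int ph" using v(1) by simp
             note [simp] = v(2-)
             show ?thesis
              apply (rule conjI)
              subgoal using v(1) by simp
              apply (rule wp_one)
              apply ((rule wp_Seq)?, rule wps, (simp?, rule ev_refl), (simp?, rule ev_refl), (simp?, rule ev_refl))+
              subgoal by (simp add: mult.commute)
              by simp_all (use F4 pk kp Fq(2) in linarith)+
            qed
            done
           subgoal for m3 w3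
            apply (elim conjE)
            subgoal premises v
            proof -
             have F3: "m3 3 = F" using v(7) Fq(1) by simp
             have b1: "mag 1 (4 * int ph)" "mag 1 (int q)" using Fq(2,3) q(3) unfolding mag_def by auto
             have b2: "mag 2 (4 * int ph * int q)" using mag_mul[OF b1] by (simp add: numeral_2_eq_2)
             have b3: "mag 1 (2 * int ph)" using Fq(2) unfolding mag_def by auto
             have b4: "mag 2 (2 * int ph * int q)" using mag_mul[OF b3 b1(2)] by (simp add: numeral_2_eq_2)
             have b5: "mag 3 (2 * int ph * int q * int n)" using mag_mul[OF b4 mag_nat[OF order_refl]] by (simp add: numeral_3_eq_3)
             have f2: "F * F = F ^ 2" "F ^ 2 * F ^ 2 = F ^ 4" "F ^ 4 * F ^ 4 = F ^ 8"
              by (simp add: power2_eq_square, simp_all flip: power_add)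
             have ff: "F * F * (F * F) = F ^ 4" by (simp add: eval_nat_numeral)
             note sm = small[OF b1(1)] small[OF b2] small[OF b3] small[OF b4] big[OF b5] small[OF mag_pow[of 2]] small[OF mag_pow[of 4]] small[OF mag_pow[of 8]]
             note [simp] = v(1-6,8) F3 f2
             show ?thesis
              apply (rule conjI)
              subgoal by simp
              apply ((rule wp_Seq)?, rule wps, (simp?, rule ev_refl), (simp?, rule ev_refl), (simp?, rule ev_refl))+
              subgoal by (simp add: scalars_def)
              using sm wbn by simp_all
            qed
            done
           subgoal using phw by simp
           using F4 F by simp
         qed
         done
        using wB0 by simp_all (use F4 NW W0[of nz] EF one_le_power[of "2::int" e] F in linarith)+
      qed
      done
     subgoal using m1 by simp
     subgoal using F4 F by simp
     subgoal using m1 by simp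
     using wbn nzn by simp_all
   qed
   done
  using wbn nzb by simp_all
qed

end

context bounded_ram begin

lemma wp_write_identity:
 assumes "m 31 = 0" "m (Suc 0) = int n" "w = (\<lambda>_. None)"
  and B: "\<And>d. 0 < d \<Longrightarrow> d < 40 \<Longrightarrow> int n * int n + 2 * int n + 5 < 2 ^ bnd d"
 shows "wp (write_identity n) (\<lambda>m' w'. w' 0 = Some 0 \<and> (\<forall>i<n. w' (1 + i) = Some 0) \<and>
  (\<forall>i<n. \<forall>j<n. w' (1 + n + n * i + j) = Some (of_bool (i = j)))) m w"
proof -
 have B': "\<And>d. 0 < d \<Longrightarrow> d < 40 \<Longrightarrow> int n + 5 < 2 ^ bnd d" "\<And>d. 0 < d \<Longrightarrow> d < 40 \<Longrightarrow> int n * int n + 5 < 2 ^ bnd d"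
  using B by (smt (verit) mult_nonneg_nonneg of_nat_0_le_iff)+
 have Bn: "int n + 5 < 2 ^ bnd 14" "int n + 5 < 2 ^ bnd 16" "int n + 5 < 2 ^ bnd 18" "int n * int n + 5 < 2 ^ bnd 18"
  "int n * int n + 2 * int n + 5 < 2 ^ bnd 15" using B B' by auto
 have Bx: "n < 2 ^ bnd 14" "n < 2 ^ bnd 16"
  using Bn(1,2) by (metis (mono_tags, lifting) add_lessD1 of_nat_add of_nat_less_iff of_nat_numeral of_nat_power)+
 note [simp] = assms(1,2)
 have "0 \<le> int n * int n" by simp
 then have b15: "1 < (2::int) ^ bnd 15" using Bn by linarith
 show ?thesis unfolding write_identity_def
  apply (rule wp_one)
  apply ((rule wp_Seq)?, rule wps, (simp?, rule ev_refl), (simp?, rule ev_refl), (simp?, rule ev_refl))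
  apply ((rule wp_Seq)?, rule wps, (simp?, rule ev_refl), (simp?, rule ev_refl), (simp?, rule ev_refl))
  apply ((rule wp_Seq)?, rule wps, (simp?, rule ev_refl), (simp?, rule ev_refl), (simp?, rule ev_refl))
  apply (rule wp_Seq, rule wp_Loop[where L = n and I = "\<lambda>k m' w'. m' 31 = 0 \<and> m' (Suc 0) = int n \<and> m' 15 = 1 + int k \<and> m' 14 = int n - int k \<and>
   w' 0 = Some 0 \<and> (\<forall>i<k. w' (1 + i) = Some 0) \<and> (\<forall>c\<ge>1 + k. w' c = None)"])
  subgoal using assms(3) by simp
  subgoal by simp
  subgoal for k m' w'
   apply (elim conjE)
   subgoal premises p
   proof -
    have a: "nat (1 + int k) = Suc k" by linarith
    have kn: "int k < int n" "0 \<le> int n * int n" using p(2) by auto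
    note [simp] = p(3-6) a
    show ?thesis
     apply (rule conjI)
     subgoal using p(2) by simp
     apply (rule wp_one)
     apply ((rule wp_Seq)?, rule wps, (simp?, rule ev_refl), (simp?, rule ev_refl), (simp?, rule ev_refl))+
     subgoal using p(7-9) by (auto simp: less_Suc_eq)
     using p(9) by simp_all (use Bn kn in linarith)+
   qed
   done
  subgoal for m1 w1
   apply (elim conjE)
   subgoal premises p
   proof -
    note [simp] = p(2-5)
    show ?thesis
     apply (rule conjI)
     subgoal by simp
     apply ((rule wp_Seq)?, rule wps, (simp?, rule ev_refl), (simp?, rule ev_refl), (simp?, rule ev_refl))
     apply (rule wp_Loop[where L = n and I = "\<lambda>i m' w'. m' 31 = 0 \<and> m' (Suc 0) = int n \<and> m' 15 = 1 + int n + int n * int i \<and> m' 16 = int n - int i \<and>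
      w' 0 = Some 0 \<and> (\<forall>i<n. w' (1 + i) = Some 0) \<and> (\<forall>i'<i. \<forall>j<n. w' (1 + n + n * i' + j) = Some (of_bool (i' = j))) \<and>
      (\<forall>c\<ge>1 + n + n * i. w' c = None)"])
     subgoal using p(6-8) by simp
     subgoal by simp
     subgoal for i m' w'
      apply (elim conjE)
      subgoal premises q
      proof -
       have i: "i < n" using q(1) .
       have ii: "int n * (int i + 1) \<le> int n * int n" using i by (intro mult_left_mono) auto
       note [simp] = q(2-5)
       show ?thesis
        apply (rule conjI)
        subgoal using i by simp
        apply ((rule wp_Seq)?, rule wps, (simp?, rule ev_refl), (simp?, rule ev_refl), (simp?, rule ev_refl))
        apply (rule wp_Seq, rule wp_Loop[where L = n and I = "\<lambda>j m' w'. m' 31 = 0 \<and> m' (Suc 0) = int n \<and> m' 15 = 1 + int n + int n * int i + int j \<and>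
         m' 16 = int n - int i \<and> m' 14 = int n - int j \<and>
         w' 0 = Some 0 \<and> (\<forall>i<n. w' (1 + i) = Some 0) \<and> (\<forall>i'<i. \<forall>j<n. w' (1 + n + n * i' + j) = Some (of_bool (i' = j))) \<and>
         (\<forall>j'<j. w' (1 + n + n * i + j') = Some (of_bool (i = j'))) \<and> (\<forall>c\<ge>1 + n + n * i + j. w' c = None)"])
        subgoal using q(6-9) by simp
        subgoal by simp
        subgoal for j m2 w2
         apply (elim conjE)
         subgoal premises r
         proof -
          have j: "j < n" using r(1) .
          have a: "nat (1 + int n + int n * int i + int j) = Suc (n + n * i + j)" by (simp add: nat_add_distrib nat_mult_distrib)
          have wn: "w2 (Suc (n + n * i + j)) = None" using r(11) by simp
          define df where "df = int i - int j"
          have df: "int n - int j - (int n - int i) = df" unfolding df_def by simp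
          have dn: "\<bar>df\<bar> \<le> int n" using i j unfolding df_def by linarith
          have d2: "0 \<le> df * df" "df * df \<le> int n * int n"
           using dn mult_mono[of "\<bar>df\<bar>" "int n" "\<bar>df\<bar>" "int n"] by (auto simp: abs_mult[symmetric])
          \<comment> \<open>The only test is for positivity; \<open>1 - (i - j) ^ 2\<close> is
            positive exactly on the diagonal.\<close>
          have pos: "1 - df * df > 0 \<longleftrightarrow> i = j"
          proof
           assume "1 - df * df > 0"
           then have "df * df \<le> 0" by linarith
           then show "i = j" using d2(1) unfolding df_def by (auto simp: mult_le_0_iff)
          qed (simp add: df_def)
          have old: "n * i' + j' < n * i" if "i' < i" "j' < n" for i' j'
          proof -
           have "n * i' + j' < n * Suc i'" using that by simp
           also have "\<dots> \<le> n * i" using that by (intro mult_le_mono2) simp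
           finally show ?thesis .
          qed
          have jn: "int j < int n" "int i < int n" "0 \<le> int n * int i" using i j by auto
          note [simp] = r(2-6) a df
          have Q: "(w2(Suc (n + n * i + j) := v)) 0 = Some 0" "\<forall>i<n. (w2(Suc (n + n * i + j) := v)) (1 + i) = Some 0"
           "\<forall>i'<i. \<forall>j'<n. (w2(Suc (n + n * i + j) := v)) (1 + n + n * i' + j') = Some (of_bool (i' = j'))"
           "\<forall>c\<ge>1 + n + n * i + Suc j. (w2(Suc (n + n * i + j) := v)) c = None" for v
          proof -
           show "(w2(Suc (n + n * i + j) := v)) 0 = Some 0" using r(7) by simp
           show "\<forall>i<n. (w2(Suc (n + n * i + j) := v)) (1 + i) = Some 0" using r(8) by simp
           show "\<forall>i'<i. \<forall>j'<n. (w2(Suc (n + n * i + j) := v)) (1 + n + n * i' + j') = Some (of_bool (i' = j'))"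
           proof (intro allI impI)
            fix i' j' assume a: "i' < i" "j' < n"
            have "1 + n + n * i' + j' \<noteq> Suc (n + n * i + j)" using old[OF a] by linarith
            then show "(w2(Suc (n + n * i + j) := v)) (1 + n + n * i' + j') = Some (of_bool (i' = j'))"
             unfolding fun_upd_apply using r(9) a by presburger
           qed
           show "\<forall>c\<ge>1 + n + n * i + Suc j. (w2(Suc (n + n * i + j) := v)) c = None" using r(11) by simp
          qed
          show ?thesis
           apply (rule conjI)
           subgoal using j by simp
           apply (rule wp_one)
           apply ((rule wp_Seq)?, rule wps, (simp?, rule ev_refl), (simp?, rule ev_refl), (simp?, rule ev_refl))
           apply ((rule wp_Seq)?, rule wps, (simp?, rule ev_refl), (simp?, rule ev_refl), (simp?, rule ev_refl))
           apply ((rule wp_Seq)?, rule wps, (simp?, rule ev_refl), (simp?, rule ev_refl), (simp?, rule ev_refl))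
           apply (rule wp_Seq, rule wp_Cond)
           subgoal
            apply ((rule wp_Seq)?, rule wps, (simp?, rule ev_refl), (simp?, rule ev_refl), (simp?, rule ev_refl))+
            subgoal using pos Q[of "Some 1"] r(10) by (auto simp: less_Suc_eq algebra_simps)
            using wn by simp_all (use Bn jn ii in \<open>simp add: algebra_simps\<close>)+
           subgoal
            apply ((rule wp_Seq)?, rule wps, (simp?, rule ev_refl), (simp?, rule ev_refl), (simp?, rule ev_refl))+
            subgoal using pos Q[of "Some 0"] r(10) by (auto simp: less_Suc_eq algebra_simps)
            using wn by simp_all (use Bn jn ii in \<open>simp add: algebra_simps\<close>)+
           using Bn dn d2 by simp_all (use Bn d2 in linarith)?
         qed
         done
        subgoal for m2 w2
         apply (elim conjE)
         subgoal premises r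
         proof -
          have iN: "int i < int n" using i by simp
          note [simp] = r(1-5)
          show ?thesis
           apply (rule conjI)
           subgoal by simp
           apply (rule wp_one)
           apply ((rule wp_Seq)?, rule wps, (simp?, rule ev_refl), (simp?, rule ev_refl), (simp?, rule ev_refl))+
           subgoal using r(6-10) by (auto simp: less_Suc_eq algebra_simps)
           by simp_all (use Bn iN in linarith)+
         qed
         done
        using Bx by simp
      qed
      done
     subgoal by simp
     using Bx by simp
   qed
   done
  using Bx Bn b15 by (simp_all add: assms(3))
qed

text \<open>The slack \<open>2 V\<close> per round pays for the test and the jump back, and the
  additional round for the final test.\<close>

lemma loop_tbound:
 assumes "tbound c \<le> B" and "bnd a + 1 \<le> V" and "2 \<le> V"
 shows "tbound (Loop K a c) \<le> (K + 1) * (B + 2 * V)"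
proof -
 have "tbound (Loop K a c) \<le> K * (B + 2 * V) + 2 * V"
 proof -
  have "bnd a + 1 + tbound c + 2 \<le> B + 2 * V" using assms by linarith
  then have "K * (bnd a + 1 + tbound c + 2) \<le> K * (B + 2 * V)" by (rule mult_le_mono2)
  then show ?thesis unfolding tbound.simps using assms by linarith
 qed
 then show ?thesis by (simp add: algebra_simps)
qed

end

section \<open>Running time\<close>

text \<open>\<open>V\<close>, \<open>X\<close> and \<open>Y\<close> bound the cost of an operation
  on two words, on a word and a big number, and on two big numbers. Keeping them apart is essential:
  a pass over the sparse matrix uses words only.\<close>

locale timed_ram = bounded_ram x "cell_bits n0 wB nB" wB xb MB for x n0 wB nB xb MB +
 fixes V X Y :: nat
 assumes V: "(wB + 1) * (wB + 1) \<le> V" "2 * (wB + 1) \<le> V" "wB + 1 + xb \<le> V" "10 \<le> V"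
  and X: "(nB + 1) * (wB + 1) \<le> X" "2 * (nB + 1) \<le> X" "V \<le> X"
  and Y: "(nB + 1) * (nB + 1) \<le> Y" "X \<le> Y"
begin

lemma VX: "wB * wB + wB + wB + 1 \<le> V" "wB + wB + 2 \<le> V" "wB + 1 \<le> V" "wB + xb + 1 \<le> V"
 "nB * wB + nB + wB + 1 \<le> X" "wB * nB + nB + wB + 1 \<le> X" "nB + nB + 2 \<le> X" "nB + wB + 2 \<le> X + V" "nB + 1 \<le> X"
 "nB * nB + nB + nB + 1 \<le> Y" "2 \<le> V" "10 \<le> X" "10 \<le> Y" "nB + 1 \<le> Y"
 using V X Y by (auto simp: algebra_simps)

lemma bits_num: "bits 0 = 1" "bits 1 = 2" "bits 2 = 3" "bits 3 = 3" "bits 4 = 4" "bits 64 = 8"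
 by (simp_all add: bits_def compute_floorlog)

lemma tbound_pass_diag: "tbound (pass_diag n) \<le> (n + 1) * (16 * V)"
 unfolding pass_diag_def
 by (rule order_trans[OF loop_tbound[where V = V and B = "14 * V"]]) (insert VX, simp_all add: algebra_simps)

lemma tbound_pass_entries: "tbound (pass_entries nz) \<le> (nz + 1) * (24 * V)"
 unfolding pass_entries_def
 by (rule order_trans[OF loop_tbound[where V = V and B = "22 * V"]]) (insert VX, simp_all add: algebra_simps bits_num)

lemma tbound_lift_pass: "tbound (lift_pass n nz) \<le> 50 * ((n + nz + 1) * V)"
 using tbound_pass_diag[of n] tbound_pass_entries[of nz] VX
 unfolding lift_pass_def by (simp add: algebra_simps bits_num)

lemma tbound_clear_array: "tbound (clear_array n) \<le> (n + 1) * (7 * V)"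
proof -
 have "tbound (Loop n 14 (Ins (Store 15 31) ;; INC 15 ;; DEC 14)) \<le> (n + 1) * (3 * V + 2 * V)"
  by (rule loop_tbound) (insert VX, simp_all)
 then show ?thesis unfolding clear_array_def using VX by (simp add: algebra_simps)
qed

lemma tbound_lift_entry: "tbound (lift_entry n nz) \<le> (2 * n + 1) * (80 * ((n + nz + 1) * V) + 3 * X)"
proof -
 define S where "S = (n + nz + 1) * V"
 have VS: "V \<le> S" "(n + 1) * V \<le> S" unfolding S_def by simp_all
 have lp: "tbound (lift_pass n nz) \<le> 50 * S" unfolding S_def by (rule tbound_lift_pass)
 have "(n + 1) * (7 * V) = 7 * ((n + 1) * V)" by (simp add: algebra_simps)
 then have cl: "tbound (clear_array n) \<le> 7 * S" using tbound_clear_array[of n] VS(2) by linarith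
 define G where "G = (2 * n + 1) * (56 * S + 3 * X)"
 have "tbound (Loop (2 * n) 13 (lift_pass n nz ;; Ins (Add 15 7 1) ;; Ins (Add 15 15 11) ;; Ins (Load 16 15) ;; Ins (Mul 43 41 16) ;;
  Ins (Add 40 40 43) ;; Ins (Mul 41 41 5) ;; DEC 13)) \<le> (2 * n + 1) * ((54 * S + 3 * X) + 2 * V)"
  by (rule loop_tbound) (insert VX VS lp, simp_all)
 also have "\<dots> \<le> G" unfolding G_def using VS by (intro mult_le_mono2) simp
 finally have 1: "tbound (Loop (2 * n) 13 (lift_pass n nz ;; Ins (Add 15 7 1) ;; Ins (Add 15 15 11) ;; Ins (Load 16 15) ;; Ins (Mul 43 41 16) ;;
  Ins (Add 40 40 43) ;; Ins (Mul 41 41 5) ;; DEC 13)) \<le> G" .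
 have "tbound (lift_entry n nz) \<le> 24 * S + G"
  unfolding lift_entry_def tbound.simps(2) using 1 cl VX VS(1) V(4) by (simp add: bits_num del: tbound.simps(2-))
 also have "\<dots> \<le> (2 * n + 1) * (80 * S + 3 * X)" unfolding G_def by (simp add: algebra_simps)
 finally show ?thesis unfolding S_def .
qed

lemma tbound_inverse_test: "tbound inverse_test \<le> 6 * Y"
 unfolding inverse_test_def using VX Y X by (simp add: algebra_simps)

lemma tbound_invert_mod: "tbound (invert_mod K) \<le> 24 * ((K + 1) * Y)"
proof -
 have "tbound (Loop K 43 (Ins (Sub 51 0 43) ;; Ins (Mul 42 42 51) ;; Ins (Div 51 42 41) ;; Ins (Mul 51 51 41) ;; Ins (Sub 42 42 51) ;;
  inverse_test)) \<le> (K + 1) * (14 * Y + 2 * Y)"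
  by (rule loop_tbound) (insert VX X Y tbound_inverse_test, simp_all add: algebra_simps)
 then show ?thesis unfolding invert_mod_def tbound.simps(2) using VX X Y tbound_inverse_test
  by (simp add: algebra_simps bits_num del: tbound.simps(2-))
qed

lemma tbound_sym_residue: "tbound sym_residue \<le> 8 * Y"
 unfolding sym_residue_def using VX X Y by (simp add: algebra_simps bits_num)

text \<open>Lifting one entry: \<open>2 n\<close> digits, each with a pass over
  \<open>n + nz\<close> words and a few operations of a word with a big number.\<close>

definition "TE n nz = (2 * n + 1) * (80 * ((n + nz + 1) * V) + 3 * X)"

lemma tbound_lift_entry_TE: "tbound (lift_entry n nz) \<le> TE n nz"
 unfolding TE_def by (rule tbound_lift_entry)

lemma tbound_inertia: "tbound (inertia n nz K) \<le> (n + 1) * (TE n nz + 70 * ((K + 1) * Y))"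
proof -
 have KY: "Y \<le> (K + 1) * Y" by simp
 have "tbound (Loop n 24 (CPY 11 10 ;; CPY 12 10 ;; INC 10 ;; lift_entry n nz ;; invert_mod K ;; Ins (Mul 43 44 42) ;; sym_residue ;;
  Ins (Mul 43 44 45) ;; Ins (Sub 43 31 43) ;; Cond 43 (INC 8) NOP ;; CPY 44 45 ;; DEC 24)) \<le> (n + 1) * ((TE n nz + 60 * ((K + 1) * Y)) + 2 * V)"
  by (rule loop_tbound) (insert VX X Y KY tbound_invert_mod[of K] tbound_sym_residue tbound_lift_entry_TE[of n nz],
   simp_all add: bits_num)
 also have "\<dots> \<le> (n + 1) * (TE n nz + 62 * ((K + 1) * Y))" using VX X Y KY by (intro mult_le_mono2) simp
 also have "\<dots> + 4 * Y \<le> (n + 1) * (TE n nz + 70 * ((K + 1) * Y))" using KY by (simp add: algebra_simps)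
 finally show ?thesis unfolding inertia_def tbound.simps(2) using VX X Y by (simp add: bits_num del: tbound.simps(2-))
qed

lemma tbound_adj_entry: "tbound (adj_entry n nz) \<le> TE n nz + 9 * Y"
 unfolding adj_entry_def using tbound_lift_entry_TE[of n nz] tbound_sym_residue VX X Y
 by simp

lemma tbound_bisect: "tbound (bisect n nz K Kb) \<le> (Kb + 2) * ((n + 1) * (TE n nz + 70 * ((K + 1) * Y)) + 20 * V)"
proof -
 let ?T = "(n + 1) * (TE n nz + 70 * ((K + 1) * Y))"
 have "tbound (Loop Kb 25 (Ins (Add 9 22 23) ;; Ins (Const 16 2) ;; Ins (Div 9 9 16) ;; inertia n nz K ;; Ins (Sub 16 8 21) ;;
  Cond 16 (CPY 23 9) (CPY 22 9) ;; Ins (Sub 25 23 22) ;; DEC 25)) \<le> (Kb + 1) * ((?T + 12 * V) + 2 * V)"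
  by (rule loop_tbound) (insert VX tbound_inertia[of n nz K], simp_all add: bits_num)
 also have "\<dots> \<le> (Kb + 1) * (?T + 20 * V)" by (intro mult_le_mono2) simp
 finally show ?thesis unfolding bisect_def tbound.simps(2) using VX tbound_inertia[of n nz K]
  by (simp add: bits_num algebra_simps del: tbound.simps(2-))
qed

lemma tbound_select: "tbound (select_column n nz) \<le> (n + 1) * (TE n nz + 40 * Y)"
proof -
 have "tbound (Loop n 24 (CPY 11 27 ;; CPY 12 27 ;; adj_entry n nz ;; Ins (Mul 43 45 44) ;; Ins (Sub 51 43 47) ;;
  Cond 51 (CPY 47 43 ;; CPY 26 27) NOP ;; INC 27 ;; DEC 24)) \<le> (n + 1) * ((TE n nz + 30 * Y) + 2 * V)"
  by (rule loop_tbound) (insert VX X Y tbound_adj_entry[of n nz], simp_all add: bits_num)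
 also have "\<dots> \<le> (n + 1) * (TE n nz + 32 * Y)" using X Y by (intro mult_le_mono2) simp
 finally show ?thesis unfolding select_column_def tbound.simps(2) using VX X Y
  by (simp add: bits_num algebra_simps del: tbound.simps(2-))
qed

lemma tbound_square_norm: "tbound (square_norm n nz) \<le> (n + 1) * (TE n nz + 40 * Y)"
proof -
 have "tbound (Loop n 24 (CPY 11 27 ;; adj_entry n nz ;; Ins (Mul 43 45 45) ;; Ins (Add 46 46 43) ;; INC 27 ;; DEC 24)) \<le> (n + 1) * ((TE n nz + 30 * Y) + 2 * V)"
  by (rule loop_tbound) (insert VX X Y tbound_adj_entry[of n nz], simp_all add: bits_num)
 also have "\<dots> \<le> (n + 1) * (TE n nz + 32 * Y)" using X Y by (intro mult_le_mono2) simp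
 finally show ?thesis unfolding square_norm_def tbound.simps(2) using VX X Y
  by (simp add: bits_num algebra_simps del: tbound.simps(2-))
qed

lemma tbound_write_vector: "tbound (write_vector n nz) \<le> (n + 1) * (TE n nz + 40 * Y)"
proof -
 have "tbound (Loop n 24 (CPY 11 27 ;; adj_entry n nz ;; Ins (Mul 43 45 5) ;; Ins (Div 43 43 48) ;; Ins (Output 28 43) ;;
  INC 28 ;; INC 27 ;; DEC 24)) \<le> (n + 1) * ((TE n nz + 30 * Y) + 2 * V)"
  by (rule loop_tbound) (insert VX X Y tbound_adj_entry[of n nz], simp_all add: bits_num)
 also have "\<dots> \<le> (n + 1) * (TE n nz + 32 * Y)" using X Y by (intro mult_le_mono2) simp
 finally show ?thesis unfolding write_vector_def tbound.simps(2) using VX X Y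
  by (simp add: bits_num algebra_simps del: tbound.simps(2-))
qed

lemma tbound_square_root: "tbound (square_root K) \<le> 30 * ((K + 1) * Y)"
proof -
 have "tbound (Loop K 49 (Ins (Add 51 48 49) ;; Ins (Mul 43 51 51) ;; Ins (Sub 43 43 46) ;; Cond 43 NOP (CPY 48 51) ;;
  Ins (Const 51 2) ;; Ins (Div 49 49 51))) \<le> (K + 1) * (20 * Y + 2 * Y)"
  by (rule loop_tbound) (insert VX X Y, simp_all add: bits_num)
 then show ?thesis unfolding square_root_def tbound.simps(2) using VX X Y
  by (simp add: bits_num algebra_simps del: tbound.simps(2-))
qed

lemma tbound_eigenpairs:
 "tbound (eigenpairs n nz K Kb Ks) \<le> (n + 1) * ((Kb + 2) * ((n + 1) * (TE n nz + 70 * ((K + 1) * Y)) + 20 * V) +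
  3 * ((n + 1) * (TE n nz + 40 * Y)) + 30 * ((Ks + 1) * Y) + 20 * V)"
proof -
 let ?B = "(Kb + 2) * ((n + 1) * (TE n nz + 70 * ((K + 1) * Y)) + 20 * V) + 3 * ((n + 1) * (TE n nz + 40 * Y)) + 30 * ((Ks + 1) * Y)"
 have "tbound (Loop n 33 (bisect n nz K Kb ;; Ins (Add 16 21 0) ;; Ins (Output 16 9) ;; select_column n nz ;; square_norm n nz ;; square_root Ks ;;
  write_vector n nz ;; INC 21 ;; DEC 33)) \<le> (n + 1) * ((?B + 4 * V) + 2 * V)"
  by (rule loop_tbound) (insert VX tbound_bisect[of n nz K Kb] tbound_select[of n nz] tbound_square_norm[of n nz] tbound_square_root[of Ks]
   tbound_write_vector[of n nz], simp_all)
 then have "tbound (eigenpairs n nz K Kb Ks) \<le> (n + 1) * (?B + 6 * V) + 4 * V"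
  unfolding eigenpairs_def tbound.simps(2) using VX by (simp add: bits_num del: tbound.simps(2-))
 also have "\<dots> \<le> (n + 1) * (?B + 20 * V)" by (simp add: algebra_simps)
 finally show ?thesis by simp
qed

lemma tbound_unpack: "tbound (unpack n) \<le> (n + 1) * (20 * Y)"
proof -
 have "tbound (Loop n 14 (Ins (Div 51 50 43) ;; Ins (Mul 42 51 43) ;; Ins (Sub 42 50 42) ;; Ins (Mul 42 42 3) ;; Ins (Store 15 42) ;;
  CPY 50 51 ;; INC 15 ;; DEC 14)) \<le> (n + 1) * (13 * Y + 2 * V)"
  by (rule loop_tbound) (insert VX X Y, simp_all)
 also have "\<dots> \<le> (n + 1) * (15 * Y)" using X Y by (intro mult_le_mono2) simp
 finally show ?thesis unfolding unpack_def tbound.simps(2) using VX X Y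
  by (simp add: algebra_simps del: tbound.simps(2-))
qed

lemma tbound_preparation:
 assumes "bits (int ph) \<le> V" "bits (4 * int ph) \<le> V" "bits (2 * int ph) \<le> V"
 shows "tbound (preparation nz Ke Kq ph) \<le> 60 * ((nz + Ke + Kq + ph + 1) * V) + X"
proof -
 have 1: "tbound (Loop nz 14 (Ins (Input 16 15) ;; Cond 16 (Ins (Add 32 32 16)) (Ins (Sub 32 32 16)) ;; Ins (Add 15 15 17) ;; DEC 14)) \<le> (nz + 1) * (8 * V + 2 * V)"
  by (rule loop_tbound) (insert VX, simp_all)
 have 2: "tbound (Loop Ke 35 (Ins (Add 34 34 34) ;; INC 15 ;; Ins (Input 16 15) ;; Ins (Sub 35 0 16))) \<le> (Ke + 1) * (4 * V + 2 * V)"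
  by (rule loop_tbound) (insert VX, simp_all)
 have 3: "tbound (Loop Kq 35 (Ins (Add 37 37 37) ;; INC 30 ;; Ins (Sub 35 36 37))) \<le> (Kq + 1) * (4 * V + 2 * V)"
  by (rule loop_tbound) (insert VX, simp_all)
 have 4: "tbound (Loop ph 14 (Ins (Mul 3 3 37) ;; DEC 14)) \<le> (ph + 1) * (4 * V + 2 * V)"
  by (rule loop_tbound) (insert VX, simp_all)
 show ?thesis unfolding preparation_def tbound.simps(2) using 1 2 3 4 VX X assms
  by (simp add: bits_num algebra_simps del: tbound.simps(2-))
qed

lemma tbound_write_identity: "tbound (write_identity n) \<le> 50 * ((n + 1) * (n + 1) * V)"
proof -
 have 1: "tbound (Loop n 14 (Ins (Output 15 31) ;; INC 15 ;; DEC 14)) \<le> (n + 1) * (3 * V + 2 * V)"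
  by (rule loop_tbound) (insert VX, simp_all)
 have 2: "tbound (Loop n 14 (Ins (Sub 18 14 16) ;; Ins (Mul 18 18 18) ;; Ins (Sub 18 0 18) ;;
   Cond 18 (Ins (Output 15 0)) (Ins (Output 15 31)) ;; INC 15 ;; DEC 14)) \<le> (n + 1) * (10 * V + 2 * V)"
  by (rule loop_tbound) (insert VX, simp_all add: algebra_simps)
 have "tbound (Loop n 16 (CPY 14 1 ;;
  Loop n 14 (Ins (Sub 18 14 16) ;; Ins (Mul 18 18 18) ;; Ins (Sub 18 0 18) ;;
   Cond 18 (Ins (Output 15 0)) (Ins (Output 15 31)) ;; INC 15 ;; DEC 14) ;;
  DEC 16)) \<le> (n + 1) * (((n + 1) * (12 * V) + 2 * V) + 2 * V)"
  by (rule loop_tbound) (insert VX 2, simp_all del: tbound.simps(4))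
 also have "\<dots> \<le> (n + 1) * ((n + 1) * (16 * V))" by (intro mult_le_mono2) (simp add: algebra_simps)
 finally show ?thesis unfolding write_identity_def tbound.simps(2) using 1 VX
  by (simp add: algebra_simps del: tbound.simps(2-))
qed

end

section \<open>One program for all inputs\<close>

text \<open>The loop bounds depend on the instance but leave no trace in the code. Erasing them
  shows that all annotated versions compile to the same program.\<close>

fun erase :: "cmd \<Rightarrow> cmd" where
 "erase (Ins I) = Ins I"
| "erase (c1 ;; c2) = erase c1 ;; erase c2"
| "erase (Cond a c1 c2) = Cond a (erase c1) (erase c2)"
| "erase (Loop K a c) = Loop 0 a (erase c)"

lemma clen_erase [simp]: "clen (erase c) = clen c"
 by (induction c) auto

lemma comp_erase: "comp q (erase c) = comp q c"
 by (induction c arbitrary: q) auto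

definition "eigen_body ph n nz Ke Kq M K Kb Ks n' =
 prologue nz Ke Kq ph ;; Loop M 53 (Ins (Flip 54) ;; flip_body) ;; epilogue n nz K Kb Ks n'"

lemma erase_eigen_body: "erase (eigen_body ph n nz Ke Kq M K Kb Ks n') = erase (eigen_body ph 0 0 0 0 0 0 0 0 0)"
 by (simp add: eigen_body_def prologue_def preparation_def epilogue_def unpack_def eigenpairs_def bisect_def inertia_def
   lift_entry_def clear_array_def lift_pass_def pass_diag_def pass_entries_def invert_mod_def inverse_test_def sym_residue_def
   select_column_def adj_entry_def square_norm_def square_root_def write_vector_def write_identity_def flip_body_def)

text \<open>The leading instruction sets cell 0 to 1, on which the unconditional jumps rely. Only
  \<open>ph\<close>, hence only the exponent of the failure probability, is built into the
  program.\<close>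

definition eigen_program :: "nat \<Rightarrow> ram_program" where
 "eigen_program ph = Const 0 1 # comp 1 (eigen_body ph 0 0 0 0 0 0 0 0 0)"

lemma eigen_program_eq: "eigen_program ph = Const 0 1 # comp 1 (eigen_body ph n nz Ke Kq M K Kb Ks n')"
 unfolding eigen_program_def by (metis comp_erase erase_eigen_body)

context bounded_ram begin

text \<open>A deterministic prologue, the coin loop and a deterministic epilogue. The final
  configuration becomes a function of the uniform number \<open>z\<close> formed by the coins, so
  probabilities reduce to counting.\<close>

lemma randomized_run:
 fixes I :: "nat \<Rightarrow> nat \<Rightarrow> (nat \<Rightarrow> int) \<Rightarrow> (nat \<Rightarrow> int option) \<Rightarrow> bool" and R :: "nat \<Rightarrow> (nat \<Rightarrow> int option) \<Rightarrow> bool"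
 assumes P: "P = Const 0 1 # comp 1 (c1 ;; Loop K 53 (Ins (Flip 54) ;; c2) ;; c3)"
  and b0: "1 \<le> bnd 0"
  and c1: "wp c1 (I 0 0) ((\<lambda>_. 0)(0 := 1)) (\<lambda>_. None)"
  and step: "\<And>k z m w. k < N \<Longrightarrow> I k z m w \<Longrightarrow> m 53 > 0 \<and> 1 < (2::int) ^ bnd 54 \<and>
   (\<forall>b. wp c2 (I (Suc k) (2 * z + of_bool b)) (m(54 := of_bool b)) w)"
  and fin: "\<And>z m w. I N z m w \<Longrightarrow> \<not> m 53 > 0"
  and c3: "\<And>z m w. z < 2 ^ N \<Longrightarrow> I N z m w \<Longrightarrow> wp c3 (\<lambda>_. R z) m w"
  and T: "2 + tbound c1 + (N * (bnd 53 + 1 + 1 + tbound c2 + 2) + bnd 53 + 3) + tbound c3 \<le> T"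
 shows "\<exists>t g. ram_run P x t = map_pmf g (pmf_of_set {..<2 ^ N}) \<and>
  (\<forall>z<2 ^ N. ram_halted P (g z) \<and> bit_ops (g z) \<le> T \<and> peak_space (g z) \<le> MB \<and> R z (outp (g z)))"
proof -
 let ?m = "(\<lambda>_. 0)(0 := 1) :: nat \<Rightarrow> int"
 let ?c2 = "Loop K 53 (Ins (Flip 54) ;; c2)"
 let ?\<sigma> = "ram_step_coin P x False ram_init"
 let ?\<Phi> = "\<lambda>z \<sigma>. ram_halted P \<sigma> \<and> bit_ops \<sigma> \<le> T \<and> peak_space \<sigma> \<le> MB \<and> R z (outp \<sigma>)"
 have fm: "fits ?m" unfolding fits_def using one_less_power[of "2::int" "bnd 0"] b0 by auto
 have mb: "mem_bits ?m \<le> MB" using MB[of ?m] fm unfolding fits_def by blast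
 have L: "length P = 1 + clen c1 + clen ?c2 + clen c3" unfolding P by simp
 have "code_at P 1 (comp 1 (c1 ;; ?c2 ;; c3))" unfolding P code_at_def by simp
 then have code: "code_at P 1 (comp 1 c1)" "code_at P (1 + clen c1) (comp (1 + clen c1) ?c2)"
  "code_at P (1 + clen c1 + clen ?c2) (comp (1 + clen c1 + clen ?c2) c3)"
  by (simp_all only: comp.simps(2) code_at_append length_comp)
 have s1: "pc ?\<sigma> = 1" "mem ?\<sigma> = ?m" "outp ?\<sigma> = (\<lambda>_. None)" "bit_ops ?\<sigma> = 2" "peak_space ?\<sigma> \<le> MB"
  using mb by (auto simp: ram_step_coin_def ram_init_def ram_halted_def P Let_def bits_one)
 have r1: "reach P x ram_init ?\<sigma>"
  by (rule reach_step) (simp add: ram_step_coin_def ram_init_def ram_halted_def P Let_def)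
 have "ends P x ?\<sigma> N ?\<Phi>"
 proof (rule ends_wp[OF c1 fm _ code(1) s1(1-3)])
  show "?m 0 = 1" by simp
  fix \<sigma>1 assume 1: "pc \<sigma>1 = 1 + clen c1" "I 0 0 (mem \<sigma>1) (outp \<sigma>1)" "fits (mem \<sigma>1)" "mem \<sigma>1 0 = 1" "steps_within ?\<sigma> (tbound c1) \<sigma>1"
  show "ends P x \<sigma>1 N ?\<Phi>"
  proof (rule ends_flip_loop[where I = I and N = N and c = c2 and a = 53 and d = 54, OF code(2)])
   show "54 \<noteq> (0::nat)" by simp
   show "m 53 > 0 \<and> 1 < (2::int) ^ bnd 54 \<and> (\<forall>b. wp c2 (I (Suc k) (2 * z + of_bool b)) (m(54 := of_bool b)) w)"
    if "k < N" "I k z m w" for k z m w using step[OF that] .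
   show "\<not> m 53 > 0" if "I N z m w" for z m w using fin[OF that] .
   show "pc \<sigma>1 = 1 + clen c1" "I 0 0 (mem \<sigma>1) (outp \<sigma>1)" "fits (mem \<sigma>1)" "mem \<sigma>1 0 = 1" using 1 by auto
  next
   fix z \<sigma>2 assume 2: "z < 2 ^ N" "pc \<sigma>2 = 1 + clen c1 + clen c2 + 4" "I N z (mem \<sigma>2) (outp \<sigma>2)" "fits (mem \<sigma>2)" "mem \<sigma>2 0 = 1"
    "steps_within \<sigma>1 (N * (bnd 53 + 1 + 1 + tbound c2 + 2) + bnd 53 + 3) \<sigma>2"
   have pc2: "pc \<sigma>2 = 1 + clen c1 + clen ?c2" using 2(2) by simp
   show "ends P x \<sigma>2 0 (\<lambda>_. ?\<Phi> z)"
   proof (rule ends_wp[OF c3[OF 2(1,3)] 2(4,5) code(3) pc2 refl refl])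
    fix \<sigma>3 assume 3: "pc \<sigma>3 = 1 + clen c1 + clen ?c2 + clen c3" "R z (outp \<sigma>3)" "steps_within \<sigma>2 (tbound c3) \<sigma>3"
    show "ends P x \<sigma>3 0 (\<lambda>_. ?\<Phi> z)"
    proof (rule ends_halted)
     show h: "ram_halted P \<sigma>3" unfolding ram_halted_def L using 3(1) by simp
     have "bit_ops \<sigma>3 \<le> T" using 3(3) 2(6) 1(5) s1(4) T unfolding steps_within_def by linarith
     moreover have "peak_space \<sigma>3 \<le> MB" using 3(3) 2(6) 1(5) s1(5) unfolding steps_within_def by linarith
     ultimately show "?\<Phi> z \<sigma>3" using h 3(2) by simp
    qed
   qed
  qed
 qed
 then have "ends P x ram_init N ?\<Phi>" by (rule ends_reach[OF r1])
 then obtain t0 g where "\<forall>t\<ge>t0. runk P x t ram_init = map_pmf g (pmf_of_set {..<2 ^ N})" "\<forall>z<2 ^ N. ?\<Phi> z (g z)"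
  unfolding ends_def by blast
 then show ?thesis unfolding ram_run_eq_runk by blast
qed

end

lemma mem_bits_cells:
 assumes "\<And>i. \<bar>m i\<bar> < 2 ^ cell_bits n w b i" and w: "64 + 3 * n \<le> 2 ^ w"
 shows "mem_bits m \<le> (64 + 3 * n) * (2 * w + 2) + 64 * b"
proof -
 have sub: "{i. m i \<noteq> 0} \<subseteq> {..<64 + 3 * n}"
 proof (rule ccontr)
  assume "\<not> {i. m i \<noteq> 0} \<subseteq> {..<64 + 3 * n}"
  then obtain i where i: "m i \<noteq> 0" "\<not> i < 64 + 3 * n" by auto
  then have "cell_bits n w b i = 0" unfolding cell_bits_def by auto
  then show False using assms(1)[of i] i by simp
 qed
 have "mem_bits m \<le> (\<Sum>i<64 + 3 * n. bits (int i) + bits (m i))"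
  unfolding mem_bits_def using sub by (intro sum_mono2) auto
 also have "\<dots> \<le> (\<Sum>i<64 + 3 * n. (2 * w + 2) + (if i < 64 then b else 0))"
 proof (rule sum_mono)
  fix i assume i: "i \<in> {..<64 + 3 * n}"
  have "i < 2 ^ w" using i w by simp
  then have "int i < 2 ^ w" by (metis of_nat_less_iff of_nat_numeral of_nat_power)
  then have 1: "bits (int i) \<le> w + 1" by (intro bits_le) simp
  have 2: "bits (m i) \<le> cell_bits n w b i + 1" by (rule bits_le[OF assms(1)])
  have "cell_bits n w b i \<le> w + (if i < 64 then b else 0)" unfolding cell_bits_def by auto
  then show "bits (int i) + bits (m i) \<le> (2 * w + 2) + (if i < 64 then b else 0)" using 1 2 by linarith
 qed
 also have "\<dots> = (64 + 3 * n) * (2 * w + 2) + (\<Sum>i<64 + 3 * n. if i < 64 then b else 0)"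
  by (simp only: sum.distrib sum_constant card_lessThan of_nat_id add_mult_distrib2)
 also have "(\<Sum>i<64 + 3 * n. if i < 64 then b else 0) = (\<Sum>i\<in>{..<64::nat}. b)"
  by (intro sum.mono_neutral_cong_right) auto
 finally show ?thesis by simp
qed

context eig_ram begin

lemma wp_prologue:
 assumes x: "x 0 = int n" "x (Suc 0) = int nz" "0 < nz" and xw: "\<And>i. \<bar>x i\<bar> + 1 < 2 ^ wB"
  and e: "\<And>k. k < e \<Longrightarrow> x (2 + 3 * nz + k) \<le> 0" "x (2 + 3 * nz + e) > 0" "int e \<le> F"
  and q: "\<And>k. k < q \<Longrightarrow> 2 ^ k < int n + (\<Sum>l<nz. \<bar>val l\<bar>) + 2 ^ e" "int n + (\<Sum>l<nz. \<bar>val l\<bar>) + 2 ^ e \<le> 2 ^ q" "int q \<le> F"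
  and Fq: "F = (2 ^ q) ^ ph" "4 * int ph \<le> F" "0 < ph"
 shows "wp (prologue nz e q ph) (\<lambda>m' w'. w' = w \<and> scalars m' \<and> m' 29 = int (4 * ph * q) \<and> m' 50 = 0 \<and> m' 53 = int (2 * ph * q * n))
  ((\<lambda>_. 0)(0 := 1)) w"
proof -
 have b: "int n < 2 ^ wB" "int nz < 2 ^ wB" using xw[of 0] xw[of "Suc 0"] unfolding x(1,2) by linarith+
 have e3: "\<And>k. k \<le> e \<Longrightarrow> \<bar>x (2 + 3 * nz + k)\<bar> + 1 < 2 ^ wB" using xw by blast
 note [simp] = x(1,2)
 show ?thesis unfolding prologue_def
  apply ((rule wp_Seq)?, rule wps, (simp?, rule ev_refl), (simp?, rule ev_refl), (simp?, rule ev_refl))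
  apply ((rule wp_Seq)?, rule wps, (simp?, rule ev_refl), (simp?, rule ev_refl), (simp?, rule ev_refl))
  apply ((rule wp_Seq)?, rule wps, (simp?, rule ev_refl), (simp?, rule ev_refl), (simp?, rule ev_refl))
  apply ((rule wp_Seq)?, rule wps, (simp?, rule ev_refl), (simp?, rule ev_refl), (simp?, rule ev_refl))
  apply (rule wp_Cond)
  subgoal by (rule wp_preparation[OF _ _ _ e(1,2) e3 e(3) q Fq]) simp_all
  using b x(3) xw[of 0] xw[of "Suc 0"] by simp_all
qed

lemma wp_flip_body:
 assumes "scalars m" "m 50 = int z" "z < 2 ^ k" "k < M" "M \<le> nB" "m 53 = int M - int k" "m 29 = p"
 shows "wp flip_body (\<lambda>m' w'. w' = w \<and> scalars m' \<and> m' 29 = p \<and> m' 50 = int (2 * z + of_bool b) \<and> m' 53 = int M - int (Suc k))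
  (m(54 := of_bool b)) w"
proof -
 have p: "(2::nat) ^ Suc k \<le> 2 ^ nB" using assms(4,5) by (intro power_increasing) auto
 have "2 * z + 1 < 2 ^ nB" using p assms(3) by simp
 then have "int (2 * z + 1) < int (2 ^ nB)" by (simp only: of_nat_less_iff)
 then have z: "2 * int z + 1 < 2 ^ nB" by simp
 have "M < 2 ^ nB" using assms(5) less_exp[of nB] by linarith
 then have M: "int M < 2 ^ nB" by simp
 have kM: "int k < int M" using assms(4) by simp
 define v :: int where "v = of_bool b"
 have ob: "0 \<le> v" "v \<le> 1" unfolding v_def by simp_all
 note [simp] = assms(1,2,6,7) scalarsD[OF assms(1)]
 have "wp flip_body (\<lambda>m' w'. w' = w \<and> scalars m' \<and> m' 29 = p \<and> m' 50 = 2 * int z + v \<and> m' 53 = int M - int (Suc k)) (m(54 := v)) w"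
  unfolding flip_body_def
  apply (rule wp_one)
  apply ((rule wp_Seq)?, rule wps, (simp?, rule ev_refl), (simp?, rule ev_refl), (simp?, rule ev_refl))
  apply ((rule wp_Seq)?, rule wps, (simp?, rule ev_refl), (simp?, rule ev_refl), (simp?, rule ev_refl))
  apply ((rule wp_Seq)?, rule wps, (simp?, rule ev_refl), (simp?, rule ev_refl), (simp?, rule ev_refl))
  subgoal by simp
  by simp_all (use z M kM ob in linarith)+
 then show ?thesis by (simp add: v_def)
qed

lemma wp_epilogue:
 assumes "scalars m" "m 50 = z" "0 \<le> z" "z < F ^ (2 * n)" "\<And>i. i < n \<Longrightarrow> D i = z div (F\<^sup>2) ^ i mod F\<^sup>2"
  and "m 29 = int p" "w = (\<lambda>_. None)" "0 < nz" and K: "2 * n \<le> 2 ^ K" and L: "2 * F ^ 5 = 2 ^ L"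
  and e: "F ^ (16 * n + 8) = 2 ^ e" and br: "sc (- (F ^ 5)) = 0" "sc (F ^ 5) = n"
 shows "wp (epilogue n nz K L (Suc e) 0) (\<lambda>_ w'. w' 0 = Some (int p) \<and> (\<forall>i<n. eigenpair_output w' i)) m w"
 unfolding epilogue_def
proof (rule wp_Cond)
 show "wp (unpack n ;; eigenpairs n nz K L (Suc e)) (\<lambda>_ w'. w' 0 = Some (int p) \<and> (\<forall>i<n. eigenpair_output w' i)) m w"
 proof (rule wp_Seq, rule wp_mono[OF wp_unpack[OF assms(1-5)]])
  fix m' w' assume h: "w' = w \<and> core m' \<and> same {14, 15, 42, 43, 50, 51} m m'"
  have "m' 29 = int p" using sameD[of "{14, 15, 42, 43, 50, 51}" m m' 29] h assms(6) by simp
  then show "wp (eigenpairs n nz K L (Suc e)) (\<lambda>_ w'. w' 0 = Some (int p) \<and> (\<forall>i<n. eigenpair_output w' i)) m' w'"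
   using wp_eigenpairs[of m' p w' K L e] h assms(7) K L e br by simp
 qed
qed (use scalarsD[OF assms(1)] assms(8) in simp)

end

context timed_ram begin

lemma tbound_prologue:
 assumes "bits (int ph) \<le> V" "bits (4 * int ph) \<le> V" "bits (2 * int ph) \<le> V"
 shows "tbound (prologue nz Ke Kq ph) \<le> 6 * V + 60 * ((nz + Ke + Kq + ph + 1) * V) + X"
 using tbound_preparation[OF assms, of nz Ke Kq] VX V unfolding prologue_def by (simp add: bits_num)

lemma tbound_epilogue:
 "tbound (epilogue n nz K Kb Ks n') \<le> 2 * V + tbound (unpack n) + tbound (eigenpairs n nz K Kb Ks) + tbound (write_identity n')"
 using VX V unfolding epilogue_def by simp

lemma tbound_flip_body: "tbound flip_body \<le> 5 * (nB + 1) + (wB + 1)"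
 unfolding flip_body_def by simp

text \<open>Every cost is bounded by a numerical multiple of a monomial in \<open>n\<close>,
  \<open>n + nz\<close> and \<open>v\<close>, so products are estimated by adding exponents. Of the
  four factors \<open>v\<close> two stem from schoolbook arithmetic, one from the Newton steps and
  one from bisection.\<close>

lemma total_tbound:
 assumes v: "V = v * v" "X = h * v" "Y = h * h" "h \<le> 81 * (n * v)" "10 \<le> v" "nB + 1 \<le> h" "wB + 1 \<le> v" and n: "1 \<le> n"
  and K: "K + 1 \<le> v" "Kb + 2 \<le> v" "Ks + 1 \<le> h" "M \<le> h" "Ke + Kq + ph \<le> v" "v + 5 \<le> h"
  and ph: "bits (int ph) \<le> V" "bits (4 * int ph) \<le> V" "bits (2 * int ph) \<le> V"
 shows "2 + tbound (prologue nz Ke Kq ph) + (M * (nB + 1 + 1 + tbound flip_body + 2) + nB + 3) + tbound (epilogue n nz K Kb Ks 0)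
  \<le> 100000000 * (n ^ 3 * (n + nz) * v ^ 4)"
proof -
 define mo where "mo i j k = n ^ i * (n + nz) ^ j * v ^ k" for i j k
 have mo_mult: "mo i j k * mo i' j' k' = mo (i + i') (j + j') (k + k')" for i j k i' j' k'
  unfolding mo_def by (simp add: power_add mult_ac)
 have mo_le: "mo i j k \<le> mo i' j' k'" if "i \<le> i'" "j \<le> j'" "k \<le> k'" for i j k i' j' k'
  unfolding mo_def using that n v(5) by (intro mult_le_mono power_increasing) auto
 \<comment> \<open>Big arithmetic costs \<open>n ^ 2\<close> per minor where the lifting costs
   \<open>n (n + nz)\<close>; this exchange absorbs it.\<close>
 have mo_nN: "mo (Suc i) j k \<le> mo i (Suc j) k" for i j k
 proof -
  have "n * (n ^ i * (n + nz) ^ j * v ^ k) \<le> (n + nz) * (n ^ i * (n + nz) ^ j * v ^ k)" by (rule mult_le_mono1) simp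
  then show ?thesis unfolding mo_def by (simp add: mult_ac)
 qed
 have P: "a * b \<le> e * mo I J K" if "a \<le> c * mo i j k" "b \<le> d * mo i' j' k'" "e = c * d" "I = i + i'" "J = j + j'" "K = k + k'"
  for a b c d e i j k i' j' k' I J K
  using mult_le_mono[OF that(1,2)] unfolding that(3-) mo_mult[symmetric] by (simp add: mult_ac)
 have n2: "n + 1 \<le> 2 * mo 1 0 0" "2 * n + 1 \<le> 3 * mo 1 0 0" "n + nz + 1 \<le> 2 * mo 0 1 0" unfolding mo_def using n by auto
 have v1: "V \<le> 1 * mo 0 0 2" unfolding mo_def v(1) by (simp add: power2_eq_square)
 have h1: "h \<le> 81 * mo 1 0 1" using v(4) unfolding mo_def by simp
 have vv: "v \<le> 1 * mo 0 0 1" unfolding mo_def by simp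
 have X1: "X \<le> 81 * mo 1 0 2" unfolding v(2) by (rule P[OF h1 vv]) simp_all
 have Y1: "Y \<le> 6561 * mo 2 0 2" unfolding v(3) by (rule P[OF h1 h1]) simp_all
 have 1: "(n + nz + 1) * V \<le> 2 * mo 0 1 2" by (rule P[OF n2(3) v1]) simp_all
 have "80 * ((n + nz + 1) * V) + 3 * X \<le> 403 * mo 0 1 2" using 1 X1 mo_nN[of 0 0 2] by simp
 then have TE: "TE n nz \<le> 1209 * mo 1 1 2" unfolding TE_def by (rule P[OF n2(2)]) simp_all
 have Kv: "K + 1 \<le> 1 * mo 0 0 1" "Kb + 2 \<le> 1 * mo 0 0 1" using K vv by auto
 have KY: "(K + 1) * Y \<le> 6561 * mo 2 0 3" by (rule P[OF Kv(1) Y1]) simp_all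
 have m1: "mo 2 0 3 \<le> mo 1 1 3" "mo 2 0 2 \<le> mo 1 1 2" "mo 3 0 3 \<le> mo 2 1 3"
  using mo_nN[of 1 0 3] mo_nN[of 1 0 2] mo_nN[of 2 0 3] by (simp_all add: numeral_2_eq_2 numeral_3_eq_3)
 have "TE n nz + 70 * ((K + 1) * Y) \<le> 460479 * mo 1 1 3" using TE KY m1(1) mo_le[of 1 1 1 1 2 3] by simp
 then have I1: "(n + 1) * (TE n nz + 70 * ((K + 1) * Y)) \<le> 920958 * mo 2 1 3" by (rule P[OF n2(1)]) simp_all
 have "(n + 1) * (TE n nz + 70 * ((K + 1) * Y)) + 20 * V \<le> 920978 * mo 2 1 3" using I1 v1 mo_le[of 0 2 0 1 2 3] by simp
 then have B1: "(Kb + 2) * ((n + 1) * (TE n nz + 70 * ((K + 1) * Y)) + 20 * V) \<le> 920978 * mo 2 1 4" by (rule P[OF Kv(2)]) simp_all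
 have "TE n nz + 40 * Y \<le> 263649 * mo 1 1 2" using TE Y1 m1(2) by simp
 then have C1: "(n + 1) * (TE n nz + 40 * Y) \<le> 527298 * mo 2 1 2" by (rule P[OF n2(1)]) simp_all
 have "Ks + 1 \<le> 81 * mo 1 0 1" using K(3) h1 by linarith
 from this Y1 have D1: "(Ks + 1) * Y \<le> 531441 * mo 3 0 3" by (rule P) simp_all
 have le4: "mo 2 1 2 \<le> mo 2 1 4" "mo 2 1 3 \<le> mo 2 1 4" "mo 0 0 2 \<le> mo 2 1 4" by (auto intro!: mo_le)
 have lin: "a + 3 * b + 30 * d + 20 * f \<le> 18446122 * z" if "a \<le> 920978 * z" "b \<le> 527298 * z" "d \<le> 531441 * z" "f \<le> 1 * z" for a b d f z :: nat
  using that by linarith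
 have "(Kb + 2) * ((n + 1) * (TE n nz + 70 * ((K + 1) * Y)) + 20 * V) +
  3 * ((n + 1) * (TE n nz + 40 * Y)) + 30 * ((Ks + 1) * Y) + 20 * V \<le> 18446122 * mo 2 1 4"
  by (rule lin[OF B1 order_trans[OF C1 mult_le_mono2[OF le4(1)]] order_trans[OF D1 mult_le_mono2[OF order_trans[OF m1(3) le4(2)]]]
    order_trans[OF v1 mult_le_mono2[OF le4(3)]]])
 then have "(n + 1) * ((Kb + 2) * ((n + 1) * (TE n nz + 70 * ((K + 1) * Y)) + 20 * V) +
  3 * ((n + 1) * (TE n nz + 40 * Y)) + 30 * ((Ks + 1) * Y) + 20 * V) \<le> 36892244 * mo 3 1 4" by (rule P[OF n2(1)]) simp_all
 then have E1: "tbound (eigenpairs n nz K Kb Ks) \<le> 36892244 * mo 3 1 4" by (rule order_trans[OF tbound_eigenpairs])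
 have "20 * Y \<le> 131220 * mo 2 0 2" using Y1 by linarith
 then have "(n + 1) * (20 * Y) \<le> 262440 * mo 3 0 2" by (rule P[OF n2(1)]) simp_all
 then have U1: "tbound (unpack n) \<le> 262440 * mo 3 0 2" by (rule order_trans[OF tbound_unpack])
 have N1: "nz + Ke + Kq + ph + 1 \<le> 2 * mo 0 1 1"
 proof -
  have "nz + 1 \<le> mo 0 1 0" unfolding mo_def using n by simp
  moreover have "Ke + Kq + ph \<le> mo 0 0 1" using K(5) vv by simp
  ultimately show ?thesis using mo_le[of 0 0 1 1 0 1] mo_le[of 0 0 0 1 1 1] by simp
 qed
 have N2: "(nz + Ke + Kq + ph + 1) * V \<le> 2 * mo 0 1 3" by (rule P[OF N1 v1]) simp_all
 have lin2: "6 * a + 60 * b + d \<le> 126 * z + y" if "a \<le> 1 * z" "b \<le> 2 * z" "d \<le> y" for a b d y z :: nat using that by linarith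
 have "6 * V + 60 * ((nz + Ke + Kq + ph + 1) * V) + X \<le> 126 * mo 0 1 3 + 81 * mo 1 0 2"
  by (rule lin2[OF order_trans[OF v1 mult_le_mono2] N2 X1]) (rule mo_le; simp)
 then have G1: "tbound (prologue nz Ke Kq ph) \<le> 126 * mo 0 1 3 + 81 * mo 1 0 2" by (rule order_trans[OF tbound_prologue[OF ph]])
 have "nB + 1 + 1 + tbound flip_body + 2 \<le> 6 * (nB + 1) + (wB + 1) + 3" using tbound_flip_body by simp
 also have "\<dots> \<le> 6 * h + v + 3" using v(6,7) by (intro add_mono mult_le_mono2) auto
 also have "\<dots> \<le> 10 * h" using K(6) by simp
 finally have "nB + 1 + 1 + tbound flip_body + 2 \<le> 810 * mo 1 0 1" using h1 by linarith
 moreover have "M \<le> 81 * mo 1 0 1" using K(4) h1 by linarith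
 ultimately have J1: "M * (nB + 1 + 1 + tbound flip_body + 2) \<le> 65610 * mo 2 0 2" by (intro P[of M 81 1 0 1 _ 810 1 0 1]) simp_all
 have W1: "tbound (epilogue n nz K Kb Ks 0) \<le> 52 * V + tbound (unpack n) + tbound (eigenpairs n nz K Kb Ks)"
  using tbound_epilogue[of n nz K Kb Ks 0] tbound_write_identity[of 0] by simp
 have fin: "mo 0 1 3 \<le> mo 3 1 4" "mo 1 0 2 \<le> mo 3 1 4" "mo 2 0 2 \<le> mo 3 1 4" "mo 1 0 1 \<le> mo 3 1 4" "mo 3 0 2 \<le> mo 3 1 4" "mo 0 0 2 \<le> mo 3 1 4" "mo 0 0 0 \<le> mo 3 1 4"
  by (auto intro!: mo_le)
 have "mo 0 0 0 = 1" unfolding mo_def by simp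
 then have "2 + tbound (prologue nz Ke Kq ph) + (M * (nB + 1 + 1 + tbound flip_body + 2) + nB + 3) + tbound (epilogue n nz K Kb Ks 0)
  \<le> 100000000 * mo 3 1 4"
  using G1 J1 W1 E1 U1 v1 h1 v(6) fin by linarith
 then show ?thesis unfolding mo_def by simp
qed

text \<open>The main branch is compiled but not entered, so its loops carry the bound 0; the factor
  \<open>n * n\<close> comes from writing the identity matrix.\<close>

lemma total_tbound_zero:
 assumes "n0 = 0" "X = V" "Y = V" and n: "1 \<le> n" and wB: "wB + 3 \<le> V"
  and ph: "bits (int ph) \<le> V" "bits (4 * int ph) \<le> V" "bits (2 * int ph) \<le> V"
 shows "2 + tbound (prologue 0 0 0 ph) + (nB + 3) + tbound (epilogue 0 0 0 0 0 n) \<le> (1100 + 60 * ph) * (n * n * V)"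
proof -
 have t0: "TE 0 0 = 83 * V" unfolding TE_def using assms by simp
 have "tbound (eigenpairs 0 0 0 0 0) \<le> 765 * V" using tbound_eigenpairs[of 0 0 0 0 0] assms unfolding t0 by simp
 moreover have "tbound (unpack 0) \<le> 20 * V" using tbound_unpack[of 0] assms by simp
 moreover have "tbound (write_identity n) \<le> 200 * (n * n * V)"
 proof -
  have "(n + 1) * (n + 1) * V \<le> (2 * n) * (2 * n) * V" using n by (intro mult_le_mono) auto
  then show ?thesis using tbound_write_identity[of n] by simp
 qed
 moreover have "tbound (prologue 0 0 0 ph) \<le> 67 * V + 60 * (ph * V)" using tbound_prologue[OF ph, of 0 0 0] assms(2) by (simp add: algebra_simps)
 moreover have "nB + 3 \<le> 2 * V" using VX X V assms(2) by linarith
 moreover have "V \<le> n * n * V" using mult_le_mono[of 1 n 1 n] n by simp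
 moreover have "ph * V \<le> ph * (n * n * V)" using calculation(6) by (rule mult_le_mono2)
 ultimately have "2 + tbound (prologue 0 0 0 ph) + (nB + 3) + tbound (epilogue 0 0 0 0 0 n) \<le> 1100 * (n * n * V) + 60 * (ph * (n * n * V))"
  using tbound_epilogue[of 0 0 0 0 0 n] V(4) by linarith
 then show ?thesis by (simp add: algebra_simps)
qed

end

section \<open>Digits, counting and the output specification\<close>

lemma concat_triples:
 "l < length ps \<Longrightarrow> concat (map (\<lambda>p. [a p, b p, c p]) ps) ! (3 * l) = a (ps ! l) \<and>
  concat (map (\<lambda>p. [a p, b p, c p]) ps) ! (3 * l + 1) = b (ps ! l) \<and>
  concat (map (\<lambda>p. [a p, b p, c p]) ps) ! (3 * l + 2) = c (ps ! l)"
proof (induction ps arbitrary: l)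
 case (Cons p ps)
 show ?case
 proof (cases l)
  case (Suc k)
  then have e: "3 * l = Suc (Suc (Suc (3 * k)))" "3 * l + 1 = Suc (Suc (Suc (3 * k + 1)))" "3 * l + 2 = Suc (Suc (Suc (3 * k + 2)))"
   by simp_all
  show ?thesis unfolding e using Cons.IH[of k] Cons.prems Suc by simp
 qed simp
qed simp

lemma length_concat_triples: "length (concat (map (\<lambda>p. [a p, b p, c p]) ps)) = 3 * length ps"
 by (induction ps) auto

text \<open>Makes the map from numbers to digit vectors injective, so that bad coin numbers can be
  counted by bad diagonals.\<close>

lemma mod_power_digits:
 fixes z z' K :: nat
 assumes "\<And>i. i < n \<Longrightarrow> z div K ^ i mod K = z' div K ^ i mod K"
 shows "z mod K ^ n = z' mod K ^ n"
 using assms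
proof (induction n)
 case (Suc n)
 have "z mod (K ^ n * K) = K ^ n * (z div K ^ n mod K) + z mod K ^ n" for z by (rule mod_mult2_eq)
 then show ?case using Suc.IH Suc.prems[of n] Suc.prems by (simp add: mult.commute)
qed simp

lemma prob_pmf_of_set_ge:
 assumes N: "0 < (N::nat)" and bad: "bad \<subseteq> {..<N}" "\<And>z. z < N \<Longrightarrow> z \<notin> bad \<Longrightarrow> g z \<in> S" "real (card bad) \<le> \<delta> * real N"
 shows "measure_pmf.prob (map_pmf g (pmf_of_set {..<N})) S \<ge> 1 - \<delta>"
proof -
 have ne: "{..<N} \<noteq> {}" using N by auto
 have "real N - real (card bad) = real (card ({..<N} - bad))"
  using bad(1) card_mono[OF _ bad(1)] by (simp add: card_Diff_subset finite_subset of_nat_diff)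
 also have "\<dots> \<le> real (card ({..<N} \<inter> g -` S))" using bad(2) by (intro of_nat_mono card_mono) auto
 finally have "(real N - real (card bad)) / real N \<le> real (card ({..<N} \<inter> g -` S)) / real N" using N by (intro divide_right_mono) auto
 also have "\<dots> = measure_pmf.prob (map_pmf g (pmf_of_set {..<N})) S"
  using measure_pmf_of_set[OF ne, of "g -` S"] by (simp add: measure_map_pmf)
 finally have "(real N - real (card bad)) / real N \<le> measure_pmf.prob (map_pmf g (pmf_of_set {..<N})) S" .
 moreover have "1 - \<delta> \<le> (real N - real (card bad)) / real N" using bad(3) N by (simp add: field_simps)
 ultimately show ?thesis by linarith
qed

definition accurate_output :: "nat \<Rightarrow> int mat \<Rightarrow> real \<Rightarrow> (nat \<Rightarrow> int option) \<Rightarrow> bool" where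
 "accurate_output n A \<epsilon> w \<longleftrightarrow> (\<exists>l v. fixed_point_output n w l v \<and>
  (\<forall>i<n.
    \<bar>eigenvalues_sorted (map_mat real_of_int A) ! i - l i\<bar> \<le> \<epsilon> \<and>
    (norm2 (v i))\<^sup>2 \<in> {1 - \<epsilon> .. 1 + \<epsilon>} \<and>
    norm2 (map_mat real_of_int A *\<^sub>v v i - l i \<cdot>\<^sub>v v i) \<le> \<epsilon>) \<and>
  (\<forall>i<n. \<forall>j<n. i \<noteq> j \<longrightarrow> \<bar>scalar_prod (v i) (v j)\<bar> \<le> \<epsilon>))"

lemma scalar_prod_vec: "scalar_prod (vec n f) (vec n h) = (\<Sum>k<n. f k * h k)"
 by (simp add: scalar_prod_def atLeast0LessThan)

lemma norm2_vec: "norm2 (vec n h) = sqrt (\<Sum>k<n. (h k)\<^sup>2)"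
 unfolding norm2_def scalar_prod_vec by (simp add: power2_eq_square)

lemma residual_vec:
 assumes "A \<in> carrier_mat n n"
 shows "map_mat real_of_int A *\<^sub>v vec n h - s \<cdot>\<^sub>v vec n h = vec n (\<lambda>k. (\<Sum>l<n. real_of_int (A $$ (k,l)) * h l) - s * h k)"
 using assms by (intro eq_vecI) (auto simp: scalar_prod_def atLeast0LessThan)

lemma accurate_outputI:
 fixes s :: "nat \<Rightarrow> int" and V :: "nat \<Rightarrow> nat \<Rightarrow> int"
 assumes A: "A \<in> carrier_mat n n" and E: "eigsys n (\<lambda>i j. real_of_int (A $$ (i,j))) lam v0"
  and w: "w 0 = Some (int p)" "\<And>i. i < n \<Longrightarrow> w (1 + i) = Some (s i)" "\<And>i j. i < n \<Longrightarrow> j < n \<Longrightarrow> w (1 + n + n * i + j) = Some (V i j)"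
  and l: "\<And>i. i < n \<Longrightarrow> \<bar>lam i - s i / 2 ^ p\<bar> \<le> \<epsilon>"
  and nrm: "\<And>i. i < n \<Longrightarrow> (\<Sum>k<n. (V i k / 2 ^ p) * (V i k / 2 ^ p)) \<in> {1 - \<epsilon> .. 1 + \<epsilon>}"
  and res: "\<And>i. i < n \<Longrightarrow> sqrt (\<Sum>k<n. ((\<Sum>l<n. real_of_int (A $$ (k,l)) * (V i l / 2 ^ p)) - s i / 2 ^ p * (V i k / 2 ^ p))\<^sup>2) \<le> \<epsilon>"
  and orth: "\<And>i j. i < n \<Longrightarrow> j < n \<Longrightarrow> i \<noteq> j \<Longrightarrow> \<bar>\<Sum>k<n. (V i k / 2 ^ p) * (V j k / 2 ^ p)\<bar> \<le> \<epsilon>"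
 shows "accurate_output n A \<epsilon> w"
proof -
 let ?l = "\<lambda>i. s i / 2 ^ p" and ?v = "\<lambda>i. vec n (\<lambda>k. V i k / 2 ^ p)"
 have M: "map_mat real_of_int A = mat n n (\<lambda>(i,j). real_of_int (A $$ (i,j)))" using A by (intro eq_matI) auto
 have "fixed_point_output n w ?l ?v"
  unfolding fixed_point_output_def by (intro exI[of _ p]) (use w in auto)
 moreover have "\<bar>eigenvalues_sorted (map_mat real_of_int A) ! i - ?l i\<bar> \<le> \<epsilon>" if "i < n" for i
  unfolding M eigsys_eigenvalues_sorted[OF E that] using l[OF that] .
 moreover have "(norm2 (?v i))\<^sup>2 \<in> {1 - \<epsilon> .. 1 + \<epsilon>}" if "i < n" for i
  using nrm[OF that] unfolding norm2_vec by (simp add: power2_eq_square sum_nonneg flip: real_sqrt_mult)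
 moreover have "norm2 (map_mat real_of_int A *\<^sub>v ?v i - ?l i \<cdot>\<^sub>v ?v i) \<le> \<epsilon>" if "i < n" for i
  unfolding residual_vec[OF A] norm2_vec using res[OF that] .
 moreover have "\<bar>scalar_prod (?v i) (?v j)\<bar> \<le> \<epsilon>" if "i < n" "j < n" "i \<noteq> j" for i j
  unfolding scalar_prod_vec using orth[OF that] .
 ultimately show ?thesis unfolding accurate_output_def by (intro exI[of _ ?l] exI[of _ ?v]) blast
qed

section \<open>Problem instances and their encoding\<close>

locale sparse_problem =
 fixes n U :: nat and A :: "int mat" and ps :: "(nat \<times> nat) list" and \<epsilon> :: real
 assumes n1: "n \<ge> 1" and A: "A \<in> carrier_mat n n" "transpose_mat A = A"
  and U: "\<And>i j. i < n \<Longrightarrow> j < n \<Longrightarrow> \<bar>A $$ (i,j)\<bar> \<le> int U"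
  and ps: "coordinate_order A ps" and eps: "\<epsilon> > 0"
begin

abbreviation "inp \<equiv> encode_input A ps \<epsilon>"
abbreviation "nz \<equiv> length ps"
abbreviation "tt \<equiv> 2 + real n * real U / \<epsilon> + \<epsilon>"
abbreviation "LS \<equiv> log_size n U \<epsilon>"

lemma symm: "i < n \<Longrightarrow> j < n \<Longrightarrow> A $$ (i,j) = A $$ (j,i)"
 using A by (metis carrier_matD index_transpose_mat(1))

lemma dist: "distinct ps" "set ps = nonzero_positions A" using ps unfolding coordinate_order_def by auto

lemma positions: "nonzero_positions A \<subseteq> {..<n} \<times> {..<n}" "p \<in> set ps \<Longrightarrow> fst p < n \<and> snd p < n \<and> A $$ p \<noteq> 0"
 unfolding dist nonzero_positions_def using A by auto

lemma nz_nnz: "nz = nnz A" unfolding nnz_def dist(2)[symmetric] using distinct_card[OF dist(1)] by simp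

lemma nz_le: "nz \<le> n * n"
proof -
 have "card (nonzero_positions A) \<le> card ({..<n} \<times> {..<n})" using positions(1) by (intro card_mono) auto
 then show ?thesis unfolding nz_nnz nnz_def by simp
qed

lemma sum_positions:
 fixes h :: "nat \<times> nat \<Rightarrow> int"
 assumes "\<And>p. A $$ p = 0 \<Longrightarrow> h p = 0"
 shows "(\<Sum>l<nz. h (ps ! l)) = (\<Sum>i<n. \<Sum>j<n. h (i,j))"
proof -
 have "(\<Sum>l<nz. h (ps ! l)) = sum_list (map h ps)" by (simp add: sum_list_sum_nth atLeast0LessThan)
 also have "\<dots> = sum h (set ps)" using sum_list_distinct_conv_sum_set[OF dist(1)] .
 also have "\<dots> = sum h ({..<n} \<times> {..<n})"
  unfolding dist(2) using positions(1) assms A by (intro sum.mono_neutral_left) (auto simp: nonzero_positions_def)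
 also have "\<dots> = (\<Sum>i<n. \<Sum>j<n. h (i,j))" by (simp add: sum.cartesian_product)
 finally show ?thesis .
qed

lemma inp_cells:
 "inp 0 = int n" "inp (Suc 0) = int nz"
 "l < nz \<Longrightarrow> inp (2 + 3 * l) = int (fst (ps ! l))" "l < nz \<Longrightarrow> inp (3 + 3 * l) = int (snd (ps ! l))"
 "l < nz \<Longrightarrow> inp (4 + 3 * l) = A $$ (ps ! l)"
 "inp (2 + 3 * nz + k) = (if k = 0 then \<lfloor>\<epsilon>\<rfloor> else \<lfloor>\<epsilon> * 2 ^ k\<rfloor> mod 2)"
proof -
 let ?C = "concat (map (\<lambda>p. [int (fst p), int (snd p), A $$ p]) ps)"
 have f: "(\<lambda>(i, j). [int i, int j, A $$ (i, j)]) = (\<lambda>p. [int (fst p), int (snd p), A $$ p])" by auto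
 have h: "inp c = (if c < 2 + 3 * nz then (int n # int nz # ?C) ! c else if c = 2 + 3 * nz then \<lfloor>\<epsilon>\<rfloor> else \<lfloor>\<epsilon> * 2 ^ (c - (2 + 3 * nz))\<rfloor> mod 2)" for c
  unfolding encode_input_def Let_def f using A by (simp add: length_concat_triples)
 show "inp 0 = int n" "inp (Suc 0) = int nz" unfolding h by simp_all
 show "inp (2 + 3 * nz + k) = (if k = 0 then \<lfloor>\<epsilon>\<rfloor> else \<lfloor>\<epsilon> * 2 ^ k\<rfloor> mod 2)" unfolding h by simp
 assume l: "l < nz"
 have s: "2 + 3 * l = Suc (Suc (3 * l))" "3 + 3 * l = Suc (Suc (3 * l + 1))" "4 + 3 * l = Suc (Suc (3 * l + 2))" by simp_all
 note C = concat_triples[OF l, where a = "\<lambda>p. int (fst p)" and b = "\<lambda>p. int (snd p)" and c = "\<lambda>p. A $$ p"]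
 show "inp (2 + 3 * l) = int (fst (ps ! l))" unfolding h s nth_Cons_Suc using l C by simp
 show "inp (3 + 3 * l) = int (snd (ps ! l))" unfolding h s nth_Cons_Suc using l C by simp
 show "inp (4 + 3 * l) = A $$ (ps ! l)" unfolding h s nth_Cons_Suc using l C by simp
qed

lemma inp_cases:
 assumes "R (int n)" "R (int nz)" "\<And>p. p \<in> set ps \<Longrightarrow> R (int (fst p)) \<and> R (int (snd p)) \<and> R (A $$ p)" "R \<lfloor>\<epsilon>\<rfloor>" "R 0" "R 1"
 shows "R (inp c)"
proof -
 have m2: "R (b mod 2)" for b :: int using assms(5,6) by (cases "even b") (auto simp: even_iff_mod_2_eq_zero odd_iff_mod_2_eq_one)
 consider "c = 0" | "c = Suc 0" | l where "l < nz" "c = 2 + 3 * l \<or> c = 3 + 3 * l \<or> c = 4 + 3 * l" | k where "c = 2 + 3 * nz + k"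
 proof -
  assume a: "c = 0 \<Longrightarrow> thesis" "c = Suc 0 \<Longrightarrow> thesis" "\<And>l. l < nz \<Longrightarrow> c = 2 + 3 * l \<or> c = 3 + 3 * l \<or> c = 4 + 3 * l \<Longrightarrow> thesis" "\<And>k. c = 2 + 3 * nz + k \<Longrightarrow> thesis"
  show thesis
  proof (cases "c < 2 \<or> c \<ge> 2 + 3 * nz")
   case True
   then show ?thesis using a(1,2) a(4)[of "c - (2 + 3 * nz)"] by linarith
  next
   case False
   then have "(c - 2) div 3 < nz" "c = 2 + 3 * ((c - 2) div 3) \<or> c = 3 + 3 * ((c - 2) div 3) \<or> c = 4 + 3 * ((c - 2) div 3)" by presburger+
   then show ?thesis using a(3) by blast
  qed
 qed
 then show ?thesis
 proof cases
  case 3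
  then have "ps ! l \<in> set ps" by simp
  then show ?thesis using assms(3) inp_cells(3-5)[OF 3(1)] 3(2) by metis
 qed (use inp_cells(1,2,6) assms(1,2,4) m2 in auto)
qed

text \<open>The width of the cell with the integer part of \<epsilon>, which \<open>n\<close>,
  \<open>U\<close> and \<open>1 / \<epsilon>\<close> do not control; the summand \<epsilon> in
  \<open>log_size\<close> pays for it.\<close>

definition "gb = (LEAST k. \<epsilon> + 3 \<le> 2 ^ k)"

lemma gb: "\<epsilon> + 3 \<le> 2 ^ gb" "\<lfloor>\<epsilon>\<rfloor> + 2 < 2 ^ gb" "real gb \<le> 4 * LS"
proof -
 have "(1::real) < 2" by simp
 from real_arch_pow[OF this, of "\<epsilon> + 3"] obtain k where "\<epsilon> + 3 < 2 ^ k" by blast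
 then have "\<epsilon> + 3 \<le> 2 ^ k" by simp
 then show 1: "\<epsilon> + 3 \<le> 2 ^ gb" unfolding gb_def by (rule LeastI)
 have "real_of_int (\<lfloor>\<epsilon>\<rfloor> + 2) < real_of_int (2 ^ gb)" using 1 of_int_floor_le[of \<epsilon>] by (simp, linarith)
 then show "\<lfloor>\<epsilon>\<rfloor> + 2 < 2 ^ gb" by (simp only: of_int_less_iff)
 have "gb \<noteq> 0" using 1 eps by (cases gb) auto
 then obtain g' where g': "gb = Suc g'" by (cases gb) auto
 then have "\<not> \<epsilon> + 3 \<le> 2 ^ g'" using not_less_Least[of g' "\<lambda>k. \<epsilon> + 3 \<le> 2 ^ k"] unfolding gb_def by simp
 then have a: "(2::real) ^ gb \<le> 2 * (\<epsilon> + 3)" unfolding g' by simp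
 have t2: "tt \<ge> 2 + \<epsilon>" "tt \<ge> 2" using eps by auto
 have "tt * 8 \<le> tt * tt ^ 3" using t2(2) power_mono[of 2 tt 3] by (intro mult_left_mono) auto
 then have "2 * (\<epsilon> + 3) \<le> tt ^ 4" using t2 by (simp add: eval_nat_numeral)
 then have "(2::real) ^ gb \<le> tt ^ 4" using a by linarith
 then have "log 2 ((2::real) ^ gb) \<le> log 2 (tt ^ 4)" using t2 by (intro log_le_cancel_iff[THEN iffD2]) auto
 then show "real gb \<le> 4 * LS" unfolding log_size_def using t2 by (simp add: log_nat_power)
qed

lemma LS1: "1 \<le> LS"
proof -
 have t: "2 \<le> tt" using eps by auto
 have "log 2 2 \<le> LS" unfolding log_size_def by (intro log_le_cancel_iff[THEN iffD2]) (use t in linarith)+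
 then show ?thesis by simp
qed

end

section \<open>Nonzero matrices\<close>

text \<open>\<open>9 \<le> ph\<close> turns \<open>F = Q ^ ph\<close> into the hypothesis
  \<open>Q ^ 9 \<le> F\<close> of the error analysis.\<close>

locale nonzero_problem = sparse_problem +
 fixes ph :: nat
 assumes nzp: "0 < length ps" and ph: "9 \<le> ph"
begin

definition "eb = (LEAST k. 1 \<le> \<epsilon> * 2 ^ k)"
definition "Wt = (\<Sum>l<nz. \<bar>A $$ (ps ! l)\<bar>)"
definition "qb = (LEAST k. int n + Wt + 2 ^ eb \<le> 2 ^ k)"
definition "fb = ph * qb"
definition "FF = (2::int) ^ fb"
text \<open>Words have to hold values up to \<open>F ^ 30\<close>, the integer part of \<epsilon>
  and the constants made from \<open>ph\<close>.\<close>

definition "wB = 30 * fb + gb + ph + 10"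
definition "nB = fb * (40 * n + 40)"
definition "MB = (64 + 3 * n) * (2 * wB + 2) + 64 * nB"
definition "DD z i = int z div (FF\<^sup>2) ^ i mod FF\<^sup>2"
definition "QQ = (2::real) ^ qb"

lemma eb: "1 \<le> \<epsilon> * 2 ^ eb" "k < eb \<Longrightarrow> \<epsilon> * 2 ^ k < 1"
proof -
 have "(1::real) < 2" by simp
 from real_arch_pow[OF this, of "1 / \<epsilon>"] obtain k where "1 / \<epsilon> < 2 ^ k" by blast
 then have "1 \<le> \<epsilon> * 2 ^ k" using eps by (simp add: field_simps)
 then show "1 \<le> \<epsilon> * 2 ^ eb" unfolding eb_def by (rule LeastI)
 show "\<epsilon> * 2 ^ k < 1" if "k < eb" for k using not_less_Least[OF that[unfolded eb_def]] by simp
qed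

lemma qb: "int n + Wt + 2 ^ eb \<le> 2 ^ qb" "k < qb \<Longrightarrow> 2 ^ k < int n + Wt + 2 ^ eb"
proof -
 let ?S = "int n + Wt + 2 ^ eb"
 have "?S \<le> int (nat ?S)" by simp
 also have "\<dots> \<le> int (2 ^ nat ?S)" using less_imp_le[OF less_exp[of "nat ?S"]] by (simp only: of_nat_le_iff)
 finally have "?S \<le> 2 ^ nat ?S" by simp
 then show "?S \<le> 2 ^ qb" unfolding qb_def by (rule LeastI)
 show "2 ^ k < ?S" if "k < qb" for k using not_less_Least[OF that[unfolded qb_def]] by simp
qed

lemma Wt: "Wt = (\<Sum>i<n. \<Sum>j<n. \<bar>A $$ (i,j)\<bar>)" unfolding Wt_def by (rule sum_positions) simp

lemma Wt1: "1 \<le> Wt"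
proof -
 have "1 \<le> \<bar>A $$ (ps ! 0)\<bar>" using positions(2)[of "ps ! 0"] nzp by (simp add: int_one_le_iff_zero_less)
 also have "\<dots> \<le> Wt" unfolding Wt_def using nzp by (intro member_le_sum) auto
 finally show ?thesis .
qed

text \<open>With \<open>U \<ge> 1\<close> the argument of the logarithm in \<open>log_size\<close>
  dominates \<open>n / \<epsilon>\<close>; this is where a nonzero matrix differs from the zero
  matrix.\<close>

lemma U1: "1 \<le> U"
proof -
 have "ps ! 0 \<in> set ps" using nzp by simp
 then have "fst (ps ! 0) < n" "snd (ps ! 0) < n" "A $$ (ps ! 0) \<noteq> 0" using positions(2) by auto
 then show ?thesis using U[of "fst (ps ! 0)" "snd (ps ! 0)"] by simp
qed

lemma qb2: "2 \<le> qb"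
proof (rule ccontr)
 assume "\<not> 2 \<le> qb"
 then have "(2::int) ^ qb \<le> 2 ^ 1" by (intro power_increasing) auto
 moreover have "(1::int) \<le> 2 ^ eb" by simp
 moreover have "1 \<le> int n" using n1 by simp
 ultimately show False using qb(1) Wt1 unfolding power_one_right by linarith
qed

lemma QQ: "4 \<le> QQ" "real n \<le> QQ" "real_of_int Wt \<le> QQ" "1 / QQ \<le> \<epsilon>" "QQ ^ ph = real_of_int FF" "QQ ^ 9 \<le> real_of_int FF"
proof -
 have "(2::real) ^ 2 \<le> 2 ^ qb" using qb2 by (intro power_increasing) auto
 then show Q4: "4 \<le> QQ" unfolding QQ_def by simp
 have "real_of_int (int n + Wt + 2 ^ eb) \<le> real_of_int (2 ^ qb)" using qb(1) by (simp only: of_int_le_iff)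
 then have S: "real n + real_of_int Wt + 2 ^ eb \<le> QQ" unfolding QQ_def by simp
 have e0: "(0::real) < 2 ^ eb" by simp
 have W0: "0 \<le> real_of_int Wt" using Wt1 by simp
 show "real n \<le> QQ" "real_of_int Wt \<le> QQ" using S e0 W0 by linarith+
 have "2 ^ eb \<le> QQ" using S W0 by linarith
 then have "1 \<le> \<epsilon> * QQ" using eb(1) eps mult_left_mono[of "2 ^ eb" QQ \<epsilon>] by linarith
 then show "1 / QQ \<le> \<epsilon>" using Q4 by (simp add: field_simps)
 show F: "QQ ^ ph = real_of_int FF" unfolding QQ_def FF_def fb_def by (simp add: power_mult[symmetric] mult.commute)
 have "QQ ^ 9 \<le> QQ ^ ph" using Q4 ph by (intro power_increasing) auto
 then show "QQ ^ 9 \<le> real_of_int FF" unfolding F .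
qed

lemma FF_facts:
 "FF = (2 ^ qb) ^ ph" "FF \<ge> 1000" "even FF" "2 ^ qb \<le> FF" "int n * int n \<le> FF" "Wt \<le> FF" "int eb \<le> FF" "int qb \<le> FF" "4 * int ph \<le> FF"
proof -
 show F: "FF = (2 ^ qb) ^ ph" unfolding FF_def fb_def by (simp add: power_mult[symmetric] mult.commute)
 have Q4: "(4::int) \<le> 2 ^ qb" using power_increasing[of 2 qb "2::int"] qb2 by simp
 have "(4::int) ^ 9 \<le> (2 ^ qb) ^ 9" using Q4 by (intro power_mono) auto
 also have "\<dots> \<le> FF" unfolding F using ph Q4 by (intro power_increasing) auto
 finally show "FF \<ge> 1000" by simp
 show "even FF" unfolding FF_def fb_def using ph qb2 by simp
 have q1: "((2::int) ^ qb) ^ 1 \<le> FF" unfolding F using ph Q4 by (intro power_increasing) auto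
 then show qF: "2 ^ qb \<le> FF" by simp
 have e0: "(0::int) < 2 ^ eb" by simp
 have nq: "int n \<le> 2 ^ qb" "Wt \<le> 2 ^ qb" "2 ^ eb \<le> (2::int) ^ qb" using qb(1) Wt1 e0 by linarith+
 have "int n * int n \<le> 2 ^ qb * 2 ^ qb" using nq(1) by (intro mult_mono) auto
 also have "\<dots> = ((2::int) ^ qb) ^ 2" by (simp add: power2_eq_square)
 also have "\<dots> \<le> FF" unfolding F using ph Q4 by (intro power_increasing) auto
 finally show "int n * int n \<le> FF" .
 show "Wt \<le> FF" using nq qF by linarith
 have ex: "int k \<le> 2 ^ k" for k :: nat using less_imp_le[OF less_exp[of k]] by simp
 show "int eb \<le> FF" "int qb \<le> FF" using ex[of eb] ex[of qb] nq qF by linarith+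
 have "4 * int ph \<le> 2 ^ ph * 2 ^ ph"
  using ex[of ph] power_increasing[of 2 ph "2::int"] ph by (intro mult_mono) auto
 also have "\<dots> = (4::int) ^ ph" by (simp add: power_mult_distrib[symmetric])
 also have "\<dots> \<le> FF" unfolding F using Q4 by (intro power_mono) auto
 finally show "4 * int ph \<le> FF" .
qed

lemma wB_facts: "FF ^ 30 \<le> (2::int) ^ wB" "(2::int) ^ nB = FF ^ (40 * n + 40)" "64 + 3 * n \<le> 2 ^ wB" "2 * n \<le> 2 ^ wB" "\<bar>inp i\<bar> + 1 < 2 ^ wB"
proof -
 have "FF ^ 30 = 2 ^ (30 * fb)" unfolding FF_def by (simp add: power_mult[symmetric] mult.commute)
 then show F30: "FF ^ 30 \<le> (2::int) ^ wB" unfolding wB_def by (simp add: power_increasing)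
 show "(2::int) ^ nB = FF ^ (40 * n + 40)" unfolding FF_def nB_def by (simp add: power_mult)
 have F1: "FF * 1000 \<le> FF ^ 30"
 proof -
  have "FF * 1000 \<le> FF * FF" using FF_facts(2) by (intro mult_left_mono) auto
  also have "\<dots> = FF ^ 2" by (simp add: power2_eq_square)
  also have "\<dots> \<le> FF ^ 30" using FF_facts(2) by (intro power_increasing) auto
  finally show ?thesis .
 qed
 have "int n * 1 \<le> int n * int n" using n1 by (intro mult_left_mono) auto
 then have nF: "int n \<le> FF" using FF_facts(5) by linarith
 have "int (64 + 3 * n) \<le> int (2 ^ wB)" using nF F1 F30 FF_facts(2) by simp
 then show "64 + 3 * n \<le> 2 ^ wB" by (simp only: of_nat_le_iff)
 then show "2 * n \<le> 2 ^ wB" by linarith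
 have "int nz \<le> int n * int n" using nz_le by (metis of_nat_le_iff of_nat_mult)
 then have nzF: "int nz \<le> FF" using FF_facts(5) by linarith
 have g: "(2::int) ^ gb \<le> 2 ^ wB" unfolding wB_def by (intro power_increasing) auto
 have e0: "0 \<le> \<lfloor>\<epsilon>\<rfloor>" using eps by simp
 show "\<bar>inp i\<bar> + 1 < 2 ^ wB"
 proof (rule inp_cases)
  fix p assume p: "p \<in> set ps"
  have 1: "fst p < n" "snd p < n" using positions(2)[OF p] by auto
  obtain l where l: "l < nz" "ps ! l = p" using p by (auto simp: in_set_conv_nth)
  have "\<bar>A $$ p\<bar> \<le> Wt" unfolding Wt_def l(2)[symmetric] using l(1) by (intro member_le_sum) auto
  then show "\<bar>int (fst p)\<bar> + 1 < 2 ^ wB \<and> \<bar>int (snd p)\<bar> + 1 < 2 ^ wB \<and> \<bar>A $$ p\<bar> + 1 < 2 ^ wB"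
   using 1 nF F1 F30 FF_facts(2,6) by linarith
 qed (use nF nzF F1 F30 FF_facts(2) gb(2) g e0 in linarith)+
qed

lemma eig: "eig_ram inp n wB nB (wB + 1) MB nz (\<lambda>l. fst (ps ! l)) (\<lambda>l. snd (ps ! l)) (\<lambda>l. A $$ (ps ! l)) (\<lambda>i j. A $$ (i,j)) (DD z) FF"
proof
 show "bits (inp i) \<le> wB + 1" for i using wB_facts(5)[of i] by (intro bits_le) simp
 show "mem_bits m \<le> MB" if "\<And>i. \<bar>m i\<bar> < 2 ^ cell_bits n wB nB i" for m
  unfolding MB_def by (rule mem_bits_cells[OF that wB_facts(3)])
 show "l < nz \<Longrightarrow> fst (ps ! l) < n" "l < nz \<Longrightarrow> snd (ps ! l) < n" for l using positions(2)[of "ps ! l"] by auto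
 show "(\<Sum>l<nz. of_bool (fst (ps ! l) = i) * (A $$ (ps ! l) * c (snd (ps ! l)))) = (\<Sum>j<n. A $$ (i, j) * c j)" if "i < n" for i c
 proof -
  have "(\<Sum>l<nz. of_bool (fst (ps ! l) = i) * (A $$ (ps ! l) * c (snd (ps ! l)))) = (\<Sum>i'<n. \<Sum>j<n. of_bool (i' = i) * (A $$ (i',j) * c j))"
   using sum_positions[of "\<lambda>p. of_bool (fst p = i) * (A $$ p * c (snd p))"] by simp
  also have "\<dots> = (\<Sum>i'<n. of_bool (i' = i) * (\<Sum>j<n. A $$ (i',j) * c j))" by (simp add: sum_distrib_left)
  also have "\<dots> = (\<Sum>j<n. A $$ (i,j) * c j)" using that by (rule sum_of_bool_delta(2))
  finally show ?thesis .
 qed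
 show "0 \<le> DD z i" "DD z i < FF\<^sup>2" for i unfolding DD_def using FF_facts(2) by simp_all
qed (use wB_facts FF_facts n1 nz_le inp_cells in \<open>auto simp: Wt_def\<close>)

definition "SS i j = real_of_int (FF ^ 3 * A $$ (i,j))"
definition "KK = nat (FF\<^sup>2)"
text \<open>The digits of the coin number in base \<open>F ^ 2\<close>, as a point of the finite
  product space on which the gap estimate counts; \<open>DD z\<close> is the same diagonal as the
  machine sees it.\<close>

definition "om z = restrict (\<lambda>i. z div KK ^ i mod KK) {..<n}" for z :: nat

lemma KK: "int KK = FF\<^sup>2" "0 < KK" "KK ^ n = 2 ^ (2 * fb * n)" "real KK = (real_of_int FF)\<^sup>2"
proof -
 show 1: "int KK = FF\<^sup>2" unfolding KK_def by simp
 have "0 < FF\<^sup>2" using FF_facts(2) by simp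
 then show "0 < KK" using 1 by linarith
 have "int (KK ^ n) = int (2 ^ (2 * fb * n))" unfolding of_nat_power 1 FF_def by (simp add: power_mult[symmetric] mult_ac)
 then show "KK ^ n = 2 ^ (2 * fb * n)" by (simp only: of_nat_eq_iff)
 show "real KK = (real_of_int FF)\<^sup>2" using arg_cong[OF 1, of real_of_int] by simp
qed

lemma DD_om: "i < n \<Longrightarrow> DD z i = int (om z i)"
 unfolding DD_def om_def by (simp add: KK(1)[symmetric] zdiv_int zmod_int)

text \<open>Eigensystems for all diagonals are chosen at once, because the counting lemmas compare
  different diagonals and quantify over the whole family.\<close>

lemma perturbation:
 obtains \<alpha> u where "\<And>om. eigsys n (\<lambda>i l. SS i l + of_bool (i = l) * real (om i)) (\<alpha> om) (u om)"
proof -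
 let ?E = "\<lambda>om. eigsys n (\<lambda>i l. SS i l + of_bool (i = l) * real (om i))"
 have ex: "\<exists>\<alpha> u. ?E om \<alpha> u" for om
  by (rule eigsys_exists) (auto simp: SS_def symm)
 define \<alpha> where "\<alpha> om = (SOME a. \<exists>u. ?E om a u)" for om
 have \<alpha>: "\<exists>u. ?E om (\<alpha> om) u" for om unfolding \<alpha>_def by (rule someI_ex[OF ex])
 define u where "u om = (SOME b. ?E om (\<alpha> om) b)" for om
 have "?E om (\<alpha> om) (u om)" for om unfolding u_def by (rule someI_ex[OF \<alpha>])
 then show thesis by (rule that)
qed

lemma perturbed:
 assumes lam: "eigsys n (\<lambda>i j. real_of_int (A $$ (i,j))) lam v0"
  and \<alpha>: "\<And>om. eigsys n (\<lambda>i l. SS i l + of_bool (i = l) * real (om i)) (\<alpha> om) (u om)"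
 shows "perturbed n (\<lambda>i j. A $$ (i,j)) (DD z) FF QQ \<epsilon> lam v0 (\<alpha> (om z)) (u (om z))"
proof
 show "0 < n" using n1 by simp
 show "A $$ (i,j) = A $$ (j,i)" if "i < n" "j < n" for i j using symm that .
 have "real_of_int Wt = (\<Sum>i<n. \<Sum>j<n. \<bar>real_of_int (A $$ (i, j))\<bar>)" unfolding Wt by simp
 then show "(\<Sum>i<n. \<Sum>j<n. \<bar>real_of_int (A $$ (i, j))\<bar>) \<le> QQ" using QQ(3) by simp
 show "0 \<le> DD z i" "DD z i < FF\<^sup>2" for i unfolding DD_def using FF_facts(2) by simp_all
 show "eigsys n (\<lambda>i j. real_of_int (FF ^ 3 * A $$ (i, j)) + of_bool (i = j) * real_of_int (DD z i)) (\<alpha> (om z)) (u (om z))"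
  by (rule eigsys_cong[OF \<alpha>]) (auto simp: SS_def DD_om)
qed (use QQ lam in auto)

text \<open>An entry of the diagonal has \<open>K = F ^ 2\<close> values and the spectral radius is
  of order \<open>F ^ 3 Q\<close>, which is also the number of windows, against the gain
  \<open>K ^ 2 = F ^ 4\<close>. With constants absorbed into powers of \<open>Q\<close> the failure
  probability is at most \<open>Q ^ 6 / F = Q ^ (6 - ph)\<close>, whence
  \<open>c + 6 \<le> ph\<close>.\<close>

lemma failure_bound:
 fixes c :: real
 assumes \<alpha>: "\<And>om. eigsys n (\<lambda>i l. SS i l + of_bool (i = l) * real (om i)) (\<alpha> om) (u om)"
  and c: "0 < c" "c + 6 \<le> real ph"
 shows "real (card {z. z < 2 ^ (2 * fb * n) \<and> (\<exists>k l. k < l \<and> l < n \<and> \<alpha> (om z) l - \<alpha> (om z) k \<le> 1)}) \<le> real n powr (- c) * real (2 ^ (2 * fb * n))"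
proof -
 let ?F = "real_of_int FF"
 let ?\<Omega> = "PiE {..<n} (\<lambda>_. {..<KK})"
 let ?bz = "{z. z < 2 ^ (2 * fb * n) \<and> (\<exists>k l. k < l \<and> l < n \<and> \<alpha> (om z) l - \<alpha> (om z) k \<le> 1)}"
 let ?bo = "{om\<in>?\<Omega>. \<exists>k l. k < l \<and> l < n \<and> \<alpha> om l - \<alpha> om k \<le> 1}"
 define R where "R = nat (2 * FF ^ 3 * 2 ^ qb)"
 have F0: "?F \<ge> 1000" using FF_facts(2) by simp
 have Rr: "real R = 2 * ?F ^ 3 * QQ"
 proof -
  have "int R = 2 * FF ^ 3 * 2 ^ qb" unfolding R_def using FF_facts(2) by simp
  from arg_cong[OF this, of real_of_int] show ?thesis unfolding QQ_def by simp
 qed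
 have R: "\<bar>\<alpha> w k\<bar> \<le> real R" if w: "w \<in> ?\<Omega>" and k: "k < n" for w k
 proof (rule eigsys_abs_le[OF \<alpha> k])
  have "(\<Sum>i<n. \<Sum>j<n. \<bar>SS i j + of_bool (i = j) * real (w i)\<bar>) \<le> (\<Sum>i<n. \<Sum>j<n. ?F ^ 3 * \<bar>real_of_int (A $$ (i,j))\<bar> + of_bool (i = j) * real KK)"
  proof (intro sum_mono)
   fix i j assume i: "i \<in> {..<n}"
   have "w i < KK" using PiE_mem[OF w i] by simp
   then have "\<bar>of_bool (i = j) * real (w i)\<bar> \<le> of_bool (i = j) * real KK" by (cases "i = j") auto
   moreover have "\<bar>SS i j\<bar> = ?F ^ 3 * \<bar>real_of_int (A $$ (i,j))\<bar>" unfolding SS_def using F0 by (simp add: abs_mult)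
   ultimately show "\<bar>SS i j + of_bool (i = j) * real (w i)\<bar> \<le> ?F ^ 3 * \<bar>real_of_int (A $$ (i,j))\<bar> + of_bool (i = j) * real KK" by linarith
  qed
  also have "\<dots> = ?F ^ 3 * real_of_int Wt + (\<Sum>i<n. \<Sum>j<n. of_bool (i = j) * real KK)" unfolding Wt by (simp add: sum.distrib sum_distrib_left)
  also have "(\<Sum>i<n. \<Sum>j<n. of_bool (i = j) * real KK) = (\<Sum>i<n. real KK)" by (intro sum.cong refl sum_of_bool_delta(1)) simp
  also have "\<dots> = real n * ?F\<^sup>2" using KK(4) by simp
  also have "?F ^ 3 * real_of_int Wt + real n * ?F\<^sup>2 \<le> ?F ^ 3 * QQ + QQ * ?F ^ 3"
   using QQ(1,2,3) F0 Wt1 by (intro add_mono mult_mono power_increasing) auto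
  also have "\<dots> = real R" unfolding Rr by simp
  finally show "(\<Sum>i<n. \<Sum>j<n. \<bar>SS i j + of_bool (i = j) * real (w i)\<bar>) \<le> real R" .
 qed
 have "card ?bz \<le> card ?bo"
 proof (rule card_inj_on_le[of om])
  show "inj_on om ?bz"
  proof (rule inj_onI)
   fix z z' assume z: "z \<in> ?bz" "z' \<in> ?bz" "om z = om z'"
   have "z div KK ^ i mod KK = z' div KK ^ i mod KK" if "i < n" for i using fun_cong[OF z(3), of i] that unfolding om_def by simp
   then have "z mod KK ^ n = z' mod KK ^ n" by (rule mod_power_digits)
   then show "z = z'" using z(1,2) unfolding KK(3) by simp
  qed
  show "om ` ?bz \<subseteq> ?bo"
  proof
   fix y assume "y \<in> om ` ?bz"
   then obtain z where z: "y = om z" "\<exists>k l. k < l \<and> l < n \<and> \<alpha> (om z) l - \<alpha> (om z) k \<le> 1" by blast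
   have "om z \<in> ?\<Omega>" unfolding om_def using KK(2) by simp
   then show "y \<in> ?bo" using z by blast
  qed
  show "finite ?bo" by (intro finite_subset[OF _ finite_PiE[of "{..<n}" "\<lambda>_. {..<KK}"]]) auto
 qed
 then have "real (card ?bz) * real KK ^ 2 \<le> real (card ?bo) * real KK ^ 2" by (intro mult_right_mono) auto
 also have "\<dots> \<le> real (2 * R + 2) * (9 / 2 * real n ^ 2 * real KK ^ n)" by (rule random_diagonal_gap[OF \<alpha> R])
 also have "\<dots> \<le> (5 * ?F ^ 3 * QQ) * (9 / 2 * QQ ^ 2 * real KK ^ n)"
 proof (intro mult_mono power_mono)
  have "2 \<le> ?F ^ 3 * QQ" using F0 QQ(1) power_increasing[of 1 3 ?F] mult_mono[of 1 "?F ^ 3" 2 QQ] by simp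
  moreover have "real (2 * R + 2) = 2 * real R + 2" by simp
  ultimately show "real (2 * R + 2) \<le> 5 * ?F ^ 3 * QQ" using Rr by linarith
 qed (use QQ F0 in auto)
 also have "\<dots> = 45 / 2 * ?F ^ 3 * QQ ^ 3 * real KK ^ n" by (simp add: eval_nat_numeral)
 \<comment> \<open>The constant disappears in \<open>Q ^ 3 \<ge> 64\<close>.\<close>
 also have "\<dots> \<le> (QQ ^ 3 * ?F ^ 3 * QQ ^ 3) * real KK ^ n"
 proof -
  have "(4::real) ^ 3 \<le> QQ ^ 3" using QQ(1) by (intro power_mono) auto
  then have "45 / 2 \<le> QQ ^ 3" by simp
  then have "45 / 2 * (?F ^ 3 * QQ ^ 3 * real KK ^ n) \<le> QQ ^ 3 * (?F ^ 3 * QQ ^ 3 * real KK ^ n)" using F0 QQ(1) by (intro mult_right_mono) auto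
  then show ?thesis by (simp add: mult_ac)
 qed
 also have "\<dots> = QQ ^ 6 * ?F ^ 3 * real KK ^ n" by (simp add: eval_nat_numeral)
 finally have m: "real (card ?bz) * ?F ^ 4 \<le> QQ ^ 6 * ?F ^ 3 * real KK ^ n" unfolding KK(4) by (simp add: power_mult[symmetric])
 have "?F ^ 4 = ?F * ?F ^ 3" by (simp add: eval_nat_numeral)
 then have "(real (card ?bz) * ?F) * ?F ^ 3 \<le> (QQ ^ 6 * real KK ^ n) * ?F ^ 3" using m by (simp add: mult_ac)
 then have m2: "real (card ?bz) * ?F \<le> QQ ^ 6 * real KK ^ n" using F0 by (simp add: mult_le_cancel_right)
 have "?F = QQ powr real ph" using QQ(1,5) by (simp add: powr_realpow)
 also have "\<dots> \<ge> QQ powr (c + 6)" using c(2) QQ(1) by (intro powr_mono) auto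
 also have "QQ powr (c + 6) = QQ powr c * QQ ^ 6" using QQ(1) by (simp add: powr_add powr_realpow)
 finally have "real (card ?bz) * (QQ powr c * QQ ^ 6) \<le> QQ ^ 6 * real KK ^ n"
  using m2 mult_left_mono[of "QQ powr c * QQ ^ 6" ?F "real (card ?bz)"] by linarith
 then have "QQ ^ 6 * (real (card ?bz) * QQ powr c) \<le> QQ ^ 6 * real KK ^ n" by (simp add: mult_ac)
 then have m3: "real (card ?bz) * QQ powr c \<le> real KK ^ n" using QQ(1) by (simp add: mult_le_cancel_left)
 have "real n powr c \<le> QQ powr c" using QQ(2) c(1) by (intro powr_mono2) auto
 then have "real (card ?bz) * real n powr c \<le> real KK ^ n" using m3 mult_left_mono[of "real n powr c" "QQ powr c" "real (card ?bz)"] by simp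
 moreover have "real n powr c > 0" using n1 by simp
 ultimately have "real (card ?bz) \<le> real n powr (- c) * real KK ^ n" by (simp add: powr_minus field_simps)
 moreover have "real KK ^ n = real (2 ^ (2 * fb * n))" using KK(3) by (simp flip: of_nat_power)
 ultimately show ?thesis by simp
qed

text \<open>Joins machine and analysis: \<open>Bm\<close> and \<open>Bp\<close> are the same integer
  matrix, and the precision \<open>4 * ph * qb\<close> makes the output denominator equal to
  \<open>F ^ 4\<close>.\<close>

lemma accurate:
 assumes lam: "eigsys n (\<lambda>i j. real_of_int (A $$ (i,j))) lam v0"
  and \<alpha>: "\<And>om. eigsys n (\<lambda>i l. SS i l + of_bool (i = l) * real (om i)) (\<alpha> om) (u om)"
  and good: "\<not> (\<exists>k l. k < l \<and> l < n \<and> \<alpha> (om z) l - \<alpha> (om z) k \<le> 1)"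
  and w: "w 0 = Some (int (4 * ph * qb))" "\<And>i. i < n \<Longrightarrow> eig_ram.eigenpair_output n (\<lambda>i j. A $$ (i,j)) (DD z) FF w i"
 shows "accurate_output n A \<epsilon> w"
proof -
 interpret E: eig_ram inp n wB nB "wB + 1" MB nz "\<lambda>l. fst (ps ! l)" "\<lambda>l. snd (ps ! l)" "\<lambda>l. A $$ (ps ! l)" "\<lambda>i j. A $$ (i,j)" "DD z" FF by (rule eig)
 interpret P: perturbed n "\<lambda>i j. A $$ (i,j)" "DD z" FF QQ \<epsilon> lam v0 "\<alpha> (om z)" "u (om z)" by (rule perturbed[OF lam \<alpha>])
 have B: "E.Bm = P.Bp" by (intro ext) (simp add: E.Bm_def P.Bp_def)
 have p: "real_of_int FF ^ 4 = 2 ^ (4 * ph * qb)" unfolding FF_def fb_def by (simp add: power_mult[symmetric] mult_ac)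
 have gap: "\<And>k l. k < l \<Longrightarrow> l < n \<Longrightarrow> \<alpha> (om z) l - \<alpha> (om z) k > 1" using good by (meson not_le)
 have "\<exists>s jj rt. P i s jj rt" if "i < n" "P = (\<lambda>i s jj rt. E.sc s \<le> i \<and> i < E.sc (s + 1) \<and> w (1 + i) = Some s \<and>
  jj < n \<and> (\<forall>j<n. E.ad s j j * E.dt s \<le> max 0 (E.ad s jj jj * E.dt s)) \<and>
  0 \<le> rt \<and> rt\<^sup>2 \<le> (\<Sum>k<n. (E.ad s k jj)\<^sup>2) * FF ^ 8 \<and> (\<Sum>k<n. (E.ad s k jj)\<^sup>2) * FF ^ 8 < (rt + 1)\<^sup>2 \<and>
  (\<forall>k<n. w (1 + n + n * i + k) = Some ((E.ad s k jj * FF ^ 8) div rt)))" for i P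
  using w(2)[OF that(1)] unfolding E.eigenpair_output_def that(2) .
 then obtain s jj rt where o: "\<And>i. i < n \<Longrightarrow> E.sc (s i) \<le> i \<and> i < E.sc (s i + 1) \<and> w (1 + i) = Some (s i) \<and>
  jj i < n \<and> (\<forall>j<n. E.ad (s i) j j * E.dt (s i) \<le> max 0 (E.ad (s i) (jj i) (jj i) * E.dt (s i))) \<and>
  0 \<le> rt i \<and> (rt i)\<^sup>2 \<le> (\<Sum>k<n. (E.ad (s i) k (jj i))\<^sup>2) * FF ^ 8 \<and> (\<Sum>k<n. (E.ad (s i) k (jj i))\<^sup>2) * FF ^ 8 < (rt i + 1)\<^sup>2 \<and>
  (\<forall>k<n. w (1 + n + n * i + k) = Some ((E.ad (s i) k (jj i) * FF ^ 8) div (rt i)))" by metis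
 note o = o[unfolded B]
 let ?V = "\<lambda>i k. (adj_mat (shifted (FF ^ 8) P.Bp (s i) n) $$ (k,jj i) * FF ^ 8) div rt i"
 have ev: "\<bar>real_of_int FF * \<alpha> (om z) i - s i\<bar> \<le> 1" "\<bar>lam i - s i / real_of_int FF ^ 4\<bar> \<le> \<epsilon>" if "i < n" for i
  using P.eigenvalue_error[OF that, of "s i"] o[OF that] by auto
 have "\<exists>\<sigma>\<in>{-1,1}. L2_set (\<lambda>k. real_of_int (?V i k) / real_of_int FF ^ 4 - \<sigma> * u (om z) i k) {..<n} \<le> 9 * real n / real_of_int FF" if "i < n" for i
  using P.eigenvector_error[OF gap that, of "s i" "jj i" "rt i"] o[OF that] by auto
 then have "\<forall>i. \<exists>\<sigma>. i < n \<longrightarrow> \<sigma> \<in> {-1,1} \<and> L2_set (\<lambda>k. real_of_int (?V i k) / real_of_int FF ^ 4 - \<sigma> * u (om z) i k) {..<n} \<le> 9 * real n / real_of_int FF"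
  by blast
 from choice[OF this] obtain \<sigma> where sg: "\<And>i. i < n \<Longrightarrow> \<sigma> i \<in> {-1,1} \<and> L2_set (\<lambda>k. real_of_int (?V i k) / real_of_int FF ^ 4 - \<sigma> i * u (om z) i k) {..<n} \<le> 9 * real n / real_of_int FF"
  by blast
 show ?thesis
 proof (rule accurate_outputI[where w = w and s = s and V = ?V, OF A(1) lam w(1)])
  fix i assume i: "i < n"
  show "w (1 + i) = Some (s i)" using o[OF i] by simp
  show "\<bar>lam i - s i / 2 ^ (4 * ph * qb)\<bar> \<le> \<epsilon>" using ev(2)[OF i] unfolding p .
  have s: "\<sigma> i \<in> {-1,1}" "L2_set (\<lambda>k. real_of_int (?V i k) / real_of_int FF ^ 4 - \<sigma> i * u (om z) i k) {..<n} \<le> 9 * real n / real_of_int FF"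
   using sg[OF i] by auto
  note oq = P.output_quality[OF i ev(1)[OF i] s]
  show "(\<Sum>k<n. (?V i k / 2 ^ (4 * ph * qb)) * (?V i k / 2 ^ (4 * ph * qb))) \<in> {1 - \<epsilon> .. 1 + \<epsilon>}" using oq(1) unfolding p .
  show "sqrt (\<Sum>k<n. ((\<Sum>l<n. real_of_int (A $$ (k,l)) * (?V i l / 2 ^ (4 * ph * qb))) - s i / 2 ^ (4 * ph * qb) * (?V i k / 2 ^ (4 * ph * qb)))\<^sup>2) \<le> \<epsilon>"
   using oq(2) unfolding p .
  fix j assume j: "j < n"
  show "w (1 + n + n * i + j) = Some (?V i j)" using o[OF i] j by simp
  assume ij: "i \<noteq> j"
  show "\<bar>\<Sum>k<n. (?V i k / 2 ^ (4 * ph * qb)) * (?V j k / 2 ^ (4 * ph * qb))\<bar> \<le> \<epsilon>"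
   using P.output_orthogonal[OF i j ij s sg[OF j, THEN conjunct1] sg[OF j, THEN conjunct2]] unfolding p .
 qed
qed

abbreviation "vb \<equiv> 2 * (wB + 1)"
abbreviation "hb \<equiv> nB + 1 + vb + 5"

text \<open>Everything is polynomial in the argument \<open>t\<close> of the logarithm in
  \<open>log_size\<close>: \<open>n U \<le> t ^ 2\<close>, the sum of the absolute entries is at
  most \<open>t ^ 4\<close>, and \<open>2 ^ eb \<le> 2 t\<close>. So the word width is linear in
  \<open>log_size\<close>.\<close>

lemma vb_le: "real vb \<le> (422 * real ph + 30) * LS"
proof -
 define t where "t = tt"
 have t2: "t \<ge> 2" "t \<ge> \<epsilon>" "t \<ge> real n * real U / \<epsilon>" unfolding t_def using eps by auto
 \<comment> \<open>\<open>n U\<close> is the product of \<open>n U / \<epsilon>\<close> and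
   \<epsilon>, both summands of \<open>t\<close>; this settles small and large \<epsilon> at
   once.\<close>
 have nU: "real n * real U \<le> t * t"
 proof -
  have "real n * real U = (real n * real U / \<epsilon>) * \<epsilon>" using eps by simp
  also have "\<dots> \<le> t * t" using t2 eps by (intro mult_mono) auto
  finally show ?thesis .
 qed
 have nn: "real n \<le> real n * real U" "1 \<le> real n * real U" using U1 n1 mult_mono[of 1 "real n" 1 "real U"] by auto
 \<comment> \<open>A nonzero entry enters here: it gives \<open>n U \<ge> 1\<close>, without which
   \<open>1 / \<epsilon>\<close> could be far larger than \<open>t\<close>.\<close>
 have inv: "1 / \<epsilon> \<le> t"
 proof -
  have "1 / \<epsilon> \<le> real n * real U / \<epsilon>" using nn(2) eps by (intro divide_right_mono) auto
  then show ?thesis using t2 by linarith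
 qed
 have W: "real_of_int Wt \<le> (t * t) * (t * t)"
 proof -
  have "Wt \<le> (\<Sum>i<n. \<Sum>j<n. int U)" unfolding Wt using U by (intro sum_mono) auto
  then have "real_of_int Wt \<le> real_of_int (\<Sum>i<n. \<Sum>j<n. int U)" by (simp only: of_int_le_iff)
  also have "\<dots> = real n * (real n * real U)" by simp
  also have "\<dots> \<le> (real n * real U) * (real n * real U)" using nn by (intro mult_right_mono) auto
  also have "\<dots> \<le> (t * t) * (t * t)" by (rule mult_mono[OF nU nU]) (use nn zero_le_square[of t] in linarith)+
  finally show ?thesis .
 qed
 have e2: "(2::real) ^ eb \<le> 2 * t"
 proof (cases eb)
  case (Suc k)
  then have "\<epsilon> * 2 ^ k < 1" using eb(2)[of k] by simp
  then have "(2::real) ^ k \<le> 1 / \<epsilon>" using eps by (simp add: field_simps)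
  then show ?thesis unfolding Suc using inv by simp
 qed (use t2 in simp)
 obtain q' where q': "qb = Suc q'" using qb2 by (cases qb) auto
 have "real_of_int (2 ^ q') < real_of_int (int n + Wt + 2 ^ eb)" using qb(2)[of q'] q' by (simp only: of_int_less_iff)
 then have a: "(2::real) ^ qb \<le> 2 * (real n + real_of_int Wt + 2 ^ eb)" unfolding q' by simp
 have t4: "t * t \<le> t ^ 4" "t \<le> t ^ 4" "(t * t) * (t * t) = t ^ 4"
 proof -
  have "t ^ 2 \<le> t ^ 4" "t ^ 1 \<le> t ^ 4" by (rule power_increasing; use t2(1) in linarith)+
  then show "t * t \<le> t ^ 4" "t \<le> t ^ 4" by (simp_all only: power2_eq_square power_one_right)
  show "(t * t) * (t * t) = t ^ 4" by (simp add: power4_eq_xxxx mult.assoc)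
 qed
 have n4: "real n \<le> t ^ 4" by (rule order_trans[OF nn(1) order_trans[OF nU t4(1)]])
 have e4: "(2::real) ^ eb \<le> 2 * t ^ 4" by (rule order_trans[OF e2]) (use t4(2) in simp)
 have "real n + real_of_int Wt + 2 ^ eb \<le> t ^ 4 + t ^ 4 + 2 * t ^ 4" by (intro add_mono n4 W[unfolded t4(3)] e4)
 then have "2 * (real n + real_of_int Wt + 2 ^ eb) \<le> 2 * (t ^ 4 + t ^ 4 + 2 * t ^ 4)" by (rule mult_left_mono) simp
 from order_trans[OF a this] have "(2::real) ^ qb \<le> 8 * t ^ 4" by simp
 also have "\<dots> \<le> t ^ 3 * t ^ 4" using power_mono[of 2 t 3] t2(1) by (intro mult_right_mono) auto
 also have "\<dots> = t ^ 7" by (simp only: power_add[symmetric]) simp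
 finally have "log 2 ((2::real) ^ qb) \<le> log 2 (t ^ 7)" using t2(1) by (intro log_le_cancel_iff[THEN iffD2]) auto
 then have q7: "real qb \<le> 7 * LS" unfolding log_size_def t_def[symmetric] using t2(1) by (simp add: log_nat_power)
 have "real fb \<le> 7 * (real ph * LS)" using mult_left_mono[OF q7, of "real ph"] unfolding fb_def by (simp add: mult_ac)
 moreover have "real ph \<le> real ph * LS" using LS1 mult_left_mono[of 1 LS "real ph"] by simp
 ultimately have "real vb \<le> 422 * (real ph * LS) + 30 * LS" unfolding wB_def using gb(3) LS1 by simp
 then show ?thesis by (simp add: algebra_simps)
qed

lemma nz_run:
 "\<exists>t g. ram_run (eigen_program ph) inp t = map_pmf g (pmf_of_set {..<2 ^ (2 * fb * n)}) \<and>
  (\<forall>z<2 ^ (2 * fb * n). ram_halted (eigen_program ph) (g z) \<and> bit_ops (g z) \<le> 100000000 * (n ^ 3 * (n + nz) * vb ^ 4) \<and> peak_space (g z) \<le> MB \<and>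
   (outp (g z) 0 = Some (int (4 * ph * qb)) \<and> (\<forall>i<n. eig_ram.eigenpair_output n (\<lambda>i j. A $$ (i,j)) (DD z) FF (outp (g z)) i)))"
proof -
 \<comment> \<open>The phases before the epilogue are common to all perturbations, so
   \<open>DD 0\<close> can stand for any of them.\<close>
 interpret E: eig_ram inp n wB nB "wB + 1" MB nz "\<lambda>l. fst (ps ! l)" "\<lambda>l. snd (ps ! l)" "\<lambda>l. A $$ (ps ! l)" "\<lambda>i j. A $$ (i,j)" "DD 0" FF by (rule eig)
 let ?M = "2 * fb * n" and ?K = wB and ?L = "5 * fb + 1" and ?e = "fb * (16 * n + 8)"
 have bodyeq: "eigen_program ph = Const 0 1 # comp 1 (prologue nz eb qb ph ;; Loop ?M 53 (Ins (Flip 54) ;; flip_body) ;; epilogue n nz ?K ?L (Suc ?e) 0)"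
  by (rule eigen_program_eq[of ph n nz eb qb ?M ?K ?L "Suc ?e" 0, unfolded eigen_body_def])
 let ?I = "\<lambda>k z m w. w = (\<lambda>_. None) \<and> E.scalars m \<and> m 29 = int (4 * ph * qb) \<and> m 50 = int z \<and> z < 2 ^ k \<and> m 53 = int ?M - int k"
 let ?R = "\<lambda>z w. w 0 = Some (int (4 * ph * qb)) \<and> (\<forall>i<n. eig_ram.eigenpair_output n (\<lambda>i j. A $$ (i,j)) (DD z) FF w i)"
 have fb1: "18 \<le> fb" using mult_le_mono[OF ph qb2] unfolding fb_def by simp
 have MnB: "?M \<le> nB" unfolding nB_def by (simp add: algebra_simps)
 have nB1: "1 \<le> nB" unfolding nB_def using fb1 by simp
 have c1: "E.wp (prologue nz eb qb ph) (?I 0 0) ((\<lambda>_. 0)(0 := 1)) (\<lambda>_. None)"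
 proof (rule E.wp_mono[OF E.wp_prologue])
  show "inp 0 = int n" "inp (Suc 0) = int nz" "0 < nz" using inp_cells nzp by auto
  show "\<bar>inp i\<bar> + 1 < 2 ^ wB" for i by (rule wB_facts(5))
  show "inp (2 + 3 * nz + k) \<le> 0" if "k < eb" for k
  proof -
   have "\<lfloor>\<epsilon> * 2 ^ k\<rfloor> = 0" using eb(2)[OF that] eps by (simp add: floor_eq_iff)
   then show ?thesis unfolding inp_cells(6) by (cases "k = 0") auto
  qed
  show "0 < inp (2 + 3 * nz + eb)"
  proof (cases eb)
   case 0
   then show ?thesis unfolding inp_cells(6) using eb(1) by simp
  next
   case (Suc k)
   then have "\<epsilon> * 2 ^ eb < 2" using eb(2)[of k] by simp
   then have "\<lfloor>\<epsilon> * 2 ^ eb\<rfloor> = 1" using eb(1) by (simp add: floor_eq_iff)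
   then show ?thesis unfolding inp_cells(6) using Suc by simp
  qed
  show "int eb \<le> FF" "int qb \<le> FF" "FF = (2 ^ qb) ^ ph" "4 * int ph \<le> FF" "0 < ph" using FF_facts ph by auto
  show "2 ^ k < int n + (\<Sum>l<nz. \<bar>A $$ (ps ! l)\<bar>) + 2 ^ eb" if "k < qb" for k using qb(2)[OF that] unfolding Wt_def .
  show "int n + (\<Sum>l<nz. \<bar>A $$ (ps ! l)\<bar>) + 2 ^ eb \<le> 2 ^ qb" using qb(1) unfolding Wt_def .
 next
  fix m' w' assume "w' = (\<lambda>_. None) \<and> E.scalars m' \<and> m' 29 = int (4 * ph * qb) \<and> m' 50 = 0 \<and> m' 53 = int (2 * ph * qb * n)"
  then show "?I 0 0 m' w'" unfolding fb_def by (simp add: mult_ac)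
 qed
 have step: "m 53 > 0 \<and> 1 < (2::int) ^ cell_bits n wB nB 54 \<and> (\<forall>b. E.wp flip_body (?I (Suc k) (2 * z + of_bool b)) (m(54 := of_bool b)) w)"
  if k: "k < ?M" and i: "?I k z m w" for k z m w
 proof (intro conjI allI)
  have i': "E.scalars m" "m 50 = int z" "z < 2 ^ k" "m 53 = int ?M - int k" "m 29 = int (4 * ph * qb)" "w = (\<lambda>_. None)" using i by auto
  have "int k < int ?M" using k by (simp only: of_nat_less_iff)
  then show "m 53 > 0" using i'(4) by linarith
  show "1 < (2::int) ^ cell_bits n wB nB 54" using nB1 one_less_power[of "2::int" nB] by simp
  fix b
  have lt: "2 * z + of_bool b < 2 ^ Suc k" using i'(3) by (cases b) auto
  show "E.wp flip_body (?I (Suc k) (2 * z + of_bool b)) (m(54 := of_bool b)) w"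
   by (rule E.wp_mono[OF E.wp_flip_body[OF i'(1-3) k MnB i'(4,5), where b = b]]) (use i'(6) lt in auto)
 qed
 have fin: "\<not> m 53 > 0" if "?I ?M z m w" for z m w using that by simp
 have c3: "E.wp (epilogue n nz ?K ?L (Suc ?e) 0) (\<lambda>_. ?R z) m w" if z: "z < 2 ^ ?M" and i: "?I ?M z m w" for z m w
 proof -
  \<comment> \<open>The epilogue is verified for the diagonal that the coins \<open>z\<close> have
    produced.\<close>
  interpret Z: eig_ram inp n wB nB "wB + 1" MB nz "\<lambda>l. fst (ps ! l)" "\<lambda>l. snd (ps ! l)" "\<lambda>l. A $$ (ps ! l)" "\<lambda>i j. A $$ (i,j)" "DD z" FF by (rule eig)
  obtain lam v0 where lam: "eigsys n (\<lambda>i j. real_of_int (A $$ (i,j))) lam v0" using eigsys_exists[of n "\<lambda>i j. real_of_int (A $$ (i,j))"] symm by auto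
  obtain \<alpha> u where \<alpha>: "\<And>om. eigsys n (\<lambda>i l. SS i l + of_bool (i = l) * real (om i)) (\<alpha> om) (u om)" using perturbation by blast
  interpret P: perturbed n "\<lambda>i j. A $$ (i,j)" "DD z" FF QQ \<epsilon> lam v0 "\<alpha> (om z)" "u (om z)" by (rule perturbed[OF lam \<alpha>])
  have B: "Z.Bm = P.Bp" by (intro ext) (simp add: Z.Bm_def P.Bp_def)
  have "int z < int (2 ^ ?M)" using z by (simp only: of_nat_less_iff)
  also have "\<dots> = FF ^ (2 * n)" unfolding FF_def by (simp add: power_mult[symmetric] mult_ac)
  finally have zF: "int z < FF ^ (2 * n)" .
  show ?thesis
  proof (rule Z.wp_epilogue[where z = "int z"])
   show "DD z i = int z div (FF\<^sup>2) ^ i mod FF\<^sup>2" for i unfolding DD_def ..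
   show "2 * FF ^ 5 = 2 ^ ?L" unfolding FF_def by (simp add: power_mult[symmetric] mult.commute)
   show "FF ^ (16 * n + 8) = 2 ^ ?e" unfolding FF_def by (simp add: power_mult)
   show "sign_changes (FF ^ 8) Z.Bm (- (FF ^ 5)) n = 0" "sign_changes (FF ^ 8) Z.Bm (FF ^ 5) n = n" unfolding B by (rule P.bracket)+
  qed (use i zF wB_facts(4) nzp in auto)
 qed
 have wv: "wB + 1 \<le> vb" "10 \<le> vb" "vb \<le> hb" unfolding wB_def by auto
 interpret T: timed_ram inp n wB nB "wB + 1" MB "vb * vb" "hb * vb" "hb * hb"
 proof
  show "(wB + 1) * (wB + 1) \<le> vb * vb" by (intro mult_le_mono) auto
  show "2 * (wB + 1) \<le> vb * vb" "10 \<le> vb * vb" using mult_le_mono[of 1 vb vb vb] wv by auto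
  show "wB + 1 + (wB + 1) \<le> vb * vb" using mult_le_mono[of 1 vb vb vb] wv by auto
  show "(nB + 1) * (wB + 1) \<le> hb * vb" by (intro mult_le_mono) auto
  have "(nB + 1) * 2 \<le> hb * vb" by (intro mult_le_mono) auto
  then show "2 * (nB + 1) \<le> hb * vb" by linarith
  show "vb * vb \<le> hb * vb" by (rule mult_le_mono1[OF wv(3)])
  show "hb * vb \<le> hb * hb" by (rule mult_le_mono2[OF wv(3)])
  show "(nB + 1) * (nB + 1) \<le> hb * hb" by (intro mult_le_mono) auto
 qed
 have hn: "hb \<le> 81 * (n * vb)"
 proof -
  have 1: "nB \<le> n * (80 * fb)" 
  proof -
   have "fb * (40 * n + 40) \<le> fb * (80 * n)" using n1 by (intro mult_le_mono2) simp
   then show ?thesis unfolding nB_def by (simp add: mult_ac)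
  qed
  have "80 * fb + (1 + vb + 5) \<le> 81 * vb" unfolding wB_def by simp
  then have "n * (80 * fb) + n * (1 + vb + 5) \<le> n * (81 * vb)" using mult_le_mono2[of "80 * fb + (1 + vb + 5)" "81 * vb" n] by (simp only: add_mult_distrib2)
  moreover have "1 + vb + 5 \<le> n * (1 + vb + 5)" using n1 by simp
  ultimately show ?thesis using 1 by (simp only: mult.left_commute[of 81 n])
 qed
 have lph: "int ph < 2 ^ ph" using less_exp[of ph] by simp
 have bp: "bits k \<le> vb * vb" if "\<bar>k\<bar> \<le> 4 * int ph" for k
 proof -
  have "(2::int) ^ (ph + 2) = 4 * 2 ^ ph" by (simp add: power_add)
  then have "\<bar>k\<bar> < 2 ^ (ph + 2)" using that lph by linarith
  then have "bits k \<le> ph + 3" using bits_le[of k "ph + 2"] by simp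
  also have "\<dots> \<le> 1 * vb" unfolding wB_def by simp
  also have "\<dots> \<le> vb * vb" by (intro mult_le_mono) auto
  finally show ?thesis .
 qed
 have tot: "2 + E.tbound (prologue nz eb qb ph) + (?M * (cell_bits n wB nB 53 + 1 + 1 + E.tbound flip_body + 2) + cell_bits n wB nB 53 + 3) + E.tbound (epilogue n nz ?K ?L (Suc ?e) 0)
  \<le> 100000000 * (n ^ 3 * (n + nz) * vb ^ 4)"
 proof -
  have eq: "eb \<le> qb"
  proof (rule power_le_imp_le_exp[of "2::int"])
   show "(2::int) ^ eb \<le> 2 ^ qb" using qb(1) Wt1 by linarith
  qed simp
  have qf: "qb \<le> fb" unfolding fb_def using ph by simp
  have "2 + E.tbound (prologue nz eb qb ph) + (?M * (nB + 1 + 1 + E.tbound flip_body + 2) + nB + 3) + E.tbound (epilogue n nz ?K ?L (Suc ?e) 0)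
   \<le> 100000000 * (n ^ 3 * (n + nz) * vb ^ 4)"
  proof (rule T.total_tbound[where h = hb and v = vb])
   show "?L + 2 \<le> vb" "eb + qb + ph \<le> vb" "?K + 1 \<le> vb" using eq qf unfolding wB_def by auto
   have "fb * (16 * n + 8) \<le> nB" unfolding nB_def by (intro mult_le_mono2) auto
   then show "Suc ?e + 1 \<le> hb" by simp
   show "?M \<le> hb" using MnB by simp
  qed (use hn wv n1 bp in auto)
  then show ?thesis by simp
 qed
 show ?thesis
 proof (rule E.randomized_run[where I = ?I and R = ?R and N = ?M, OF bodyeq])
  show "1 \<le> cell_bits n wB nB 0" by (simp add: wB_def)
  show "E.wp (prologue nz eb qb ph) (?I 0 0) ((\<lambda>_. 0)(0 := 1)) (\<lambda>_. None)" by (rule c1)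
  show "m 53 > 0 \<and> 1 < (2::int) ^ cell_bits n wB nB 54 \<and> (\<forall>b. E.wp flip_body (?I (Suc k) (2 * z + of_bool b)) (m(54 := of_bool b)) w)"
   if "k < ?M" "?I k z m w" for k z m w by (rule step[OF that])
  show "\<not> m 53 > 0" if "?I ?M z m w" for z m w by (rule fin[OF that])
  show "E.wp (epilogue n nz ?K ?L (Suc ?e) 0) (\<lambda>_. ?R z) m w" if "z < 2 ^ ?M" "?I ?M z m w" for z m w by (rule c3[OF that])
 qed (rule tot)
qed

lemma MB_le: "real MB \<le> 6000 * (real n * real vb)"
proof -
 have "(64 + 3 * n) * vb \<le> (67 * n) * vb" using n1 by (intro mult_le_mono) auto
 then have a: "(64 + 3 * n) * (2 * wB + 2) \<le> 67 * (n * vb)" by (simp add: algebra_simps)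
 have "nB \<le> vb * (80 * n)" unfolding nB_def using n1 by (intro mult_le_mono) (auto simp: wB_def)
 then have "64 * nB \<le> 5120 * (n * vb)" by (simp add: algebra_simps)
 then have "MB \<le> 6000 * (n * vb)" unfolding MB_def using a by linarith
 then have "real MB \<le> real (6000 * (n * vb))" by (simp only: of_nat_le_iff)
 then show ?thesis by (simp add: algebra_simps)
qed

lemma nonzero_result:
 assumes c: "0 < c" "c + 6 \<le> real ph"
 shows "\<exists>t. (\<forall>\<sigma> \<in> set_pmf (ram_run (eigen_program ph) inp t). ram_halted (eigen_program ph) \<sigma> \<and>
   real (bit_ops \<sigma>) \<le> 100000000 * (422 * real ph + 30) ^ 4 * real n ^ 3 * real (nnz A + n) * LS ^ 4 \<and>
   real (peak_space \<sigma>) \<le> 6000 * (422 * real ph + 30) * real n * LS) \<and>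
  measure_pmf.prob (ram_run (eigen_program ph) inp t) {\<sigma>. accurate_output n A \<epsilon> (outp \<sigma>)} \<ge> 1 - real n powr (- c)"
proof -
 let ?N = "2 ^ (2 * fb * n) :: nat" and ?k = "422 * real ph + 30"
 obtain t g where r: "ram_run (eigen_program ph) inp t = map_pmf g (pmf_of_set {..<?N})"
  and g: "\<And>z. z < ?N \<Longrightarrow> ram_halted (eigen_program ph) (g z) \<and> bit_ops (g z) \<le> 100000000 * (n ^ 3 * (n + nz) * vb ^ 4) \<and> peak_space (g z) \<le> MB \<and>
   (outp (g z) 0 = Some (int (4 * ph * qb)) \<and> (\<forall>i<n. eig_ram.eigenpair_output n (\<lambda>i j. A $$ (i,j)) (DD z) FF (outp (g z)) i))"
  using nz_run by blast
 obtain lam v0 where lam: "eigsys n (\<lambda>i j. real_of_int (A $$ (i,j))) lam v0" using eigsys_exists[of n "\<lambda>i j. real_of_int (A $$ (i,j))"] symm by auto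
 obtain \<alpha> u where \<alpha>: "\<And>om. eigsys n (\<lambda>i l. SS i l + of_bool (i = l) * real (om i)) (\<alpha> om) (u om)" using perturbation by blast
 have N0: "0 < ?N" by simp
 have "0 \<in> {..<?N}" using N0 by (simp only: lessThan_iff)
 then have "{..<?N} \<noteq> {}" by blast
 from set_pmf_of_set[OF this] have set: "set_pmf (map_pmf g (pmf_of_set {..<?N})) = g ` {..<?N}" unfolding set_map_pmf by simp
 have "real vb ^ 4 \<le> (?k * LS) ^ 4" by (rule power_mono[OF vb_le]) simp
 then have "100000000 * (real n ^ 3 * (real n + real nz) * real vb ^ 4) \<le> 100000000 * (real n ^ 3 * (real n + real nz) * (?k * LS) ^ 4)"
  by (intro mult_left_mono) auto
 also have "\<dots> = 100000000 * ?k ^ 4 * real n ^ 3 * real (nnz A + n) * LS ^ 4"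
  unfolding nz_nnz power_mult_distrib of_nat_add by (simp only: mult_ac add_ac)
 finally have T: "real (100000000 * (n ^ 3 * (n + nz) * vb ^ 4)) \<le> 100000000 * ?k ^ 4 * real n ^ 3 * real (nnz A + n) * LS ^ 4"
  by (simp only: of_nat_mult of_nat_power of_nat_add of_nat_numeral)
 note MB_le
 also have "6000 * (real n * real vb) \<le> 6000 * (real n * (?k * LS))" using vb_le by (intro mult_left_mono) auto
 also have "\<dots> = 6000 * ?k * real n * LS" by (simp only: mult_ac)
 finally have M: "real MB \<le> 6000 * ?k * real n * LS" .
 have 1: "ram_halted (eigen_program ph) (g z) \<and> real (bit_ops (g z)) \<le> 100000000 * ?k ^ 4 * real n ^ 3 * real (nnz A + n) * LS ^ 4 \<and>
   real (peak_space (g z)) \<le> 6000 * ?k * real n * LS" if "z < ?N" for z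
 proof -
  have b: "ram_halted (eigen_program ph) (g z)" "bit_ops (g z) \<le> 100000000 * (n ^ 3 * (n + nz) * vb ^ 4)" "peak_space (g z) \<le> MB"
   using g[OF that] by blast+
  have "real (bit_ops (g z)) \<le> real (100000000 * (n ^ 3 * (n + nz) * vb ^ 4))" using b(2) by (simp only: of_nat_le_iff)
  note bo = order_trans[OF this T]
  have "real (peak_space (g z)) \<le> real MB" using b(3) by (simp only: of_nat_le_iff)
  note pk = order_trans[OF this M]
  show ?thesis using b(1) bo pk by blast
 qed
 have pr: "1 - real n powr (- c) \<le> measure_pmf.prob (map_pmf g (pmf_of_set {..<?N})) {\<sigma>. accurate_output n A \<epsilon> (outp \<sigma>)}"
 proof (rule prob_pmf_of_set_ge[OF N0])
  show "real (card {z. z < ?N \<and> (\<exists>k l. k < l \<and> l < n \<and> \<alpha> (om z) l - \<alpha> (om z) k \<le> 1)}) \<le> real n powr (- c) * real ?N"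
   by (rule failure_bound[OF \<alpha> c])
  fix z assume z: "z < ?N" "z \<notin> {z. z < ?N \<and> (\<exists>k l. k < l \<and> l < n \<and> \<alpha> (om z) l - \<alpha> (om z) k \<le> 1)}"
  then have good: "\<not> (\<exists>k l. k < l \<and> l < n \<and> \<alpha> (om z) l - \<alpha> (om z) k \<le> 1)" by blast
  have "accurate_output n A \<epsilon> (outp (g z))" by (rule accurate[OF lam \<alpha> good]) (use g[OF z(1)] in blast)+
  then show "g z \<in> {\<sigma>. accurate_output n A \<epsilon> (outp \<sigma>)}" by simp
 qed auto
 show ?thesis
 proof (intro exI[of _ t] conjI ballI)
  fix \<sigma> assume "\<sigma> \<in> set_pmf (ram_run (eigen_program ph) inp t)"
  then obtain z where z: "z < ?N" "\<sigma> = g z" unfolding r set by blast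
  show "ram_halted (eigen_program ph) \<sigma>"
   "real (bit_ops \<sigma>) \<le> 100000000 * ?k ^ 4 * real n ^ 3 * real (nnz A + n) * LS ^ 4"
   "real (peak_space \<sigma>) \<le> 6000 * ?k * real n * LS"
   using 1[OF z(1)] unfolding z(2) by blast+
 qed (unfold r, rule pr)
qed

end

section \<open>The zero matrix\<close>

context sparse_problem begin

text \<open>No array is used, so the machine has 64 cells only and a width linear in
  \<open>n\<close> stays within \<open>O(n)\<close> bits. Charging an operation with order
  \<open>n ^ 2\<close> gives \<open>n ^ 4\<close> up to logarithms, which is
  \<open>n ^ 3 (nnz + n)\<close> for \<open>nnz = 0\<close>.\<close>

lemma zero_result:
 assumes nz0: "nz = 0" and c: "0 < c"
 shows "\<exists>t. (\<forall>\<sigma> \<in> set_pmf (ram_run (eigen_program ph) inp t). ram_halted (eigen_program ph) \<sigma> \<and>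
   real (bit_ops \<sigma>) \<le> (1100 + 60 * real ph) * (220 + real ph) * real n ^ 3 * real (nnz A + n) * LS ^ 4 \<and>
   real (peak_space \<sigma>) \<le> 1500 * real n * LS) \<and>
  measure_pmf.prob (ram_run (eigen_program ph) inp t) {\<sigma>. accurate_output n A \<epsilon> (outp \<sigma>)} \<ge> 1 - real n powr (- c)"
proof -
 define b where "b = 2 * n + 4"
 define xb where "xb = b + gb + 1"
 define V where "V = 4 * ((b + 1) * (b + 1)) + xb + ph + 3"
 have nn: "int n * int n + 2 * int n + 5 < 2 ^ b"
 proof -
  have "n + 1 \<le> 2 ^ n" using less_exp[of n] by linarith
  then have "(n + 1) * (n + 1) \<le> 2 ^ n * 2 ^ n" by (intro mult_le_mono)
  then have "int ((n + 1) * (n + 1)) \<le> int (2 ^ n * 2 ^ n)" by (simp only: of_nat_le_iff)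
  then have "int n * int n + 2 * int n + 1 \<le> 2 ^ n * 2 ^ n" by (simp add: algebra_simps)
  moreover have "(2::int) ^ b = 16 * (2 ^ n * 2 ^ n)"
  proof -
   have "b = n + n + 4" unfolding b_def by simp
   then have "(2::int) ^ b = 2 ^ n * 2 ^ n * 2 ^ 4" by (simp only: power_add)
   then show ?thesis by simp
  qed
  moreover have "1 \<le> (2::int) ^ n * 2 ^ n" using mult_mono[of 1 "(2::int) ^ n" 1 "2 ^ n"] by simp
  ultimately show ?thesis by linarith
 qed
 have nb: "int n < 2 ^ b"
 proof -
  have "0 \<le> int n * int n" by simp
  then show ?thesis using nn by linarith
 qed
 have b64: "(64::nat) + 3 * 0 \<le> 2 ^ b"
 proof -
  have "(2::nat) ^ 6 \<le> 2 ^ b" unfolding b_def using n1 by (intro power_increasing) auto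
  then show ?thesis by simp
 qed
 have xbi: "\<bar>inp i\<bar> < 2 ^ (b + gb)" for i
 proof (rule inp_cases)
  have e0: "0 \<le> \<lfloor>\<epsilon>\<rfloor>" using eps by simp
  have p: "(2::int) ^ b \<le> 2 ^ (b + gb)" "(2::int) ^ gb \<le> 2 ^ (b + gb)" by (auto intro!: power_increasing)
  show "\<bar>int n\<bar> < 2 ^ (b + gb)" using nb p by linarith
  show "\<bar>int nz\<bar> < 2 ^ (b + gb)" using nz0 by simp
  show "\<bar>\<lfloor>\<epsilon>\<rfloor>\<bar> < 2 ^ (b + gb)" "\<bar>1::int\<bar> < 2 ^ (b + gb)" using gb(2) p e0 by linarith+
  show "\<bar>0::int\<bar> < 2 ^ (b + gb)" by simp
 qed (use nz0 in auto)
 obtain sq where sq: "sq = (b + 1) * (b + 1)" by blast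
 have sq1: "b + 1 \<le> sq" unfolding sq by simp
 have Vs: "V = 4 * sq + xb + ph + 3" unfolding V_def sq ..
 have b5: "5 \<le> b" unfolding b_def using n1 by simp
 have "sq \<le> V" unfolding Vs by simp
 then have v1: "(b + 1) * (b + 1) \<le> V" unfolding sq .
 have v2: "2 * (b + 1) \<le> V" "b + 1 + xb \<le> V" "10 \<le> V" "b + 3 \<le> V" using sq1 b5 by (simp_all add: Vs)
 interpret T: timed_ram inp 0 b b xb "64 * (2 * b + 2) + 64 * b" V V V
 proof
  show "bits (inp i) \<le> xb" for i unfolding xb_def by (rule bits_le[OF xbi])
  show "mem_bits m \<le> 64 * (2 * b + 2) + 64 * b" if "\<And>i. \<bar>m i\<bar> < 2 ^ cell_bits 0 b b i" for m
   using mem_bits_cells[OF that b64] by simp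
 qed (rule v1 v2 order_refl)+
 have bodyeq: "eigen_program ph = Const 0 1 # comp 1 (prologue 0 0 0 ph ;; Loop 0 53 (Ins (Flip 54) ;; flip_body) ;; epilogue 0 0 0 0 0 n)"
  by (rule eigen_program_eq[of ph 0 0 0 0 0 0 0 0 n, unfolded eigen_body_def])
 let ?I = "\<lambda>(k::nat) (z::nat) m w. w = (\<lambda>_. None) \<and> m 31 = 0 \<and> m (Suc 0) = int n \<and> m 2 = 0 \<and> m 53 = (0::int)"
 let ?R = "\<lambda>(z::nat) w'. w' 0 = Some (0::int) \<and> (\<forall>i<n. w' (1 + i) = Some 0) \<and> (\<forall>i<n. \<forall>j<n. w' (1 + n + n * i + j) = Some (of_bool (i = j)))"
 note [simp] = inp_cells(1,2) nz0
 have c1: "T.wp (prologue 0 0 0 ph) (?I 0 0) ((\<lambda>_. 0)(0 := 1)) (\<lambda>_. None)"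
  unfolding prologue_def
  apply (rule T.wp_Seq, rule T.wps, (simp?, rule ev_refl), (simp?, rule ev_refl), (simp?, rule ev_refl))
  apply (rule T.wp_Seq, rule T.wps, (simp?, rule ev_refl), (simp?, rule ev_refl), (simp?, rule ev_refl))
  apply (rule T.wp_Seq, rule T.wps, (simp?, rule ev_refl), (simp?, rule ev_refl), (simp?, rule ev_refl))
  apply (rule T.wp_Seq, rule T.wps, (simp?, rule ev_refl), (simp?, rule ev_refl), (simp?, rule ev_refl))
  apply (rule T.wp_Cond)
  subgoal by simp
  apply (rule T.wps, (simp?, rule ev_refl), (simp?, rule ev_refl), (simp?, rule ev_refl))
  using nb by simp_all
 have c3: "T.wp (epilogue 0 0 0 0 0 n) (\<lambda>_. ?R z) m w" if "?I 0 z m w" for z :: nat and m w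
  unfolding epilogue_def
 proof (rule T.wp_Cond)
  show "T.wp (write_identity n) (\<lambda>_. ?R z) m w"
   by (rule T.wp_write_identity) (use that nn in auto)
 qed (use that in simp)
 have bp: "bits k \<le> V" if "\<bar>k\<bar> \<le> 4 * int ph" for k
 proof -
  have lph: "int ph < 2 ^ ph" using less_exp[of ph] by simp
  have "(2::int) ^ (ph + 2) = 4 * 2 ^ ph" by (simp add: power_add)
  then have "\<bar>k\<bar> < 2 ^ (ph + 2)" using that lph by linarith
  then have "bits k \<le> ph + 3" using bits_le[of k "ph + 2"] by simp
  then show ?thesis unfolding V_def by simp
 qed
 have tot0: "2 + T.tbound (prologue 0 0 0 ph) + (b + 3) + T.tbound (epilogue 0 0 0 0 0 n) \<le> (1100 + 60 * ph) * (n * n * V)"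
  by (rule T.total_tbound_zero) (use n1 bp v2 in auto)
 have tot: "2 + T.tbound (prologue 0 0 0 ph) + (0 * (cell_bits 0 b b 53 + 1 + 1 + T.tbound flip_body + 2) + cell_bits 0 b b 53 + 3) + T.tbound (epilogue 0 0 0 0 0 n)
  \<le> (1100 + 60 * ph) * (n * n * V)" using tot0 by simp
 have b1: "1 \<le> cell_bits 0 b b 0" unfolding b_def by simp
 have "\<exists>t g. ram_run (eigen_program ph) inp t = map_pmf g (pmf_of_set {..<2 ^ 0}) \<and>
  (\<forall>z<2 ^ 0. ram_halted (eigen_program ph) (g z) \<and> bit_ops (g z) \<le> (1100 + 60 * ph) * (n * n * V) \<and>
   peak_space (g z) \<le> 64 * (2 * b + 2) + 64 * b \<and> ?R z (outp (g z)))"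
 proof (rule T.randomized_run[where I = ?I and R = ?R and N = 0, OF bodyeq b1])
  show "T.wp (prologue 0 0 0 ph) (?I 0 0) ((\<lambda>_. 0)(0 := 1)) (\<lambda>_. None)" by (rule c1)
  show "\<not> m 53 > 0" if "?I 0 z m w" for z :: nat and m w using that by simp
  show "T.wp (epilogue 0 0 0 0 0 n) (\<lambda>_. ?R z) m w" if "z < 2 ^ 0" "?I 0 z m w" for z :: nat and m w by (rule c3[OF that(2)])
 qed (simp, rule tot)
 then obtain t g where r: "ram_run (eigen_program ph) inp t = map_pmf g (pmf_of_set {..<2 ^ 0})"
  and g: "\<And>z. z < 2 ^ 0 \<Longrightarrow> ram_halted (eigen_program ph) (g z) \<and> bit_ops (g z) \<le> (1100 + 60 * ph) * (n * n * V) \<and>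
   peak_space (g z) \<le> 64 * (2 * b + 2) + 64 * b \<and> ?R z (outp (g z))"
  by blast
 have s0: "{..<(2::nat) ^ 0} = {0}" by auto
 have r': "ram_run (eigen_program ph) inp t = return_pmf (g 0)" unfolding r s0 by (simp add: pmf_of_set_singleton)
 have A0: "A $$ (i,j) = 0" if "i < n" "j < n" for i j
 proof -
  have "ps = []" using nz0 unfolding length_0_conv .
  then have "set ps = {}" by (simp only: list.set)
  then have "(i,j) \<notin> nonzero_positions A" unfolding dist(2)[symmetric] by simp
  then show ?thesis using that A(1) unfolding nonzero_positions_def by auto
 qed
 \<comment> \<open>The unit vectors are an eigensystem of the zero matrix, so the output is
   exact.\<close>
 have E: "eigsys n (\<lambda>i j. real_of_int (A $$ (i,j))) (\<lambda>_. 0) (\<lambda>k i. of_bool (k = i))"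
  unfolding eigsys_def using A0 by (auto simp: sum_of_bool_delta)
 have g0: "ram_halted (eigen_program ph) (g 0) \<and> bit_ops (g 0) \<le> (1100 + 60 * ph) * (n * n * V) \<and>
   peak_space (g 0) \<le> 64 * (2 * b + 2) + 64 * b \<and> ?R 0 (outp (g 0))" by (rule g) simp
 then have R: "?R 0 (outp (g 0))" by blast
 have "accurate_output n A \<epsilon> (outp (g 0))"
 proof (rule accurate_outputI[OF A(1) E, where p = 0 and s = "\<lambda>_. 0" and V = "\<lambda>i j. of_bool (i = j)"])
  show "outp (g 0) 0 = Some (int 0)" using R by simp
  fix i assume i: "i < n"
  have one: "(\<Sum>k<n. of_bool (i = k) * of_bool (i = k) :: real) = 1" using sum_of_bool_delta(1)[OF i, of "\<lambda>k. of_bool (i = k) :: real"] by simp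
  show "(\<Sum>k<n. real_of_int (of_bool (i = k)) / 2 ^ 0 * (real_of_int (of_bool (i = k)) / 2 ^ 0)) \<in> {1 - \<epsilon>..1 + \<epsilon>}"
   using one eps by simp
  show "sqrt (\<Sum>k<n. ((\<Sum>l<n. real_of_int (A $$ (k, l)) * (real_of_int (of_bool (i = l)) / 2 ^ 0)) - real_of_int 0 / 2 ^ 0 * (real_of_int (of_bool (i = k)) / 2 ^ 0))\<^sup>2) \<le> \<epsilon>"
   using A0 eps by simp
  fix j assume j: "j < n" "i \<noteq> j"
  have "(\<Sum>k<n. of_bool (i = k) * of_bool (j = k) :: real) = 0" using sum_of_bool_delta(1)[OF i, of "\<lambda>k. of_bool (j = k) :: real"] j by simp
  then show "\<bar>\<Sum>k<n. real_of_int (of_bool (i = k)) / 2 ^ 0 * (real_of_int (of_bool (j = k)) / 2 ^ 0)\<bar> \<le> \<epsilon>" using eps by simp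
 qed (use R eps in auto)
 then have pr: "measure_pmf.prob (return_pmf (g 0)) {\<sigma>. accurate_output n A \<epsilon> (outp \<sigma>)} = 1" by simp
 have Vr: "real V \<le> (220 + real ph) * (real n ^ 2 * LS)"
 proof -
  have n1': "1 \<le> real n" using n1 by simp
  have nsq: "real n \<le> real n ^ 2" "1 \<le> real n ^ 2" using n1' power_increasing[of 1 2 "real n"] one_le_power[of "real n" 2] by simp_all
  have "real V = 16 * real n ^ 2 + 80 * real n + 100 + (2 * real n + 4 + real gb + 1) + real ph + 3"
   unfolding V_def xb_def b_def by (simp add: algebra_simps power2_eq_square)
  also have "\<dots> \<le> 206 * real n ^ 2 + 4 * LS + real ph" using gb(3) nsq by linarith
  also have "\<dots> \<le> 206 * (real n ^ 2 * LS) + 4 * (real n ^ 2 * LS) + real ph * (real n ^ 2 * LS)"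
  proof -
   have "real n ^ 2 * 1 \<le> real n ^ 2 * LS" using LS1 by (intro mult_left_mono) auto
   moreover have "1 * LS \<le> real n ^ 2 * LS" using LS1 nsq by (intro mult_right_mono) auto
   moreover have "1 \<le> real n ^ 2 * LS" using calculation nsq by linarith
   then have "real ph * 1 \<le> real ph * (real n ^ 2 * LS)" by (intro mult_left_mono) auto
   ultimately show ?thesis by linarith
  qed
  also have "\<dots> \<le> (220 + real ph) * (real n ^ 2 * LS)" using LS1 by (simp add: algebra_simps)
  finally show ?thesis .
 qed
 have "bit_ops (g 0) \<le> (1100 + 60 * ph) * (n * n * V)" using g0 by blast
 then have "real (bit_ops (g 0)) \<le> real ((1100 + 60 * ph) * (n * n * V))" by (simp only: of_nat_le_iff)
 also have "\<dots> = (1100 + 60 * real ph) * (real n ^ 2 * real V)" by (simp add: power2_eq_square)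
 also have "\<dots> \<le> (1100 + 60 * real ph) * (real n ^ 2 * ((220 + real ph) * (real n ^ 2 * LS)))" using Vr by (intro mult_left_mono) auto
 also have "\<dots> \<le> (1100 + 60 * real ph) * (real n ^ 2 * ((220 + real ph) * (real n ^ 2 * LS ^ 4)))"
  using LS1 power_increasing[of 1 4 LS] by (intro mult_left_mono) auto
 also have "\<dots> = (1100 + 60 * real ph) * (220 + real ph) * real n ^ 3 * real (nnz A + n) * LS ^ 4"
  unfolding nz_nnz[symmetric] nz0 by (simp add: eval_nat_numeral)
 finally have t: "real (bit_ops (g 0)) \<le> (1100 + 60 * real ph) * (220 + real ph) * real n ^ 3 * real (nnz A + n) * LS ^ 4" .
 have "peak_space (g 0) \<le> 64 * (2 * b + 2) + 64 * b" using g0 by blast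
 also have "\<dots> \<le> 1500 * n" unfolding b_def using n1 by simp
 finally have "real (peak_space (g 0)) \<le> 1500 * real n * 1" by linarith
 also have "\<dots> \<le> 1500 * real n * LS" using LS1 by (intro mult_left_mono) auto
 finally have m: "real (peak_space (g 0)) \<le> 1500 * real n * LS" .
 have h: "ram_halted (eigen_program ph) (g 0)" using g0 by blast
 show ?thesis
  by (intro exI[of _ t] conjI ballI) (use h t m pr in \<open>auto simp: r'\<close>)
qed

end

theorem theorem7p10:
  fixes c :: real
  assumes "c > 0"
  shows "\<exists>(P :: ram_program) (C :: real) (k :: nat).
    \<forall>(n :: nat) (U :: nat) (A :: int mat) (ps :: (nat \<times> nat) list) (\<epsilon> :: real).
      n \<ge> 1 \<and> A \<in> carrier_mat n n \<and> transpose_mat A = A \<and>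
      (\<forall>i<n. \<forall>j<n. A $$ (i, j) \<in> {- int U .. int U}) \<and>
      coordinate_order A ps \<and> \<epsilon> > 0 \<longrightarrow>
      (\<exists>t.
        (\<forall>\<sigma> \<in> set_pmf (ram_run P (encode_input A ps \<epsilon>) t).
           ram_halted P \<sigma> \<and>
           real (bit_ops \<sigma>) \<le> C * real n ^ 3 * real (nnz A + n) * log_size n U \<epsilon> ^ k \<and>
           real (peak_space \<sigma>) \<le> C * real n * log_size n U \<epsilon>) \<and>
        measure_pmf.prob (ram_run P (encode_input A ps \<epsilon>) t)
          {\<sigma>. \<exists>l v. fixed_point_output n (outp \<sigma>) l v \<and>
             (\<forall>i<n.
                \<bar>eigenvalues_sorted (map_mat real_of_int A) ! i - l i\<bar> \<le> \<epsilon> \<and>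
                (norm2 (v i))\<^sup>2 \<in> {1 - \<epsilon> .. 1 + \<epsilon>} \<and>
                norm2 (map_mat real_of_int A *\<^sub>v v i - l i \<cdot>\<^sub>v v i) \<le> \<epsilon>) \<and>
             (\<forall>i<n. \<forall>j<n. i \<noteq> j \<longrightarrow> \<bar>scalar_prod (v i) (v j)\<bar> \<le> \<epsilon>)}
          \<ge> 1 - real n powr (- c))"
proof -
 \<comment> \<open>Meets both demands on the exponent: at least 9 for the error analysis and at
   least \<open>c + 6\<close> for the failure probability.\<close>
 define ph where "ph = 9 + nat \<lceil>c\<rceil>"
 have "c \<le> real (nat \<lceil>c\<rceil>)" by (rule real_nat_ceiling_ge)
 then have ph: "9 \<le> ph" "c + 6 \<le> real ph" unfolding ph_def of_nat_add by (simp, linarith)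
 define C where "C = 100000000 * (422 * real ph + 30) ^ 4 + 6000 * (422 * real ph + 30) + (1100 + 60 * real ph) * (220 + real ph) + 1500"
 have Cge: "100000000 * (422 * real ph + 30) ^ 4 \<le> C" "6000 * (422 * real ph + 30) \<le> C" "(1100 + 60 * real ph) * (220 + real ph) \<le> C" "1500 \<le> C"
  unfolding C_def by auto
 show ?thesis
 proof (rule exI[of _ "eigen_program ph"], rule exI[of _ C], rule exI[of _ 4], intro allI impI)
  fix n U :: nat and A :: "int mat" and ps :: "(nat \<times> nat) list" and \<epsilon> :: real
  assume h: "n \<ge> 1 \<and> A \<in> carrier_mat n n \<and> transpose_mat A = A \<and>
   (\<forall>i<n. \<forall>j<n. A $$ (i, j) \<in> {- int U .. int U}) \<and> coordinate_order A ps \<and> \<epsilon> > 0"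
  have "\<bar>A $$ (i,j)\<bar> \<le> int U" if "i < n" "j < n" for i j
  proof -
   have "A $$ (i,j) \<in> {- int U .. int U}" using h that by blast
   then show ?thesis unfolding atLeastAtMost_iff by linarith
  qed
  then interpret S: sparse_problem n U A ps \<epsilon>
   by unfold_locales (use h in blast)+
  have L0: "0 \<le> log_size n U \<epsilon>" using S.LS1 by linarith
  let ?P = "eigen_program ph" and ?x = "encode_input A ps \<epsilon>"
  have up: "a * real n ^ 3 * real (nnz A + n) * log_size n U \<epsilon> ^ 4 \<le> C * real n ^ 3 * real (nnz A + n) * log_size n U \<epsilon> ^ 4"
   "a * real n * log_size n U \<epsilon> \<le> C * real n * log_size n U \<epsilon>" if "a \<le> C" for a
   using that L0 by (intro mult_right_mono; simp)+
  have "\<exists>a a'. a \<le> C \<and> a' \<le> C \<and> (\<exists>t. (\<forall>\<sigma> \<in> set_pmf (ram_run ?P ?x t). ram_halted ?P \<sigma> \<and>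
    real (bit_ops \<sigma>) \<le> a * real n ^ 3 * real (nnz A + n) * log_size n U \<epsilon> ^ 4 \<and> real (peak_space \<sigma>) \<le> a' * real n * log_size n U \<epsilon>) \<and>
   measure_pmf.prob (ram_run ?P ?x t) {\<sigma>. accurate_output n A \<epsilon> (outp \<sigma>)} \<ge> 1 - real n powr (- c))"
  proof (cases "length ps = 0")
   case True
   show ?thesis using S.zero_result[OF True assms, of ph] Cge(3,4) by blast
  next
   case False
   interpret Nz: nonzero_problem n U A ps \<epsilon> ph by unfold_locales (use False ph in auto)
   show ?thesis using Nz.nonzero_result[OF assms ph(2)] Cge(1,2) by blast
  qed
  then obtain a a' t where a: "a \<le> C" "a' \<le> C"
   and r: "\<And>\<sigma>. \<sigma> \<in> set_pmf (ram_run ?P ?x t) \<Longrightarrow> ram_halted ?P \<sigma> \<and>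
    real (bit_ops \<sigma>) \<le> a * real n ^ 3 * real (nnz A + n) * log_size n U \<epsilon> ^ 4 \<and> real (peak_space \<sigma>) \<le> a' * real n * log_size n U \<epsilon>"
   and p: "measure_pmf.prob (ram_run ?P ?x t) {\<sigma>. accurate_output n A \<epsilon> (outp \<sigma>)} \<ge> 1 - real n powr (- c)" by blast
  show "\<exists>t.
    (\<forall>\<sigma> \<in> set_pmf (ram_run ?P (encode_input A ps \<epsilon>) t).
     ram_halted ?P \<sigma> \<and>
     real (bit_ops \<sigma>) \<le> C * real n ^ 3 * real (nnz A + n) * log_size n U \<epsilon> ^ 4 \<and>
     real (peak_space \<sigma>) \<le> C * real n * log_size n U \<epsilon>) \<and>
    measure_pmf.prob (ram_run ?P (encode_input A ps \<epsilon>) t)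
     {\<sigma>. \<exists>l v. fixed_point_output n (outp \<sigma>) l v \<and>
      (\<forall>i<n.
        \<bar>eigenvalues_sorted (map_mat real_of_int A) ! i - l i\<bar> \<le> \<epsilon> \<and>
        (norm2 (v i))\<^sup>2 \<in> {1 - \<epsilon> .. 1 + \<epsilon>} \<and>
        norm2 (map_mat real_of_int A *\<^sub>v v i - l i \<cdot>\<^sub>v v i) \<le> \<epsilon>) \<and>
      (\<forall>i<n. \<forall>j<n. i \<noteq> j \<longrightarrow> \<bar>scalar_prod (v i) (v j)\<bar> \<le> \<epsilon>)}
     \<ge> 1 - real n powr (- c)"
  proof (intro exI[of _ t] conjI ballI)
   fix \<sigma> assume s: "\<sigma> \<in> set_pmf (ram_run ?P (encode_input A ps \<epsilon>) t)"
   note rs = r[OF s]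
   show "ram_halted ?P \<sigma>" using rs by blast
   show "real (bit_ops \<sigma>) \<le> C * real n ^ 3 * real (nnz A + n) * log_size n U \<epsilon> ^ 4" by (rule order_trans[OF _ up(1)[OF a(1)]]) (use rs in blast)
   show "real (peak_space \<sigma>) \<le> C * real n * log_size n U \<epsilon>" by (rule order_trans[OF _ up(2)[OF a(2)]]) (use rs in blast)
  qed (rule p[unfolded accurate_output_def])
 qed
qed

end
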